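(* Let $k$ be a perfect field of characteristic $p>0$, let $\mathrm{W}=W(k)$ be the ring of infinite Witt vectors over $k$, let $G$ be a finite group, let $n\ge1$ be an integer, and let $A=\mathrm{W}/\mathrm{W}p^n$. Let $V$ be a projective $kG$-module with $\dim_k V$ finite and $\mathrm{End}_{kG}(V)=k$. Let $\hat V$ be a projective $AG$-module such that $k\otimes_A\hat V$ is isomorphic to $V$ as a $kG$-module, and let $M=\mathrm{Hom}_A(\hat V,\hat V)$ (a free $A$-module and a projective $AG$-module). Suppose $V'$ is a $(\mathbb{Z}/p^n)G$-module which is a free, finitely generated $\mathbb{Z}/p^n$-module with the following properties: (i) The group $\mathrm{Hom}_{(\mathbb{Z}/p^n)G}(V',M)$ is a free rank one $A$-module with respect to the $A$-module structure coming from the multiplication action of $A$ on $M$. (ii) There is an injective homomorphism $\psi:V'\to M$ in $\mathrm{Hom}_{(\mathbb{Z}/p^n)G}(V',M)$. (iii) There are elements $\tau,\lambda\in\psi(V')\subset M=\mathrm{Hom}_A(\hat V,\hat V)$ and an element $v\in\hat V$ such that $\tau(\lambda(v))-\lambda(\tau(v))\notin p\hat V$. Let $K=V'$ as abelian $p$-groups, let $\delta:G\to\mathrm{Aut}(K)$ be the group homomorphism given by the $G$-action on $V'$, and let $\Gamma$ be the semi-direct product $K\rtimes_\delta G$. Let $\tilde V$ be the $k\Gamma$-module obtained by inflating $V$ via the natural surjection $\pi:\Gamma\to G$. Then the universal deformation ring $R_{\mathrm{W}}(\Gamma,\tilde V)$ is well defined and is isomorphic to $\mathrm{W}[[t]]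/(p^nt,t^2)$.
   Context: $G$ acts on $M=\mathrm{Hom}_A(\hat V,\hat V)$ by conjugation via its action on $\hat V$. An $AG$-module is regarded as a $(\mathbb{Z}/p^n)G$-module by restriction of operators. Universal deformation ring: let $\hat{\mathcal{C}}$ be the category of complete local commutative Noetherian $\mathrm{W}$-algebras with residue field $k$; morphisms are continuous $\mathrm{W}$-algebra homomorphisms inducing the identity on $k$. For a finite group $\Gamma$ and a finite dimensional $k\Gamma$-module $\tilde V$, a lift of $\tilde V$ over $B\in\hat{\mathcal{C}}$ is a pair $(N,\phi)$ where $N$ is a finitely generated free $B$-module with $B$-linear $\Gamma$-action and $\phi:k\otimes_B N\to\tilde V$ is a $k\Gamma$-isomorphism. $\mathrm{Def}_{\tilde V}(B)$ is the set of isomorphism classes of lifts (isomorphisms compatible with the maps $\phi$), functorial in $B$ by extension of scalars. The universal deformation ring $R_{\mathrm{W}}(\Gamma,\tilde V)$ is the object of $\hat{\mathcal{C}}$ (if it exists) representing the functor $B\mapsto\mathrm{Def}_{\tilde V}(B)$; it is well defined when this functor is representable. *)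

theory Defs
  imports "HOL-Library.Poly_Mapping" "HOL-Algebra.Algebra" "HOL-Number_Theory.Residues"
begin

section \<open>Witt vectors\<close>

type_synonym 'v int_mpoly = "('v \<Rightarrow>\<^sub>0 nat) \<Rightarrow>\<^sub>0 int"

definition mpoly_var :: "'v \<Rightarrow> 'v int_mpoly" where
  "mpoly_var v = Poly_Mapping.single (Poly_Mapping.single v 1) 1"

definition mpoly_eval :: "('a, 'm) ring_scheme \<Rightarrow> ('v \<Rightarrow> 'a) \<Rightarrow> 'v int_mpoly \<Rightarrow> 'a" where
  "mpoly_eval R x P =
     (\<Oplus>\<^bsub>R\<^esub>m \<in> Poly_Mapping.keys P. add_pow R (Poly_Mapping.lookup P m)
        (\<Otimes>\<^bsub>R\<^esub>v \<in> Poly_Mapping.keys m. x v [^]\<^bsub>R\<^esub> Poly_Mapping.lookup m v))"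

definition ghost :: "nat \<Rightarrow> (nat \<Rightarrow> 'v int_mpoly) \<Rightarrow> nat \<Rightarrow> 'v int_mpoly" where
  "ghost p x n = (\<Sum>i\<le>n. of_nat (p ^ i) * x i ^ (p ^ (n - i)))"

text \<open>The universal polynomials of Witt vector addition and multiplication, with integer
  coefficients, in the variables \<open>X\<^sub>i = Inl i\<close> and \<open>Y\<^sub>i = Inr i\<close>. They are uniquely determined by
  the ghost component equations.\<close>

definition witt_sum_poly :: "nat \<Rightarrow> nat \<Rightarrow> (nat + nat) int_mpoly" where
  "witt_sum_poly p = (THE S. \<forall>n. ghost p S n =
     ghost p (\<lambda>i. mpoly_var (Inl i)) n + ghost p (\<lambda>i. mpoly_var (Inr i)) n)"

definition witt_prod_poly :: "nat \<Rightarrow> nat \<Rightarrow> (nat + nat) int_mpoly" where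
  "witt_prod_poly p = (THE P. \<forall>n. ghost p P n =
     ghost p (\<lambda>i. mpoly_var (Inl i)) n * ghost p (\<lambda>i. mpoly_var (Inr i)) n)"

definition Witt :: "nat \<Rightarrow> ('k, 'm) ring_scheme \<Rightarrow> (nat \<Rightarrow> 'k) ring" where
  "Witt p k =
    \<lparr>carrier = {x. \<forall>i. x i \<in> carrier k},
     monoid.mult = \<lambda>x y n. mpoly_eval k (case_sum x y) (witt_prod_poly p n),
     monoid.one = \<lambda>i. if i = 0 then \<one>\<^bsub>k\<^esub> else \<zero>\<^bsub>k\<^esub>,
     ring.zero = \<lambda>i. \<zero>\<^bsub>k\<^esub>,
     ring.add = \<lambda>x y n. mpoly_eval k (case_sum x y) (witt_sum_poly p n)\<rparr>"

definition Witt_residue :: "(nat \<Rightarrow> 'k) \<Rightarrow> 'k" where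
  "Witt_residue x = x 0"

definition truncated_Witt :: "nat \<Rightarrow> nat \<Rightarrow> ('k, 'm) ring_scheme \<Rightarrow> (nat \<Rightarrow> 'k) set ring" where
  "truncated_Witt p n k = Witt p k Quot (PIdl\<^bsub>Witt p k\<^esub> (add_pow (Witt p k) (p ^ n) \<one>\<^bsub>Witt p k\<^esub>))"

definition truncated_Witt_residue :: "(nat \<Rightarrow> 'k) set \<Rightarrow> 'k" where
  "truncated_Witt_residue Z = the_elem (Witt_residue ` Z)"


section \<open>Modules with a linear group action\<close>

text \<open>An \<open>RG\<close>-module, for a commutative ring \<open>R\<close>, is an \<open>R\<close>-module with an \<open>R\<close>-linear action
  of \<open>G\<close>. The fields \<open>mult\<close> and \<open>one\<close> that module records inherit from ring records are not used.\<close>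

record ('a, 'b, 'g) gmodule = "('a, 'b) module" +
  act :: "'g \<Rightarrow> 'b \<Rightarrow> 'b"

locale group_module = R?: module R M + G?: group G
  for R :: "('a, 'm) ring_scheme" (structure) and G :: "('g, 'l) monoid_scheme" (structure)
    and M :: "('a, 'b, 'g) gmodule" (structure) +
  assumes act_closed: "\<lbrakk>g \<in> carrier G; x \<in> carrier M\<rbrakk> \<Longrightarrow> act M g x \<in> carrier M"
    and act_add: "\<lbrakk>g \<in> carrier G; x \<in> carrier M; y \<in> carrier M\<rbrakk>
      \<Longrightarrow> act M g (x \<oplus>\<^bsub>M\<^esub> y) = act M g x \<oplus>\<^bsub>M\<^esub> act M g y"
    and act_smult: "\<lbrakk>g \<in> carrier G; a \<in> carrier R; x \<in> carrier M\<rbrakk>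
      \<Longrightarrow> act M g (a \<odot>\<^bsub>M\<^esub> x) = a \<odot>\<^bsub>M\<^esub> act M g x"
    and act_one: "x \<in> carrier M \<Longrightarrow> act M \<one>\<^bsub>G\<^esub> x = x"
    and act_mult: "\<lbrakk>g \<in> carrier G; h \<in> carrier G; x \<in> carrier M\<rbrakk>
      \<Longrightarrow> act M (g \<otimes>\<^bsub>G\<^esub> h) x = act M g (act M h x)"

definition lin_maps ::
  "('a, 'm) ring_scheme \<Rightarrow> ('a, 'b, 'm1) module_scheme \<Rightarrow> ('a, 'c, 'm2) module_scheme \<Rightarrow> ('b \<Rightarrow> 'c) set"
  where "lin_maps R M N = {f \<in> carrier M \<rightarrow>\<^sub>E carrier N.
     (\<forall>x\<in>carrier M. \<forall>y\<in>carrier M. f (x \<oplus>\<^bsub>M\<^esub> y) = f x \<oplus>\<^bsub>N\<^esub> f y) \<and>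
     (\<forall>a\<in>carrier R. \<forall>x\<in>carrier M. f (a \<odot>\<^bsub>M\<^esub> x) = a \<odot>\<^bsub>N\<^esub> f x)}"

definition ghoms ::
  "('a, 'm) ring_scheme \<Rightarrow> ('g, 'l) monoid_scheme \<Rightarrow> ('a, 'b, 'g) gmodule \<Rightarrow> ('a, 'c, 'g) gmodule \<Rightarrow> ('b \<Rightarrow> 'c) set"
  where "ghoms R G M N = {f \<in> lin_maps R M N.
     \<forall>g\<in>carrier G. \<forall>x\<in>carrier M. f (act M g x) = act N g (f x)}"

definition gisos ::
  "('a, 'm) ring_scheme \<Rightarrow> ('g, 'l) monoid_scheme \<Rightarrow> ('a, 'b, 'g) gmodule \<Rightarrow> ('a, 'c, 'g) gmodule \<Rightarrow> ('b \<Rightarrow> 'c) set"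
  where "gisos R G M N = {f \<in> ghoms R G M N. bij_betw f (carrier M) (carrier N)}"

definition free_of_rank ::
  "('a, 'm) ring_scheme \<Rightarrow> ('a, 'b, 'm1) module_scheme \<Rightarrow> nat \<Rightarrow> bool" where
  "free_of_rank R M d \<longleftrightarrow> (\<exists>S \<subseteq> carrier M. finite S \<and> card S = d \<and>
     (\<forall>x\<in>carrier M. \<exists>!c. c \<in> S \<rightarrow>\<^sub>E carrier R \<and> x = (\<Oplus>\<^bsub>M\<^esub>s\<in>S. c s \<odot>\<^bsub>M\<^esub> s)))"

text \<open>The module of all maps in \<open>H\<close> (extensional maps \<open>D \<rightarrow> N\<close>) with pointwise operations.\<close>

definition map_module ::
  "('b \<Rightarrow> 'c) set \<Rightarrow> 'b set \<Rightarrow> ('a, 'c, 'm) module_scheme \<Rightarrow> ('a, 'b \<Rightarrow> 'c) module" where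
  "map_module H D N =
    \<lparr>carrier = H, monoid.mult = undefined, monoid.one = undefined,
     ring.zero = (\<lambda>x\<in>D. \<zero>\<^bsub>N\<^esub>), ring.add = (\<lambda>f h. \<lambda>x\<in>D. f x \<oplus>\<^bsub>N\<^esub> h x),
     smult = (\<lambda>a f. \<lambda>x\<in>D. a \<odot>\<^bsub>N\<^esub> f x)\<rparr>"

definition End_gmodule ::
  "('a, 'm) ring_scheme \<Rightarrow> ('g, 'l) monoid_scheme \<Rightarrow> ('a, 'b, 'g) gmodule \<Rightarrow> ('a, 'b \<Rightarrow> 'b, 'g) gmodule" where
  "End_gmodule R G N =
     module.extend (map_module (lin_maps R N N) (carrier N) N)
       (gmodule.fields (\<lambda>g f. \<lambda>x\<in>carrier N. act N g (f (act N (inv\<^bsub>G\<^esub> g) x))))"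

definition Hom_module ::
  "('a, 'm) ring_scheme \<Rightarrow> ('g, 'l) monoid_scheme \<Rightarrow> ('a, 'b, 'g) gmodule \<Rightarrow> ('a, 'c, 'g) gmodule
     \<Rightarrow> ('s, 'c, 'g) gmodule \<Rightarrow> ('s, 'b \<Rightarrow> 'c) module" where
  \<comment> \<open>\<open>RG\<close>-homomorphisms \<open>M \<rightarrow> N\<close>, with scalar action induced by a second module structure \<open>N'\<close>
     on the same carrier as \<open>N\<close>\<close>
  "Hom_module R G M N N' = map_module (ghoms R G M N) (carrier M) N'"

text \<open>The free \<open>RG\<close>-module on the set \<open>I\<close>: finitely supported functions on \<open>I \<times> G\<close>.\<close>

definition free_gmodule ::
  "('a, 'm) ring_scheme \<Rightarrow> ('g, 'l) monoid_scheme \<Rightarrow> 'i set \<Rightarrow> ('a, 'i \<times> 'g \<Rightarrow> 'a, 'g) gmodule" where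
  "free_gmodule R G I =
    \<lparr>carrier = {f. (\<forall>z. f z \<in> carrier R) \<and> (\<forall>z. z \<notin> I \<times> carrier G \<longrightarrow> f z = \<zero>\<^bsub>R\<^esub>) \<and>
                   finite {z. f z \<noteq> \<zero>\<^bsub>R\<^esub>}},
     monoid.mult = undefined, monoid.one = undefined,
     ring.zero = (\<lambda>z. \<zero>\<^bsub>R\<^esub>), ring.add = (\<lambda>f h z. f z \<oplus>\<^bsub>R\<^esub> h z),
     smult = (\<lambda>a f z. a \<otimes>\<^bsub>R\<^esub> f z),
     act = (\<lambda>g f (i, h). if h \<in> carrier G then f (i, inv\<^bsub>G\<^esub> g \<otimes>\<^bsub>G\<^esub> h) else \<zero>\<^bsub>R\<^esub>)\<rparr>"

text \<open>Projective = direct summand of a free \<open>RG\<close>-module. Index sets \<open>I\<close> in the type of elements of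
  \<open>M\<close> suffice, because a projective module is a summand of the free module on its own carrier.\<close>

definition projective_gmodule ::
  "('a, 'm) ring_scheme \<Rightarrow> ('g, 'l) monoid_scheme \<Rightarrow> ('a, 'b, 'g) gmodule \<Rightarrow> bool" where
  "projective_gmodule R G M \<longleftrightarrow> group_module R G M \<and>
     (\<exists>I :: 'b set. \<exists>i \<in> ghoms R G M (free_gmodule R G I). \<exists>r \<in> ghoms R G (free_gmodule R G I) M.
        \<forall>x\<in>carrier M. r (i x) = x)"

definition restrict_scalars :: "('s \<Rightarrow> 'a) \<Rightarrow> ('a, 'b, 'g) gmodule \<Rightarrow> ('s, 'b, 'g) gmodule" where
  "restrict_scalars f N =
     ring.extend (ring.truncate N)
       \<lparr>smult = (\<lambda>s x. f s \<odot>\<^bsub>N\<^esub> x), act = act N\<rparr>"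

definition inflate :: "('h \<Rightarrow> 'g) \<Rightarrow> ('a, 'b, 'g) gmodule \<Rightarrow> ('a, 'b, 'h) gmodule" where
  "inflate \<pi> N = module.extend (module.truncate N) (gmodule.fields (\<lambda>h. act N (\<pi> h)))"

definition semidirect ::
  "('x, 'm) monoid_scheme \<Rightarrow> ('g, 'l) monoid_scheme \<Rightarrow> ('g \<Rightarrow> 'x \<Rightarrow> 'x) \<Rightarrow> ('x \<times> 'g) monoid" where
  "semidirect K G \<delta> =
    \<lparr>carrier = carrier K \<times> carrier G,
     monoid.mult = (\<lambda>(x, g) (y, h). (x \<otimes>\<^bsub>K\<^esub> \<delta> g y, g \<otimes>\<^bsub>G\<^esub> h)),
     monoid.one = (\<one>\<^bsub>K\<^esub>, \<one>\<^bsub>G\<^esub>)\<rparr>"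


section \<open>Extension of scalars\<close>

text \<open>For a ring homomorphism \<open>f : B \<rightarrow> C\<close>, the tensor product \<open>C \<otimes>\<^sub>B N\<close> is the free abelian group
  on \<open>C \<times> N\<close> modulo the subgroup generated by the usual bilinearity relations.\<close>

definition tensor_relations ::
  "('a, 'm) ring_scheme \<Rightarrow> ('c, 'l) ring_scheme \<Rightarrow> ('a \<Rightarrow> 'c) \<Rightarrow> ('a, 'b, 'n) module_scheme
     \<Rightarrow> ('c \<times> 'b \<Rightarrow>\<^sub>0 int) set" where
  "tensor_relations B C f N = generate (free_Abelian_group (carrier C \<times> carrier N))
     ({frag_of (c \<oplus>\<^bsub>C\<^esub> d, x) - frag_of (c, x) - frag_of (d, x) | c d x.
         c \<in> carrier C \<and> d \<in> carrier C \<and> x \<in> carrier N} \<union>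
      {frag_of (c, x \<oplus>\<^bsub>N\<^esub> y) - frag_of (c, x) - frag_of (c, y) | c x y.
         c \<in> carrier C \<and> x \<in> carrier N \<and> y \<in> carrier N} \<union>
      {frag_of (c \<otimes>\<^bsub>C\<^esub> f b, x) - frag_of (c, b \<odot>\<^bsub>N\<^esub> x) | b c x.
         b \<in> carrier B \<and> c \<in> carrier C \<and> x \<in> carrier N})"

definition pure_tensor ::
  "('a, 'm) ring_scheme \<Rightarrow> ('c, 'l) ring_scheme \<Rightarrow> ('a \<Rightarrow> 'c) \<Rightarrow> ('a, 'b, 'n) module_scheme
     \<Rightarrow> 'c \<Rightarrow> 'b \<Rightarrow> ('c \<times> 'b \<Rightarrow>\<^sub>0 int) set" where
  "pure_tensor B C f N c x =
     tensor_relations B C f N #>\<^bsub>free_Abelian_group (carrier C \<times> carrier N)\<^esub> frag_of (c, x)"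

text \<open>The scalar and group actions are those given by \<open>d \<cdot> (c \<otimes> x) = dc \<otimes> x\<close> and
  \<open>g \<cdot> (c \<otimes> x) = c \<otimes> gx\<close> on pure tensors: on a coset, apply the map to all representatives and
  saturate again under the relations.\<close>

definition ext_scalars ::
  "('a, 'm) ring_scheme \<Rightarrow> ('c, 'l) ring_scheme \<Rightarrow> ('a \<Rightarrow> 'c) \<Rightarrow> ('a, 'b, 'g) gmodule
     \<Rightarrow> ('c, ('c \<times> 'b \<Rightarrow>\<^sub>0 int) set, 'g) gmodule" where
  "ext_scalars B C f N =
    (let F = free_Abelian_group (carrier C \<times> carrier N); H = tensor_relations B C f N in
    \<lparr>carrier = rcosets\<^bsub>F\<^esub> H,
     monoid.mult = undefined, monoid.one = undefined,
     ring.zero = H, add = set_mult F,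
     smult = (\<lambda>d Z. H <#>\<^bsub>F\<^esub> (frag_extend (\<lambda>(c, x). frag_of (d \<otimes>\<^bsub>C\<^esub> c, x)) ` Z)),
     act = (\<lambda>g Z. H <#>\<^bsub>F\<^esub> (frag_extend (\<lambda>(c, x). frag_of (c, act N g x)) ` Z))\<rparr>)"


section \<open>Complete local Noetherian algebras\<close>

text \<open>A \<open>W\<close>-algebra together with the identification of its residue field with \<open>k\<close>, given as the
  reduction map onto \<open>k\<close>. Here \<open>'w\<close> is the type of elements of \<open>W\<close>.\<close>

record ('b, 'w, 'k) walg = "'b ring" +
  structmap :: "'w \<Rightarrow> 'b"
  resmap :: "'b \<Rightarrow> 'k"

definition max_ideal :: "('b, 'm) ring_scheme \<Rightarrow> 'b set" where
  "max_ideal B = (THE m. maximalideal m B)"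

abbreviation max_ideal_pow :: "('b, 'm) ring_scheme \<Rightarrow> nat \<Rightarrow> 'b set" where
  "max_ideal_pow B i \<equiv> max_ideal B [^]\<^bsub>ideals_set B\<^esub> i"

text \<open>\<open>B \<rightarrow> lim B/m\<^sup>i\<close> is injective and surjective.\<close>

definition adically_complete :: "('b, 'm) ring_scheme \<Rightarrow> bool" where
  "adically_complete B \<longleftrightarrow>
     (\<Inter>i. max_ideal_pow B i) = {\<zero>\<^bsub>B\<^esub>} \<and>
     (\<forall>x. (\<forall>i. x i \<in> carrier B \<and> x (Suc i) \<ominus>\<^bsub>B\<^esub> x i \<in> max_ideal_pow B i) \<longrightarrow>
          (\<exists>y\<in>carrier B. \<forall>i. y \<ominus>\<^bsub>B\<^esub> x i \<in> max_ideal_pow B i))"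

definition in_Chat :: "nat \<Rightarrow> ('k, 'l) ring_scheme \<Rightarrow> ('b, nat \<Rightarrow> 'k, 'k) walg \<Rightarrow> bool" where
  "in_Chat p k B \<longleftrightarrow>
     cring B \<and> noetherian_ring B \<and> (\<exists>!m. maximalideal m B) \<and> adically_complete B \<and>
     structmap B \<in> ring_hom (Witt p k) B \<and>
     resmap B \<in> ring_hom B k \<and> resmap B ` carrier B = carrier k \<and>
     a_kernel B k (resmap B) = max_ideal B \<and>
     (\<forall>w\<in>carrier (Witt p k). resmap B (structmap B w) = Witt_residue w)"

definition Chat_homs ::
  "nat \<Rightarrow> ('k, 'l) ring_scheme \<Rightarrow> ('b, nat \<Rightarrow> 'k, 'k) walg \<Rightarrow> ('c, nat \<Rightarrow> 'k, 'k) walg \<Rightarrow> ('b \<Rightarrow> 'c) set"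
  where "Chat_homs p k B C = {f \<in> carrier B \<rightarrow>\<^sub>E carrier C. f \<in> ring_hom B C \<and>
     (\<forall>w\<in>carrier (Witt p k). f (structmap B w) = structmap C w) \<and>
     (\<forall>j. \<exists>i. f ` max_ideal_pow B i \<subseteq> max_ideal_pow C j) \<and>
     (\<forall>b\<in>carrier B. resmap C (f b) = resmap B b)}"

definition Chat_isomorphic ::
  "nat \<Rightarrow> ('k, 'l) ring_scheme \<Rightarrow> ('b, nat \<Rightarrow> 'k, 'k) walg \<Rightarrow> ('c, nat \<Rightarrow> 'k, 'k) walg \<Rightarrow> bool" where
  "Chat_isomorphic p k B C \<longleftrightarrow> (\<exists>f \<in> Chat_homs p k B C. \<exists>h \<in> Chat_homs p k C B.
     (\<forall>b\<in>carrier B. h (f b) = b) \<and> (\<forall>c\<in>carrier C. f (h c) = c))"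


section \<open>Lifts and deformations\<close>

type_synonym ('b, 'n, 'g, 'k, 'v) lift = "('b, 'n, 'g) gmodule \<times> (('k \<times> 'n \<Rightarrow>\<^sub>0 int) set \<Rightarrow> 'v)"

definition residual ::
  "('k, 'l) ring_scheme \<Rightarrow> ('b, nat \<Rightarrow> 'k, 'k) walg \<Rightarrow> ('b, 'n, 'g) gmodule
     \<Rightarrow> ('k, ('k \<times> 'n \<Rightarrow>\<^sub>0 int) set, 'g) gmodule" where
  "residual k B N = ext_scalars B k (resmap B) N"

abbreviation residual_tensor ::
  "('k, 'l) ring_scheme \<Rightarrow> ('b, nat \<Rightarrow> 'k, 'k) walg \<Rightarrow> ('b, 'n, 'g) gmodule
     \<Rightarrow> 'k \<Rightarrow> 'n \<Rightarrow> ('k \<times> 'n \<Rightarrow>\<^sub>0 int) set" where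
  "residual_tensor k B N \<equiv> pure_tensor B k (resmap B) N"

fun is_lift ::
  "('k, 'l) ring_scheme \<Rightarrow> ('g, 'l') monoid_scheme \<Rightarrow> ('k, 'v, 'g) gmodule
     \<Rightarrow> ('b, nat \<Rightarrow> 'k, 'k) walg \<Rightarrow> ('b, 'n, 'g, 'k, 'v) lift \<Rightarrow> bool" where
  "is_lift k \<Gamma> U B (N, \<phi>) \<longleftrightarrow>
     group_module B \<Gamma> N \<and> (\<exists>d. free_of_rank B N d) \<and> \<phi> \<in> gisos k \<Gamma> (residual k B N) U"

fun lift_isomorphic ::
  "('k, 'l) ring_scheme \<Rightarrow> ('g, 'l') monoid_scheme \<Rightarrow> ('b, nat \<Rightarrow> 'k, 'k) walg
     \<Rightarrow> ('b, 'n, 'g, 'k, 'v) lift \<Rightarrow> ('b, 'n', 'g, 'k, 'v) lift \<Rightarrow> bool" where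
  "lift_isomorphic k \<Gamma> B (N, \<phi>) (N', \<phi>') \<longleftrightarrow> (\<exists>f \<in> gisos B \<Gamma> N N'.
     \<forall>c\<in>carrier k. \<forall>x\<in>carrier N.
       \<phi>' (residual_tensor k B N' c (f x)) = \<phi> (residual_tensor k B N c x))"

text \<open>Isomorphism classes of lifts form a set once a universe for the underlying modules is fixed.
  The type \<open>nat \<Rightarrow> 'b\<close> contains a copy of every free module of finite rank over a ring whose
  elements have type \<open>'b\<close>.\<close>

definition lifts ::
  "('k, 'l) ring_scheme \<Rightarrow> ('g, 'l') monoid_scheme \<Rightarrow> ('k, 'v, 'g) gmodule
     \<Rightarrow> ('b, nat \<Rightarrow> 'k, 'k) walg \<Rightarrow> ('b, nat \<Rightarrow> 'b, 'g, 'k, 'v) lift set" where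
  "lifts k \<Gamma> U B = {L. is_lift k \<Gamma> U B L}"

definition Def ::
  "('k, 'l) ring_scheme \<Rightarrow> ('g, 'l') monoid_scheme \<Rightarrow> ('k, 'v, 'g) gmodule
     \<Rightarrow> ('b, nat \<Rightarrow> 'k, 'k) walg \<Rightarrow> ('b, nat \<Rightarrow> 'b, 'g, 'k, 'v) lift set set" where
  "Def k \<Gamma> U B = lifts k \<Gamma> U B //
     {(L, L'). L \<in> lifts k \<Gamma> U B \<and> L' \<in> lifts k \<Gamma> U B \<and> lift_isomorphic k \<Gamma> B L L'}"

text \<open>The lift \<open>C \<otimes>\<^sub>B N\<close> of \<open>U\<close> over \<open>C\<close>, with \<open>k \<otimes>\<^sub>C (C \<otimes>\<^sub>B N) \<cong> k \<otimes>\<^sub>B N \<rightarrow> U\<close>; the composite is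
  determined by its values on the tensors \<open>a \<otimes> (c \<otimes> x)\<close>.\<close>

fun ext_lift ::
  "('k, 'l) ring_scheme \<Rightarrow> ('g, 'l') monoid_scheme \<Rightarrow> ('k, 'v, 'g) gmodule
     \<Rightarrow> ('b, nat \<Rightarrow> 'k, 'k) walg \<Rightarrow> ('c, nat \<Rightarrow> 'k, 'k) walg \<Rightarrow> ('b \<Rightarrow> 'c)
     \<Rightarrow> ('b, 'n, 'g, 'k, 'v) lift \<Rightarrow> ('c, ('c \<times> 'n \<Rightarrow>\<^sub>0 int) set, 'g, 'k, 'v) lift" where
  "ext_lift k \<Gamma> U B C f (N, \<phi>) =
    (let N' = ext_scalars B C f N in
     (N', THE \<phi>'. \<phi>' \<in> ghoms k \<Gamma> (residual k C N') U \<and>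
        (\<forall>a\<in>carrier k. \<forall>c\<in>carrier C. \<forall>x\<in>carrier N.
           \<phi>' (residual_tensor k C N' a (pure_tensor B C f N c x)) =
           \<phi> (residual_tensor k B N (a \<otimes>\<^bsub>k\<^esub> resmap C c) x))))"

definition Def_map ::
  "('k, 'l) ring_scheme \<Rightarrow> ('g, 'l') monoid_scheme \<Rightarrow> ('k, 'v, 'g) gmodule
     \<Rightarrow> ('b, nat \<Rightarrow> 'k, 'k) walg \<Rightarrow> ('c, nat \<Rightarrow> 'k, 'k) walg \<Rightarrow> ('b \<Rightarrow> 'c)
     \<Rightarrow> ('b, nat \<Rightarrow> 'b, 'g, 'k, 'v) lift set \<Rightarrow> ('c, nat \<Rightarrow> 'c, 'g, 'k, 'v) lift set" where
  "Def_map k \<Gamma> U B C f Z =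
     {L' \<in> lifts k \<Gamma> U C. \<exists>L\<in>Z. lift_isomorphic k \<Gamma> C (ext_lift k \<Gamma> U B C f L) L'}"

text \<open>\<open>R\<close> represents the deformation functor of \<open>U\<close>: there are bijections
  \<open>Hom(R, B) \<rightarrow> Def(B)\<close>, natural in \<open>B\<close>. HOL cannot quantify over types inside a formula, so the
  type \<open>'b\<close> of elements of the test objects \<open>B\<close> is a parameter; results should be stated
  for arbitrary \<open>'b\<close>. Every object of the category is a quotient of a power series ring in finitely
  many variables over \<open>W\<close>, hence has an isomorphic copy with elements of type
  \<open>(nat \<Rightarrow> nat \<Rightarrow> 'k) set\<close>. So already this instance of \<open>'b\<close> captures the whole category.\<close>

definition universal_deformation_ring ::
  "'b itself \<Rightarrow> nat \<Rightarrow> ('k, 'l) ring_scheme \<Rightarrow> ('g, 'l') monoid_scheme \<Rightarrow> ('k, 'v, 'g) gmodule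
     \<Rightarrow> ('r, nat \<Rightarrow> 'k, 'k) walg \<Rightarrow> bool" where
  "universal_deformation_ring (_ :: 'b itself) p k \<Gamma> U R \<longleftrightarrow> in_Chat p k R \<and>
     (\<exists>\<eta> :: ('b, nat \<Rightarrow> 'k, 'k) walg \<Rightarrow> ('r \<Rightarrow> 'b) \<Rightarrow> ('b, nat \<Rightarrow> 'b, 'g, 'k, 'v) lift set.
        (\<forall>B. in_Chat p k B \<longrightarrow> bij_betw (\<eta> B) (Chat_homs p k R B) (Def k \<Gamma> U B)) \<and>
        (\<forall>B C. in_Chat p k B \<and> in_Chat p k C \<longrightarrow>
           (\<forall>f \<in> Chat_homs p k B C. \<forall>h \<in> Chat_homs p k R B.
              \<eta> C (compose (carrier R) f h) = Def_map k \<Gamma> U B C f (\<eta> B h))))"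


section \<open>The ring \<open>W[[t]]/(p\<^sup>n t, t\<^sup>2)\<close>\<close>

definition power_series :: "('a, 'm) ring_scheme \<Rightarrow> (nat \<Rightarrow> 'a) ring" where
  "power_series R =
    \<lparr>carrier = {f. \<forall>i. f i \<in> carrier R},
     monoid.mult = (\<lambda>f h n. \<Oplus>\<^bsub>R\<^esub>i \<in> {..n}. f i \<otimes>\<^bsub>R\<^esub> h (n - i)),
     monoid.one = (\<lambda>i. if i = 0 then \<one>\<^bsub>R\<^esub> else \<zero>\<^bsub>R\<^esub>),
     ring.zero = (\<lambda>i. \<zero>\<^bsub>R\<^esub>),
     ring.add = (\<lambda>f h i. f i \<oplus>\<^bsub>R\<^esub> h i)\<rparr>"

definition ps_const :: "('a, 'm) ring_scheme \<Rightarrow> 'a \<Rightarrow> nat \<Rightarrow> 'a" where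
  "ps_const R a = (\<lambda>i. if i = 0 then a else \<zero>\<^bsub>R\<^esub>)"

definition ps_var :: "('a, 'm) ring_scheme \<Rightarrow> nat \<Rightarrow> 'a" where
  "ps_var R = (\<lambda>i. if i = 1 then \<one>\<^bsub>R\<^esub> else \<zero>\<^bsub>R\<^esub>)"

definition W_t_mod :: "nat \<Rightarrow> nat \<Rightarrow> ('k, 'm) ring_scheme \<Rightarrow> ((nat \<Rightarrow> nat \<Rightarrow> 'k) set, nat \<Rightarrow> 'k, 'k) walg" where
  "W_t_mod p n k =
    (let W = Witt p k; S = power_series W; t = ps_var W;
         I = Idl\<^bsub>S\<^esub> {add_pow S (p ^ n) t, t [^]\<^bsub>S\<^esub> (2::nat)}
     in ring.extend (S Quot I)
          \<lparr>structmap = (\<lambda>w. I +>\<^bsub>S\<^esub> ps_const W w),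
           resmap = (\<lambda>Z. the_elem ((\<lambda>f. Witt_residue (f 0)) ` Z))\<rparr>)"

end

theory Submission
  imports Defs
begin

text \<open>
Write \<open>W\<close> for the Witt ring. The projective \<open>A G\<close>-module lifting \<open>V\<close> is free of finite
rank over \<open>A\<close>, and since \<open>V\<close> is projective, averaging lets its matrices be lifted to a homomorphism \<open>\<rho>\<close> from \<open>G\<close> to matrices over \<open>W\<close>
(\<open>basis_lift\<close>, \<open>lift_projective_representation\<close>). Lift \<open>\<psi>\<close> entrywise to matrices over \<open>W\<close>, additive and equivariant modulo
\<open>p^n\<close>. For a test algebra \<open>B\<close> and \<open>s\<close> in its maximal ideal with \<open>s^2 = 0\<close> and \<open>p^n s = 0\<close>, the formula
\<open>(x, g) \<mapsto> (1 + s \<psi>(x)) \<rho>(g)\<close> is a representation of \<open>K \<rtimes> G\<close> lifting \<open>V\<close>, because \<open>s^2\<close> and \<open>p^n s\<close> kill all error terms.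
Such \<open>s\<close> are exactly the images of \<open>t\<close> under the homomorphisms \<open>W[[t]]/(p^n t, t^2) \<rightarrow> B\<close> (\<open>hom_of_admissible\<close>,
\<open>hom_admissible\<close>), so it remains to see that every lift is conjugate to one of these, for exactly one \<open>s\<close>.

Uniqueness: a matrix congruent to 1 that commutes with \<open>\<rho>\<close> is scalar, as \<open>End(V) = k\<close>, and some entry of \<open>\<psi>\<close> is a
unit (\<open>sig_unique\<close>). Existence: by projectivity the restriction of a lift to \<open>G\<close> is conjugate to \<open>\<rho>\<close>. Then \<open>x\<close> in \<open>K\<close> acts by
\<open>1 + a(x)\<close>, and one must show \<open>a = s \<psi>\<close>. Choose \<open>s\<close> so that this holds at one entry where \<open>\<psi>\<close> is a unit, and let \<open>I\<close> be the
ideal generated by \<open>s^2\<close>, \<open>p^n s\<close> and the entries of \<open>a - s \<psi>\<close>. By Nakayama, \<open>I = 0\<close> as soon as every map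
\<open>l : I/mI \<rightarrow> k\<close> vanishes on these generators (\<open>zero_by_functionals\<close>). Comparing the images of \<open>x + y\<close> and \<open>y + x\<close> gives
\<open>l(s^2) [\<psi> x, \<psi> y] = 0\<close>, and the hypothesis on commutators forces \<open>l(s^2) = 0\<close>. Hence products \<open>a(x) a(y)\<close> are invisible to
\<open>l\<close>, \<open>a\<close> looks additive, and \<open>p^n K = 0\<close> yields \<open>l(p^n s) = 0\<close>. Finally \<open>x \<mapsto> l(a(x) - s \<psi>(x))\<close> is an equivariant
homomorphism to \<open>End(V)\<close>, therefore a multiple of \<open>\<psi>\<close>, as \<open>Hom(V', M)\<close> is free of rank one, and it vanishes at the chosen entry; so it is zero
(\<open>nilpotent_part\<close>).

Everything is done with explicit matrices. A lift of \<open>V\<close> is described by the matrices of its action in a basis that reduces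
to a fixed basis of \<open>V\<close>; isomorphism of lifts becomes conjugation by matrices congruent to 1 (locale
\<open>framed_representation\<close>).
\<close>

text \<open>Formulas below involve many rings at once. The following input notation puts the structure right after the operator,
and \<open>x <: R\<close> is membership in the carrier.\<close>

abbreviation (input) car where "car \<equiv> carrier"
abbreviation (input) in_carrier (infix "<:" 50) where "x <: S \<equiv> x \<in> carrier S"
abbreviation (input) mult_in ("(_ *._ _)" [70, 1000, 71] 70) where "x *.R y \<equiv> x \<otimes>\<^bsub>R\<^esub> y"
abbreviation (input) add_in ("(_ +._ _)" [65, 1000, 66] 65) where "x +.R y \<equiv> x \<oplus>\<^bsub>R\<^esub> y"
abbreviation (input) minus_in ("(_ -._ _)" [65, 1000, 66] 65) where "x -.R y \<equiv> x \<ominus>\<^bsub>R\<^esub> y"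
abbreviation (input) smult_in ("(_ *:_ _)" [70, 1000, 71] 70) where "a *:M x \<equiv> a \<odot>\<^bsub>M\<^esub> x"
abbreviation (input) uminus_in ("(-:_ _)" [1000, 81] 80) where "-:R x \<equiv> \<ominus>\<^bsub>R\<^esub> x"
abbreviation (input) inv_in ("(~._ _)" [1000, 81] 80) where "~.G x \<equiv> inv\<^bsub>G\<^esub> x"
abbreviation (input) pow_in ("(_ ^._ _)" [76, 1000, 75] 75) where "x ^.R n \<equiv> x [^]\<^bsub>R\<^esub> n"
abbreviation (input) zero_in ("0@_" [1000] 1000) where "0@R \<equiv> \<zero>\<^bsub>R\<^esub>"
abbreviation (input) one_in ("1@_" [1000] 1000) where "1@R \<equiv> \<one>\<^bsub>R\<^esub>"

section \<open>Integer polynomials and the ghost map\<close>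

lemma frobenius_add_dvd:
 fixes a b :: "'a::comm_ring_1"
 assumes p:"Factorial_Ring.prime p"
 shows "of_nat p dvd (a + b) ^ p - (a ^ p + b ^ p)"
proof -
 have p0:"0 < p" using p prime_gt_0_nat by blast
 have split:"{..p} = insert 0 (insert p {0<..<p})" using p0 by auto
 have "(a + b) ^ p = (\<Sum>i\<le>p. of_nat (p choose i) * a ^ i * b ^ (p - i))"
  by (rule binomial_ring)
 also have "... = b ^ p + a ^ p + (\<Sum>i\<in>{0<..<p}. of_nat (p choose i) * a ^ i * b ^ (p - i))"
  unfolding split using p0 by (simp add:sum.insert add.assoc)
 finally have eq:"(a + b) ^ p - (a ^ p + b ^ p) = (\<Sum>i\<in>{0<..<p}. of_nat (p choose i) * a ^ i * b ^ (p - i))"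
  by (simp add:algebra_simps)
 have "of_nat p dvd (of_nat (p choose i) * a ^ i * b ^ (p - i) :: 'a)" if "i\<in>{0<..<p}" for i
 proof -
  have "p dvd (p choose i)" using that p by (intro dvd_choose_prime) auto
  then have "(of_nat p :: 'a) dvd of_nat (p choose i)" by (auto simp:dvd_def)
  then show ?thesis by (simp add:dvd_mult2)
 qed
 then show ?thesis unfolding eq by (rule dvd_sum)
qed

text \<open>Raising to the \<open>p\<close>-th power improves a congruence modulo \<open>p^i\<close> to one modulo \<open>p^(i+1)\<close>.\<close>
lemma power_prime_cong:
 fixes a b :: "'a::comm_ring_1"
 assumes p:"Factorial_Ring.prime p" and j:"0 < j" and ab:"of_nat (p ^ j) dvd a - b"
 shows "of_nat (p ^ Suc j) dvd a ^ p - b ^ p"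
proof -
 have p0:"0 < p" using p prime_gt_0_nat by blast
 obtain c where c:"a = b + of_nat (p ^ j) * c"
  using ab by (auto simp:dvd_def) (metis add.commute diff_add_cancel)
 have split:"{..p} = insert 0 (insert p {0<..<p})" using p0 by auto
 let ?q = "of_nat (p ^ j) * c :: 'a"
 have "a ^ p = (\<Sum>i\<le>p. of_nat (p choose i) * ?q ^ i * b ^ (p - i))"
  unfolding c by (subst add.commute) (rule binomial_ring)
 also have "... = b ^ p + ?q ^ p + (\<Sum>i\<in>{0<..<p}. of_nat (p choose i) * ?q ^ i * b ^ (p - i))"
  unfolding split using p0 by (simp add:sum.insert add.assoc)
 finally have eq:"a ^ p - b ^ p = ?q ^ p + (\<Sum>i\<in>{0<..<p}. of_nat (p choose i) * ?q ^ i * b ^ (p - i))"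
  by simp
 have d1:"of_nat (p ^ Suc j) dvd ?q ^ p"
 proof -
  have "Suc j \<le> j * p"
  proof -
  have "2 \<le> p" using p prime_ge_2_nat by blast
  then have "j * 2 \<le> j * p" by simp
  then show ?thesis using j by linarith
  qed
  then have "p ^ Suc j dvd (p ^ j) ^ p" by (metis le_imp_power_dvd power_mult)
  then have "(of_nat (p ^ Suc j) :: 'a) dvd of_nat ((p ^ j) ^ p)" by (metis dvdE dvd_triv_left of_nat_mult)
  then show ?thesis by (simp add:power_mult_distrib dvd_mult2)
 qed
 have d2:"of_nat (p ^ Suc j) dvd (of_nat (p choose i) * ?q ^ i * b ^ (p - i))" if i:"i\<in>{0<..<p}" for i
 proof -
  have 1:"p dvd (p choose i)" using i p by (intro dvd_choose_prime) auto
  have 2:"p ^ j dvd (p ^ j) ^ i" using i by (simp add:dvd_power)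
  have "p ^ Suc j dvd (p choose i) * (p ^ j) ^ i"
  using mult_dvd_mono[OF 1 2] by simp
  then have "(of_nat (p ^ Suc j) :: 'a) dvd of_nat ((p choose i) * (p ^ j) ^ i)" by (metis dvdE dvd_triv_left of_nat_mult)
  then have "(of_nat (p ^ Suc j) :: 'a) dvd of_nat ((p choose i) * (p ^ j) ^ i) * (c ^ i * b ^ (p - i))"
  by (rule dvd_mult2)
  then show ?thesis by (simp add:power_mult_distrib mult.assoc)
 qed
 show ?thesis unfolding eq by (rule dvd_add[OF d1 dvd_sum[OF d2]])
qed

lemma power_prime_power_cong:
 fixes a b :: "'a::comm_ring_1"
 assumes p:"Factorial_Ring.prime p" and ab:"of_nat p dvd a - b"
 shows "of_nat (p ^ Suc j) dvd a ^ (p ^ j) - b ^ (p ^ j)"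
proof (induction j)
 case 0 then show ?case using ab by simp
next
 case (Suc j)
 have "of_nat (p ^ Suc (Suc j)) dvd (a ^ (p ^ j)) ^ p - (b ^ (p ^ j)) ^ p"
  by (rule power_prime_cong[OF p _ Suc]) simp
 then show ?case by (simp add:mult.commute flip: power_mult)
qed

definition mpoly_frob :: "nat => 'v int_mpoly => 'v int_mpoly" where
 "mpoly_frob p = frag_extend (%m. frag_of (\<Sum>i<p. m))"

lemma frag_of_mult:"frag_of m * frag_of m' = (frag_of (m + m') :: 'v int_mpoly)"
 by (simp add:mult_single)

lemma frag_of_power:"(frag_of m :: 'v int_mpoly) ^ j = frag_of (\<Sum>i<j. m)"
 by (induction j) (simp_all add: frag_of_mult add.commute)

lemma int_mpoly_bilinear_induct:
 assumes "!!m m'. P (frag_of m) (frag_of m')"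
  "!!b. P 0 b" "!!a. P a 0"
  "!!a a' b. P a b==>P a' b==>P (a - a') b"
  "!!a b b'. P a b==>P a b'==>P a (b - b')"
 shows "P (a::'v int_mpoly) b"
proof -
 have single:"P (frag_of m) b" for m
 proof (rule frag_induction[of b UNIV "P (frag_of m)"])
  show "P (frag_of m) 0" by (rule assms(3))
  show "P (frag_of m) (frag_of x)" for x by (rule assms(1))
  show "P (frag_of m) (a - b)" if "P (frag_of m) a" "P (frag_of m) b" for a b
  using that by (rule assms(5))
 qed simp
 show ?thesis
 proof (rule frag_induction[of a UNIV "%a. P a b"])
  show "P 0 b" by (rule assms(2))
  show "P (frag_of x) b" for x by (rule single)
  show "P (a - a') b" if "P a b" "P a' b" for a a' using that by (rule assms(4))
 qed simp
qed

lemma mpoly_frob_diff:"mpoly_frob p (a - b) = mpoly_frob p a - mpoly_frob p b"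
 and mpoly_frob_add:"mpoly_frob p (a + b) = mpoly_frob p a + mpoly_frob p b"
 and mpoly_frob_0:"mpoly_frob p 0 = 0"
 by (simp_all add: mpoly_frob_def frag_extend_diff frag_extend_add)

lemma mpoly_frob_mult:"mpoly_frob p (a * b) = mpoly_frob p a * mpoly_frob p b"
proof (induction a b rule: int_mpoly_bilinear_induct)
 case (1 m m') then show ?case
  by (simp add:mpoly_frob_def frag_of_mult sum.distrib)
qed (simp_all add: mpoly_frob_diff mpoly_frob_0 left_diff_distrib right_diff_distrib)

lemma mpoly_frob_1:"mpoly_frob p 1 = 1"
 by (simp add:mpoly_frob_def flip: single_one)

lemma mpoly_frob_power:"mpoly_frob p (a ^ j) = mpoly_frob p a ^ j"
 by (induction j) (simp_all add: mpoly_frob_1 mpoly_frob_mult)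

lemma mpoly_frob_of_nat:"mpoly_frob p (of_nat j) = of_nat j"
 by (induction j) (simp_all add: mpoly_frob_0 mpoly_frob_1 mpoly_frob_add)

lemma mpoly_frob_sum:"mpoly_frob p (sum f S) = (\<Sum>i\<in>S. mpoly_frob p (f i))"
 by (induction S rule: infinite_finite_induct) (simp_all add: mpoly_frob_0 mpoly_frob_add)

lemma mpoly_frob_cong:
 assumes p:"Factorial_Ring.prime p"
 shows "of_nat p dvd mpoly_frob p a - a ^ p"
proof (rule frag_induction[of a UNIV])
 show "of_nat p dvd mpoly_frob p 0 - (0 :: 'a int_mpoly) ^ p"
  using prime_gt_0_nat[OF p] by (simp add:mpoly_frob_0 zero_power)
 show "of_nat p dvd mpoly_frob p (frag_of x) - (frag_of x :: 'a int_mpoly) ^ p" for x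
  by (simp add:mpoly_frob_def frag_of_power)
 fix a b :: "'a int_mpoly"
 assume a:"of_nat p dvd mpoly_frob p a - a ^ p" and b:"of_nat p dvd mpoly_frob p b - b ^ p"
 have "of_nat p dvd a ^ p - ((a - b) ^ p + b ^ p)"
  using frobenius_add_dvd[OF p,of "a - b" b] by simp
 then have "of_nat p dvd (mpoly_frob p a - a ^ p) - (mpoly_frob p b - b ^ p) + (a ^ p - ((a - b) ^ p + b ^ p))"
  by (intro dvd_add[OF dvd_diff[OF a b]])
 then show "of_nat p dvd mpoly_frob p (a - b) - (a - b) ^ p"
  by (simp add:mpoly_frob_diff algebra_simps)
qed simp

lemma of_nat_mult_cancel_mpoly:
 assumes "j > 0" "of_nat j * a = of_nat j * (b :: 'v int_mpoly)"
 shows "a = b"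
proof (rule poly_mapping_eqI)
 have lk:"Poly_Mapping.lookup (of_nat j * c) m = int j * Poly_Mapping.lookup c m" for c :: "'v int_mpoly" and m
  by (induction j) (simp_all add: lookup_add algebra_simps)
 show "Poly_Mapping.lookup a m = Poly_Mapping.lookup b m" for m
  using assms(2) assms(1) lk[of a m] lk[of b m] by simp
qed

lemma ghost_Suc_head:"ghost p x (Suc n) = (\<Sum>i\<le>n. of_nat (p ^ i) * x i ^ (p ^ (Suc n - i))) + of_nat (p ^ Suc n) * x (Suc n)"
 by (simp add:ghost_def)

lemma ghost_split:"ghost p x n = (\<Sum>i<n. of_nat (p ^ i) * x i ^ (p ^ (n - i))) + of_nat (p ^ n) * x n"
 unfolding ghost_def by (simp flip: lessThan_Suc_atMost)

lemma ghost_inj: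
 assumes p:"p > 0" and eq:"!!n. n < N==>ghost p x n = ghost p y n" and n:"n < N"
 shows "x n = (y n :: 'v int_mpoly)"
 using n
proof (induction n rule: less_induct)
 case (less n)
 have "(\<Sum>i<n. of_nat (p ^ i) * x i ^ (p ^ (n - i))) = (\<Sum>i<n. of_nat (p ^ i) * y i ^ (p ^ (n - i)))"
  by (rule sum.cong) (use less in auto)
 with eq[OF less.prems] have "of_nat (p ^ n) * x n = of_nat (p ^ n) * y n"
  by (simp add:ghost_split)
 then show ?case by (rule of_nat_mult_cancel_mpoly[rotated]) (use p in simp)
qed

text \<open>The ghost map detects congruences modulo \<open>p\<close> one power of \<open>p\<close> later; this controls how Witt components change when
 ghost components are perturbed.\<close>
lemma ghost_cong_imp_cong:
 assumes p:"Factorial_Ring.prime p"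
  and eq:"!!n. of_nat (p ^ Suc n) dvd ghost p x n - ghost p y n"
 shows "of_nat p dvd x n - (y n :: 'v int_mpoly)"
proof (induction n rule: less_induct)
 case (less n)
 have p0:"0 < p" using p prime_gt_0_nat by blast
 have "of_nat (p ^ Suc n) dvd of_nat (p ^ i) * x i ^ (p ^ (n - i)) - of_nat (p ^ i) * y i ^ (p ^ (n - i))"
  if i:"i < n" for i
 proof -
  have "of_nat (p ^ Suc (n - i)) dvd x i ^ (p ^ (n - i)) - y i ^ (p ^ (n - i))"
  by (rule power_prime_power_cong[OF p less[OF i]])
  then have "of_nat (p ^ i) * of_nat (p ^ Suc (n - i)) dvd of_nat (p ^ i) * (x i ^ (p ^ (n - i)) - y i ^ (p ^ (n - i)))"
  by (rule mult_dvd_mono[OF dvd_refl])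
  moreover have "(of_nat (p ^ i) * of_nat (p ^ Suc (n - i)) :: 'v int_mpoly) = of_nat (p ^ Suc n)"
  using i by (simp flip: of_nat_mult of_nat_power power_add power_Suc)
  ultimately show ?thesis by (simp add:right_diff_distrib)
 qed
 then have "of_nat (p ^ Suc n) dvd (\<Sum>i<n. of_nat (p ^ i) * x i ^ (p ^ (n - i)) - of_nat (p ^ i) * y i ^ (p ^ (n - i)))"
  by (intro dvd_sum) simp
 from dvd_diff[OF eq[of n] this]
 have "of_nat (p ^ Suc n) dvd of_nat (p ^ n) * (x n - y n)"
  by (simp add:ghost_split sum_subtractf algebra_simps)
 then obtain c where "of_nat (p ^ n) * (x n - y n) = of_nat (p ^ n) * (of_nat p * c)"
  by (auto simp:dvd_def mult.assoc mult.left_commute)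
 then have "x n - y n = of_nat p * c" by (rule of_nat_mult_cancel_mpoly[rotated]) (use p0 in simp)
 then show ?case by simp
qed

lemma frob_ghost_cong:
 assumes p:"Factorial_Ring.prime p"
 shows "of_nat (p ^ Suc n) dvd (\<Sum>i\<le>n. of_nat (p ^ i) * x i ^ (p ^ (Suc n - i))) - mpoly_frob p (ghost p x n)"
proof -
 have "of_nat (p ^ Suc n) dvd of_nat (p ^ i) * x i ^ (p ^ (Suc n - i)) - of_nat (p ^ i) * mpoly_frob p (x i) ^ (p ^ (n - i))"
  if i:"i \<le> n" for i
 proof -
  have "of_nat p dvd x i ^ p - mpoly_frob p (x i)"
  using mpoly_frob_cong[OF p,of "x i"] by (subst minus_diff_eq[symmetric],subst dvd_minus_iff)
  then have "of_nat (p ^ Suc (n - i)) dvd (x i ^ p) ^ (p ^ (n - i)) - mpoly_frob p (x i) ^ (p ^ (n - i))"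
  by (rule power_prime_power_cong[OF p])
  then have "of_nat (p ^ i) * of_nat (p ^ Suc (n - i)) dvd of_nat (p ^ i) * ((x i ^ p) ^ (p ^ (n - i)) - mpoly_frob p (x i) ^ (p ^ (n - i)))"
  by (rule mult_dvd_mono[OF dvd_refl])
  moreover have "(of_nat (p ^ i) * of_nat (p ^ Suc (n - i)) :: 'a int_mpoly) = of_nat (p ^ Suc n)"
  using i by (simp flip: of_nat_mult of_nat_power power_add power_Suc)
  moreover have "(x i ^ p) ^ (p ^ (n - i)) = x i ^ (p ^ (Suc n - i))"
  using i by (simp add:Suc_diff_le flip: power_mult)
  ultimately show ?thesis by (simp add:right_diff_distrib)
 qed
 then have "of_nat (p ^ Suc n) dvd (\<Sum>i\<le>n. of_nat (p ^ i) * x i ^ (p ^ (Suc n - i)) - of_nat (p ^ i) * mpoly_frob p (x i) ^ (p ^ (n - i)))"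
  by (intro dvd_sum) simp
 then show ?thesis
  unfolding ghost_def mpoly_frob_sum mpoly_frob_mult mpoly_frob_of_nat mpoly_frob_power
  by (simp only: sum_subtractf)
qed

definition dwork :: "nat => (nat => 'v int_mpoly) => bool" where
 "dwork p g \<longleftrightarrow> (ALL n. of_nat (p ^ Suc n) dvd g (Suc n) - mpoly_frob p (g n))"

lemma dwork_ghost:
 assumes "Factorial_Ring.prime p" shows "dwork p (ghost p x)"
 unfolding dwork_def ghost_Suc_head
proof
 fix n
 have "of_nat (p ^ Suc n) dvd (\<Sum>i\<le>n. of_nat (p ^ i) * x i ^ (p ^ (Suc n - i))) - mpoly_frob p (ghost p x n) + of_nat (p ^ Suc n) * x (Suc n)"
  by (intro dvd_add frob_ghost_cong[OF assms] dvd_triv_left)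
 then show "of_nat (p ^ Suc n) dvd (\<Sum>i\<le>n. of_nat (p ^ i) * x i ^ (p ^ (Suc n - i))) + of_nat (p ^ Suc n) * x (Suc n) - mpoly_frob p (ghost p x n)"
  by (simp add:algebra_simps)
qed

lemma dwork_diff: assumes "dwork p g" "dwork p h" shows "dwork p (%n. g n - h n)"
 unfolding dwork_def mpoly_frob_diff
proof
 fix n
 have "of_nat (p ^ Suc n) dvd (g (Suc n) - mpoly_frob p (g n)) - (h (Suc n) - mpoly_frob p (h n))"
  by (rule dvd_diff[OF spec[OF assms(1)[unfolded dwork_def]] spec[OF assms(2)[unfolded dwork_def]]])
 then show "of_nat (p ^ Suc n) dvd g (Suc n) - h (Suc n) - (mpoly_frob p (g n) - mpoly_frob p (h n))"
  by (simp add:algebra_simps)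
qed

lemma dwork_add: assumes "dwork p g" "dwork p h" shows "dwork p (%n. g n + h n)"
 unfolding dwork_def mpoly_frob_add
proof
 fix n
 have "of_nat (p ^ Suc n) dvd (g (Suc n) - mpoly_frob p (g n)) + (h (Suc n) - mpoly_frob p (h n))"
  by (rule dvd_add[OF spec[OF assms(1)[unfolded dwork_def]] spec[OF assms(2)[unfolded dwork_def]]])
 then show "of_nat (p ^ Suc n) dvd g (Suc n) + h (Suc n) - (mpoly_frob p (g n) + mpoly_frob p (h n))"
  by (simp add:algebra_simps)
qed

lemma dwork_mult: assumes g:"dwork p g" and h:"dwork p h" shows "dwork p (%n. g n * h n)"
 unfolding dwork_def mpoly_frob_mult
proof
 fix n
 have "of_nat (p ^ Suc n) dvd (g (Suc n) - mpoly_frob p (g n)) * h (Suc n) + mpoly_frob p (g n) * (h (Suc n) - mpoly_frob p (h n))"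
  by (rule dvd_add[OF dvd_mult2[OF spec[OF g[unfolded dwork_def]]] dvd_mult[OF spec[OF h[unfolded dwork_def]]]])
 then show "of_nat (p ^ Suc n) dvd g (Suc n) * h (Suc n) - mpoly_frob p (g n) * mpoly_frob p (h n)"
  by (simp add:algebra_simps)
qed

lemma dwork_of_nat:"dwork p (%n. of_nat c)"
 by (simp add:dwork_def mpoly_frob_of_nat)

text \<open>Dwork's lemma: the congruences \<open>g (n+1) \<equiv> Frob (g n)\<close> modulo \<open>p^(n+1)\<close> are exactly what is needed to solve
 the triangular system \<open>ghost x = g\<close> over the integers, one component at a time.\<close>
lemma dwork_imp_ghost:
 fixes g :: "nat => 'v int_mpoly"
 assumes p:"Factorial_Ring.prime p" and g:"dwork p g"
 shows "EX x. ALL n. ghost p x n = g n"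
proof -
 define good where "good n c \<longleftrightarrow> (\<forall>m\<le>n. ghost p c m = g m)" for n c
 have ghost_upd:"ghost p (c(j := a)) m = ghost p c m" if "m < j" for c :: "nat => 'v int_mpoly" and a j m
  unfolding ghost_def by (rule sum.cong) (use that in auto)
 have "EX f. ALL n. good n (f n) & (\<forall>m\<le>n. f (Suc n) m = f n m)"
 proof (rule dependent_nat_choice)
  show "EX c. good 0 c" by (rule exI[of _ "%_. g 0"]) (simp add:good_def ghost_def)
 next
  fix c n assume c:"good n c"
  have "of_nat (p ^ Suc n) dvd (g (Suc n) - mpoly_frob p (g n)) - ((\<Sum>i\<le>n. of_nat (p ^ i) * c i ^ (p ^ (Suc n - i))) - mpoly_frob p (ghost p c n))"
  by (rule dvd_diff[OF spec[OF g[unfolded dwork_def]] frob_ghost_cong[OF p]])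
  moreover have "ghost p c n = g n" using c by (simp add:good_def)
  ultimately have "of_nat (p ^ Suc n) dvd g (Suc n) - (\<Sum>i\<le>n. of_nat (p ^ i) * c i ^ (p ^ (Suc n - i)))"
  by simp
  then obtain a where a:"g (Suc n) - (\<Sum>i\<le>n. of_nat (p ^ i) * c i ^ (p ^ (Suc n - i))) = of_nat (p ^ Suc n) * a"
  by (auto simp:dvd_def)
  let ?c = "c(Suc n := a)"
  have "ghost p ?c (Suc n) = (\<Sum>i\<le>n. of_nat (p ^ i) * ?c i ^ (p ^ (Suc n - i))) + of_nat (p ^ Suc n) * a"
  by (simp add:ghost_Suc_head)
  also have "(\<Sum>i\<le>n. of_nat (p ^ i) * ?c i ^ (p ^ (Suc n - i))) = (\<Sum>i\<le>n. of_nat (p ^ i) * c i ^ (p ^ (Suc n - i)))"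
  by (rule sum.cong) auto
  also have "(\<Sum>i\<le>n. of_nat (p ^ i) * c i ^ (p ^ (Suc n - i))) + of_nat (p ^ Suc n) * a = g (Suc n)"
  unfolding a[symmetric] by simp
  finally have "ghost p ?c (Suc n) = g (Suc n)" .
  then have "good (Suc n) ?c" using c by (auto simp:good_def ghost_upd le_Suc_eq)
  then show "EX c'. good (Suc n) c' & (\<forall>m\<le>n. c' m = c m)" by (intro exI[of _ ?c]) auto
 qed
 then obtain f where ff:"ALL n. good n (f n) & (\<forall>m\<le>n. f (Suc n) m = f n m)" by (rule exE)
 have f:"good n (f n)" "m \<le> n==>f (Suc n) m = f n m" for n m using ff by simp_all
 have stab:"f (m + j) m = f m m" for m j
 proof (induction j)
  case (Suc j) then show ?case using f(2)[of m "m + j"] by simp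
 qed simp
 have stab': "f n m = f m m" if "m \<le> n" for n m using stab[of m "n - m"] that by simp
 have "ghost p (%n. f n n) n = ghost p (f n) n" for n
  unfolding ghost_def
 proof (rule sum.cong[OF refl])
  fix i assume "i\<in>{..n}"
  then have e:"f n i = f i i" using stab'[of i n] by simp
  show "of_nat (p ^ i) * f i i ^ p ^ (n - i) = of_nat (p ^ i) * f n i ^ p ^ (n - i)"
  unfolding e ..
 qed
 then show ?thesis using f(1) by (intro exI[of _ "%n. f n n"]) (simp add:good_def)
qed

lemma ghost_ext:
 assumes "p > 0" "!!n. ghost p x n = ghost p y n" shows "x = (y :: nat => 'v int_mpoly)"
 by (rule ext,rule ghost_inj[OF assms(1,2) lessI])

lemma ghost_witt_sum_poly:
 assumes p:"Factorial_Ring.prime p"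
 shows "ghost p (witt_sum_poly p) n =
  ghost p (%i. mpoly_var (Inl i)) n + ghost p (%i. mpoly_var (Inr i)) n"
proof -
 have p0:"0 < p" using p prime_gt_0_nat by blast
 let ?P = "%S. ALL n. ghost p S n = ghost p (%i. mpoly_var (Inl i :: nat + nat)) n + ghost p (%i. mpoly_var (Inr i)) n"
 have ex:"EX S. ?P S" by (intro dwork_imp_ghost dwork_add dwork_ghost p)
 then have "\<exists>!S. ?P S" by (rule ex_ex1I) (rule ghost_ext[OF p0],simp)
 from theI'[OF this] show ?thesis unfolding witt_sum_poly_def by blast
qed

lemma ghost_witt_prod_poly:
 assumes p:"Factorial_Ring.prime p"
 shows "ghost p (witt_prod_poly p) n =
  ghost p (%i. mpoly_var (Inl i)) n * ghost p (%i. mpoly_var (Inr i)) n"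
proof -
 have p0:"0 < p" using p prime_gt_0_nat by blast
 let ?P = "%S. ALL n. ghost p S n = ghost p (%i. mpoly_var (Inl i :: nat + nat)) n * ghost p (%i. mpoly_var (Inr i)) n"
 have ex:"EX S. ?P S" by (intro dwork_imp_ghost dwork_mult dwork_ghost p)
 then have "\<exists>!S. ?P S" by (rule ex_ex1I) (rule ghost_ext[OF p0],simp)
 from theI'[OF this] show ?thesis unfolding witt_prod_poly_def by blast
qed

section \<open>Evaluating integer polynomials in commutative rings\<close>

definition monom_eval :: "('a,'m) ring_scheme => ('v => 'a) => ('v \<Rightarrow>\<^sub>0 nat) => 'a" where
 "monom_eval R x m = (\<Otimes>\<^bsub>R\<^esub>v\<in>Poly_Mapping.keys m. x v ^.R Poly_Mapping.lookup m v)"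

lemma mpoly_eval_alt:"mpoly_eval R x P =
  (\<Oplus>\<^bsub>R\<^esub>m\<in>Poly_Mapping.keys P. add_pow R (Poly_Mapping.lookup P m) (monom_eval R x m))"
 by (simp add:mpoly_eval_def monom_eval_def)

lemma (in abelian_group) eq_minusI:
 assumes "a \<oplus> c = b" "a<:G" "c<:G" shows "a = b \<ominus> c"
 using assms(2,3) unfolding assms(1)[symmetric] by (simp add:a_minus_def a_assoc r_neg)

context cring
begin

lemma monom_eval_closed:
 assumes "!!v. x v<:R" shows "monom_eval R x m<:R"
 unfolding monom_eval_def by (rule finprod_closed) (use assms in auto)

lemma monom_eval_superset:
 assumes x:"!!v. x v<:R" and S:"finite S" "Poly_Mapping.keys m <= S"
 shows "monom_eval R x m = (\<Otimes>v\<in>S. x v [^] Poly_Mapping.lookup m v)"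
 unfolding monom_eval_def
 by (rule finprod_mono_neutral_cong_left) (use x S in \<open>auto simp:in_keys_iff\<close>)

lemma monom_eval_add:
 assumes x:"!!v. x v<:R"
 shows "monom_eval R x (m + m') = monom_eval R x m \<otimes> monom_eval R x m'"
proof -
 let ?S = "Poly_Mapping.keys m \<union> Poly_Mapping.keys m'"
 have S:"finite ?S" by simp
 have "monom_eval R x (m + m') = (\<Otimes>v\<in>?S. x v [^] Poly_Mapping.lookup (m + m') v)"
  by (rule monom_eval_superset[OF x S Poly_Mapping.keys_add])
 also have "... = (\<Otimes>v\<in>?S. x v [^] Poly_Mapping.lookup m v \<otimes> x v [^] Poly_Mapping.lookup m' v)"
  by (simp add:lookup_add nat_pow_mult x)
 also have "... = (\<Otimes>v\<in>?S. x v [^] Poly_Mapping.lookup m v) \<otimes> (\<Otimes>v\<in>?S. x v [^] Poly_Mapping.lookup m' v)"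
  by (rule finprod_multf) (use x in auto)
 finally show ?thesis
  using monom_eval_superset[OF x S,of m] monom_eval_superset[OF x S,of m'] by simp
qed

lemma mpoly_eval_closed:
 assumes x:"!!v. x v<:R" shows "mpoly_eval R x P<:R"
 unfolding mpoly_eval_alt by (rule finsum_closed) (auto intro: monom_eval_closed[OF x])

lemma mpoly_eval_superset:
 assumes x:"!!v. x v<:R" and S:"finite S" "Poly_Mapping.keys P <= S"
 shows "mpoly_eval R x P = (\<Oplus>m\<in>S. add_pow R (Poly_Mapping.lookup P m) (monom_eval R x m))"
 unfolding mpoly_eval_alt
 by (rule add.finprod_mono_neutral_cong_left) (use S in \<open>auto simp:in_keys_iff add_pow_def[of R "0::int"] intro!: monom_eval_closed[OF x]\<close>)

lemma mpoly_eval_add: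
 assumes x:"!!v. x v<:R"
 shows "mpoly_eval R x (P + Q) = mpoly_eval R x P \<oplus> mpoly_eval R x Q"
proof -
 let ?S = "Poly_Mapping.keys P \<union> Poly_Mapping.keys Q"
 have S:"finite ?S" by simp
 have "mpoly_eval R x (P + Q) = (\<Oplus>m\<in>?S. add_pow R (Poly_Mapping.lookup (P + Q) m) (monom_eval R x m))"
  by (rule mpoly_eval_superset[OF x S Poly_Mapping.keys_add])
 also have "... = (\<Oplus>m\<in>?S. add_pow R (Poly_Mapping.lookup P m) (monom_eval R x m) \<oplus> add_pow R (Poly_Mapping.lookup Q m) (monom_eval R x m))"
  by (simp add:lookup_add add.int_pow_mult monom_eval_closed[OF x])
 also have "... = (\<Oplus>m\<in>?S. add_pow R (Poly_Mapping.lookup P m) (monom_eval R x m)) \<oplus> (\<Oplus>m\<in>?S. add_pow R (Poly_Mapping.lookup Q m) (monom_eval R x m))"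
  by (rule finsum_addf) (auto intro: monom_eval_closed[OF x])
 finally show ?thesis
  using mpoly_eval_superset[OF x S,of P] mpoly_eval_superset[OF x S,of Q] by simp
qed

lemma mpoly_eval_0:"mpoly_eval R x 0 = \<zero>"
 by (simp add:mpoly_eval_alt)

lemma mpoly_eval_diff:
 assumes x:"!!v. x v<:R"
 shows "mpoly_eval R x (P - Q) = mpoly_eval R x P \<ominus> mpoly_eval R x Q"
proof (rule eq_minusI)
 show "mpoly_eval R x (P - Q) \<oplus> mpoly_eval R x Q = mpoly_eval R x P"
  using mpoly_eval_add[OF x,where P = "P - Q" and Q = Q] by simp
qed (auto intro: mpoly_eval_closed[OF x])

lemma mpoly_eval_frag_of:
 assumes x:"!!v. x v<:R"
 shows "mpoly_eval R x (frag_of m) = monom_eval R x m"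
 by (simp add:mpoly_eval_alt monom_eval_closed[OF x])

lemma mpoly_eval_mult:
 assumes x:"!!v. x v<:R"
 shows "mpoly_eval R x (P * Q) = mpoly_eval R x P \<otimes> mpoly_eval R x Q"
proof (induction P Q rule: int_mpoly_bilinear_induct)
 case (1 m m') then show ?case
  by (simp add:frag_of_mult mpoly_eval_frag_of[OF x] monom_eval_add[OF x])
next
 case (4 a a' b) then show ?case
  by (simp add:mpoly_eval_diff[OF x] left_diff_distrib) 
  (simp add:a_minus_def l_distr l_minus mpoly_eval_closed[OF x])
next
 case (5 a b b') then show ?case
  by (simp add:mpoly_eval_diff[OF x] right_diff_distrib) 
  (simp add:a_minus_def r_distr r_minus mpoly_eval_closed[OF x])
qed (simp_all add: mpoly_eval_0 mpoly_eval_closed[OF x])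

lemma mpoly_eval_1:"mpoly_eval R x 1 = \<one>"
proof -
 have "(1 :: 'v int_mpoly) = frag_of 0" by (simp flip: single_one)
 moreover have "mpoly_eval R x (frag_of 0) = \<one>"
  by (simp add:mpoly_eval_alt monom_eval_def)
 ultimately show ?thesis by metis
qed

lemma mpoly_eval_var:
 assumes x:"!!v. x v<:R" shows "mpoly_eval R x (mpoly_var v) = x v"
 unfolding mpoly_var_def mpoly_eval_frag_of[OF x] by (simp add:monom_eval_def x)

lemma mpoly_eval_of_nat:
 assumes x:"!!v. x v<:R" shows "mpoly_eval R x (of_nat j) = add_pow R j \<one>"
 by (induction j) (simp_all add: mpoly_eval_0 mpoly_eval_1 mpoly_eval_add[OF x] a_comm mpoly_eval_closed[OF x])

lemma mpoly_eval_power: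
 assumes x:"!!v. x v<:R" shows "mpoly_eval R x (P ^ j) = mpoly_eval R x P [^] j"
 by (induction j) (simp_all add: mpoly_eval_1 mpoly_eval_mult[OF x] m_comm mpoly_eval_closed[OF x])

end

lemma (in ring_hom_cring) hom_mpoly_eval:
 assumes x:"!!v. x v<:R"
 shows "h (mpoly_eval R x P) = mpoly_eval S (%v. h (x v)) P"
proof -
 have hx:"h (x v)<:S" for v using x by simp
 show ?thesis
 proof (rule frag_induction[of P UNIV])
  show "h (mpoly_eval R x (frag_of m)) = mpoly_eval S (%v. h (x v)) (frag_of m)" for m
  unfolding R.mpoly_eval_frag_of[OF x] S.mpoly_eval_frag_of[OF hx] monom_eval_def
  by (subst hom_finprod) (auto simp:x comp_def ring.hom_nat_pow intro!: S.finprod_cong')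
  show "h (mpoly_eval R x (a - b)) = mpoly_eval S (%v. h (x v)) (a - b)"
  if "h (mpoly_eval R x a) = mpoly_eval S (%v. h (x v)) a"
  "h (mpoly_eval R x b) = mpoly_eval S (%v. h (x v)) b" for a b
  using that unfolding R.mpoly_eval_diff[OF x] S.mpoly_eval_diff[OF hx]
  by (simp add:a_minus_def R.mpoly_eval_closed[OF x])
 qed (simp_all add: R.mpoly_eval_0 S.mpoly_eval_0)
qed

text \<open>A type-class ring as a record, so that identities between ghost components of integer polynomials can be transported
 to arbitrary rings by evaluation.\<close>
definition type_ring :: "'a::comm_ring_1 ring" where
 "type_ring = \<lparr>carrier = UNIV,monoid.mult = (*),one = 1,ring.zero = 0,add = (+)\<rparr>"

lemma type_ring_simps [simp]:
 "car type_ring = UNIV" "x*.type_ring y = x * y" "1@type_ring = 1"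
 "0@type_ring = 0" "x+.type_ring y = x + y"
 by (simp_all add: type_ring_def)

lemma cring_type_ring:"cring (type_ring :: 'a::comm_ring_1 ring)"
 by (rule cringI; (rule abelian_groupI comm_monoidI)?)
  (auto simp:algebra_simps intro: exI[of _ "- _"] add.left_inverse)

section \<open>The ring of Witt vectors\<close>

abbreviation witt_add :: "nat => ('k,'m) ring_scheme => (nat => 'k) => (nat => 'k) => nat => 'k" where
 "witt_add p R \<equiv> ring.add (Witt p R)"

abbreviation witt_mult :: "nat => ('k,'m) ring_scheme => (nat => 'k) => (nat => 'k) => nat => 'k" where
 "witt_mult p R \<equiv> monoid.mult (Witt p R)"

lemma witt_add_apply:"witt_add p R x y n = mpoly_eval R (case_sum x y) (witt_sum_poly p n)"
 and witt_mult_apply:"witt_mult p R x y n = mpoly_eval R (case_sum x y) (witt_prod_poly p n)"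
 and witt_zero:"0@(Witt p R) = (%i. 0@R)"
 and witt_one:"1@(Witt p R) = (%i. if i = 0 then 1@R else 0@R)"
 and witt_carrier:"x<:(Witt p R) \<longleftrightarrow> (ALL i. x i<:R)"
 by (simp_all add: Witt_def)

lemma (in ring_hom_cring) hom_witt_add:
 assumes "!!i. x i<:R" "!!i. y i<:R"
 shows "h (witt_add p R x y n) = witt_add p S (%i. h (x i)) (%i. h (y i)) n"
 unfolding witt_add_apply
 by (subst hom_mpoly_eval)
  (use assms in \<open>auto split: sum.split intro!: arg_cong[of _ _ "%z. mpoly_eval S z _"]\<close>)

lemma (in ring_hom_cring) hom_witt_mult:
 assumes "!!i. x i<:R" "!!i. y i<:R"
 shows "h (witt_mult p R x y n) = witt_mult p S (%i. h (x i)) (%i. h (y i)) n"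
 unfolding witt_mult_apply
 by (subst hom_mpoly_eval)
  (use assms in \<open>auto split: sum.split intro!: arg_cong[of _ _ "%z. mpoly_eval S z _"]\<close>)

lemma mpoly_eval_ghost:
 fixes x :: "'v => 'w int_mpoly"
 shows "mpoly_eval type_ring x (ghost p z n) = ghost p (%i. mpoly_eval type_ring x (z i)) n"
proof -
 interpret T: cring "type_ring :: 'w int_mpoly ring" by (rule cring_type_ring)
 have x:"x v<:type_ring" for v by simp
 have nat:"add_pow type_ring j (1 :: 'w int_mpoly) = of_nat j" for j :: nat
  by (induction j) (simp_all add: add.commute)
 have pow:"a ^.type_ring j = (a :: 'w int_mpoly) ^ j" for a and j :: nat
  by (induction j) (simp_all add: mult.commute)
 have sum:"mpoly_eval type_ring x (sum f S) = (\<Sum>i\<in>S. mpoly_eval type_ring x (f i))" if "finite S" for f :: "nat => 'v int_mpoly" and S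
  using that by (induction S) (simp_all add: T.mpoly_eval_0[simplified] T.mpoly_eval_add[OF x,simplified])
 show ?thesis
  unfolding ghost_def
  by (subst sum) (simp_all only: finite_atMost T.mpoly_eval_mult[OF x] T.mpoly_eval_power[OF x] T.mpoly_eval_of_nat[OF x] type_ring_simps nat pow)
qed

lemma ghost_witt_add:
 fixes x y :: "nat => 'v int_mpoly"
 assumes p:"Factorial_Ring.prime p"
 shows "ghost p (witt_add p type_ring x y) n = ghost p x n + ghost p y n"
proof -
 interpret T: cring "type_ring :: 'v int_mpoly ring" by (rule cring_type_ring)
 have c:"case_sum x y v<:type_ring" for v by simp
 have "witt_add p type_ring x y = (%i. mpoly_eval type_ring (case_sum x y) (witt_sum_poly p i))"
  by (rule ext) (rule witt_add_apply)
 then have "ghost p (witt_add p type_ring x y) n = mpoly_eval type_ring (case_sum x y) (ghost p (witt_sum_poly p) n)"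
  by (simp add:mpoly_eval_ghost)
 also have "... = ghost p x n + ghost p y n"
  unfolding ghost_witt_sum_poly[OF p] T.mpoly_eval_add[OF c] mpoly_eval_ghost T.mpoly_eval_var[OF c] by simp
 finally show ?thesis .
qed

lemma ghost_witt_mult:
 fixes x y :: "nat => 'v int_mpoly"
 assumes p:"Factorial_Ring.prime p"
 shows "ghost p (witt_mult p type_ring x y) n = ghost p x n * ghost p y n"
proof -
 interpret T: cring "type_ring :: 'v int_mpoly ring" by (rule cring_type_ring)
 have c:"case_sum x y v<:type_ring" for v by simp
 have "witt_mult p type_ring x y = (%i. mpoly_eval type_ring (case_sum x y) (witt_prod_poly p i))"
  by (rule ext) (rule witt_mult_apply)
 then have "ghost p (witt_mult p type_ring x y) n = mpoly_eval type_ring (case_sum x y) (ghost p (witt_prod_poly p) n)"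
  by (simp add:mpoly_eval_ghost)
 also have "... = ghost p x n * ghost p y n"
  unfolding ghost_witt_prod_poly[OF p] T.mpoly_eval_mult[OF c] mpoly_eval_ghost T.mpoly_eval_var[OF c] by simp
 finally show ?thesis .
qed

lemma ghost_zero:"p > 0==>ghost p (%i. 0) n = 0"
 by (simp add:ghost_def zero_power)

lemma ghost_one: assumes "p > 0" shows "ghost p (%i. if i = 0 then 1 else 0) n = 1"
proof -
 have "ghost p (%i. if i = 0 then 1 else 0) n = (\<Sum>i\<le>n. if i = 0 then 1 else 0)"
  unfolding ghost_def by (rule sum.cong) (use assms in \<open>auto simp:zero_power\<close>)
 then show ?thesis by simp
qed

definition gen_witt :: "nat => nat => (nat \<times> nat) int_mpoly" where
 "gen_witt a i = mpoly_var (a,i)"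

text \<open>Identities between Witt vectors over a commutative ring follow from the same identities
 between the generic Witt vectors by evaluation, and those can be checked on ghost components.\<close>

lemma (in cring) generic_evaluation:
 assumes "!!i. x i<:R" "!!i. y i<:R" "!!i. z i<:R"
 shows "EX h. ring_hom_cring type_ring R h \<and>
  (%i. h (gen_witt 0 i)) = x & (%i. h (gen_witt 1 i)) = y & (%i. h (gen_witt 2 i)) = z"
proof -
 define u where "u = (%(a,i). if a = (0::nat) then x i else if a = 1 then y i else z (i::nat))"
 let ?h = "mpoly_eval R u"
 have u:"u v<:R" for v using assms by (auto simp:u_def split: prod.split)
 have "ring_hom_cring type_ring R ?h"
  by (rule ring_hom_cringI[OF cring_type_ring is_cring],rule ring_hom_memI)
  (simp_all add: mpoly_eval_closed[OF u] mpoly_eval_add[OF u] mpoly_eval_mult[OF u] mpoly_eval_1)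
 then show ?thesis
  by (intro exI[of _ ?h]) (simp add:gen_witt_def mpoly_eval_var[OF u],simp add:u_def)
qed

lemma cring_witt_type_ring:
 assumes p:"Factorial_Ring.prime p"
 shows "cring (Witt p (type_ring :: 'v int_mpoly ring))"
proof -
 have p0:"0 < p" using p prime_gt_0_nat by blast
 note g = ghost_witt_add[OF p] ghost_witt_mult[OF p] ghost_zero[OF p0] ghost_one[OF p0]
 let ?W = "Witt p (type_ring :: 'v int_mpoly ring)"
 have c:"x<:?W" for x by (simp add:witt_carrier)
 have neg:"EX y. y+.?W x = 0@?W" for x
 proof -
  have "dwork p (%n. of_nat 0 - ghost p x n)"
  by (intro dwork_diff dwork_of_nat dwork_ghost p)
  then obtain y where y:"!!n. ghost p y n = - ghost p x n" using dwork_imp_ghost[OF p] by auto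
  have "y+.?W x = 0@?W" by (rule ghost_ext[OF p0]) (simp add:g y witt_zero)
  then show ?thesis by blast
 qed
 show ?thesis
 proof (rule cringI)
  show "abelian_group ?W"
  by (rule abelian_groupI; (rule c | rule ghost_ext[OF p0])?)
  (use neg c in \<open>auto simp:g witt_zero algebra_simps\<close>)
  show "comm_monoid ?W"
  by (rule comm_monoidI; (rule c | rule ghost_ext[OF p0])?)
  (simp_all add: g g(4)[folded type_ring_simps(3,4)] witt_one algebra_simps)
  show "(x+.?W y)*.?W z = x*.?W z+.?W y*.?W z" for x y z
  by (rule ghost_ext[OF p0]) (simp add:g algebra_simps)
 qed
qed

text \<open>The ring axioms are polynomial identities in the components. They hold for integer polynomials because the ghost
 map is injective there, and evaluation carries them to any commutative ring.\<close>
lemma (in cring) cring_Witt: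
 assumes p:"Factorial_Ring.prime p"
 shows "cring (Witt p R)"
proof -
 let ?W = "Witt p R"
 let ?T = "Witt p (type_ring :: (nat \<times> nat) int_mpoly ring)"
 interpret T: cring ?T by (rule cring_witt_type_ring[OF p])
 have tc:"t<:?T" for t by (simp add:witt_carrier)
 have gen:"EX h x0 y0 z0. (ALL a b. h (a+.?T b) = h a+.?W h b) & (ALL a b. h (a*.?T b) = h a*.?W h b) \<and>
  h 0@?T = 0@?W & h 1@?T = 1@?W & (ALL a. h a<:?W) & h x0 = x & h y0 = y & h z0 = z"
  if "x<:?W" "y<:?W" "z<:?W" for x y z
 proof -
  obtain h where h:"ring_hom_cring type_ring R h" and e:"(%i. h (gen_witt 0 i)) = x"
  "(%i. h (gen_witt 1 i)) = y" "(%i. h (gen_witt 2 i)) = z"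
  using generic_evaluation[of x y z] \<open>x\<in>car ?W\<close> \<open>y\<in>car ?W\<close> \<open>z\<in>car ?W\<close> unfolding witt_carrier by blast
  interpret h: ring_hom_cring type_ring R h by (rule h)
  show ?thesis
  proof (intro exI[of _ "%a i. h (a i)"] exI conjI allI)
  show "(%i. h ((a+.?T b) i)) = (%i. h (a i))+.?W (%i. h (b i))" for a b
  by (rule ext) (rule h.hom_witt_add; simp)
  show "(%i. h ((a*.?T b) i)) = (%i. h (a i))*.?W (%i. h (b i))" for a b
  by (rule ext) (rule h.hom_witt_mult; simp)
  show "(%i. h (0@?T i)) = 0@?W" using h.hom_zero by (simp add:witt_zero)
  show "(%i. h (1@?T i)) = 1@?W" using h.hom_zero h.hom_one by (auto simp:witt_one)
  show "(%i. h (a i))<:?W" for a using h.hom_closed by (simp add:witt_carrier)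
  qed (rule e)+
 qed
 have one:"1@?W<:?W" and zero:"0@?W<:?W"
  by (simp_all add: witt_carrier witt_zero witt_one)
 show ?thesis
 proof (rule cringI)
  show "abelian_group ?W"
  proof (rule abelian_groupI)
  fix x y assume "x<:?W" "y<:?W"
  from gen[OF this zero] show "x+.?W y<:?W" "x+.?W y = y+.?W x"
  by (metis,metis T.a_comm tc)
  next
  fix x y z assume "x<:?W" "y<:?W" "z<:?W"
  from gen[OF this] show "x+.?W y+.?W z = x+.?W (y+.?W z)"
  by (metis T.a_assoc tc)
  next
  fix x assume "x<:?W"
  from gen[OF this zero zero] show "0@?W+.?W x = x" "\<exists>y\<in>car ?W. y+.?W x = 0@?W"
  by (metis T.l_zero tc,metis T.l_neg tc)
  qed (rule zero)
  show "comm_monoid ?W"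
  proof (rule comm_monoidI)
  fix x y assume "x<:?W" "y<:?W"
  from gen[OF this zero] show "x*.?W y<:?W" "x*.?W y = y*.?W x"
  by (metis,metis T.m_comm tc)
  next
  fix x y z assume "x<:?W" "y<:?W" "z<:?W"
  from gen[OF this] show "x*.?W y*.?W z = x*.?W (y*.?W z)"
  by (metis T.m_assoc tc)
  next
  fix x assume "x<:?W"
  from gen[OF this zero zero] show "1@?W*.?W x = x"
  by (metis T.l_one tc)
  qed (rule one)
  fix x y z assume "x<:?W" "y<:?W" "z<:?W"
  from gen[OF this] show "(x+.?W y)*.?W z = x*.?W z+.?W y*.?W z"
  by (metis T.l_distr tc)
 qed
qed

lemma (in ring_hom_cring) ring_hom_cring_Witt:
 assumes p:"Factorial_Ring.prime p"
 shows "ring_hom_cring (Witt p R) (Witt p S) (%x i. h (x i))"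
proof (rule ring_hom_cringI[OF R.cring_Witt[OF p] S.cring_Witt[OF p]],rule ring_hom_memI)
 fix x assume x:"x<:(Witt p R)"
 then show "(%i. h (x i))<:(Witt p S)" by (simp add:witt_carrier)
 fix y assume y:"y<:(Witt p R)"
 show "(%i. h ((x*.(Witt p R) y) i)) = (%i. h (x i))*.(Witt p S) (%i. h (y i))"
  by (rule ext) (rule hom_witt_mult; use x y in \<open>simp add:witt_carrier\<close>)
 show "(%i. h ((x+.(Witt p R) y) i)) = (%i. h (x i))+.(Witt p S) (%i. h (y i))"
  by (rule ext) (rule hom_witt_add; use x y in \<open>simp add:witt_carrier\<close>)
qed (auto simp:witt_one)

lemma ghost_witt_minus:
 fixes x y :: "nat => 'v int_mpoly"
 assumes p:"Factorial_Ring.prime p"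
 shows "ghost p (x-.(Witt p type_ring) y) n = ghost p x n - ghost p y n"
proof -
 interpret T: cring "Witt p (type_ring :: 'v int_mpoly ring)" by (rule cring_witt_type_ring[OF p])
 have tc:"t<:(Witt p (type_ring :: 'v int_mpoly ring))" for t by (simp add:witt_carrier)
 have "(x-.(Witt p type_ring) y)+.(Witt p type_ring) y = x"
  by (simp add:a_minus_def T.a_assoc T.l_neg tc)
 then show ?thesis using ghost_witt_add[OF p,of "x-.(Witt p type_ring) y" y n] by simp
qed

lemma ghost_prefix:
 assumes "!!j. j \<le> n==>x j = y j" shows "ghost p x n = ghost p y n"
 unfolding ghost_def by (rule sum.cong) (use assms in auto)

lemma ghost_prefix_zero:
 assumes "p > 0" "!!j. j \<le> n==>x j = 0" shows "ghost p x n = 0"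
 using ghost_prefix[of n x "%_. 0" p] assms ghost_zero[of p n] by simp

context cring
begin

lemma witt_add_prefix:
 assumes p:"Factorial_Ring.prime p" and y:"y<:(Witt p R)" and z:"z<:(Witt p R)"
  and z0:"!!j. j < N==>z j = \<zero>" and n:"n < N"
 shows "(y+.(Witt p R) z) n = y n"
proof -
 have p0:"0 < p" using p prime_gt_0_nat by blast
 obtain h where h:"ring_hom_cring type_ring R h" 
  "(%i. h (gen_witt 1 i)) = y" "(%i. h (gen_witt 2 i)) = z"
  using generic_evaluation[of y y z] y z unfolding witt_carrier by blast
 interpret h: ring_hom_cring type_ring R h by (rule h)
 define Z where "Z = (%j. if j < N then 0 else gen_witt 2 j)"
 have hz:"(%i. h (Z i)) = z"
  using h(3) z0 h.hom_zero by (auto simp:Z_def fun_eq_iff)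
 have "witt_add p type_ring (gen_witt 1) Z n = gen_witt 1 n"
 proof (rule ghost_inj[OF p0 _ n])
  fix m assume "m < N"
  then show "ghost p (witt_add p type_ring (gen_witt 1) Z) m = ghost p (gen_witt 1) m"
  unfolding ghost_witt_add[OF p] by (simp add:ghost_prefix_zero[OF p0] Z_def)
 qed
 then have "h (gen_witt 1 n) = witt_add p R (%i. h (gen_witt 1 i)) (%i. h (Z i)) n"
  by (metis h.hom_witt_add UNIV_I type_ring_simps(1))
 then show ?thesis unfolding h(2) hz using fun_cong[OF h(2),of n] by simp
qed

lemma witt_minus_prefix:
 assumes p:"Factorial_Ring.prime p" and x:"x<:(Witt p R)" and y:"y<:(Witt p R)"
  and xy:"!!j. j < N==>x j = y j" and n:"n < N"
 shows "(x-.(Witt p R) y) n = \<zero>"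
proof -
 have p0:"0 < p" using p prime_gt_0_nat by blast
 obtain h where h:"ring_hom_cring type_ring R h" 
  "(%i. h (gen_witt 0 i)) = x" "(%i. h (gen_witt 1 i)) = y"
  using generic_evaluation[of x y y] x y unfolding witt_carrier by blast
 interpret h: ring_hom_cring type_ring R h by (rule h)
 interpret w: ring_hom_cring "Witt p type_ring" "Witt p R" "%x i. h (x i)"
  by (rule h.ring_hom_cring_Witt[OF p])
 define X0 where "X0 = (%j. if j < N then gen_witt 1 j else gen_witt 0 j)"
 have hx:"(%i. h (X0 i)) = x"
  using h(2,3) xy by (auto simp:X0_def fun_eq_iff)
 have tc:"t\<in>car (Witt p (type_ring :: (nat \<times> nat) int_mpoly ring))" for t by (simp add:witt_carrier)
 have "(X0-.(Witt p type_ring) gen_witt 1) n = 0"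
 proof (rule ghost_inj[OF p0 _ n])
  fix m assume "m < N"
  then show "ghost p (X0-.(Witt p type_ring) gen_witt 1) m = ghost p (%_. 0) m"
  unfolding ghost_witt_minus[OF p] ghost_zero[OF p0]
  using ghost_prefix[of m X0 "gen_witt 1" p] by (simp add:X0_def)
 qed
 then have "h ((X0-.(Witt p type_ring) gen_witt 1) n) = \<zero>" using h.hom_zero by simp
 moreover have "(%i. h ((X0-.(Witt p type_ring) gen_witt 1) i)) = x-.(Witt p R) y"
  using hx h(3) w.hom_a_inv[OF tc[of "gen_witt 1"]] w.hom_add[OF tc[of X0] tc[of "-:(Witt p type_ring) gen_witt 1"]]
  by (simp add:a_minus_def)
 ultimately show ?thesis by (metis (no_types))
qed

text \<open>Multiplication by \<open>p\<close> is Verschiebung after Frobenius; this is where characteristic \<open>p\<close> enters.\<close>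
lemma witt_p_mult:
 assumes p:"Factorial_Ring.prime p" and char:"add_pow R p \<one> = \<zero>" and x:"x<:(Witt p R)"
 shows "add_pow (Witt p R) p x = (%i. if i = 0 then \<zero> else x (i - 1) [^] p)"
proof -
 have p0:"0 < p" using p prime_gt_0_nat by blast
 let ?T = "Witt p (type_ring :: (nat \<times> nat) int_mpoly ring)"
 obtain h where h:"ring_hom_cring type_ring R h" and hx:"(%i. h (gen_witt 0 i)) = x"
  using generic_evaluation[of x x x] x unfolding witt_carrier by blast
 interpret h: ring_hom_cring type_ring R h by (rule h)
 interpret w: ring_hom_cring ?T "Witt p R" "%x i. h (x i)"
  by (rule h.ring_hom_cring_Witt[OF p])
 have tc:"t<:?T" for t by (simp add:witt_carrier)
 have g:"ghost p (add_pow ?T j X0) n = of_nat j * ghost p X0 n" for j :: nat and X0 n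
  by (induction j) (simp_all add: w.R.add.nat_pow_Suc tc ghost_witt_add[OF p] witt_zero ghost_zero[OF p0] algebra_simps)
 have ha:"(%i. h (add_pow ?T j X0 i)) = add_pow (Witt p R) j (%i. h (X0 i))" for j :: nat and X0
 proof (induction j)
  case 0 then show ?case using w.hom_zero by simp
 next
  case (Suc j) then show ?case using w.hom_add[OF tc tc] by (simp add:tc)
 qed
 have hn:"h (of_nat j) = add_pow R j \<one>" for j :: nat
  by (induction j) (use h.hom_zero h.hom_one h.hom_add in \<open>auto simp:a_comm\<close>)
 define X0 where "X0 = (gen_witt 0 :: nat => (nat \<times> nat) int_mpoly)"
 define VF where "VF = (%i. if i = 0 then 0 else X0 (i - 1) ^ p)"
 have "of_nat (p ^ Suc n) dvd ghost p (add_pow ?T p X0) n - ghost p VF n" for n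
 proof (cases n)
  case 0 then show ?thesis by (simp add:g) (simp add:ghost_def VF_def)
 next
  case (Suc m)
  have "ghost p VF n = (\<Sum>i\<le>m. of_nat (p ^ Suc i) * (X0 i ^ p) ^ (p ^ (m - i)))"
  unfolding ghost_def Suc sum.atMost_Suc_shift by (simp add:VF_def p0 zero_power)
  also have "... = of_nat p * (\<Sum>i\<le>m. of_nat (p ^ i) * X0 i ^ (p ^ (n - i)))"
  unfolding sum_distrib_left by (rule sum.cong) (auto simp:Suc Suc_diff_le algebra_simps simp flip: power_mult)
  also have "... = of_nat p * (ghost p X0 n - of_nat (p ^ n) * X0 n)"
  unfolding Suc ghost_Suc_head by simp
  finally have e:"ghost p VF n = of_nat p * (ghost p X0 n - of_nat (p ^ n) * X0 n)" .
  have "ghost p (add_pow ?T p X0) n - ghost p VF n = of_nat (p ^ Suc n) * X0 n"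
  unfolding g e by (simp add:algebra_simps)
  then show ?thesis by simp
 qed
 then have dv:"of_nat p dvd add_pow ?T p X0 n - VF n" for n by (rule ghost_cong_imp_cong[OF p])
 have "h (add_pow ?T p X0 n) = h (VF n)" for n
 proof -
  from dv obtain c where "add_pow ?T p X0 n = VF n + of_nat p * c"
  by (metis dvdE add.commute diff_add_cancel)
  then have "h (add_pow ?T p X0 n) = h (VF n) \<oplus> h (of_nat p) \<otimes> h c"
  using h.hom_add h.hom_mult by simp
  then show ?thesis using h.hom_closed by (simp add:hn char)
 qed
 moreover have "h (VF n) = (if n = 0 then \<zero> else x (n - 1) [^] p)" for n
 proof -
  have "h (a ^ j) = h a [^] j" for a and j :: nat
  by (induction j) (use h.hom_one h.hom_mult h.hom_closed in \<open>auto simp:m_comm\<close>)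
  then show ?thesis using h.hom_zero hx by (auto simp:VF_def X0_def)
 qed
 ultimately show ?thesis using ha[of p X0] hx by (simp add:X0_def)
qed

end

section \<open>Complete discrete valuation rings with uniformiser p\<close>

text \<open>The only properties of \<open>W(k)\<close> used later: a \<open>p\<close>-adically complete, \<open>p\<close>-torsion-free ring with \<open>W/p = k\<close>.\<close>
locale p_ring = W?: cring W + k: field k for W (structure) and k :: "('k,'l) ring_scheme" +
 fixes res :: "'a => 'k" and p :: nat
 assumes res_hom:"res\<in>ring_hom W k"
  and res_surj:"res ` car W = car k"
  and res_p:"res (add_pow W p \<one>) = 0@k"
  and res_ker:"[|w\<in>car W; res w = 0@k|]==>\<exists>v\<in>car W. w = add_pow W p \<one> \<otimes> v"
  and p_cancel:"[|v\<in>car W; add_pow W p \<one> \<otimes> v = \<zero>|]==>v = \<zero>"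
  and p_separated:"[|w\<in>car W; !!i::nat. \<exists>v\<in>car W. w = add_pow W p \<one> [^] i \<otimes> v|]==>w = \<zero>"
  and p_complete:"[|!!i. x i\<in>car W; !!i::nat. \<exists>v\<in>car W. x (Suc i) \<ominus> x i = add_pow W p \<one> [^] i \<otimes> v|]
 ==>\<exists>y\<in>car W. ALL i. \<exists>v\<in>car W. y \<ominus> x i = add_pow W p \<one> [^] i \<otimes> v"
begin

definition unif :: 'a where "unif = add_pow W p \<one>"

definition Pp :: "nat => 'a set" where "Pp i = PIdl (unif [^] i)"

sublocale res: ring_hom_cring W k res
 by (rule ring_hom_cringI[OF W.is_cring k.is_cring res_hom])

lemma unif_closed [simp,intro]: "unif<:W"
 by (simp add:unif_def)

lemma Pp_ideal:"ideal (Pp i) W"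
 unfolding Pp_def by (rule cgenideal_ideal) simp

lemma Pp_iff:"w\<in>Pp i \<longleftrightarrow> (\<exists>v\<in>car W. w = unif [^] i \<otimes> v)"
 unfolding Pp_def cgenideal_def by (auto simp:m_comm)

lemma PpI:"v<:W==>unif [^] i \<otimes> v\<in>Pp i"
 unfolding Pp_iff by blast

lemma Pp_closed:"w\<in>Pp i==>w<:W"
 by (auto simp:Pp_iff)

lemma Pp_0 [simp]: "Pp 0 = car W"
 by (auto simp:Pp_iff) 

lemma Pp_add:"a\<in>Pp i==>b\<in>Pp i==>a \<oplus> b\<in>Pp i"
 by (rule additive_subgroup.a_closed[OF ideal.axioms(1)[OF Pp_ideal]])

lemma Pp_zero [simp]: "\<zero>\<in>Pp i"
 by (rule additive_subgroup.zero_closed[OF ideal.axioms(1)[OF Pp_ideal]])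

lemma Pp_uminus:"a\<in>Pp i==>\<ominus> a\<in>Pp i"
 by (rule additive_subgroup.a_inv_closed[OF ideal.axioms(1)[OF Pp_ideal]])

lemma Pp_minus:"a\<in>Pp i==>b\<in>Pp i==>a \<ominus> b\<in>Pp i"
 unfolding a_minus_def by (intro Pp_add Pp_uminus)

lemma Pp_mult: assumes "a\<in>Pp i" "b\<in>Pp j" shows "a \<otimes> b\<in>Pp (i + j)"
proof -
 obtain u v where "u<:W" "a = unif [^] i \<otimes> u" "v<:W" "b = unif [^] j \<otimes> v"
  using assms unfolding Pp_iff by blast
 then have "a \<otimes> b = (unif [^] i \<otimes> unif [^] j) \<otimes> (u \<otimes> v)" by (simp add:m_ac)
 then have "a \<otimes> b = unif [^] (i + j) \<otimes> (u \<otimes> v)" by (simp add:nat_pow_mult)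
 then show ?thesis using \<open>u\<in>car W\<close> \<open>v\<in>car W\<close> by (simp add:PpI)
qed

lemma Pp_mult_l:"a<:W==>b\<in>Pp j==>a \<otimes> b\<in>Pp j"
 by (rule ideal.I_l_closed[OF Pp_ideal])

lemma Pp_mult_r:"b\<in>Pp j==>a<:W==>b \<otimes> a\<in>Pp j"
 by (rule ideal.I_r_closed[OF Pp_ideal])

lemma Pp_mono: assumes "j \<le> i" "a\<in>Pp i" shows "a\<in>Pp j"
proof -
 obtain u where u:"u<:W" "a = unif [^] i \<otimes> u" using assms(2) unfolding Pp_iff by blast
 have "unif [^] i = unif [^] j \<otimes> unif [^] (i - j)" using assms(1) by (simp add:nat_pow_mult)
 then show ?thesis using u by (simp add:m_assoc PpI)
qed

lemma unif_pow_cancel:"v<:W==>unif [^] (i::nat) \<otimes> v = \<zero>==>v = \<zero>"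
proof (induction i arbitrary: v)
 case (Suc i)
 then have "unif [^] i \<otimes> (unif \<otimes> v) = \<zero>" by (simp add:m_assoc)
 then have "unif \<otimes> v = \<zero>" using Suc.IH[of "unif \<otimes> v"] Suc.prems(1) by simp
 then show ?case using p_cancel[OF Suc.prems(1)] by (simp add:unif_def)
qed simp

lemma unif_pow_inj:
 assumes "a<:W" "b<:W" "unif [^] (i::nat) \<otimes> a = unif [^] i \<otimes> b" shows "a = b"
proof -
 have "unif [^] i \<otimes> (a \<ominus> b) = unif [^] i \<otimes> a \<ominus> unif [^] i \<otimes> b" using assms(1,2) by (simp add:a_minus_def r_distr r_minus)
 then have "unif [^] i \<otimes> (a \<ominus> b) = \<zero>" using assms(1,2) by (simp add:assms(3) a_minus_def r_neg)
 then have "a \<ominus> b = \<zero>" using unif_pow_cancel[of "a \<ominus> b" i] assms(1,2) by simp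
 then show ?thesis using assms(1,2) by simp
qed

lemma Pp_cancel: assumes "v<:W" "unif [^] i \<otimes> v\<in>Pp (i + j)" shows "v\<in>Pp j"
proof -
 obtain u where u:"u<:W" "unif [^] i \<otimes> v = unif [^] (i + j) \<otimes> u" using assms(2) unfolding Pp_iff by blast
 then have "unif [^] i \<otimes> v = unif [^] i \<otimes> (unif [^] j \<otimes> u)" by (simp add:nat_pow_mult m_assoc[symmetric])
 then have "v = unif [^] j \<otimes> u" using unif_pow_inj[of v "unif [^] j \<otimes> u" i] assms(1) u(1) by simp
 then show ?thesis using u by (simp add:PpI)
qed

lemma res_unif:"res unif = 0@k"
 using res_p by (simp add:unif_def)

lemma Pp_1:"w\<in>Pp 1 \<longleftrightarrow> w<:W & res w = 0@k"
 using res_ker[of w] by (auto simp:Pp_iff res_unif unif_def[symmetric])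

lemma Pp_res:"i \<ge> 1==>w\<in>Pp i==>res w = 0@k"
 using Pp_mono[of 1 i w] Pp_1 by blast

lemma Pp_separated: assumes "w<:W" "!!i. i \<ge> N==>w\<in>Pp i" shows "w = \<zero>"
proof (rule p_separated[OF assms(1)])
 fix i :: nat
 have "w\<in>Pp i" using assms(2)[of "max i N"] Pp_mono[of i "max i N" w] by simp
 then show "\<exists>v\<in>car W. w = add_pow W p \<one> [^] i \<otimes> v" by (simp add:Pp_iff unif_def)
qed

lemma Pp_complete: assumes "!!i. x i<:W" "!!i. x (Suc i) \<ominus> x i\<in>Pp i"
 shows "\<exists>y\<in>car W. ALL i. y \<ominus> x i\<in>Pp i"
 using p_complete[of x] assms unfolding Pp_iff unif_def by blast

lemma one_minus_unif_unit:
 assumes u:"u<:W" shows "\<exists>y\<in>car W. (\<one> \<ominus> unif \<otimes> u) \<otimes> y = \<one>"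
proof -
 define q where "q = unif \<otimes> u"
 have q:"q<:W" using u by (simp add:q_def)
 have qi:"q [^] i\<in>Pp i" for i :: nat
  using u by (simp add:q_def nat_pow_distrib PpI)
 define s where "s = rec_nat \<zero> (%i a. a \<oplus> q [^] i)"
 have s:"s 0 = \<zero>" "s (Suc i) = s i \<oplus> q [^] i" for i by (simp_all add: s_def)
 have sc:"s i<:W" for i by (induction i) (simp_all add: s q)
 have "s (Suc i) \<ominus> s i\<in>Pp i" for i
 proof -
  have "s (Suc i) \<ominus> s i = q [^] i" using sc[of i] q by (simp add:s a_minus_def a_comm[of "s i"] a_assoc r_neg)
  then show ?thesis using qi by simp
 qed
 then obtain y where y:"y<:W" "!!i. y \<ominus> s i\<in>Pp i" using Pp_complete[of s] sc by blast
 have tele:"(\<one> \<ominus> q) \<otimes> s i = \<one> \<ominus> q [^] i" for i :: nat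
 proof (induction i)
  case 0 then show ?case using q by (simp add:s r_neg a_minus_def)
 next
  case (Suc i)
  have "(\<one> \<ominus> q) \<otimes> s (Suc i) = (\<one> \<ominus> q) \<otimes> s i \<oplus> (\<one> \<ominus> q) \<otimes> q [^] i"
  using q sc by (simp add:s r_distr)
  also have "... = (\<one> \<ominus> q [^] i) \<oplus> (\<one> \<ominus> q) \<otimes> q [^] i" by (simp add:Suc)
  also have "... = \<one> \<ominus> q [^] Suc i"
  proof -
  have "(\<one> \<ominus> a) \<oplus> (\<one> \<ominus> q) \<otimes> a = \<one> \<ominus> a \<otimes> q" if "a<:W" for a
  using that q by algebra
  then show ?thesis using q by simp
  qed
  finally show ?case .
 qed
 have "(\<one> \<ominus> q) \<otimes> y \<ominus> \<one> = \<zero>"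
 proof (rule Pp_separated)
  show "(\<one> \<ominus> q) \<otimes> y \<ominus> \<one>\<in>Pp i" for i
  proof -
  have "(\<one> \<ominus> q) \<otimes> y \<ominus> \<one> = (\<one> \<ominus> q) \<otimes> (y \<ominus> s i) \<oplus> ((\<one> \<ominus> q) \<otimes> s i \<ominus> \<one>)"
  proof -
  have "a \<otimes> y \<ominus> \<one> = a \<otimes> (y \<ominus> b) \<oplus> (a \<otimes> b \<ominus> \<one>)" if "a<:W" "b<:W" for a b
  using that y(1) by algebra
  from this[of "\<one> \<ominus> q" "s i"] show ?thesis using q sc[of i] by simp
  qed
  also have "(\<one> \<ominus> q) \<otimes> s i \<ominus> \<one> = \<ominus> (q [^] i)"
  proof -
  have "(\<one> \<ominus> a) \<ominus> \<one> = \<ominus> a" if "a<:W" for a using that by algebra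
  then show ?thesis unfolding tele using q by simp
  qed
  finally show ?thesis using q y qi by (simp add:Pp_add Pp_mult_l Pp_uminus)
  qed
 qed (use q y in simp)
 then have "(\<one> \<ominus> q) \<otimes> y = \<one>" using q y by simp
 then show ?thesis using y unfolding q_def by blast
qed

lemma unit_if_res:
 assumes w:"w<:W" "res w ~= 0@k" shows "\<exists>v\<in>car W. w \<otimes> v = \<one>"
proof -
 have "res w\<in>Units k" using w k.field_Units by simp
 then have "~.k (res w)<:k" "res w*.k ~.k (res w) = 1@k" by simp_all
 then obtain v where v:"v<:W" "res w*.k res v = 1@k" using res_surj by (metis imageE)
 have "res (\<one> \<ominus> w \<otimes> v) = 0@k" using v w by (simp add:a_minus_def k.r_neg)
 then obtain u where u:"u<:W" "\<one> \<ominus> w \<otimes> v = unif \<otimes> u"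
  using res_ker[of "\<one> \<ominus> w \<otimes> v"] v w unfolding unif_def by auto
 have "\<one> \<ominus> unif \<otimes> u = w \<otimes> v"
  using u(1) v w unfolding u(2)[symmetric] by (simp add:a_minus_def minus_add r_neg2 r_neg1)
 moreover obtain y where y:"y<:W" "(\<one> \<ominus> unif \<otimes> u) \<otimes> y = \<one>"
  using one_minus_unif_unit[OF u(1)] by blast
 ultimately show ?thesis using v w by (intro bexI[of _ "v \<otimes> y"]) (simp_all add: m_assoc)
qed

lemma unif_pow_decomp:
 assumes w:"w<:W" "w ~= \<zero>"
 obtains i u where "u<:W" "res u ~= 0@k" "w = unif [^] (i::nat) \<otimes> u"
proof -
 have "EX i. w \<notin> Pp i" using Pp_separated[of w 0] w by blast
 then have l:"w \<notin> Pp (LEAST i. w \<notin> Pp i)" by (rule LeastI_ex)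
 obtain j where j:"(LEAST i. w \<notin> Pp i) = Suc j" using l w by (cases "LEAST i. w \<notin> Pp i") auto
 have "w\<in>Pp j" using not_less_Least[of j "%i. w \<notin> Pp i"] unfolding j by blast
 then obtain u where u:"u<:W" "w = unif [^] j \<otimes> u" unfolding Pp_iff by blast
 have "res u ~= 0@k"
 proof
  assume "res u = 0@k"
  then have "u\<in>Pp 1" using u(1) by (simp only: Pp_1)
  then have "w\<in>Pp (j + 1)" unfolding u(2) by (intro Pp_mult) (use PpI[of \<one> j] in simp_all)
  then show False using l j by simp
 qed
 then show ?thesis using that u by blast
qed

text \<open>Every non-zero element is a unit times a power of \<open>p\<close>.\<close>
lemma ideal_cases:
 assumes J:"ideal J W"
 shows "J = {\<zero>} \<or> (EX i. J = Pp i)"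
proof (cases "J = {\<zero>}")
 case False
 interpret J: ideal J W by (rule J)
 have mem:"EX i. unif [^] i\<in>J & w\<in>Pp i" if w:"w\<in>J" "w ~= \<zero>" for w
 proof -
  have wc:"w<:W" using w by (simp add:J.Icarr)
  obtain i u where u:"u<:W" "res u ~= 0@k" "w = unif [^] (i::nat) \<otimes> u"
  using unif_pow_decomp[OF wc w(2)] .
  obtain v where v:"v<:W" "u \<otimes> v = \<one>" using unit_if_res u by blast
  have "w \<otimes> v = unif [^] i" using u v by (simp add:m_assoc)
  then have "unif [^] i\<in>J" using J.I_r_closed[OF w(1) v(1)] by simp
  then show ?thesis using u by (auto simp:PpI)
 qed
 have "\<not> J <= {\<zero>}" using False J.zero_closed by auto
 then obtain w where w:"w\<in>J" "w ~= \<zero>" by auto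
 have ex:"EX i::nat. unif [^] i\<in>J" using mem[OF w] by blast
 define i where "i = (LEAST i::nat. unif [^] i\<in>J)"
 have i:"unif [^] i\<in>J" unfolding i_def by (rule LeastI_ex[OF ex])
 have "J <= Pp i"
 proof
  fix w assume w:"w\<in>J"
  show "w\<in>Pp i"
  proof (cases "w = \<zero>")
  case nz: False
  obtain j where j:"unif [^] j\<in>J" "w\<in>Pp j" using mem[OF w nz] by blast
  have "i \<le> j" unfolding i_def by (rule Least_le) (rule j(1))
  then show ?thesis using j(2) by (rule Pp_mono)
  qed simp
 qed
 moreover have "Pp i <= J" using J.I_r_closed[OF i] by (auto simp:Pp_iff)
 ultimately show ?thesis by blast
qed simp

lemma unif_pow_eq:"add_pow W (p ^ i) \<one> = unif [^] i"
proof (induction i)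
 case (Suc i)
 have "unif [^] Suc i = add_pow W (p ^ i) \<one> \<otimes> add_pow W p \<one>" by (simp add:Suc unif_def)
 also have "... = add_pow W (p ^ i) (add_pow W p \<one>)" by (simp add:add_pow_ldistr)
 also have "... = add_pow W (p ^ Suc i) \<one>" by (simp add:add.nat_pow_pow mult.commute)
 finally show ?case ..
qed simp

end

text \<open>Since \<open>k\<close> is perfect, Frobenius is bijective on components, so \<open>p^i W\<close> consists of the Witt vectors whose first \<open>i\<close>
 components vanish. Completeness and separation are then componentwise statements.\<close>
lemma p_ring_Witt:
 assumes k:"field k" and p:"Factorial_Ring.prime p" and char:"add_pow k p 1@k = 0@k"
  and perf:"(%a. a ^.k p) ` car k = car k"
 shows "p_ring (Witt p k) k Witt_residue p"
proof -
 interpret k: field k by (rule k)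
 let ?W = "Witt p k"
 interpret W: cring ?W by (rule k.cring_Witt[OF p])
 let ?u = "add_pow ?W p 1@?W"
 have p0:"0 < p" using p prime_gt_0_nat by blast
 have ux:"?u*.?W x = (%i. if i = 0 then 0@k else x (i - 1) ^.k p)" if x:"x<:?W" for x
  using k.witt_p_mult[OF p char x] W.add_pow_ldistr[of "1@?W" x p] x by simp
 have pow0:"a ^.k p = 0@k \<longleftrightarrow> a = 0@k" if "a<:k" for a
 proof
  have "a ^.k j = 0@k==>a = 0@k" for j :: nat
  by (induction j) (use that k.integral k.zero_not_one in auto)
  then show "a ^.k p = 0@k==>a = 0@k" by blast
  show "a = 0@k==>a ^.k p = 0@k" using p0 by (simp add:k.nat_pow_zero)
 qed
 have uix:"(\<exists>v\<in>car ?W. x = ?u ^.?W i*.?W v) \<longleftrightarrow> (\<forall>j<i. x j = 0@k)"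
  if x:"x<:?W" for x and i :: nat
  using x
 proof (induction i arbitrary: x)
  case 0 then show ?case by auto
 next
  case (Suc i)
  show ?case
  proof
  assume "\<exists>v\<in>car ?W. x = ?u ^.?W Suc i*.?W v"
  then obtain v where v:"v<:?W" "x = ?u ^.?W Suc i*.?W v" by blast
  let ?y = "?u ^.?W i*.?W v"
  have y:"?y<:?W" using v by simp
  have "x = ?u*.?W ?y" using v by (simp add:W.m_ac)
  moreover have "\<forall>j<i. ?y j = 0@k" using Suc.IH[OF y] v by blast
  ultimately show "\<forall>j<Suc i. x j = 0@k" using ux[OF y] p0 by (auto simp:k.nat_pow_zero)
  next
  assume z:"\<forall>j<Suc i. x j = 0@k"
  have "ALL j. EX a. a<:k & a ^.k p = x (Suc j)"
  using perf Suc.prems unfolding witt_carrier by (metis (no_types,lifting) imageE)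
  then obtain y where y:"!!j. y j<:k" "!!j. y j ^.k p = x (Suc j)" by metis
  have yc:"y<:?W" using y by (simp add:witt_carrier)
  have xy:"x = ?u*.?W y" unfolding ux[OF yc] using z y(2) by (auto simp:fun_eq_iff gr0_conv_Suc)
  have "\<forall>j<i. y j = 0@k"
  proof (intro allI impI)
  fix j assume "j < i"
  then have "y j ^.k p = 0@k" using z y(2)[of j] by simp
  then show "y j = 0@k" using pow0 y(1) by blast
  qed
  then obtain v where "v<:?W" "y = ?u ^.?W i*.?W v" using Suc.IH[OF yc] by blast
  then show "\<exists>v\<in>car ?W. x = ?u ^.?W Suc i*.?W v"
  by (intro bexI[of _ v]) (simp_all add: xy W.m_ac)
  qed
 qed
 show ?thesis
 proof (intro p_ring.intro p_ring_axioms.intro)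
  show "cring ?W" "field k" by unfold_locales
  show hom:"Witt_residue\<in>ring_hom ?W k"
  proof (rule ring_hom_memI)
  fix x y assume x:"x<:?W" and y:"y<:?W"
  show "Witt_residue x<:k" using x by (simp add:Witt_residue_def witt_carrier)
  define E where "E = mpoly_eval k (case_sum x y)"
  have c:"case_sum x y v<:k" for v using x y by (auto simp:witt_carrier split: sum.split)
  have s0:"witt_sum_poly p 0 = mpoly_var (Inl 0) + mpoly_var (Inr 0)"
  using ghost_witt_sum_poly[OF p,of 0] by (simp add:ghost_def)
  have p0:"witt_prod_poly p 0 = mpoly_var (Inl 0) * mpoly_var (Inr 0)"
  using ghost_witt_prod_poly[OF p,of 0] by (simp add:ghost_def)
  show "Witt_residue (x+.?W y) = Witt_residue x+.k Witt_residue y"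
  by (simp add:Witt_residue_def witt_add_apply s0 k.mpoly_eval_add[OF c] k.mpoly_eval_var[OF c])
  show "Witt_residue (x*.?W y) = Witt_residue x*.k Witt_residue y"
  by (simp add:Witt_residue_def witt_mult_apply p0 k.mpoly_eval_mult[OF c] k.mpoly_eval_var[OF c])
  qed (simp add:Witt_residue_def witt_one)
  show "Witt_residue ` car ?W = car k"
  proof
  show "Witt_residue ` car ?W <= car k" by (auto simp:Witt_residue_def witt_carrier)
  show "car k <= Witt_residue ` car ?W"
  by (rule subsetI,rule_tac x = "%_. x" in image_eqI) (auto simp:Witt_residue_def witt_carrier)
  qed
  show "Witt_residue ?u = 0@k" using ux[of "1@?W"] by (simp add:Witt_residue_def)
  show "\<exists>v\<in>car ?W. w = ?u*.?W v" if "w<:?W" "Witt_residue w = 0@k" for w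
  using uix[OF that(1),of 1] that by (simp add:Witt_residue_def)
  show "v = 0@?W" if v:"v<:?W" "?u*.?W v = 0@?W" for v
  proof (rule ext)
  fix j
  have "(?u*.?W v) (Suc j) = 0@k" unfolding v(2) by (simp add:witt_zero)
  then show "v j = 0@?W j" using ux[OF v(1)] pow0 v(1) by (simp add:witt_zero witt_carrier)
  qed
  show "w = 0@?W" if w:"w<:?W" "!!i::nat. \<exists>v\<in>car ?W. w = ?u ^.?W i*.?W v" for w
  proof (rule ext)
  show "w j = 0@?W j" for j using uix[OF w(1),of "Suc j"] w(2)[of "Suc j"] by (simp add:witt_zero)
  qed
  fix x assume x:"!!i. x i<:?W"
  and xx:"!!i::nat. \<exists>v\<in>car ?W. x (Suc i)-.?W x i = ?u ^.?W i*.?W v"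
  have step:"x (Suc i) j = x i j" if "j < i" for i j
  proof -
  let ?d = "x (Suc i)-.?W x i"
  have d:"?d<:?W" using x by simp
  have "\<forall>j<i. ?d j = 0@k" using uix[OF d] xx by blast
  then have "(x i+.?W ?d) j = x i j" using k.witt_add_prefix[OF p x d _ that] by blast
  moreover have "x i+.?W ?d = x (Suc i)"
  using x[of i] x[of "Suc i"] by (simp add:a_minus_def W.a_comm[of "x i"] W.a_assoc W.l_neg)
  ultimately show ?thesis by simp
  qed
  define y where "y j = x (Suc j) j" for j
  have stab:"x (Suc j + i) j = y j" for i j
  by (induction i) (simp_all add: y_def step)
  have yx:"y j = x i j" if "j < i" for i j
  using stab[of j "i - Suc j"] that by simp
  have yc:"y<:?W" using x by (simp add:y_def witt_carrier)
  have "\<exists>v\<in>car ?W. y-.?W x i = ?u ^.?W i*.?W v" for i :: nat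
  using uix[of "y-.?W x i" i] k.witt_minus_prefix[OF p yc x,of i i] yx x yc by simp
  then show "\<exists>y\<in>car ?W. ALL i. \<exists>v\<in>car ?W. y-.?W x i = ?u ^.?W i*.?W v"
  using yc by blast
 qed
qed

section \<open>The ring of power series modulo \<open>p\<^sup>n t\<close> and \<open>t\<^sup>2\<close>\<close>

lemma (in ideal) coset_eq_iff:
 assumes "a<:R" "b<:R"
 shows "I +> a = I +> b \<longleftrightarrow> a \<ominus> b\<in>I"
proof
 assume "I +> a = I +> b"
 then have "a\<in>I +> b" using a_rcos_self[OF assms(1)] by simp
 then show "a \<ominus> b\<in>I" using a_rcos_module_minus[OF ring_axioms assms(2,1)] by simp
next
 assume "a \<ominus> b\<in>I"
 then have "a\<in>I +> b" using a_rcos_module_minus[OF ring_axioms assms(2,1)] by simp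
 then show "I +> a = I +> b" using a_repr_independence' assms by metis
qed

lemma cring_cong:
 assumes "cring A" "car B = car A" "monoid.mult B = monoid.mult A" "1@B = 1@A"
  "0@B = 0@A" "ring.add B = ring.add A"
 shows "cring B"
proof -
 interpret A: cring A by (rule assms(1))
 show ?thesis
 proof (rule cringI)
  show "abelian_group B"
  by (rule abelian_groupI) (auto simp:assms A.a_ac intro: bexI[of _ "-:A _"] A.l_neg)
  show "comm_monoid B"
  by (rule comm_monoidI) (auto simp:assms A.m_ac)
 qed (auto simp:assms A.l_distr)
qed

context cring
begin

lemma ps_simps:
 "f<:(power_series R) \<longleftrightarrow> (ALL i. f i<:R)"
 "(f*.(power_series R) h) n = (\<Oplus>i\<in>{..n}. f i \<otimes> h (n - i))"
 "(f+.(power_series R) h) n = f n \<oplus> h n"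
 "0@(power_series R) = (%i. \<zero>)" "1@(power_series R) = (%i. if i = 0 then \<one> else \<zero>)"
 by (simp_all add: power_series_def)

lemma power_series_one_mult:
 assumes "!!i. h i<:R"
 shows "(\<Oplus>i\<in>{..n}. (if i = 0 then \<one> else \<zero>) \<otimes> h (n - i)) = h (n::nat)"
proof -
 have "(\<Oplus>i\<in>{..n}. (if i = 0 then \<one> else \<zero>) \<otimes> h (n - i)) = (\<Oplus>i\<in>{..n}. if 0 = i then h (n - i) else \<zero>)"
  by (rule finsum_cong') (use assms in auto)
 also have "... = h (n - 0)"
  using finsum_singleton[of 0 "{..n}" "%i. h (n - i)"] assms by (simp add:Pi_def)
 finally show ?thesis by simp
qed

lemma cring_power_series:"cring (power_series R)"
proof (rule cringI)
 show "abelian_group (power_series R)"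
 proof (rule abelian_groupI)
  fix x assume x:"x<:(power_series R)"
  show "\<exists>y\<in>car (power_series R). y+.(power_series R) x = 0@(power_series R)"
  by (rule bexI[of _ "%i. \<ominus> x i"]) (use x in \<open>auto simp:ps_simps l_neg\<close>)
 qed (auto simp:ps_simps fun_eq_iff a_ac)
 show "comm_monoid (power_series R)"
 proof (rule comm_monoidI)
  fix x y z
  assume "x<:(power_series R)" "y<:(power_series R)" "z<:(power_series R)"
  then have c:"!!i. x i<:R" "!!i. y i<:R" "!!i. z i<:R"
  by (auto simp:ps_simps)
  show "x*.(power_series R) y<:(power_series R)"
  using c by (auto simp:ps_simps intro!: finsum_closed)
  have l:"(\<Oplus>i\<in>{..k}. x i \<otimes> y (n-i)) = (\<Oplus>i\<in>{..k}. x (k-i) \<otimes> y (i+n-k))" if "k \<le> n" for k n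
  using that
  proof (induct k)
  case 0 then show ?case by (simp add:c)
  next
  case (Suc k) then show ?case
  by (subst (2) finsum_Suc2) (simp add:Pi_def a_comm c)+
  qed
  show "x*.(power_series R) y = y*.(power_series R) x"
  by (rule ext) (use l in \<open>simp add:ps_simps Pi_def m_comm c\<close>)
  have a:"k \<le> n==>(\<Oplus>j\<in>{..k}. (\<Oplus>i\<in>{..j}. x i \<otimes> y (j-i)) \<otimes> z (n-j)) =
  (\<Oplus>j\<in>{..k}. x j \<otimes> (\<Oplus>i\<in>{..k-j}. y i \<otimes> z (n-j-i)))" (is "_==>?eq k") for k n
  proof (induct k)
  case 0 then show ?case by (simp add:Pi_def m_assoc c)
  next
  case (Suc k)
  then have "k \<le> n" by arith
  then have "?eq k" by (rule Suc)
  then show ?case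
  by (simp cong: finsum_cong add: Suc_diff_le Pi_def l_distr r_distr m_assoc c)
  (simp cong: finsum_cong add: Pi_def a_ac finsum_ldistr m_assoc c)
  qed
  show "x*.(power_series R) y*.(power_series R) z = x*.(power_series R) (y*.(power_series R) z)"
  by (rule ext) (simp add:ps_simps a)
  show "1@(power_series R)*.(power_series R) x = x"
  by (rule ext) (simp add:ps_simps power_series_one_mult c)
 qed (auto simp:ps_simps)
 fix x y z
 assume "x<:(power_series R)" "y<:(power_series R)" "z<:(power_series R)"
 then have c:"!!i. x i<:R" "!!i. y i<:R" "!!i. z i<:R"
  by (auto simp:ps_simps)
 show "(x+.(power_series R) y)*.(power_series R) z = x*.(power_series R) z+.(power_series R) y*.(power_series R) z"
  by (rule ext) (simp add:ps_simps c l_distr finsum_addf)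
qed

lemma power_series_minus:
 assumes "f<:(power_series R)" "g<:(power_series R)"
 shows "(f-.(power_series R) g) i = f i \<ominus> g i"
proof -
 interpret S: cring "power_series R" by (rule cring_power_series)
 have "(%i. f i \<ominus> g i) = f-.(power_series R) g"
 proof (rule S.eq_minusI)
  show "(%i. f i \<ominus> g i)+.(power_series R) g = f"
  using assms by (auto simp:ps_simps a_minus_def a_assoc l_neg)
 qed (use assms in \<open>auto simp:ps_simps\<close>)
 then show ?thesis by (metis (no_types,lifting))
qed

lemma power_series_const_mult:
 assumes "w<:R" "!!i. f i<:R"
 shows "ps_const R w*.(power_series R) f = (%i. w \<otimes> f i)"
proof
 fix n
 have "(ps_const R w*.(power_series R) f) n = (\<Oplus>i\<in>{..n}. if 0 = i then w \<otimes> f (n - i) else \<zero>)"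
  unfolding ps_simps ps_const_def by (rule finsum_cong') (use assms in auto)
 also have "... = w \<otimes> f (n - 0)"
  using finsum_singleton[of 0 "{..n}" "%i. w \<otimes> f (n - i)"] assms by (simp add:Pi_def)
 finally show "(ps_const R w*.(power_series R) f) n = w \<otimes> f n" by simp
qed

lemma power_series_var_mult:
 assumes "!!i. f i<:R"
 shows "ps_var R*.(power_series R) f = (%i. if i = 0 then \<zero> else f (i - 1))"
proof
 fix n
 have "(ps_var R*.(power_series R) f) n = (\<Oplus>i\<in>{..n}. if 1 = i then f (n - i) else \<zero>)"
  unfolding ps_simps ps_var_def by (rule finsum_cong') (use assms in auto)
 also have "... = (if n = 0 then \<zero> else f (n - 1))"
  using finsum_singleton[of 1 "{..n}" "%i. f (n - i)"] assms by (cases n) (simp_all add: Pi_def)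
 finally show "(ps_var R*.(power_series R) f) n = (if n = 0 then \<zero> else f (n - 1))" .
qed

lemma power_series_mult_01:
 assumes "!!i. f i<:R" "!!i. g i<:R"
 shows "(f*.(power_series R) g) 0 = f 0 \<otimes> g 0"
  "(f*.(power_series R) g) (Suc 0) = f 0 \<otimes> g (Suc 0) \<oplus> f (Suc 0) \<otimes> g 0"
 using assms by (simp_all add: ps_simps a_comm)

end

context p_ring
begin

abbreviation "PS \<equiv> power_series W"

sublocale PS: cring PS by (rule W.cring_power_series)

definition Rideal :: "nat => (nat => 'a) set" where
 "Rideal n = Idl\<^bsub>PS\<^esub> {add_pow PS (p ^ n) (ps_var W),ps_var W ^.PS (2::nat)}"

definition Rring :: "nat => ((nat => 'a) set,'a,'k) walg" where
 "Rring n = ring.extend (PS Quot Rideal n)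
  \<lparr>structmap = (%w. Rideal n +>\<^bsub>PS\<^esub> ps_const W w),
  resmap = (%Z. the_elem ((%f. res (f 0)) ` Z))\<rparr>"

lemma ps_var_closed:"ps_var W<:PS"
 by (auto simp:W.ps_simps ps_var_def)

lemma ps_const_closed:"w<:W==>ps_const W w<:PS"
 by (auto simp:W.ps_simps ps_const_def)

lemma add_pow_ps_var:"add_pow PS (m::nat) (ps_var W) = (%i. if i = 1 then add_pow W m \<one> else \<zero>)"
proof (induction m)
 case 0 then show ?case by (auto simp:W.ps_simps)
next
 case (Suc m) then show ?case by (auto simp:W.ps_simps ps_var_def)
qed

lemma Rideal_gens:"{add_pow PS (p ^ n) (ps_var W),ps_var W ^.PS (2::nat)} <= car PS"
 using ps_var_closed by auto

lemma ideal_Rideal:"ideal (Rideal n) PS"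
 unfolding Rideal_def by (rule PS.genideal_ideal[OF Rideal_gens])

text \<open>Membership in the ideal \<open>(p^n t, t^2)\<close> is a condition on the first two coefficients only.\<close>
lemma Rideal_iff:"f\<in>Rideal n \<longleftrightarrow> f<:PS & f 0 = \<zero> & f 1\<in>Pp n"
proof
 let ?K = "{f\<in>car PS. f 0 = \<zero> & f 1\<in>Pp n}"
 have K:"ideal ?K PS"
 proof (rule idealI)
  show "ring PS" by unfold_locales
  show "subgroup ?K (add_monoid PS)"
  proof (rule PS.add.subgroupI)
  show "?K ~= {}" using PS.zero_closed by (auto simp:W.ps_simps intro!: exI[of _ "%_. \<zero>"])
  fix a assume a:"a\<in>?K"
  then have "-:PS a = 0@PS-.PS a" by (simp add:a_minus_def)
  then have "(-:PS a) i = \<zero> \<ominus> a i" for i using a W.power_series_minus[of "0@PS" a i] by (simp add:W.ps_simps)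
  then show "-:PS a\<in>?K" using a by (auto simp:a_minus_def Pp_uminus Pp_closed)
  qed (auto simp:W.ps_simps Pp_add)
  fix a x assume a:"a\<in>?K" and x:"x<:PS"
  then have c:"!!i. a i<:W" "!!i. x i<:W" by (auto simp:W.ps_simps)
  show "x*.PS a\<in>?K" 
  using a x PS.m_closed[of x a] W.power_series_mult_01[OF c(2,1)] c by (auto simp:Pp_mult_l)
  then show "a*.PS x\<in>?K" using a x by (simp add:PS.m_comm)
 qed
 have "{add_pow PS (p ^ n) (ps_var W),ps_var W ^.PS (2::nat)} <= ?K"
 proof -
  have "ps_var W ^.PS (2::nat) = ps_var W*.PS ps_var W"
  using ps_var_closed by (simp add:numeral_2_eq_2)
  also have "... = (%i. if i = 0 then \<zero> else ps_var W (i - 1))"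
  by (rule W.power_series_var_mult) (auto simp:ps_var_def)
  finally have sq:"ps_var W ^.PS (2::nat) = (%i. if i = 0 then \<zero> else ps_var W (i - 1))" .
  have "add_pow PS (p ^ n) (ps_var W)\<in>?K"
  using ps_var_closed PpI[of \<one> n] unfolding add_pow_ps_var unif_pow_eq by (auto simp:W.ps_simps)
  moreover have "(ps_var W ^.PS (2::nat)) 0 = \<zero>" "(ps_var W ^.PS (2::nat)) 1 = \<zero>"
  by (simp_all only: sq) (simp_all add: ps_var_def)
  then have "ps_var W ^.PS (2::nat)\<in>?K"
  using PS.nat_pow_closed[OF ps_var_closed,of 2] by simp
  ultimately show ?thesis by simp
 qed
 then have sub:"Rideal n <= ?K" unfolding Rideal_def by (rule PS.genideal_minimal[OF K])
 show "f\<in>Rideal n==>f<:PS & f 0 = \<zero> & f 1\<in>Pp n" using sub by blast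
 assume f:"f<:PS & f 0 = \<zero> & f 1\<in>Pp n"
 then obtain v where v:"v<:W" "f 1 = unif [^] n \<otimes> v" by (auto simp:Pp_iff)
 have fc:"f i<:W" for i using f by (simp add:W.ps_simps)
 interpret I: ideal "Rideal n" PS by (rule ideal_Rideal)
 let ?a = "add_pow PS (p ^ n) (ps_var W)" and ?b = "ps_var W ^.PS (2::nat)"
 let ?g = "%i. f (i + 2)"
 have gc:"?g<:PS" using fc by (simp add:W.ps_simps)
 have ab:"?a\<in>Rideal n" "?b\<in>Rideal n"
  using PS.genideal_self[OF Rideal_gens,of n] by (auto simp:Rideal_def)
 have e1:"ps_const W v*.PS ?a = (%i. v \<otimes> (if i = 1 then unif [^] n else \<zero>))"
  unfolding add_pow_ps_var unif_pow_eq by (rule W.power_series_const_mult) (use v in auto)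
 have e2:"?b*.PS ?g = ps_var W*.PS (ps_var W*.PS ?g)"
  using ps_var_closed gc by (simp add:numeral_2_eq_2 PS.m_assoc)
 also have e3:"... = (%i. if i = 0 then \<zero> else if i = 1 then \<zero> else ?g (i - 2))"
  using fc by (subst (1 2) W.power_series_var_mult) (auto simp:fun_eq_iff numeral_2_eq_2)
 finally have e2:"?b*.PS ?g = (%i. if i = 0 then \<zero> else if i = 1 then \<zero> else ?g (i - 2))" .
 have feq:"f = (ps_const W v*.PS ?a)+.PS (?b*.PS ?g)"
 proof
  fix i
  consider "i = 0" | "i = 1" | j where "i = Suc (Suc j)" by (metis One_nat_def not0_implies_Suc)
  then show "f i = ((ps_const W v*.PS ?a)+.PS (?b*.PS ?g)) i"
  unfolding W.ps_simps(3) e1 e2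
  by cases (use f v fc in \<open>simp_all add: m_comm\<close>)
 qed
 show "f\<in>Rideal n"
  by (subst feq) (rule I.a_closed[OF I.I_l_closed[OF ab(1) ps_const_closed[OF v(1)]] I.I_r_closed[OF ab(2) gc]])
qed

definition lin :: "'a => 'a => nat => 'a" where
 "lin a b = (%i. if i = 0 then a else if i = 1 then b else \<zero>)"

lemma lin_simps [simp]: "lin a b 0 = a" "lin a b 1 = b" "lin a b (Suc 0) = b"
 by (simp_all add: lin_def)

text \<open>The class of \<open>a + b t\<close>. Every class has this form, with \<open>a\<close> unique and \<open>b\<close> unique modulo \<open>p^n\<close>.\<close>
definition Rel :: "nat => 'a => 'a => (nat => 'a) set" where
 "Rel n a b = Rideal n +>\<^bsub>PS\<^esub> lin a b"

lemma lin_closed:"a<:W==>b<:W==>lin a b<:PS"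
 by (simp add:lin_def W.ps_simps)

lemma Rideal_coset_eq:
 assumes "f<:PS" "g<:PS"
 shows "Rideal n +>\<^bsub>PS\<^esub> f = Rideal n +>\<^bsub>PS\<^esub> g \<longleftrightarrow> f 0 = g 0 & f 1 \<ominus> g 1\<in>Pp n"
proof -
 have c:"f i<:W" "g i<:W" for i using assms by (auto simp:W.ps_simps)
 show ?thesis
  using PS.minus_closed[OF assms] c W.power_series_minus[OF assms,of 0] W.power_series_minus[OF assms,of 1]
  unfolding ideal.coset_eq_iff[OF ideal_Rideal assms] Rideal_iff by (auto simp del: One_nat_def)
qed

lemma Rideal_coset:"f<:PS==>Rideal n +>\<^bsub>PS\<^esub> f = Rel n (f 0) (f 1)"
 unfolding Rel_def by (subst Rideal_coset_eq) (auto simp:lin_def W.ps_simps a_minus_def r_neg)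

lemma Rel_eq:
 assumes "a<:W" "b<:W" "a'<:W" "b'<:W"
 shows "Rel n a b = Rel n a' b' \<longleftrightarrow> a = a' & b \<ominus> b'\<in>Pp n"
 unfolding Rel_def using assms by (subst Rideal_coset_eq) (auto simp:lin_closed)

lemma Rring_sel:
 "car (Rring n) = car (PS Quot Rideal n)"
 "monoid.mult (Rring n) = monoid.mult (PS Quot Rideal n)"
 "1@(Rring n) = 1@(PS Quot Rideal n)" "0@(Rring n) = 0@(PS Quot Rideal n)"
 "ring.add (Rring n) = ring.add (PS Quot Rideal n)"
 by (simp_all add: Rring_def ring.defs)

lemma cring_Rring:"cring (Rring n)"
 by (rule cring_cong[OF ideal.quotient_is_cring[OF ideal_Rideal PS.is_cring] Rring_sel])

lemma Rring_cases:
 assumes "z<:(Rring n)"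
 obtains a b where "a<:W" "b<:W" "z = Rel n a b"
proof -
 obtain f where f:"f<:PS" "z = Rideal n +>\<^bsub>PS\<^esub> f"
  using assms unfolding Rring_sel by (auto simp:FactRing_def A_RCOSETS_def' a_r_coset_def')
 then show ?thesis using that[of "f 0" "f 1"] Rideal_coset by (simp add:W.ps_simps)
qed

lemma Rel_closed:"a<:W==>b<:W==>Rel n a b<:(Rring n)"
 unfolding Rring_sel Rel_def using lin_closed[of a b] by (auto simp:FactRing_def A_RCOSETS_def' a_r_coset_def')

lemma Rel_add:
 assumes "a<:W" "b<:W" "a'<:W" "b'<:W"
 shows "Rel n a b+.(Rring n) Rel n a' b' = Rel n (a \<oplus> a') (b \<oplus> b')"
proof -
 interpret I: ideal "Rideal n" PS by (rule ideal_Rideal)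
 note l = lin_closed[OF assms(1,2)] lin_closed[OF assms(3,4)]
 have "Rel n a b+.(Rring n) Rel n a' b' = Rideal n +>\<^bsub>PS\<^esub> (lin a b+.PS lin a' b')"
  unfolding Rring_sel Rel_def using I.a_rcos_sum[OF l] by (simp add:FactRing_def)
 then show ?thesis using Rideal_coset[OF PS.a_closed[OF l]] by (simp add:W.ps_simps)
qed

lemma Rel_mult:
 assumes "a<:W" "b<:W" "a'<:W" "b'<:W"
 shows "Rel n a b*.(Rring n) Rel n a' b' = Rel n (a \<otimes> a') (a \<otimes> b' \<oplus> b \<otimes> a')"
proof -
 interpret I: ideal "Rideal n" PS by (rule ideal_Rideal)
 note l = lin_closed[OF assms(1,2)] lin_closed[OF assms(3,4)]
 have c:"lin a b i<:W" "lin a' b' i<:W" for i using l by (auto simp:W.ps_simps)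
 have "Rel n a b*.(Rring n) Rel n a' b' = Rideal n +>\<^bsub>PS\<^esub> (lin a b*.PS lin a' b')"
  unfolding Rring_sel Rel_def using I.rcoset_mult_add[OF l] by (simp add:FactRing_def)
 then show ?thesis using Rideal_coset[OF PS.m_closed[OF l]] W.power_series_mult_01[OF c] by simp
qed

lemma Rel_one:"1@(Rring n) = Rel n \<one> \<zero>"
 unfolding Rring_sel using Rideal_coset[OF PS.one_closed] by (simp add:FactRing_def W.ps_simps)

lemma Rel_zero:"0@(Rring n) = Rel n \<zero> \<zero>"
proof -
 interpret I: ideal "Rideal n" PS by (rule ideal_Rideal)
 have "Rideal n = Rideal n +>\<^bsub>PS\<^esub> 0@PS" by (simp add:PS.a_coset_add_zero I.a_subset)
 then have "0@(Rring n) = Rideal n +>\<^bsub>PS\<^esub> 0@PS" unfolding Rring_sel by (simp add:FactRing_def)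
 also have "... = Rel n \<zero> \<zero>" using Rideal_coset[OF PS.zero_closed] by (simp add:W.ps_simps)
 finally show ?thesis .
qed

lemma structmap_Rring:"w<:W==>structmap (Rring n) w = Rel n w \<zero>"
 using Rideal_coset[OF ps_const_closed] by (simp add:Rring_def ring.defs ps_const_def)

lemma resmap_Rring:
 assumes "a<:W" "b<:W"
 shows "resmap (Rring n) (Rel n a b) = res a"
proof -
 have "(%f. res (f 0)) ` (Rideal n +>\<^bsub>PS\<^esub> lin a b) = {res a}"
 proof
  show "(%f. res (f 0)) ` (Rideal n +>\<^bsub>PS\<^esub> lin a b) <= {res a}"
  using assms by (auto simp:a_r_coset_def' Rideal_iff W.ps_simps lin_def)
  have "lin a b\<in>Rideal n +>\<^bsub>PS\<^esub> lin a b"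
  by (rule abelian_subgroup.a_rcos_self[OF _ lin_closed[OF assms]])
  (rule abelian_subgroupI3; use ideal_Rideal in \<open>simp add:ideal.axioms PS.is_abelian_group\<close>)
  then show "{res a} <= (%f. res (f 0)) ` (Rideal n +>\<^bsub>PS\<^esub> lin a b)"
  by (auto simp:lin_def intro!: image_eqI[of _ _ "lin a b"])
 qed
 then show ?thesis by (simp add:Rring_def ring.defs Rel_def)
qed

lemma Rring_uminus:
 assumes "a<:W" "b<:W"
 shows "-:(Rring n) Rel n a b = Rel n (\<ominus> a) (\<ominus> b)"
proof -
 interpret R: cring "Rring n" by (rule cring_Rring)
 show ?thesis
  by (rule R.minus_equality) (use assms in \<open>auto simp:Rel_add Rel_closed Rel_zero l_neg\<close>)
qed

lemma Rring_minus:
 assumes "a<:W" "b<:W" "a'<:W" "b'<:W"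
 shows "Rel n a b-.(Rring n) Rel n a' b' = Rel n (a \<ominus> a') (b \<ominus> b')"
 using assms by (simp add:a_minus_def Rring_uminus Rel_add)

end

section \<open>Noetherian local rings\<close>

lemma (in noetherian_ring) maximal_in_ideals:
 assumes "A ~= {}" "!!J. J\<in>A==>ideal J R"
 shows "\<exists>M\<in>A. \<forall>J\<in>A. M <= J \<longrightarrow> J = M"
proof (rule subset_Zorn_nonempty[OF assms(1)])
 fix C assume C:"C ~= {}" "subset.chain A C"
 have "subset.chain {I. ideal I R} C" 
  using C(2) assms(2) unfolding pred_on.chain_def by blast
 from ideal_chain_is_trivial[OF C(1) this] show "\<Union>C\<in>A"
  using C(2) unfolding pred_on.chain_def by blast
qed

locale local_over = B?: cring B + k: field k for B (structure) and k :: "('k,'l) ring_scheme" +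
 fixes r :: "'a => 'k"
 assumes r_hom:"r\<in>ring_hom B k"
  and r_surj:"r ` car B = car k"
  and r_unit:"[|b\<in>car B; r b ~= 0@k|]==>\<exists>c\<in>car B. b \<otimes> c = \<one>"
begin

sublocale r: ring_hom_cring B k r
 by (rule ring_hom_cringI[OF B.is_cring k.is_cring r_hom])

lemma kernel_iff:"x\<in>a_kernel B k r \<longleftrightarrow> x<:B & r x = 0@k"
 unfolding a_kernel_def' by simp

lemma maximalideal_kernel:"maximalideal (a_kernel B k r) B"
proof (rule maximalidealI)
 show K:"ideal (a_kernel B k r) B" by (rule r.ring.kernel_is_ideal)
 have "\<one> \<notin> a_kernel B k r" by (simp add:kernel_iff)
 then show "car B ~= a_kernel B k r" by auto
 fix J assume J:"ideal J B" "a_kernel B k r <= J" "J <= car B"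
 show "J = a_kernel B k r \<or> J = car B"
 proof (cases "J <= a_kernel B k r")
  case False
  then obtain b where b0:"b\<in>J" "b \<notin> a_kernel B k r" by blast
  then have b:"b\<in>J" "b<:B" "r b ~= 0@k" using J(3) by (auto simp only: kernel_iff)
  then obtain c where "c<:B" "b \<otimes> c = \<one>" using r_unit by blast
  then have "\<one>\<in>J" using ideal.I_r_closed[OF J(1) b(1)] by metis
  then show ?thesis using ideal.one_imp_carrier[OF J(1)] by blast
 qed (use J in blast)
qed

lemma maximalideal_unique: assumes "maximalideal J B" shows "J = a_kernel B k r"
proof -
 interpret J: maximalideal J B by (rule assms)
 have "J <= a_kernel B k r"
 proof
  fix b assume b:"b\<in>J"
  have bc:"b<:B" using b by (rule J.Icarr)
  show "b\<in>a_kernel B k r"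
  proof (rule ccontr)
  assume "b \<notin> a_kernel B k r"
  then obtain c where "c<:B" "b \<otimes> c = \<one>" using r_unit bc by (auto simp:kernel_iff)
  then have "\<one>\<in>J" using J.I_r_closed[OF b] by metis
  then show False using J.one_imp_carrier J.I_notcarr by blast
  qed
 qed
 moreover have "a_kernel B k r <= car B" by (auto simp:kernel_iff)
 ultimately have "a_kernel B k r = J \<or> a_kernel B k r = car B"
  by (rule J.I_maximal[OF r.ring.kernel_is_ideal])
 then show ?thesis
  using maximalideal.I_notcarr[OF maximalideal_kernel] by blast
qed

lemma max_ideal_eq:"max_ideal B = a_kernel B k r"
 unfolding max_ideal_def using maximalideal_kernel maximalideal_unique by (rule the_equality)

text \<open>Elements of the dual of \<open>I/mI\<close>, as functions on \<open>I\<close>.\<close>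
definition functional :: "'a set => ('a => 'k) => bool" where
 "functional I l \<longleftrightarrow> (\<forall>x\<in>I. l x<:k) & (\<forall>x\<in>I. \<forall>y\<in>I. l (x \<oplus> y) = l x+.k l y) \<and>
  (\<forall>b\<in>car B. \<forall>x\<in>I. l (b \<otimes> x) = r b*.k l x)"

text \<open>A form of Nakayama's lemma: a non-zero finitely generated ideal contains a maximal proper subideal, and the quotient is
 a copy of \<open>k\<close>; the quotient map is then a functional that does not vanish on the generators.\<close>
lemma zero_by_functionals:
 assumes noeth:"noetherian_ring B" and X0:"X0 <= car B"
  and zero:"!!l x. functional (Idl X0) l==>x\<in>X0==>l x = 0@k"
 shows "X0 <= {\<zero>}"
proof (rule ccontr)
 assume nz:"\<not> X0 <= {\<zero>}"
 interpret N: noetherian_ring B by (rule noeth)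
 define I where "I = Idl X0"
 have I:"ideal I B" unfolding I_def by (rule B.genideal_ideal[OF X0])
 interpret I: ideal I B by (rule I)
 have XI:"X0 <= I" unfolding I_def by (rule B.genideal_self[OF X0])
 let ?A = "{J. ideal J B & J <= I & J ~= I}"
 obtain x0 where x0:"x0\<in>X0" "x0 ~= \<zero>" using nz by blast
 have "{\<zero>} ~= I" using x0 XI by blast
 then have "{\<zero>}\<in>?A" using B.zeroideal I.zero_closed by simp
 then have "\<exists>N\<in>?A. \<forall>J\<in>?A. N <= J \<longrightarrow> J = N"
  by (intro N.maximal_in_ideals) blast+
 then obtain N where NA:"N\<in>?A" and Nmax:"\<forall>J\<in>?A. N <= J \<longrightarrow> J = N" by (rule bexE)
 have N:"ideal N B" "N <= I" "N ~= I" using NA by simp_all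
 interpret N': ideal N B by (rule N)
 have decomp:"\<exists>c\<in>car B. u \<ominus> c \<otimes> w\<in>N" if w:"w\<in>I" "w \<notin> N" and u:"u\<in>I" for u w
 proof -
  have wc:"w<:B" using w(1) by (rule I.Icarr)
  let ?J = "N <+>\<^bsub>B\<^esub> PIdl w"
  have Pw:"ideal (PIdl w) B" by (rule B.cgenideal_ideal[OF wc])
  have J:"ideal ?J B" by (rule B.add_ideals[OF N(1) Pw])
  have NJ:"N <= ?J"
  proof
  fix x assume x:"x\<in>N"
  have "x = x \<oplus> \<zero>" using N'.Icarr[OF x] by simp
  then show "x\<in>?J" unfolding set_add_def'
  using x additive_subgroup.zero_closed[OF ideal.axioms(1)[OF Pw]] by blast
  qed
  have wJ:"w\<in>?J"
  proof -
  have "w = \<zero> \<oplus> w" using wc by simp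
  then show ?thesis unfolding set_add_def'
  using B.cgenideal_self[OF wc] N'.zero_closed by blast
  qed
  have JI:"?J <= I"
  using N(2) w(1) I.I_l_closed by (auto simp:set_add_def' cgenideal_def)
  have "?J = I"
  proof (rule ccontr)
  assume "?J ~= I"
  then have "?J = N" using Nmax J JI NJ by simp
  then show False using wJ w(2) by blast
  qed
  then have "u\<in>?J" using u by simp
  then obtain a c where ac:"a\<in>N" "c<:B" "u = a \<oplus> c \<otimes> w"
  by (auto simp:set_add_def' cgenideal_def)
  have "u \<ominus> c \<otimes> w = a" using ac wc N'.Icarr[OF ac(1)] by (simp add:a_minus_def a_assoc r_neg)
  then show ?thesis using ac by blast
 qed
 obtain v where v:"v\<in>I" "v \<notin> N" using N by blast
 have vc:"v<:B" using v(1) by (rule I.Icarr)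
 have unit:"w\<in>N" if "b<:B" "r b ~= 0@k" "b \<otimes> w\<in>N" "w<:B" for b w
 proof -
  obtain c where c:"c<:B" "b \<otimes> c = \<one>" using r_unit \<open>b\<in>car B\<close> \<open>r b ~= _\<close> by blast
  have "c \<otimes> (b \<otimes> w) = w" using c that by (simp add:m_assoc[symmetric] m_comm)
  then show ?thesis using N'.I_l_closed[OF that(3) c(1)] by simp
 qed
 have mv:"b \<otimes> v\<in>N" if b:"b<:B" "r b = 0@k" for b
 proof (rule ccontr)
  assume nb:"b \<otimes> v \<notin> N"
  have "b \<otimes> v\<in>I" using I.I_l_closed[OF v(1) b(1)] .
  then obtain c where c:"c<:B" "v \<ominus> c \<otimes> (b \<otimes> v)\<in>N" using decomp[OF _ nb v(1)] by blast
  have "v \<ominus> c \<otimes> (b \<otimes> v) = (\<one> \<ominus> c \<otimes> b) \<otimes> v" using vc b c by algebra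
  moreover have "r (\<one> \<ominus> c \<otimes> b) ~= 0@k" using b c by (simp add:a_minus_def)
  ultimately show False using unit[of "\<one> \<ominus> c \<otimes> b" v] c b vc v(2) by simp
 qed
 have wd:"r c = r d" if "c<:B" "d<:B" "u\<in>I" "u \<ominus> c \<otimes> v\<in>N" "u \<ominus> d \<otimes> v\<in>N" for c d u
 proof (rule ccontr)
  assume ne:"r c ~= r d"
  have uc:"u<:B" using that by (simp add:I.Icarr)
  have "(u \<ominus> d \<otimes> v) \<oplus> \<ominus> (u \<ominus> c \<otimes> v) = (c \<ominus> d) \<otimes> v" using that vc uc by algebra
  then have "(c \<ominus> d) \<otimes> v\<in>N" using N'.a_closed[OF that(5) N'.a_inv_closed[OF that(4)]] by simp
  moreover have "r (c \<ominus> d) ~= 0@k" using ne that k.r_right_minus_eq[of "r c" "r d"] by (simp add:a_minus_def)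
  ultimately show False using unit[of "c \<ominus> d" v] that vc v(2) by simp
 qed
 define C where "C u = (SOME c. c<:B & u \<ominus> c \<otimes> v\<in>N)" for u
 have C:"C u<:B" "u \<ominus> C u \<otimes> v\<in>N" if "u\<in>I" for u
  using someI_ex[of "%c. c<:B & u \<ominus> c \<otimes> v\<in>N"] decomp[OF v that] unfolding C_def by auto
 define l where "l u = r (C u)" for u
 have lI:"l u = r c" if "c<:B" "u\<in>I" "u \<ominus> c \<otimes> v\<in>N" for u c
  unfolding l_def using wd C that by blast
 have "functional (Idl X0) l"
  unfolding functional_def I_def[symmetric]
 proof (intro conjI ballI)
  fix x assume x:"x\<in>I"
  show "l x<:k" using C[OF x] by (simp add:l_def)
  have xc:"x<:B" using x by (rule I.Icarr)
  show "l (x \<oplus> y) = l x+.k l y" if y:"y\<in>I" for y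
  proof -
  have yc:"y<:B" using y by (rule I.Icarr)
  note Cc = C(1)[OF x] C(1)[OF y]
  have "(x \<ominus> C x \<otimes> v) \<oplus> (y \<ominus> C y \<otimes> v) = (x \<oplus> y) \<ominus> (C x \<oplus> C y) \<otimes> v"
  using xc yc Cc vc by algebra
  then have "l (x \<oplus> y) = r (C x \<oplus> C y)"
  using lI[of "C x \<oplus> C y" "x \<oplus> y"] Cc I.a_closed[OF x y] N'.a_closed[OF C(2)[OF x] C(2)[OF y]] by simp
  then show ?thesis using Cc by (simp add:l_def)
  qed
  show "l (b \<otimes> x) = r b*.k l x" if b:"b<:B" for b
  proof -
  note Cc = C(1)[OF x]
  have "b \<otimes> (x \<ominus> C x \<otimes> v) = (b \<otimes> x) \<ominus> (b \<otimes> C x) \<otimes> v"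
  using xc b Cc vc by algebra
  then have "l (b \<otimes> x) = r (b \<otimes> C x)"
  using lI[of "b \<otimes> C x" "b \<otimes> x"] Cc b I.I_l_closed[OF x b] N'.I_l_closed[OF C(2)[OF x] b] by simp
  then show ?thesis using Cc b by (simp add:l_def)
  qed
 qed
 then have lz:"l x = 0@k" if "x\<in>X0" for x using zero that by blast
 have "X0 <= N"
 proof
  fix x assume x:"x\<in>X0"
  then have xI:"x\<in>I" using XI by blast
  have xc:"x<:B" using xI by (rule I.Icarr)
  have "C x \<otimes> v\<in>N" using mv[of "C x"] lz[OF x] C[OF xI] by (simp add:l_def)
  from N'.a_closed[OF C(2)[OF xI] this] show "x\<in>N"
  using xc C(1)[OF xI] vc by (simp add:a_minus_def a_assoc l_neg)
 qed
 then have "I <= N" unfolding I_def by (rule B.genideal_minimal[OF N(1)])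
 then show False using N by blast
qed

end

lemma in_ChatD:
 assumes "in_Chat p k B" and k:"field k"
 shows "local_over B k (resmap B)" "noetherian_ring B"
  "structmap B\<in>ring_hom (Witt p k) B"
  "w<:(Witt p k)==>resmap B (structmap B w) = Witt_residue w"
  "b\<in>max_ideal B \<longleftrightarrow> b<:B & resmap B b = 0@k"
proof -
 have B:"cring B" "noetherian_ring B" "\<exists>!m. maximalideal m B" "resmap B\<in>ring_hom B k" "resmap B ` car B = car k"
  and K:"a_kernel B k (resmap B) = max_ideal B"
  using assms by (auto simp:in_Chat_def)
 interpret B: cring B by (rule B)
 interpret N: noetherian_ring B by (rule B)
 interpret k: field k by (rule k)
 show ker:"b\<in>max_ideal B \<longleftrightarrow> b<:B & resmap B b = 0@k" for b
  unfolding K[symmetric] a_kernel_def' by simp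
 show "local_over B k (resmap B)"
 proof (intro local_over.intro local_over_axioms.intro)
  fix b assume b:"b<:B" "resmap B b ~= 0@k"
  show "\<exists>c\<in>car B. b*.B c = 1@B"
  proof (rule ccontr)
  assume nu:"\<not> (\<exists>c\<in>car B. b*.B c = 1@B)"
  let ?A = "{J. ideal J B & b\<in>J & 1@B \<notin> J}"
  have "PIdl\<^bsub>B\<^esub> b\<in>?A"
  using B.cgenideal_ideal[OF b(1)] B.cgenideal_self[OF b(1)] nu b(1) by (auto simp:cgenideal_def B.m_comm)
  then have "\<exists>M\<in>?A. \<forall>J\<in>?A. M <= J \<longrightarrow> J = M"
  by (intro N.maximal_in_ideals) blast+
  then obtain M where MA:"M\<in>?A" and max:"\<forall>J\<in>?A. M <= J \<longrightarrow> J = M" by (rule bexE)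
  have M:"ideal M B" "b\<in>M" "1@B \<notin> M" using MA by simp_all
  have "maximalideal M B"
  proof (rule maximalidealI[OF M(1)])
  show "car B ~= M" using M by auto
  show "J = M \<or> J = car B" if "ideal J B" "M <= J" "J <= car B" for J
  using max that M ideal.one_imp_carrier[OF that(1)] by blast
  qed
  then have "M = max_ideal B" unfolding max_ideal_def using B(3) by (metis the1_equality)
  then show False using ker M b by blast
  qed
 qed (use B k in auto)
 show "noetherian_ring B" "structmap B\<in>ring_hom (Witt p k) B"
  "w<:(Witt p k)==>resmap B (structmap B w) = Witt_residue w"
  using assms by (auto simp:in_Chat_def)
qed

section \<open>Local structure of \<open>W[[t]]/(p\<^sup>n t,t\<^sup>2)\<close>\<close>

context p_ring
begin

lemma local_over_Rring:"local_over (Rring n) k (resmap (Rring n))"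
proof (intro local_over.intro local_over_axioms.intro cring_Rring)
 show "field k" by unfold_locales
 show "resmap (Rring n)\<in>ring_hom (Rring n) k"
  by (rule ring_hom_memI; (elim Rring_cases)?)
  (auto simp:resmap_Rring Rel_add Rel_mult Rel_one)
 show "resmap (Rring n) ` car (Rring n) = car k"
 proof
  show "resmap (Rring n) ` car (Rring n) <= car k" by (auto elim!: Rring_cases simp: resmap_Rring)
  show "car k <= resmap (Rring n) ` car (Rring n)"
  proof
  fix c assume "c<:k"
  then obtain w where w:"w<:W" "c = res w" using res_surj by blast
  then show "c\<in>resmap (Rring n) ` car (Rring n)"
  by (intro image_eqI[of _ _ "Rel n w \<zero>"]) (auto simp:resmap_Rring Rel_closed)
  qed
 qed
 fix z assume z:"z<:(Rring n)" "resmap (Rring n) z ~= 0@k"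
 obtain a b where ab:"a<:W" "b<:W" "z = Rel n a b" using Rring_cases[OF z(1)] .
 obtain v where v:"v<:W" "a \<otimes> v = \<one>" using unit_if_res[of a] z ab by (auto simp:resmap_Rring)
 have "a \<otimes> (\<ominus> (v \<otimes> v \<otimes> b)) \<oplus> b \<otimes> v = \<ominus> ((a \<otimes> v) \<otimes> v \<otimes> b) \<oplus> b \<otimes> v" using ab v(1) by algebra
 also have "... = \<zero>" using ab v by (simp add:m_comm l_neg)
 finally show "\<exists>c\<in>car (Rring n). z*.(Rring n) c = 1@(Rring n)"
  using ab v by (intro bexI[of _ "Rel n v (\<ominus> (v \<otimes> v \<otimes> b))"]) (simp_all add: Rel_mult Rel_one Rel_closed)
qed

lemma noetherian_Rring:"noetherian_ring (Rring n)"
proof -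
 interpret R: cring "Rring n" by (rule cring_Rring)
 show ?thesis
 proof (rule R.noetherian_ringI)
  fix J assume J:"ideal J (Rring n)"
  interpret J: ideal J "Rring n" by (rule J)
  let ?JW = "{a\<in>car W. \<exists>b\<in>car W. Rel n a b\<in>J}"
  let ?Jt = "{b\<in>car W. Rel n \<zero> b\<in>J}"
  have iW:"ideal ?JW W"
  proof (rule idealI)
  show "ring W" by unfold_locales
  show "subgroup ?JW (add_monoid W)"
  proof (rule W.add.subgroupI)
  show "?JW ~= {}" using J.zero_closed by (auto simp:Rel_zero intro!: exI[of _ \<zero>] bexI[of _ \<zero>])
  fix a assume "a\<in>?JW"
  then obtain b where b:"a<:W" "b<:W" "Rel n a b\<in>J" by blast
  then have "Rel n (\<ominus> a) (\<ominus> b)\<in>J" using J.a_inv_closed[OF b(3)] by (simp add:Rring_uminus)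
  then show "\<ominus> a\<in>?JW" using b by auto
  fix a' assume "a'\<in>?JW"
  then obtain b' where b': "a'<:W" "b'<:W" "Rel n a' b'\<in>J" by blast
  then have "Rel n (a \<oplus> a') (b \<oplus> b')\<in>J" using J.a_closed[OF b(3) b'(3)] b by (simp add:Rel_add)
  then show "a \<oplus> a'\<in>?JW" using b b' by auto
  qed auto
  fix a x assume "a\<in>?JW" and x:"x<:W"
  then obtain b where b:"a<:W" "b<:W" "Rel n a b\<in>J" by blast
  have "Rel n (a \<otimes> x) (b \<otimes> x)\<in>J"
  using J.I_r_closed[OF b(3) Rel_closed[OF x zero_closed]] b x by (simp add:Rel_mult)
  then show "a \<otimes> x\<in>?JW" using b x by auto
  then show "x \<otimes> a\<in>?JW" using b x by (simp add:m_comm)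
  qed
  have it:"ideal ?Jt W"
  proof (rule idealI)
  show "ring W" by unfold_locales
  show "subgroup ?Jt (add_monoid W)"
  proof (rule W.add.subgroupI)
  show "?Jt ~= {}" using J.zero_closed by (auto simp:Rel_zero intro!: exI[of _ \<zero>])
  fix a assume a:"a\<in>?Jt"
  then show "\<ominus> a\<in>?Jt" using J.a_inv_closed[of "Rel n \<zero> a"] by (simp add:Rring_uminus)
  fix a' assume a': "a'\<in>?Jt"
  then show "a \<oplus> a'\<in>?Jt" using a J.a_closed[of "Rel n \<zero> a" "Rel n \<zero> a'"] by (simp add:Rel_add)
  qed auto
  fix a x assume a:"a\<in>?Jt" and x:"x<:W"
  then show "a \<otimes> x\<in>?Jt"
  using J.I_r_closed[of "Rel n \<zero> a",OF _ Rel_closed[OF x zero_closed]] by (simp add:Rel_mult)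
  then show "x \<otimes> a\<in>?Jt" using a x by (simp add:m_comm)
  qed
  have gW:"\<exists>g\<in>?JW. \<forall>a\<in>?JW. \<exists>v\<in>car W. a = g \<otimes> v" if "?JW = I" "ideal I W" for I
  using ideal_cases[OF that(2)]
  proof
  assume I0:"I = {\<zero>}"
  show ?thesis unfolding that(1) I0 by (auto intro!: bexI[of _ \<zero>])
  next
  assume "EX i. I = Pp i"
  then obtain i where i:"I = Pp i" ..
  show ?thesis unfolding that(1) i using PpI[of \<one> i] by (intro bexI[of _ "unif [^] i"]) (auto simp:Pp_iff)
  qed
  have gt:"\<exists>g\<in>?Jt. \<forall>a\<in>?Jt. \<exists>v\<in>car W. a = g \<otimes> v" if "?Jt = I" "ideal I W" for I
  using ideal_cases[OF that(2)]
  proof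
  assume I0:"I = {\<zero>}"
  show ?thesis unfolding that(1) I0 by (auto intro!: bexI[of _ \<zero>])
  next
  assume "EX i. I = Pp i"
  then obtain i where i:"I = Pp i" ..
  show ?thesis unfolding that(1) i using PpI[of \<one> i] by (intro bexI[of _ "unif [^] i"]) (auto simp:Pp_iff)
  qed
  obtain g where g:"g\<in>?JW" "!!a. a\<in>?JW==>\<exists>v\<in>car W. a = g \<otimes> v" using gW[OF refl iW] by blast
  obtain b0 where b0:"b0<:W" "Rel n g b0\<in>J" and gc:"g<:W" using g(1) by blast
  obtain q where q:"q\<in>?Jt" "!!a. a\<in>?Jt==>\<exists>v\<in>car W. a = q \<otimes> v" using gt[OF refl it] by blast
  have qc:"q<:W" "Rel n \<zero> q\<in>J" using q(1) by auto
  let ?G = "{Rel n g b0,Rel n \<zero> q}"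
  have Gc:"?G <= car (Rring n)" using gc b0 qc by (simp add:Rel_closed)
  interpret K: ideal "Idl\<^bsub>Rring n\<^esub> ?G" "Rring n" by (rule R.genideal_ideal[OF Gc])
  have GK:"Rel n g b0\<in>Idl\<^bsub>Rring n\<^esub> ?G" "Rel n \<zero> q\<in>Idl\<^bsub>Rring n\<^esub> ?G" using R.genideal_self[OF Gc] by auto
  have "J <= Idl\<^bsub>Rring n\<^esub> ?G"
  proof
  fix z assume z:"z\<in>J"
  obtain a b where ab:"a<:W" "b<:W" "z = Rel n a b" using Rring_cases[OF J.Icarr[OF z]] .
  then have "a\<in>?JW" using z by blast
  then obtain v where v:"v<:W" "a = g \<otimes> v" using g(2) by blast
  have y:"Rel n g b0*.(Rring n) Rel n v \<zero> = Rel n a (b0 \<otimes> v)" using gc b0 v by (simp add:Rel_mult)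
  have "z-.(Rring n) Rel n g b0*.(Rring n) Rel n v \<zero>\<in>J"
  unfolding a_minus_def by (intro J.a_closed J.a_inv_closed z J.I_r_closed b0 Rel_closed v zero_closed)
  moreover have "Rel n a b-.(Rring n) Rel n a (b0 \<otimes> v) = Rel n (a \<ominus> a) (b \<ominus> b0 \<otimes> v)"
  by (rule Rring_minus) (use ab b0 v in auto)
  moreover have "a \<ominus> a = \<zero>" using ab by (simp add:a_minus_def r_neg)
  ultimately have "b \<ominus> b0 \<otimes> v\<in>?Jt" unfolding y ab(3) using ab(2) b0(1) v(1) by simp
  then obtain u where u:"u<:W" "b \<ominus> b0 \<otimes> v = q \<otimes> u" using q(2) by blast
  have "Rel n g b0*.(Rring n) Rel n v \<zero> +.(Rring n) Rel n \<zero> q*.(Rring n) Rel n u \<zero>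
  = Rel n a (b0 \<otimes> v \<oplus> (b \<ominus> b0 \<otimes> v))"
  unfolding u(2) y using qc u b0 v ab gc by (simp add:Rel_mult Rel_add)
  also have "b0 \<otimes> v \<oplus> (b \<ominus> b0 \<otimes> v) = b" using b0 v ab(2) by algebra
  finally have "z = Rel n g b0*.(Rring n) Rel n v \<zero> +.(Rring n) Rel n \<zero> q*.(Rring n) Rel n u \<zero>" using ab by simp
  then show "z\<in>Idl\<^bsub>Rring n\<^esub> ?G"
  using K.a_closed[OF K.I_r_closed[OF GK(1) Rel_closed[OF v(1) zero_closed]] K.I_r_closed[OF GK(2) Rel_closed[OF u(1) zero_closed]]] by simp
  qed
  moreover have "Idl\<^bsub>Rring n\<^esub> ?G <= J" by (rule R.genideal_minimal[OF J]) (use b0 qc in simp)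
  ultimately show "\<exists>A\<subseteq>car (Rring n). finite A & J = Idl\<^bsub>Rring n\<^esub> A"
  using Gc by (intro exI[of _ ?G]) auto
 qed
qed

definition Rpow :: "nat => nat => (nat => 'a) set set" where
 "Rpow n i = {Rel n a b | a b. a\<in>Pp i & b\<in>Pp (i - 1)}"

text \<open>The maximal ideal is \<open>(p, t)\<close>, and \<open>t^2 = 0\<close>, so its powers are \<open>p^i W + p^(i-1) W t\<close>.\<close>
lemma max_ideal_pow_Rring:"max_ideal_pow (Rring n) i = Rpow n i"
proof -
 interpret R: local_over "Rring n" k "resmap (Rring n)" by (rule local_over_Rring)
 have m:"max_ideal (Rring n) = {Rel n a b | a b. a\<in>Pp 1 & b\<in>car W}"
 proof -
  have "z\<in>max_ideal (Rring n) \<longleftrightarrow> z<:(Rring n) & resmap (Rring n) z = 0@k" for z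
  unfolding R.max_ideal_eq R.kernel_iff ..
  note mem = this
  show ?thesis
  proof (intro equalityI subsetI)
  fix z assume z:"z\<in>max_ideal (Rring n)"
  then obtain a b where "a<:W" "b<:W" "z = Rel n a b" using mem Rring_cases by metis
  moreover have "a\<in>Pp 1" using calculation z mem by (simp add:resmap_Rring Pp_1 del: One_nat_def)
  ultimately show "z\<in>{Rel n a b | a b. a\<in>Pp 1 & b\<in>car W}" by blast
  next
  fix z assume "z\<in>{Rel n a b | a b. a\<in>Pp 1 & b\<in>car W}"
  then obtain a b where "z = Rel n a b" "a\<in>Pp 1" "b<:W" by blast
  then show "z\<in>max_ideal (Rring n)" unfolding mem by (simp add:resmap_Rring Rel_closed Pp_1 del: One_nat_def)
  qed
 qed
 have mi:"ideal (max_ideal (Rring n)) (Rring n)"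
  unfolding R.max_ideal_eq by (rule R.r.ring.kernel_is_ideal)
 show ?thesis
 proof (induction i)
  case 0
  have "max_ideal_pow (Rring n) 0 = car (Rring n)" by (simp add:ideals_set_def)
  also have "... = Rpow n 0" by (auto simp:Rpow_def Rel_closed elim!: Rring_cases)
  finally show ?case .
 next
  case (Suc i)
  have e:"max_ideal_pow (Rring n) (Suc i) = ideal_prod (Rring n) (Rpow n i) (max_ideal (Rring n))"
  using Suc by (simp add:ideals_set_def)
  show ?case unfolding e
  proof
  show "ideal_prod (Rring n) (Rpow n i) (max_ideal (Rring n)) <= Rpow n (Suc i)"
  proof
  fix z assume "z\<in>ideal_prod (Rring n) (Rpow n i) (max_ideal (Rring n))"
  then show "z\<in>Rpow n (Suc i)"
  proof (induction rule: ideal_prod.induct)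
  case (prod x y)
  obtain a b where ab:"x = Rel n a b" "a\<in>Pp i" "b\<in>Pp (i - 1)" using prod by (auto simp:Rpow_def)
  obtain c d where cd:"y = Rel n c d" "c\<in>Pp 1" "d<:W" using prod by (auto simp:m)
  note cl = Pp_closed[OF ab(2)] Pp_closed[OF ab(3)] Pp_closed[OF cd(2)] cd(3)
  have "a \<otimes> c\<in>Pp (Suc i)" using Pp_mult[OF ab(2) cd(2)] by simp
  moreover have "a \<otimes> d \<oplus> b \<otimes> c\<in>Pp i"
  using Pp_mult[OF ab(3) cd(2)] Pp_mult_r[OF ab(2) cd(3)] cl by (cases i) (auto intro: Pp_add)
  ultimately show ?case using cl by (auto simp:ab cd Rel_mult Rpow_def)
  next
  case (sum x y)
  then obtain a b c d where ab:"x = Rel n a b" "a\<in>Pp (Suc i)" "b\<in>Pp i"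
  "y = Rel n c d" "c\<in>Pp (Suc i)" "d\<in>Pp i" by (auto simp:Rpow_def)
  then have "a \<oplus> c\<in>Pp (Suc i)" "b \<oplus> d\<in>Pp i" by (auto intro: Pp_add)
  then show ?case using ab by (auto simp:Rel_add Pp_closed Rpow_def)
  qed
  qed
  show "Rpow n (Suc i) <= ideal_prod (Rring n) (Rpow n i) (max_ideal (Rring n))"
  proof
  fix z assume "z\<in>Rpow n (Suc i)"
  then obtain a b where z:"z = Rel n a b" "a\<in>Pp (Suc i)" "b\<in>Pp i" by (auto simp:Rpow_def)
  obtain v where v:"v<:W" "a = unif [^] Suc i \<otimes> v" using z(2) by (auto simp:Pp_iff)
  let ?x = "Rel n (unif [^] i \<otimes> v) \<zero>" and ?y = "Rel n unif \<zero>"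
  let ?x' = "Rel n b \<zero>" and ?y' = "Rel n \<zero> \<one>"
  have bc:"b<:W" using z(3) by (rule Pp_closed)
  have "unif\<in>Pp 1" by (simp add:Pp_1 res_unif del: One_nat_def)
  then have "?y\<in>max_ideal (Rring n)" "?y'\<in>max_ideal (Rring n)" unfolding m using Pp_zero[of 1] by blast+
  moreover have "?x\<in>Rpow n i" "?x'\<in>Rpow n i" using PpI[OF v(1)] z(3) Pp_zero unfolding Rpow_def by blast+
  ultimately have "?x*.(Rring n) ?y+.(Rring n) ?x'*.(Rring n) ?y'\<in>ideal_prod (Rring n) (Rpow n i) (max_ideal (Rring n))"
  by (intro ideal_prod.sum ideal_prod.prod)
  moreover have "?x*.(Rring n) ?y+.(Rring n) ?x'*.(Rring n) ?y' = z"
  using v bc by (simp add:z Rel_mult Rel_add m_ac)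
  ultimately show "z\<in>ideal_prod (Rring n) (Rpow n i) (max_ideal (Rring n))" by simp
  qed
  qed
 qed
qed

lemma adically_complete_Rring:"adically_complete (Rring n)"
proof -
 interpret R: cring "Rring n" by (rule cring_Rring)
 have mem:"Rel n a b\<in>Rpow n i \<longleftrightarrow> a\<in>Pp i & (\<exists>c\<in>Pp (i - 1). b \<ominus> c\<in>Pp n)"
  if "a<:W" "b<:W" for a b i
 proof
  assume "Rel n a b\<in>Rpow n i"
  then show "a\<in>Pp i & (\<exists>c\<in>Pp (i - 1). b \<ominus> c\<in>Pp n)"
  using that by (auto simp:Rpow_def Rel_eq Pp_closed)
 next
  assume "a\<in>Pp i & (\<exists>c\<in>Pp (i - 1). b \<ominus> c\<in>Pp n)"
  then obtain c where c:"a\<in>Pp i" "c\<in>Pp (i - 1)" "b \<ominus> c\<in>Pp n" by blast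
  then have "Rel n a b = Rel n a c" using that by (simp add:Rel_eq Pp_closed)
  then show "Rel n a b\<in>Rpow n i" using c unfolding Rpow_def by blast
 qed
 show ?thesis
  unfolding adically_complete_def max_ideal_pow_Rring
 proof (intro conjI allI impI)
  show "(\<Inter>i. Rpow n i) = {0@(Rring n)}"
  proof
  show "{0@(Rring n)} <= (\<Inter>i. Rpow n i)" unfolding Rel_zero Rpow_def using Pp_zero by blast
  show "(\<Inter>i. Rpow n i) <= {0@(Rring n)}"
  proof
  fix z assume z:"z\<in>(\<Inter>i. Rpow n i)"
  then have "z\<in>Rpow n 0" by blast
  then obtain a b where ab:"z = Rel n a b" "a<:W" "b<:W" by (auto simp:Rpow_def)
  have zi:"Rel n a b\<in>Rpow n i" for i using z ab(1) by blast
  have "a = \<zero>" using zi mem[OF ab(2,3)] by (intro Pp_separated[of a 0] ab) blast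
  moreover obtain c where c:"c\<in>Pp n" "b \<ominus> c\<in>Pp n" using zi[of "Suc n"] mem[OF ab(2,3),of "Suc n"] by auto
  have "b = (b \<ominus> c) \<oplus> c" using ab c Pp_closed by (simp add:a_minus_def a_assoc l_neg)
  then have "b\<in>Pp n" using Pp_add[OF c(2,1)] by simp
  then have "b \<ominus> \<zero>\<in>Pp n" using ab by (simp add:a_minus_def)
  ultimately show "z\<in>{0@(Rring n)}" using ab by (simp add:Rel_zero Rel_eq)
  qed
  qed
  fix x assume x:"ALL i. x i<:(Rring n) & x (Suc i)-.(Rring n) x i\<in>Rpow n i"
  have "ALL i. EX a b. a<:W & b<:W & x i = Rel n a b" using x by (meson Rring_cases)
  then obtain a b where ab:"!!i. a i<:W" "!!i. b i<:W" "!!i. x i = Rel n (a i) (b i)" by metis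
  have d:"a (Suc i) \<ominus> a i\<in>Pp i" "\<exists>c\<in>Pp (i - 1). (b (Suc i) \<ominus> b i) \<ominus> c\<in>Pp n" for i
  using x mem[of "a (Suc i) \<ominus> a i" "b (Suc i) \<ominus> b i" i] ab by (simp_all add: Rring_minus)
  obtain y where y:"y<:W" "!!i. y \<ominus> a i\<in>Pp i" using Pp_complete[of a] ab d by blast
  have bd:"\<exists>c\<in>Pp (i - 1). (b (i + j) \<ominus> b i) \<ominus> c\<in>Pp n" for i j
  proof (induction j)
  case 0 then show ?case using ab by (intro bexI[of _ \<zero>]) (simp_all add: a_minus_def r_neg)
  next
  case (Suc j)
  obtain c where c:"c\<in>Pp (i - 1)" "(b (i + j) \<ominus> b i) \<ominus> c\<in>Pp n" using Suc by blast
  obtain c' where c': "c'\<in>Pp (i + j - 1)" "(b (Suc (i + j)) \<ominus> b (i + j)) \<ominus> c'\<in>Pp n" using d(2) by blast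
  have c'2:"c'\<in>Pp (i - 1)" by (rule Pp_mono[OF _ c'(1)]) simp
  have "((b (Suc (i + j)) \<ominus> b (i + j)) \<ominus> c') \<oplus> ((b (i + j) \<ominus> b i) \<ominus> c) = (b (Suc (i + j)) \<ominus> b i) \<ominus> (c' \<oplus> c)"
  using ab(2)[of "Suc (i+j)"] ab(2)[of "i + j"] ab(2)[of i] Pp_closed[OF c(1)] Pp_closed[OF c'(1)] by algebra
  then show ?case using Pp_add[OF c'(2) c(2)] Pp_add[OF c'2 c(1)] by auto
  qed
  have "Rel n y (b (Suc n))-.(Rring n) x i\<in>Rpow n i" for i
  proof -
  have "\<exists>c\<in>Pp (i - 1). (b (Suc n) \<ominus> b i) \<ominus> c\<in>Pp n"
  proof (cases "i \<le> Suc n")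
  case True then show ?thesis using bd[of i "Suc n - i"] by simp
  next
  case False
  obtain c where c:"c\<in>Pp n" "(b i \<ominus> b (Suc n)) \<ominus> c\<in>Pp n" using bd[of "Suc n" "i - Suc n"] False by auto
  have "\<ominus> (((b i \<ominus> b (Suc n)) \<ominus> c) \<oplus> c) = (b (Suc n) \<ominus> b i) \<ominus> \<zero>"
  using ab(2)[of i] ab(2)[of "Suc n"] Pp_closed[OF c(1)] by algebra
  then show ?thesis using Pp_uminus[OF Pp_add[OF c(2,1)]] by (intro bexI[of _ \<zero>]) auto
  qed
  then show ?thesis using mem[of "y \<ominus> a i" "b (Suc n) \<ominus> b i" i] y ab by (simp add:Rring_minus)
  qed
  then show "\<exists>z\<in>car (Rring n). ALL i. z-.(Rring n) x i\<in>Rpow n i"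
  using y ab by (intro bexI[of _ "Rel n y (b (Suc n))"]) (auto simp:Rel_closed)
 qed
qed

end

lemma W_t_mod_eq: 
 assumes "p_ring (Witt p k) k Witt_residue p"
 shows "W_t_mod p n k = p_ring.Rring (Witt p k) Witt_residue p n"
 by (simp add:W_t_mod_def Let_def p_ring.Rring_def[OF assms] p_ring.Rideal_def[OF assms])

lemma in_Chat_W_t_mod:
 assumes "p_ring (Witt p k) k Witt_residue p"
 shows "in_Chat p k (W_t_mod p n k)"
proof -
 interpret W: p_ring "Witt p k" k Witt_residue p by (rule assms)
 interpret R: local_over "W.Rring n" k "resmap (W.Rring n)" by (rule W.local_over_Rring)
 show ?thesis
  unfolding W_t_mod_eq[OF assms] in_Chat_def
 proof (intro conjI ballI W.cring_Rring W.noetherian_Rring W.adically_complete_Rring R.r_hom R.r_surj)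
  show "\<exists>!m. maximalideal m (W.Rring n)" using R.maximalideal_kernel R.maximalideal_unique by blast
  show "structmap (W.Rring n)\<in>ring_hom (Witt p k) (W.Rring n)"
  by (rule ring_hom_memI) (simp_all add: W.structmap_Rring W.Rel_closed W.Rel_add W.Rel_mult W.Rel_one)
  show "a_kernel (W.Rring n) k (resmap (W.Rring n)) = max_ideal (W.Rring n)" by (simp add:R.max_ideal_eq)
 qed (simp add:W.structmap_Rring W.resmap_Rring)
qed

section \<open>Matrices over a commutative ring\<close>

lemma (in abelian_monoid) finsum_swap:
 assumes "!!i j. i < a==>j < b==>f i j<:G"
 shows "(\<Oplus>i\<in>{..<a::nat}. \<Oplus>j\<in>{..<b::nat}. f i j) = (\<Oplus>j\<in>{..<b}. \<Oplus>i\<in>{..<a}. f i j)"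
 using assms
proof (induction a)
 case 0
 have "(\<Oplus>j\<in>{..<b}. \<Oplus>i\<in>{..<0::nat}. f i j) = (\<Oplus>j\<in>{..<b}. \<zero>)" by simp
 then show ?case by (simp add:finsum_zero)
next
 case (Suc a)
 have ins:"{..<Suc a} = insert a {..<a}" by auto
 have IH:"(\<Oplus>i\<in>{..<a}. \<Oplus>j\<in>{..<b}. f i j) = (\<Oplus>j\<in>{..<b}. \<Oplus>i\<in>{..<a}. f i j)"
  by (rule Suc.IH) (use Suc.prems in auto)
 have "(\<Oplus>i\<in>{..<Suc a}. \<Oplus>j\<in>{..<b}. f i j) = (\<Oplus>j\<in>{..<b}. f a j) \<oplus> (\<Oplus>i\<in>{..<a}. \<Oplus>j\<in>{..<b}. f i j)"
  unfolding ins by (rule finsum_insert) (use Suc.prems in \<open>auto intro!: finsum_closed\<close>)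
 also have "... = (\<Oplus>j\<in>{..<b}. f a j \<oplus> (\<Oplus>i\<in>{..<a}. f i j))"
  unfolding IH by (rule finsum_addf[symmetric]) (use Suc.prems in \<open>auto intro!: finsum_closed\<close>)
 also have "... = (\<Oplus>j\<in>{..<b}. \<Oplus>i\<in>{..<Suc a}. f i j)"
  by (rule finsum_cong') (use Suc.prems in \<open>auto simp:ins finsum_insert Pi_def intro!: finsum_closed\<close>)
 finally show ?case .
qed

text \<open>Vectors and matrices are functions on all of \<open>nat\<close> that vanish outside the size in question. Then equal matrices are
 equal functions and sizes may vary inside a statement.\<close>
definition vecs :: "('a,'m) ring_scheme => nat => (nat => 'a) set" where
 "vecs R d = {c. (ALL i. c i<:R) & (\<forall>i\<ge>d. c i = 0@R)}"

definition rmat :: "('a,'m) ring_scheme => nat => nat => (nat => nat => 'a) set" where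
 "rmat R a b = {A. (ALL i j. A i j<:R) & (ALL i j. a \<le> i \<or> b \<le> j \<longrightarrow> A i j = 0@R)}"

definition mat_vec :: "('a,'m) ring_scheme => nat => (nat => nat => 'a) => (nat => 'a) => nat => 'a" where
 "mat_vec R e A c = (%i. \<Oplus>\<^bsub>R\<^esub>l\<in>{..<e}. A i l*.R c l)"

definition mmul :: "('a,'m) ring_scheme => nat => (nat => nat => 'a) => (nat => nat => 'a) => nat => nat => 'a" where
 "mmul R e A Y = (%i j. \<Oplus>\<^bsub>R\<^esub>l\<in>{..<e}. A i l*.R Y l j)"

definition mone :: "('a,'m) ring_scheme => nat => nat => nat => 'a" where
 "mone R d = (%i j. if i = j & i < d then 1@R else 0@R)"

definition Mat :: "('a,'m) ring_scheme => nat => (nat => nat => 'a) ring" where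
 "Mat R d = \<lparr>carrier = rmat R d d,monoid.mult = mmul R d,one = mone R d,
  ring.zero = (%i j. 0@R),ring.add = (%A Y i j. A i j+.R Y i j)\<rparr>"

definition mmap :: "('a => 'b) => (nat => nat => 'a) => nat => nat => 'b" where
 "mmap f A = (%i j. f (A i j))"

definition smat :: "('a,'m) ring_scheme => 'a => (nat => nat => 'a) => nat => nat => 'a" where
 "smat R s A = (%i j. s*.R A i j)"

lemma Mat_sel [simp]:
 "car (Mat R d) = rmat R d d" "A*.(Mat R d) Y = mmul R d A Y" "1@(Mat R d) = mone R d"
 "0@(Mat R d) = (%i j. 0@R)" "A+.(Mat R d) Y = (%i j. A i j+.R Y i j)"
 by (simp_all add: Mat_def)

lemma rmatD:"A\<in>rmat R a b==>A i j<:R" by (simp add:rmat_def)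
lemma rmat_col:"A\<in>rmat R a b==>(%i. A i j)\<in>vecs R a" by (simp add:rmat_def vecs_def)
lemma vecsD:"c\<in>vecs R d==>c i<:R" by (simp add:vecs_def)

lemma mmul_col:"mmul R e A Y i j = mat_vec R e A (%l. Y l j) i"
 by (simp add:mmul_def mat_vec_def)

context cring
begin

lemma mat_vec_closed:"(!!i j. A i j<:R)==>(!!i. c i<:R)==>mat_vec R e A c i<:R"
 unfolding mat_vec_def by (rule finsum_closed) auto

lemma mmul_entry_closed:"(!!i j. A i j<:R)==>(!!i j. Y i j<:R)==>mmul R e A Y i j<:R"
 unfolding mmul_col by (rule mat_vec_closed)

lemma mat_vec_assoc:
 assumes "!!i j. A i j<:R" "!!i j. Y i j<:R" "!!i. c i<:R"
 shows "mat_vec R f (mmul R e A Y) c = mat_vec R e A (mat_vec R f Y c)"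
proof
 fix i
 have "mat_vec R f (mmul R e A Y) c i = (\<Oplus>l\<in>{..<f}. \<Oplus>m\<in>{..<e}. A i m \<otimes> Y m l \<otimes> c l)"
  unfolding mat_vec_def mmul_def
  by (rule finsum_cong') (use assms in \<open>auto intro!: finsum_ldistr finsum_closed\<close>)
 also have "... = (\<Oplus>m\<in>{..<e}. \<Oplus>l\<in>{..<f}. A i m \<otimes> Y m l \<otimes> c l)"
  by (rule finsum_swap) (use assms in auto)
 also have "... = mat_vec R e A (mat_vec R f Y c) i"
  unfolding mat_vec_def
  by (rule finsum_cong') (use assms in \<open>auto simp:m_assoc finsum_rdistr intro!: finsum_closed\<close>)
 finally show "mat_vec R f (mmul R e A Y) c i = mat_vec R e A (mat_vec R f Y c) i" .
qed

lemma mmul_assoc: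
 assumes "!!i j. A i j<:R" "!!i j. Y i j<:R" "!!i j. Z i j<:R"
 shows "mmul R f (mmul R e A Y) Z = mmul R e A (mmul R f Y Z)"
proof (intro ext)
 fix i j
 have "mat_vec R f (mmul R e A Y) (%l. Z l j) i = mat_vec R e A (mat_vec R f Y (%l. Z l j)) i"
  by (subst mat_vec_assoc) (use assms in auto)
 then show "mmul R f (mmul R e A Y) Z i j = mmul R e A (mmul R f Y Z) i j"
  unfolding mmul_col .
qed

lemma finsum_delta:
 assumes "!!l. f l<:R"
 shows "(\<Oplus>l\<in>{..<d::nat}. if l = i then f l else \<zero>) = (if i < d then f i else \<zero>)"
proof (cases "i < d")
 case True
 have "(\<Oplus>l\<in>{..<d}. if l = i then f l else \<zero>) = (\<Oplus>l\<in>{..<d}. if i = l then f l else \<zero>)"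
  by (rule finsum_cong') (use assms in auto)
 also have "... = f i" using finsum_singleton[of i "{..<d}" f] True assms by (simp add:Pi_def)
 finally show ?thesis using True by simp
next
 case False
 then have "(\<Oplus>l\<in>{..<d}. if l = i then f l else \<zero>) = (\<Oplus>l\<in>{..<d}. \<zero>)" by (intro finsum_cong') auto
 then show ?thesis using False by simp
qed

lemma mone_vec:
 assumes "c\<in>vecs R d" shows "mat_vec R d (mone R d) c = c"
proof
 fix i
 have "mat_vec R d (mone R d) c i = (\<Oplus>l\<in>{..<d}. if l = i then c l else \<zero>)"
  unfolding mat_vec_def mone_def by (rule finsum_cong') (use assms in \<open>auto simp:vecs_def\<close>)
 also have "... = c i" using finsum_delta[where f = c and d = d and i = i] assms by (auto simp:vecs_def)
 finally show "mat_vec R d (mone R d) c i = c i" .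
qed

lemma mone_mult: assumes "A\<in>rmat R d e" shows "mmul R d (mone R d) A = A"
 using mone_vec[OF rmat_col[OF assms]] by (simp add:fun_eq_iff mmul_col)

lemma mmul_one: assumes "A\<in>rmat R e d" shows "mmul R d A (mone R d) = A"
proof (intro ext)
 fix i j
 have "mmul R d A (mone R d) i j = (\<Oplus>l\<in>{..<d}. if l = j then A i l else \<zero>)"
  unfolding mmul_def mone_def by (rule finsum_cong') (use assms in \<open>auto simp:rmat_def\<close>)
 also have "... = A i j" using finsum_delta[where f = "A i" and d = d and i = j] assms by (auto simp:rmat_def)
 finally show "mmul R d A (mone R d) i j = A i j" .
qed

lemma mmul_rmat:"A\<in>rmat R a b==>Y\<in>rmat R b' c==>mmul R e A Y\<in>rmat R a c"
 unfolding rmat_def mmul_def by (auto intro!: finsum_closed simp: finsum_zero cong: finsum_cong)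

lemma mone_rmat [simp]: "mone R d\<in>rmat R d d"
 by (auto simp:rmat_def mone_def)

lemma ring_Mat:"ring (Mat R d)"
proof (rule ringI)
 show "abelian_group (Mat R d)"
 proof (rule abelian_groupI)
  fix A assume "A<:(Mat R d)"
  then show "\<exists>Y\<in>car (Mat R d). Y+.(Mat R d) A = 0@(Mat R d)"
  by (intro bexI[of _ "%i j. \<ominus> A i j"]) (auto simp:rmat_def l_neg)
 qed (auto simp:rmat_def a_ac)
 show "Group.monoid (Mat R d)"
 proof (rule monoidI)
  fix A Y Z assume "A<:(Mat R d)" "Y<:(Mat R d)" "Z<:(Mat R d)"
  then show "A*.(Mat R d) Y*.(Mat R d) Z = A*.(Mat R d) (Y*.(Mat R d) Z)"
  by (simp add:mmul_assoc rmatD)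
 qed (auto simp:mmul_rmat mone_mult mmul_one)
 fix A Y Z assume "A<:(Mat R d)" "Y<:(Mat R d)" "Z<:(Mat R d)"
 then have c:"A i j<:R" "Y i j<:R" "Z i j<:R" for i j by (auto simp:rmat_def)
 show "(A+.(Mat R d) Y)*.(Mat R d) Z = A*.(Mat R d) Z+.(Mat R d) Y*.(Mat R d) Z"
  by (simp add:mmul_def l_distr c finsum_addf fun_eq_iff)
 show "Z*.(Mat R d) (A+.(Mat R d) Y) = Z*.(Mat R d) A+.(Mat R d) Z*.(Mat R d) Y"
  by (simp add:mmul_def r_distr c finsum_addf fun_eq_iff)
qed

lemma Mat_uminus: assumes "A\<in>rmat R d d" shows "-:(Mat R d) A = (%i j. \<ominus> A i j)"
proof -
 interpret M: ring "Mat R d" by (rule ring_Mat)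
 show ?thesis by (rule M.minus_equality) (use assms in \<open>auto simp:rmat_def l_neg\<close>)
qed

lemma Mat_minus: assumes "A\<in>rmat R d d" "Y\<in>rmat R d d" shows "(A-.(Mat R d) Y) i j = A i j \<ominus> Y i j"
 using assms by (simp add:a_minus_def Mat_uminus)

lemma smat_rmat:"s<:R==>A\<in>rmat R a b==>smat R s A\<in>rmat R a b"
 by (auto simp:rmat_def smat_def)

lemma smmul_l:
 assumes "s<:R" "!!i j. A i j<:R" "!!i j. Y i j<:R"
 shows "mmul R e (smat R s A) Y = smat R s (mmul R e A Y)"
 unfolding mmul_def smat_def using assms by (simp add:m_assoc finsum_rdistr fun_eq_iff)

lemma smmul_r:
 assumes "s<:R" "!!i j. A i j<:R" "!!i j. Y i j<:R"
 shows "mmul R e A (smat R s Y) = smat R s (mmul R e A Y)"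
 unfolding mmul_def smat_def using assms by (simp add:m_lcomm finsum_rdistr fun_eq_iff)

lemma smat_add:
 assumes "s<:R" "!!i j. A i j<:R" "!!i j. Y i j<:R"
 shows "smat R s (%i j. A i j \<oplus> Y i j) = (%i j. smat R s A i j \<oplus> smat R s Y i j)"
 using assms by (simp add:smat_def r_distr)

lemma smat_smat:
 assumes "s<:R" "t<:R" "!!i j. A i j<:R"
 shows "smat R s (smat R t A) = smat R (s \<otimes> t) A"
 using assms by (simp add:smat_def m_assoc)

lemma smone:"(!!i j. A i j<:R)==>smat R \<one> A = A"
 by (simp add:smat_def)

end

context ring_hom_cring
begin

lemma mmap_rmat:"A\<in>rmat R a b==>mmap h A\<in>rmat S a b"
 by (auto simp:rmat_def mmap_def)

lemma map_vecs:"c\<in>vecs R d==>(%i. h (c i))\<in>vecs S d"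
 by (auto simp:vecs_def)

lemma map_mmul:
 assumes "!!i j. A i j<:R" "!!i j. Y i j<:R"
 shows "mmap h (mmul R e A Y) = mmul S e (mmap h A) (mmap h Y)"
 unfolding mmap_def mmul_def
 by (intro ext,subst hom_finsum) (use assms in \<open>auto simp:comp_def intro!: S.finsum_cong'\<close>)

lemma mmap_vec:
 assumes "!!i j. A i j<:R" "!!i. c i<:R"
 shows "h (mat_vec R e A c i) = mat_vec S e (mmap h A) (%i. h (c i)) i"
 unfolding mmap_def mat_vec_def
 by (subst hom_finsum) (use assms in \<open>auto simp:comp_def intro!: S.finsum_cong'\<close>)

lemma mmap_one:"mmap h (mone R d) = mone S d"
 by (auto simp:mmap_def mone_def fun_eq_iff)

lemma mmap_hom:"mmap h\<in>ring_hom (Mat R d) (Mat S d)"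
proof (rule ring_hom_memI)
 fix A Y assume "A<:(Mat R d)" "Y<:(Mat R d)"
 then have c:"A\<in>rmat R d d" "Y\<in>rmat R d d" by auto
 show "mmap h A<:(Mat S d)" using c by (simp add:mmap_rmat)
 show "mmap h (A*.(Mat R d) Y) = mmap h A*.(Mat S d) mmap h Y"
  using c by (simp add:map_mmul rmatD)
 show "mmap h (A+.(Mat R d) Y) = mmap h A+.(Mat S d) mmap h Y"
  using rmatD[OF c(1)] rmatD[OF c(2)] by (simp add:mmap_def)
qed (simp add:mmap_one)

lemma rmat_lift:
 assumes surj:"h ` car R = car S" and A:"A\<in>rmat S a b"
 shows "\<exists>Y\<in>rmat R a b. mmap h Y = A"
proof -
 have "EX y. y<:R & h y = A i j & (a \<le> i \<or> b \<le> j \<longrightarrow> y = \<zero>)" for i j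
 proof (cases "a \<le> i \<or> b \<le> j")
  case True then show ?thesis using A by (intro exI[of _ \<zero>]) (auto simp:rmat_def)
 next
  case False
  have "A i j\<in>h ` car R" using A surj by (simp add:rmat_def)
  then show ?thesis using False by auto
 qed
 then obtain Y where "!!i j. Y i j<:R & h (Y i j) = A i j & (a \<le> i \<or> b \<le> j \<longrightarrow> Y i j = \<zero>)" by metis
 then show ?thesis by (intro bexI[of _ Y]) (auto simp:rmat_def mmap_def)
qed

end

text \<open>Column operations clear one row at a time: the pivots reduce to 1, hence are units.\<close>
lemma (in local_over) right_inverse_mod:
 assumes P:"P\<in>rmat B d d" "mmap r P = mone k d"
 shows "\<exists>Q\<in>rmat B d d. mmap r Q = mone k d & mmul B d P Q = mone B d"
proof -
 have "\<exists>Q\<in>rmat B d d. mmap r Q = mone k d & (\<forall>i<n. ALL j. mmul B d P Q i j = mone B d i j)"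
  if "n \<le> d" for n
  using that
 proof (induction n)
  case 0 then show ?case by (intro bexI[of _ "mone B d"]) (simp_all add: r.mmap_one)
 next
  case (Suc n)
  then obtain Q where Q:"Q\<in>rmat B d d" "mmap r Q = mone k d"
  "!!i j. i < n==>mmul B d P Q i j = mone B d i j" by auto
  define T where "T = mmul B d P Q"
  have T:"T\<in>rmat B d d" unfolding T_def by (rule B.mmul_rmat[OF P(1) Q(1)])
  have Tc:"T i j<:B" for i j by (rule rmatD[OF T])
  have rT:"mmap r T = mone k d"
  unfolding T_def by (subst r.map_mmul) (simp_all add: rmatD[OF P(1)] rmatD[OF Q(1)] P Q k.mone_mult[OF k.mone_rmat])
  then have rTij:"r (T i j) = mone k d i j" for i j by (simp add:mmap_def fun_eq_iff)
  have "r (T n n) = 1@k" using rTij[of n n] Suc.prems by (simp add:mone_def)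
  then obtain w where w:"w<:B" "T n n \<otimes> w = \<one>" using r_unit[OF Tc,of n n] by auto
  have rw:"r w = 1@k"
  using r.hom_mult[OF Tc[of n n] w(1)] w \<open>r (T n n) = 1@k\<close> by simp
  define f where "f j = (if j = n then w \<ominus> \<one> else \<ominus> (w \<otimes> T n j))" for j
  have fc:"f j<:B" for j using w Tc by (simp add:f_def)
  have rf:"r (f j) = 0@k" for j
  using w Tc rw rTij[of n j] by (simp add:f_def a_minus_def k.r_neg mone_def)
  define E where "E = (%i j. mone B d i j \<oplus> (if i = n then f j else \<zero>))"
  have oc:"mone B d i j<:B" for i j by (simp add:mone_def)
  have E:"E\<in>rmat B d d"
  proof -
  have "f j = \<zero>" if "d \<le> j" for j
  using T that Suc.prems w by (auto simp:f_def rmat_def)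
  then show ?thesis using fc oc Suc.prems by (auto simp:E_def rmat_def mone_def)
  qed
  have rE:"mmap r E = mone k d"
  proof -
  have "mone k d i j<:k" for i j by (simp add:mone_def)
  then show ?thesis using r.mmap_one[of d] rf fc oc by (auto simp:mmap_def E_def fun_eq_iff)
  qed
  have TE:"mmul B d T E i j = T i j \<oplus> T i n \<otimes> f j" for i j
  proof -
  have "mmul B d T E i j = (\<Oplus>l\<in>{..<d}. T i l \<otimes> mone B d l j \<oplus> (if l = n then T i l \<otimes> f j else \<zero>))"
  unfolding mmul_def E_def
  by (rule B.finsum_cong') (auto simp:Tc fc oc B.r_distr)
  also have "... = mmul B d T (mone B d) i j \<oplus> (\<Oplus>l\<in>{..<d}. if l = n then T i l \<otimes> f j else \<zero>)"
  unfolding mmul_def by (rule B.finsum_addf) (auto simp:Tc fc oc)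
  also have "... = T i j \<oplus> T i n \<otimes> f j"
  using B.finsum_delta[where f = "%l. T i l \<otimes> f j" and d = d and i = n] Suc.prems by (simp add:B.mmul_one[OF T] Tc fc)
  finally show ?thesis .
  qed
  have "mmul B d P (mmul B d Q E) = mmul B d T E"
  unfolding T_def by (subst B.mmul_assoc) (simp_all add: rmatD[OF P(1)] rmatD[OF Q(1)] rmatD[OF E])
  moreover have "mmul B d T E i j = mone B d i j" if "i < Suc n" for i j
  proof (cases "i = n")
  case False
  then have "T i j = mone B d i j" "T i n = \<zero>" using Q(3)[of i] that by (auto simp:T_def mone_def)
  then show ?thesis unfolding TE using fc oc by simp
  next
  case True
  show ?thesis
  proof (cases "j = n")
  case jn: True
  have "T n n \<oplus> T n n \<otimes> (w \<ominus> \<one>) = T n n \<otimes> w" using Tc[of n n] w(1) by algebra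
  then show ?thesis unfolding TE True jn f_def using w Suc.prems by (simp add:mone_def)
  next
  case jn: False
  have "T n j \<oplus> T n n \<otimes> (\<ominus> (w \<otimes> T n j)) = T n j \<ominus> (T n n \<otimes> w) \<otimes> T n j"
  using Tc[of n n] Tc[of n j] w(1) by algebra
  also have "... = \<zero>" using w Tc[of n j] by (simp add:a_minus_def B.r_neg)
  finally show ?thesis unfolding TE True f_def using jn by (simp add:mone_def)
  qed
  qed
  moreover have "mmap r (mmul B d Q E) = mone k d"
  by (subst r.map_mmul) (simp_all add: rmatD[OF Q(1)] rmatD[OF E] Q rE k.mone_mult[OF k.mone_rmat])
  ultimately show ?case
  by (intro bexI[of _ "mmul B d Q E"]) (auto intro: B.mmul_rmat[OF Q(1) E])
 qed
 from this[of d] obtain Q where Q:"Q\<in>rmat B d d" "mmap r Q = mone k d"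
  "!!i j. i < d==>mmul B d P Q i j = mone B d i j" by auto
 have "mmul B d P Q = mone B d"
 proof (intro ext)
  fix i j
  show "mmul B d P Q i j = mone B d i j"
  using Q(3) B.mmul_rmat[OF P(1) Q(1),of d] by (cases "i < d") (auto simp:rmat_def mone_def)
 qed
 then show ?thesis using Q by blast
qed

lemma (in local_over) inverse_mod:
 assumes P:"P\<in>rmat B d d" "mmap r P = mone k d"
 shows "\<exists>Q\<in>rmat B d d. mmap r Q = mone k d & mmul B d P Q = mone B d & mmul B d Q P = mone B d"
proof -
 obtain Q where Q:"Q\<in>rmat B d d" "mmap r Q = mone k d" "mmul B d P Q = mone B d"
  using right_inverse_mod[OF P] by blast
 obtain T where T:"T\<in>rmat B d d" "mmul B d Q T = mone B d"
  using right_inverse_mod[OF Q(1,2)] by blast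
 have "P = mmul B d P (mmul B d Q T)" by (simp add:T B.mmul_one[OF P(1)])
 also have "... = mmul B d (mmul B d P Q) T"
  by (subst B.mmul_assoc) (simp_all add: rmatD[OF P(1)] rmatD[OF Q(1)] rmatD[OF T(1)])
 also have "... = T" by (simp add:Q B.mone_mult[OF T(1)])
 finally show ?thesis using Q T by blast
qed

text \<open>Invertibility modulo the maximal ideal is enough also for rectangular matrices; this makes
 a comparison of the ranks superfluous.\<close>

lemma (in local_over) rect_inverse_mod:
 assumes A:"A\<in>rmat B a b" and Y:"Y0\<in>rmat k b a"
  and XY:"mmul k b (mmap r A) Y0 = mone k a" and YX:"mmul k a Y0 (mmap r A) = mone k b"
 shows "\<exists>Z\<in>rmat B b a. mmul B b A Z = mone B a & mmul B a Z A = mone B b"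
proof -
 obtain Y1 where Y1:"Y1\<in>rmat B b a" "mmap r Y1 = Y0" using r.rmat_lift[OF r_surj Y] by blast
 note c = rmatD[OF A] rmatD[OF Y1(1)]
 have 1:"mmul B b A Y1\<in>rmat B a a" "mmul B a Y1 A\<in>rmat B b b"
  by (rule B.mmul_rmat[OF A Y1(1)],rule B.mmul_rmat[OF Y1(1) A])
 have "mmap r (mmul B b A Y1) = mone k a" "mmap r (mmul B a Y1 A) = mone k b"
  using XY YX by (simp_all add: r.map_mmul c Y1)
 then obtain Q Q' where Q:"Q\<in>rmat B a a" "mmul B a (mmul B b A Y1) Q = mone B a"
  and Q': "Q'\<in>rmat B b b" "mmul B b Q' (mmul B a Y1 A) = mone B b"
  using inverse_mod[OF 1(1)] inverse_mod[OF 1(2)] by blast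
 note c = c rmatD[OF Q(1)] rmatD[OF Q'(1)]
 let ?Z = "mmul B a Y1 Q" and ?Z' = "mmul B b Q' Y1"
 have Z:"?Z\<in>rmat B b a" "?Z'\<in>rmat B b a"
  by (rule B.mmul_rmat[OF Y1(1) Q(1)],rule B.mmul_rmat[OF Q'(1) Y1(1)])
 have XZ:"mmul B b A ?Z = mone B a" using Q(2) by (simp add:B.mmul_assoc c)
 have ZX:"mmul B a ?Z' A = mone B b" using Q'(2) by (simp add:B.mmul_assoc c)
 have "?Z' = mmul B a ?Z' (mmul B b A ?Z)" unfolding XZ by (rule B.mmul_one[OF Z(2),symmetric])
 also have "... = mmul B b (mmul B a ?Z' A) ?Z"
  by (subst B.mmul_assoc) (simp_all add: c rmatD[OF Z(1)] rmatD[OF Z(2)])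
 also have "... = ?Z" unfolding ZX by (rule B.mone_mult[OF Z(1)])
 finally show ?thesis using XZ ZX Z by metis
qed

section \<open>Modules with a finite basis\<close>

definition lincomb :: "('a,'b,'m) module_scheme => nat => (nat => 'a) => (nat => 'b) => 'b" where
 "lincomb M d c e = (\<Oplus>\<^bsub>M\<^esub>i\<in>{..<d}. c i*:M e i)"

definition is_basis :: "('a,'m) ring_scheme => ('a,'b,'m1) module_scheme => nat => (nat => 'b) => bool" where
 "is_basis R M d e \<longleftrightarrow> (\<forall>i<d. e i<:M) \<and>
  (\<forall>x\<in>car M. \<exists>!c. c\<in>vecs R d & x = lincomb M d c e)"

definition coords :: "('a,'m) ring_scheme => ('a,'b,'m1) module_scheme => nat => (nat => 'b) => 'b => nat => 'a" where
 "coords R M d e x = (THE c. c\<in>vecs R d & x = lincomb M d c e)"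

lemma lincomb_cong:"module R M==>(!!i. i < d==>c i = c' i)==>(!!i. i < d==>e i = e' i) ==>
  (!!i. i < d==>c' i<:R)==>(!!i. i < d==>e' i<:M)==>lincomb M d c e = lincomb M d c' e'"
 unfolding lincomb_def
 by (rule abelian_monoid.finsum_cong') (auto simp:module_def abelian_group.axioms module.smult_closed)

context module
begin

lemma lincomb_closed:
 "(!!i. i < d==>c i<:R)==>(!!i. i < d==>e i<:M)==>lincomb M d c e<:M"
 unfolding lincomb_def by (rule M.finsum_closed) auto

lemma lincomb_add:
 assumes "!!i. i < d==>c i<:R" "!!i. i < d==>c' i<:R" "!!i. i < d==>e i<:M"
 shows "lincomb M d (%i. c i \<oplus> c' i) e = lincomb M d c e+.M lincomb M d c' e"
proof -
 have "lincomb M d (%i. c i \<oplus> c' i) e = (\<Oplus>\<^bsub>M\<^esub>i\<in>{..<d}. c i*:M e i+.M c' i*:M e i)"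
  unfolding lincomb_def by (rule M.finsum_cong') (use assms in \<open>auto simp:smult_l_distr\<close>)
 also have "... = lincomb M d c e+.M lincomb M d c' e"
  unfolding lincomb_def by (rule M.finsum_addf) (use assms in auto)
 finally show ?thesis .
qed

lemma lincomb_add_right:
 assumes "!!i. i < d==>c i<:R" "!!i. i < d==>e i<:M" "!!i. i < d==>e' i<:M"
 shows "lincomb M d c (%i. e i+.M e' i) = lincomb M d c e+.M lincomb M d c e'"
proof -
 have "lincomb M d c (%i. e i+.M e' i) = (\<Oplus>\<^bsub>M\<^esub>i\<in>{..<d}. c i*:M e i+.M c i*:M e' i)"
  unfolding lincomb_def by (rule M.finsum_cong') (use assms in \<open>auto simp:smult_r_distr\<close>)
 also have "... = lincomb M d c e+.M lincomb M d c e'"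
  unfolding lincomb_def by (rule M.finsum_addf) (use assms in auto)
 finally show ?thesis .
qed

lemma lincomb_smult:
 assumes "a<:R" "!!i. i < d==>c i<:R" "!!i. i < d==>e i<:M"
 shows "lincomb M d (%i. a \<otimes> c i) e = a*:M lincomb M d c e"
proof -
 have "lincomb M d (%i. a \<otimes> c i) e = (\<Oplus>\<^bsub>M\<^esub>i\<in>{..<d}. a*:M (c i*:M e i))"
  unfolding lincomb_def by (rule M.finsum_cong') (use assms in \<open>auto simp:smult_assoc1\<close>)
 also have "... = a*:M lincomb M d c e"
  unfolding lincomb_def by (rule finsum_smult_ldistr[symmetric]) (use assms in auto)
 finally show ?thesis .
qed

lemma lincomb_zero: assumes "!!i. i < d==>e i<:M" shows "lincomb M d (%i. \<zero>) e = 0@M"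
proof -
 have "lincomb M d (%i. \<zero>) e = (\<Oplus>\<^bsub>M\<^esub>i\<in>{..<d}. 0@M)"
  unfolding lincomb_def by (rule M.finsum_cong') (use assms in auto)
 then show ?thesis by simp
qed

lemma lincomb_unit: assumes "!!i. i < d==>e i<:M" "j < d"
 shows "lincomb M d (%i. mone R d i j) e = e j"
proof -
 have "lincomb M d (%i. mone R d i j) e = (\<Oplus>\<^bsub>M\<^esub>i\<in>{..<d}. if j = i then e i else 0@M)"
  unfolding lincomb_def by (rule M.finsum_cong') (use assms in \<open>auto simp:mone_def\<close>)
 also have "... = e j" using M.finsum_singleton[of j "{..<d}" e] assms by (simp add:Pi_def)
 finally show ?thesis .
qed

lemma finsum_smult_rdistr:
 assumes "!!i. i < d==>c i<:R" "x<:M"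
 shows "(\<Oplus>i\<in>{..<d::nat}. c i)*:M x = (\<Oplus>\<^bsub>M\<^esub>i\<in>{..<d}. c i*:M x)"
 using assms
proof (induction d)
 case (Suc d)
 have ins:"{..<Suc d} = insert d {..<d}" by auto
 have 1:"(\<Oplus>i\<in>{..<Suc d}. c i) = c d \<oplus> (\<Oplus>i\<in>{..<d}. c i)"
  unfolding ins by (rule R.finsum_insert) (use Suc.prems in auto)
 have 2:"(\<Oplus>\<^bsub>M\<^esub>i\<in>{..<Suc d}. c i*:M x) = c d*:M x+.M (\<Oplus>\<^bsub>M\<^esub>i\<in>{..<d}. c i*:M x)"
  unfolding ins by (rule M.finsum_insert) (use Suc.prems in auto)
 have c:"(\<Oplus>i\<in>{..<d}. c i)<:R" by (rule R.finsum_closed) (use Suc.prems in auto)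
 show ?case unfolding 1 2 using Suc c by (simp add:smult_l_distr)
qed simp

lemma lincomb_mat:
 assumes A:"!!i j. i < b==>j < a==>A i j<:R" and c:"!!j. j < a==>c j<:R"
  and s:"!!i. i < b==>s i<:M"
 shows "lincomb M b (mat_vec R a A c) s = lincomb M a c (%j. lincomb M b (%i. A i j) s)"
proof -
 have "lincomb M b (mat_vec R a A c) s = (\<Oplus>\<^bsub>M\<^esub>i\<in>{..<b}. \<Oplus>\<^bsub>M\<^esub>j\<in>{..<a}. (A i j \<otimes> c j)*:M s i)"
  unfolding lincomb_def mat_vec_def
  by (rule M.finsum_cong') (use assms in \<open>auto intro!: finsum_smult_rdistr M.finsum_closed\<close>)
 also have "... = (\<Oplus>\<^bsub>M\<^esub>j\<in>{..<a}. \<Oplus>\<^bsub>M\<^esub>i\<in>{..<b}. (A i j \<otimes> c j)*:M s i)"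
  by (rule M.finsum_swap) (use assms in auto)
 also have "... = lincomb M a c (%j. lincomb M b (%i. A i j) s)"
  unfolding lincomb_def
 proof (rule M.finsum_cong'[OF refl])
  show "(%j. c j*:M (\<Oplus>\<^bsub>M\<^esub>i\<in>{..<b}. A i j*:M s i))\<in>{..<a} \<rightarrow> car M"
  using assms by (auto intro!: smult_closed M.finsum_closed)
  fix j assume "j\<in>{..<a}"
  then have j:"j < a" by simp
  have "(\<Oplus>\<^bsub>M\<^esub>i\<in>{..<b}. (A i j \<otimes> c j)*:M s i) = (\<Oplus>\<^bsub>M\<^esub>i\<in>{..<b}. c j*:M (A i j*:M s i))"
  by (rule M.finsum_cong') (use assms j in \<open>auto simp:smult_assoc1[symmetric] m_comm\<close>)
  also have "... = c j*:M (\<Oplus>\<^bsub>M\<^esub>i\<in>{..<b}. A i j*:M s i)"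
  by (rule finsum_smult_ldistr[symmetric]) (use assms j in auto)
  finally show "(\<Oplus>\<^bsub>M\<^esub>i\<in>{..<b}. (A i j \<otimes> c j)*:M s i) = c j*:M (\<Oplus>\<^bsub>M\<^esub>i\<in>{..<b}. A i j*:M s i)" .
 qed
 finally show ?thesis .
qed

lemma is_basisI:
 assumes "!!i. i < d==>e i<:M"
  and gen:"!!x. x<:M==>\<exists>c\<in>vecs R d. x = lincomb M d c e"
  and indep:"!!c. c\<in>vecs R d==>lincomb M d c e = 0@M==>c = (%i. \<zero>)"
 shows "is_basis R M d e"
 unfolding is_basis_def
proof (intro conjI allI impI ballI)
 fix x assume x:"x<:M"
 obtain c where c:"c\<in>vecs R d" "x = lincomb M d c e" using gen[OF x] by blast
 show "\<exists>!c. c\<in>vecs R d & x = lincomb M d c e"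
 proof (rule ex1I[of _ c])
  fix c' assume c': "c'\<in>vecs R d & x = lincomb M d c' e"
  have cc:"c i<:R" "c' i<:R" for i using c c' by (auto simp:vecs_def)
  let ?d = "%i. c' i \<oplus> (\<ominus> \<one>) \<otimes> c i"
  have "lincomb M d ?d e = x+.M (\<ominus> \<one>)*:M x"
  using c c' assms(1) cc by (subst lincomb_add) (auto simp:lincomb_smult)
  also have "... = 0@M" using x by (simp add:smult_l_minus M.r_neg)
  finally have "?d = (%i. \<zero>)" using c c' by (intro indep) (auto simp:vecs_def)
  then have dz:"?d i = \<zero>" for i by meson
  have "c' i = c i" for i using cc[of i] dz[of i] R.r_right_minus_eq[of "c' i" "c i"] by (simp add:a_minus_def l_minus)
  then show "c' = c" by blast
 qed (use c in simp)
qed (use assms in simp)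

lemma
 assumes "is_basis R M d e"
 shows basis_closed:"i < d==>e i<:M"
  and coords_vecs:"x<:M==>coords R M d e x\<in>vecs R d"
  and lincomb_coords:"x<:M==>lincomb M d (coords R M d e x) e = x"
  and coords_unique:"c\<in>vecs R d==>coords R M d e (lincomb M d c e) = c"
proof -
 show cl:"i < d==>e i<:M" for i using assms by (simp add:is_basis_def)
 have *: "coords R M d e x\<in>vecs R d & x = lincomb M d (coords R M d e x) e" if "x<:M" for x
  unfolding coords_def
  by (rule theI'[where P = "%c. c\<in>vecs R d & x = lincomb M d c e"]) (use assms that in \<open>simp add:is_basis_def\<close>)
 show "x<:M==>coords R M d e x\<in>vecs R d" using * by blast
 show "x<:M==>lincomb M d (coords R M d e x) e = x" using * by simp
 assume c:"c\<in>vecs R d"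
 then have "lincomb M d c e<:M" by (intro lincomb_closed) (auto simp:vecs_def cl)
 then show "coords R M d e (lincomb M d c e) = c"
  using *[of "lincomb M d c e"] c assms unfolding is_basis_def by metis
qed

lemma coords_add:
 assumes b:"is_basis R M d e" and x:"x<:M" "y<:M"
 shows "coords R M d e (x+.M y) = (%i. coords R M d e x i \<oplus> coords R M d e y i)"
proof -
 note cv = coords_vecs[OF b x(1)] coords_vecs[OF b x(2)]
 have "lincomb M d (%i. coords R M d e x i \<oplus> coords R M d e y i) e = x+.M y"
  using cv x by (subst lincomb_add) (auto simp:vecs_def basis_closed[OF b] lincomb_coords[OF b])
 moreover have "(%i. coords R M d e x i \<oplus> coords R M d e y i)\<in>vecs R d" using cv by (auto simp:vecs_def)
 ultimately show ?thesis using coords_unique[OF b] by metis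
qed

lemma coords_smult:
 assumes b:"is_basis R M d e" and x:"a<:R" "x<:M"
 shows "coords R M d e (a*:M x) = (%i. a \<otimes> coords R M d e x i)"
proof -
 note cv = coords_vecs[OF b x(2)]
 have "lincomb M d (%i. a \<otimes> coords R M d e x i) e = a*:M x"
  using cv x by (subst lincomb_smult) (auto simp:vecs_def basis_closed[OF b] lincomb_coords[OF b])
 moreover have "(%i. a \<otimes> coords R M d e x i)\<in>vecs R d" using cv x by (auto simp:vecs_def)
 ultimately show ?thesis using coords_unique[OF b] by metis
qed

lemma coords_basis:
 assumes b:"is_basis R M d e" and j:"j < d"
 shows "coords R M d e (e j) = (%i. mone R d i j)"
 using coords_unique[OF b,of "%i. mone R d i j"] lincomb_unit[of d e j] basis_closed[OF b] j
  rmat_col[OF R.mone_rmat] by simp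

lemma is_basis_change:
 assumes b:"is_basis R M b s" and A:"A\<in>rmat R b a" and Z:"Z\<in>rmat R a b"
  and AZ:"mmul R a A Z = mone R b" and ZA:"mmul R b Z A = mone R a"
 shows "is_basis R M a (%j. lincomb M b (%i. A i j) s)"
proof (rule is_basisI)
 note sc = basis_closed[OF b]
 show "lincomb M b (%i. A i j) s<:M" for j
  by (rule lincomb_closed) (use rmatD[OF A] sc in auto)
 have vec:"mat_vec R m Y c\<in>vecs R n" if "Y\<in>rmat R n m" "c\<in>vecs R m'" for Y c n m m'
  using that unfolding vecs_def mat_vec_def rmat_def by (auto intro!: R.finsum_closed simp: R.finsum_zero cong: R.finsum_cong)
 fix x assume x:"x<:M"
 let ?c = "coords R M b s x"
 have c:"?c\<in>vecs R b" by (rule coords_vecs[OF b x])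
 have "mat_vec R a A (mat_vec R b Z ?c) = mat_vec R b (mmul R a A Z) ?c"
  by (rule R.mat_vec_assoc[symmetric]) (use rmatD[OF A] rmatD[OF Z] vecsD[OF c] in auto)
 also have "... = ?c" unfolding AZ by (rule R.mone_vec[OF c])
 finally have "x = lincomb M b (mat_vec R a A (mat_vec R b Z ?c)) s" by (simp add:lincomb_coords[OF b x])
 also have "... = lincomb M a (mat_vec R b Z ?c) (%j. lincomb M b (%i. A i j) s)"
  by (rule lincomb_mat) (use rmatD[OF A] vecsD[OF vec[OF Z c]] sc in auto)
 finally show "\<exists>c\<in>vecs R a. x = lincomb M a c (%j. lincomb M b (%i. A i j) s)" using vec[OF Z c] by blast
next
 note sc = basis_closed[OF b]
 have vec:"mat_vec R m Y c\<in>vecs R n" if "Y\<in>rmat R n m" "c\<in>vecs R m'" for Y c n m m'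
  using that unfolding vecs_def mat_vec_def rmat_def by (auto intro!: R.finsum_closed simp: R.finsum_zero cong: R.finsum_cong)
 fix c assume c:"c\<in>vecs R a" and z:"lincomb M a c (%j. lincomb M b (%i. A i j) s) = 0@M"
 have z1:"lincomb M b (mat_vec R a A c) s = 0@M"
  unfolding z[symmetric] by (rule lincomb_mat) (use rmatD[OF A] vecsD[OF c] sc in auto)
 have z2:"lincomb M b (%i. \<zero>) s = 0@M" by (rule lincomb_zero) (rule sc)
 have zv:"(%i. \<zero>)\<in>vecs R b" by (simp add:vecs_def)
 have "mat_vec R a A c = (%i. \<zero>)"
  using coords_unique[OF b vec[OF A c]] coords_unique[OF b zv] unfolding z1 z2 by (rule trans[OF sym])
 then have "mat_vec R b Z (mat_vec R a A c) = (%i. \<zero>)"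
  by (auto simp:mat_vec_def rmatD[OF Z] R.finsum_zero cong: R.finsum_cong)
 moreover have "mat_vec R b Z (mat_vec R a A c) = c"
  using R.mat_vec_assoc[of Z A c a b] rmatD[OF A] rmatD[OF Z] vecsD[OF c] ZA R.mone_vec[OF c] by simp
 ultimately show "c = (%i. \<zero>)" by simp
qed

lemma lin_maps_lincomb:
 assumes N:"module R N" and f:"f\<in>lin_maps R M N"
  and c:"!!i. i < d==>c i<:R" and e:"!!i. i < d==>e i<:M"
 shows "f (lincomb M d c e) = lincomb N d c (%i. f (e i))"
proof -
 interpret N: module R N by (rule N)
 have f1:"f x<:N" if "x<:M" for x
  using f that by (auto simp:lin_maps_def)
 have f2:"f (x+.M y) = f x+.N f y" if "x<:M" "y<:M" for x y
  using f that by (auto simp:lin_maps_def)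
 have f3:"f (a*:M x) = a*:N f x" if "x<:M" "a<:R" for x a
  using f that by (auto simp:lin_maps_def)
 note f' = f1 f2 f3
 have f0:"f 0@M = 0@N"
  using f3[of "0@M" \<zero>] f1[of "0@M"] by simp
 show ?thesis using c e
 proof (induction d)
  case 0 then show ?case by (simp add:lincomb_def f0)
 next
  case (Suc d)
  have ins:"{..<Suc d} = insert d {..<d}" by auto
  have 1:"lincomb M (Suc d) c e = c d*:M e d+.M lincomb M d c e"
  unfolding lincomb_def ins by (rule M.finsum_insert) (use Suc.prems in auto)
  have 2:"lincomb N (Suc d) c (%i. f (e i)) = c d*:N f (e d)+.N lincomb N d c (%i. f (e i))"
  unfolding lincomb_def ins by (rule N.M.finsum_insert) (use Suc.prems f' in auto)
  have "lincomb M d c e<:M" by (rule lincomb_closed) (use Suc.prems in auto)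
  then show ?case unfolding 1 2 using Suc by (simp add:f')
 qed
qed

lemma basis_map:
 assumes N:"module R N" and b:"is_basis R M d e" and e': "!!i. i < d==>e' i<:N"
 shows "(\<lambda>x\<in>car M. lincomb N d (coords R M d e x) e')\<in>lin_maps R M N"
  "j < d==>(\<lambda>x\<in>car M. lincomb N d (coords R M d e x) e') (e j) = e' j"
  "is_basis R N d e'==>bij_betw (\<lambda>x\<in>car M. lincomb N d (coords R M d e x) e') (car M) (car N)"
proof -
 interpret N: module R N by (rule N)
 let ?f = "\<lambda>x\<in>car M. lincomb N d (coords R M d e x) e'"
 note cv = vecsD[OF coords_vecs[OF b]]
 show "?f\<in>lin_maps R M N"
  unfolding lin_maps_def
  by (auto simp:coords_add[OF b] coords_smult[OF b] N.lincomb_add N.lincomb_smult cv e' intro!: N.lincomb_closed)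
 show "?f (e j) = e' j" if "j < d"
  using that by (simp add:basis_closed[OF b] coords_basis[OF b] N.lincomb_unit e')
 assume b': "is_basis R N d e'"
 show "bij_betw ?f (car M) (car N)"
 proof (rule bij_betw_byWitness[where f' = "%y. lincomb M d (coords R N d e' y) e"])
  note cv' = vecsD[OF N.coords_vecs[OF b']]
  have l:"lincomb M d (coords R N d e' y) e<:M" if "y<:N" for y
  by (rule lincomb_closed) (use that cv' basis_closed[OF b] in auto)
  have l': "lincomb N d (coords R M d e x) e'<:N" if "x<:M" for x
  by (rule N.lincomb_closed) (use that cv e' in auto)
  show "\<forall>x\<in>car M. lincomb M d (coords R N d e' (?f x)) e = x"
  by (simp add:N.coords_unique[OF b'] coords_vecs[OF b] lincomb_coords[OF b])
  show "\<forall>y\<in>car N. ?f (lincomb M d (coords R N d e' y) e) = y"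
  by (simp add:l coords_unique[OF b] N.coords_vecs[OF b'] N.lincomb_coords[OF b'])
  show "?f ` car M <= car N" using l' by auto
  show "(%y. lincomb M d (coords R N d e' y) e) ` car N <= car M" using l by auto
 qed
qed

lemma free_of_rank_imp_basis:
 assumes "free_of_rank R M d" shows "EX e. is_basis R M d e"
proof -
 obtain S where S:"S <= car M" "finite S" "card S = d"
  and u': "\<forall>x\<in>car M. \<exists>!c. c\<in>S \<rightarrow>\<^sub>E car R & x = (\<Oplus>\<^bsub>M\<^esub>s\<in>S. c s*:M s)"
  using assms unfolding free_of_rank_def by (elim exE conjE)
 note u = bspec[OF u']
 obtain e where e:"bij_betw e {..<d} S"
  using ex_bij_betw_nat_finite[OF S(2)] S(3) by (auto simp:atLeast0LessThan)
 have inj:"inj_on e {..<d}" and im:"e ` {..<d} = S" using e by (auto simp:bij_betw_def)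
 have ec:"e i<:M" if "i < d" for i using that im S(1) by blast
 have sum:"lincomb M d (%i. c (e i)) e = (\<Oplus>\<^bsub>M\<^esub>s\<in>S. c s*:M s)" if c:"c\<in>S \<rightarrow> car R" for c
 proof -
  have "(\<Oplus>\<^bsub>M\<^esub>s\<in>e ` {..<d}. c s*:M s) = (\<Oplus>\<^bsub>M\<^esub>i\<in>{..<d}. c (e i)*:M e i)"
  by (rule M.finsum_reindex[OF _ inj]) (use c S(1) im in auto)
  then show ?thesis unfolding lincomb_def im by simp
 qed
 define idx where "idx = the_inv_into {..<d} e"
 have idx:"idx (e i) = i" if "i < d" for i unfolding idx_def using that by (simp add:the_inv_into_f_f inj)
 have "is_basis R M d e"
  unfolding is_basis_def
 proof (intro conjI allI impI ballI ec)
  fix x assume x:"x<:M"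
  from u[OF x] obtain c where c:"c\<in>S \<rightarrow>\<^sub>E car R" "x = (\<Oplus>\<^bsub>M\<^esub>s\<in>S. c s*:M s)" by blast
  have cf:"c\<in>S \<rightarrow> car R" using c(1) by (simp add:PiE_def)
  show "\<exists>!c. c\<in>vecs R d & x = lincomb M d c e"
  proof (rule ex1I[of _ "%i. if i < d then c (e i) else \<zero>"])
  have "lincomb M d (%i. if i < d then c (e i) else \<zero>) e = lincomb M d (%i. c (e i)) e"
  using c im ec by (intro lincomb_cong[OF module_axioms]) auto
  then show "(%i. if i < d then c (e i) else \<zero>)\<in>vecs R d & x = lincomb M d (%i. if i < d then c (e i) else \<zero>) e"
  using c(2) cf sum[OF cf] im by (auto simp:vecs_def)
  next
  fix b assume b:"b\<in>vecs R d & x = lincomb M d b e"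
  let ?b = "\<lambda>s\<in>S. b (idx s)"
  have bc:"?b\<in>S \<rightarrow>\<^sub>E car R" using b by (auto simp:vecs_def)
  have be:"?b (e i) = b i" if "i < d" for i using that im idx by auto
  have "lincomb M d (%i. ?b (e i)) e = lincomb M d b e"
  by (rule lincomb_cong[OF module_axioms]) (use be ec b vecsD in auto)
  then have "x = (\<Oplus>\<^bsub>M\<^esub>s\<in>S. ?b s*:M s)" using sum[of ?b] bc b by auto
  then have "?b = c" using u[OF x] bc c by metis
  then have "b i = c (e i)" if "i < d" for i using be[OF that] by simp
  then show "b = (%i. if i < d then c (e i) else \<zero>)" using b by (auto simp:vecs_def)
  qed
 qed
 then show ?thesis by blast
qed

lemma is_basis_inj:
 assumes b:"is_basis R M d e" and nt:"\<one> ~= \<zero>" shows "inj_on e {..<d}"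
proof (rule inj_onI)
 fix i j assume ij:"i\<in>{..<d}" "j\<in>{..<d}" "e i = e j"
 have "mone R d i i = mone R d i j"
  using coords_basis[OF b,of i] coords_basis[OF b,of j] ij by (simp add:fun_eq_iff)
 then show "i = j" using nt ij by (auto simp:mone_def split: if_splits)
qed

lemma is_basis_imp_free_of_rank:
 assumes b:"is_basis R M d e" and nt:"\<one> ~= \<zero>" shows "free_of_rank R M d"
proof -
 have inj:"inj_on e {..<d}" by (rule is_basis_inj[OF assms])
 have ec:"e i<:M" if "i < d" for i using b that by (rule basis_closed)
 have sum:"(\<Oplus>\<^bsub>M\<^esub>s\<in>e ` {..<d}. c s*:M s) = lincomb M d (%i. if i < d then c (e i) else \<zero>) e"
  if c:"c\<in>e ` {..<d} \<rightarrow> car R" for c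
 proof -
  have "(\<Oplus>\<^bsub>M\<^esub>s\<in>e ` {..<d}. c s*:M s) = (\<Oplus>\<^bsub>M\<^esub>i\<in>{..<d}. c (e i)*:M e i)"
  by (rule M.finsum_reindex[OF _ inj]) (use c ec in auto)
  also have "... = lincomb M d (%i. if i < d then c (e i) else \<zero>) e"
  unfolding lincomb_def
  proof (rule M.finsum_cong'[OF refl])
  have "c (e i)<:R" if "i < d" for i using c that by auto
  then show "(%i. (if i < d then c (e i) else \<zero>)*:M e i)\<in>{..<d} \<rightarrow> car M" using ec by auto
  qed simp
  finally show ?thesis .
 qed
 define idx where "idx = the_inv_into {..<d} e"
 have idx:"idx (e i) = i" if "i < d" for i unfolding idx_def using that by (simp add:the_inv_into_f_f inj)
 show ?thesis
  unfolding free_of_rank_def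
 proof (intro exI[of _ "e ` {..<d}"] conjI ballI)
  show "card (e ` {..<d}) = d" using card_image[OF inj] by simp
  fix x assume x:"x<:M"
  let ?c = "\<lambda>s\<in>e ` {..<d}. coords R M d e x (idx s)"
  have cv:"coords R M d e x\<in>vecs R d" by (rule coords_vecs[OF b x])
  have cc:"?c\<in>e ` {..<d} \<rightarrow>\<^sub>E car R" using vecsD[OF cv] by auto
  show "\<exists>!c. c\<in>e ` {..<d} \<rightarrow>\<^sub>E car R & x = (\<Oplus>\<^bsub>M\<^esub>s\<in>e ` {..<d}. c s*:M s)"
  proof (rule ex1I[of _ ?c],intro conjI cc)
  have "(%i. if i < d then ?c (e i) else \<zero>) = coords R M d e x"
  using cv idx by (auto simp:vecs_def)
  then have "(\<Oplus>\<^bsub>M\<^esub>s\<in>e ` {..<d}. ?c s*:M s) = lincomb M d (coords R M d e x) e"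
  using sum[of ?c] cc by auto
  then show "x = (\<Oplus>\<^bsub>M\<^esub>s\<in>e ` {..<d}. ?c s*:M s)" by (simp add:lincomb_coords[OF b x])
  fix c assume c:"c\<in>e ` {..<d} \<rightarrow>\<^sub>E car R & x = (\<Oplus>\<^bsub>M\<^esub>s\<in>e ` {..<d}. c s*:M s)"
  then have "x = lincomb M d (%i. if i < d then c (e i) else \<zero>) e" using sum[of c] by auto
  moreover have "(%i. if i < d then c (e i) else \<zero>)\<in>vecs R d" using c by (auto simp:vecs_def)
  ultimately have "coords R M d e x = (%i. if i < d then c (e i) else \<zero>)"
  using coords_unique[OF b] by metis
  then have "c (e i) = ?c (e i)" if "i < d" for i using that idx by auto
  then show "c = ?c" using c cc by (intro extensionalityI[of _ "e ` {..<d}"]) (auto simp:PiE_def)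
  qed
 qed (use ec in auto)
qed

end

section \<open>Group actions in coordinates\<close>

definition acts_by :: "('a,'m) ring_scheme => ('g,'l) monoid_scheme => ('a,'b,'g) gmodule => nat =>
  (nat => 'b) => ('g => nat => nat => 'a) => bool" where
 "acts_by R G M d e \<rho> \<longleftrightarrow> (\<forall>g\<in>car G. \<rho> g\<in>rmat R d d \<and>
  (\<forall>j<d. act M g (e j) = lincomb M d (%i. \<rho> g i j) e))"

lemma lin_maps_eqI:
 assumes M:"module R M" and N:"module R N" and f:"f\<in>lin_maps R M N" and h:"h\<in>lin_maps R M N"
  and b:"is_basis R M d e" and eq:"!!j. j < d==>f (e j) = h (e j)"
 shows "f = h"
proof -
 interpret M: module R M by (rule M)
 interpret N: module R N by (rule N)
 have ext:"f\<in>extensional (car M)" "h\<in>extensional (car M)"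
  and cl:"!!x. x<:M==>f x<:N"  "!!x. x<:M==>h x<:N"
  using f h by (auto simp:lin_maps_def PiE_def)
 note ec = M.basis_closed[OF b]
 show ?thesis
 proof (rule extensionalityI[OF ext])
  fix x assume x:"x<:M"
  note cv = vecsD[OF M.coords_vecs[OF b x]]
  have "f x = f (lincomb M d (coords R M d e x) e)" by (simp add:M.lincomb_coords[OF b x])
  also have "... = lincomb N d (coords R M d e x) (%i. f (e i))"
  by (rule M.lin_maps_lincomb[OF N f]) (use cv ec in auto)
  also have "... = lincomb N d (coords R M d e x) (%i. h (e i))"
  by (rule lincomb_cong[OF N]) (use eq cv cl ec in auto)
  also have "... = h (lincomb M d (coords R M d e x) e)"
  by (rule M.lin_maps_lincomb[OF N h,symmetric]) (use cv ec in auto)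
  also have "... = h x" by (simp add:M.lincomb_coords[OF b x])
  finally show "f x = h x" .
 qed
qed

context group_module
begin

lemma act_lin_maps:"g<:G==>(\<lambda>x\<in>car M. act M g x)\<in>lin_maps R M M"
 by (auto simp:lin_maps_def act_closed act_add act_smult)

lemma act_lincomb:
 assumes g:"g<:G" and "!!i. i < d==>c i<:R" "!!i. i < d==>e i<:M"
 shows "act M g (lincomb M d c e) = lincomb M d c (%i. act M g (e i))"
proof -
 have "(\<lambda>x\<in>car M. act M g x) (lincomb M d c e) = lincomb M d c (%i. (\<lambda>x\<in>car M. act M g x) (e i))"
  by (rule lin_maps_lincomb[OF module_axioms act_lin_maps[OF g]]) (use assms in auto)
 also have "... = lincomb M d c (%i. act M g (e i))"
  by (rule lincomb_cong[OF module_axioms]) (use assms act_closed in auto)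
 finally show ?thesis using lincomb_closed[of d c e] assms by simp
qed

lemma acts_by_exists:
 assumes b:"is_basis R M d e" shows "EX \<rho>. acts_by R G M d e \<rho>"
proof (intro exI)
 let ?s = "%g i j. if j < d then coords R M d e (act M g (e j)) i else 0@R"
 have cl:"act M g (e j)<:M" if "g<:G" "j < d" for g j
  using that basis_closed[OF b] act_closed by blast
 show "acts_by R G M d e ?s"
  unfolding acts_by_def
 proof (intro ballI conjI allI impI)
  fix g assume g:"g<:G"
  note cv = coords_vecs[OF b cl[OF g]]
  show "?s g\<in>rmat R d d" using cv by (auto simp:rmat_def vecs_def)
  fix j assume j:"j < d"
  then show "act M g (e j) = lincomb M d (%i. ?s g i j) e"
  using lincomb_coords[OF b cl[OF g j]] by simp
 qed
qed

lemma acts_by_lincomb: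
 assumes b:"is_basis R M d e" and a:"acts_by R G M d e \<rho>" and g:"g<:G" and c:"!!i. i < d==>c i<:R"
 shows "act M g (lincomb M d c e) = lincomb M d (mat_vec R d (\<rho> g) c) e"
proof -
 note ec = basis_closed[OF b]
 have s:"\<rho> g i j<:R" for i j using a g by (auto simp:acts_by_def rmat_def)
 have "act M g (lincomb M d c e) = lincomb M d c (%i. act M g (e i))"
  by (rule act_lincomb[OF g]) (use c ec in auto)
 also have "... = lincomb M d c (%j. lincomb M d (%i. \<rho> g i j) e)"
 proof (rule lincomb_cong[OF module_axioms])
  fix j assume j:"j < d"
  show "act M g (e j) = lincomb M d (%i. \<rho> g i j) e" using a g j unfolding acts_by_def by blast
  show "lincomb M d (%i. \<rho> g i j) e<:M" by (rule lincomb_closed) (use s ec in auto)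
 qed (use c in auto)
 also have "... = lincomb M d (mat_vec R d (\<rho> g) c) e"
  by (rule lincomb_mat[symmetric]) (use s c ec in auto)
 finally show ?thesis .
qed

lemma rmat_eqI_lincomb:
 assumes b:"is_basis R M d e" and A:"A\<in>rmat R d m" "A'\<in>rmat R d m"
  and eq:"!!j. j < m==>lincomb M d (%i. A i j) e = lincomb M d (%i. A' i j) e"
 shows "A = A'"
proof (intro ext)
 fix i j
 show "A i j = A' i j"
 proof (cases "j < m")
  case True
  have "(%i. A i j) = (%i. A' i j)"
  using coords_unique[OF b rmat_col[OF A(2)],of j]
  unfolding eq[OF True,symmetric] coords_unique[OF b rmat_col[OF A(1)]] .
  then show ?thesis by meson
 next
  case False then show ?thesis using A by (simp add:rmat_def)
 qed
qed

lemma acts_by_mult: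
 assumes b:"is_basis R M d e" and a:"acts_by R G M d e \<rho>" and g:"g<:G" "h<:G"
 shows "\<rho> (g*.G h) = mmul R d (\<rho> g) (\<rho> h)"
proof (rule rmat_eqI_lincomb[OF b])
 have s:"\<rho> g\<in>rmat R d d" "\<rho> h\<in>rmat R d d" "\<rho> (g*.G h)\<in>rmat R d d"
  using a g by (auto simp:acts_by_def)
 show "\<rho> (g*.G h)\<in>rmat R d d" by (rule s)
 show "mmul R d (\<rho> g) (\<rho> h)\<in>rmat R d d" by (rule R.mmul_rmat[OF s(1,2)])
 fix j assume j:"j < d"
 have "lincomb M d (%i. \<rho> (g*.G h) i j) e = act M (g*.G h) (e j)"
  using a g j by (simp add:acts_by_def)
 also have "... = act M g (act M h (e j))" using g j basis_closed[OF b] by (simp add:act_mult)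
 also have "... = act M g (lincomb M d (%i. \<rho> h i j) e)" using a g j by (simp add:acts_by_def)
 also have "... = lincomb M d (mat_vec R d (\<rho> g) (%i. \<rho> h i j)) e"
  by (rule acts_by_lincomb[OF b a g(1)]) (use rmatD[OF s(2)] in auto)
 finally show "lincomb M d (%i. \<rho> (g*.G h) i j) e = lincomb M d (%i. mmul R d (\<rho> g) (\<rho> h) i j) e"
  by (simp add:mmul_col)
qed

lemma acts_by_one:
 assumes b:"is_basis R M d e" and a:"acts_by R G M d e \<rho>"
 shows "\<rho> 1@G = mone R d"
proof (rule rmat_eqI_lincomb[OF b _ R.mone_rmat])
 show "\<rho> 1@G\<in>rmat R d d" using a by (auto simp:acts_by_def)
 fix j assume j:"j < d"
 have "lincomb M d (%i. \<rho> 1@G i j) e = act M 1@G (e j)"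
  using a j by (simp add:acts_by_def)
 also have "... = e j" using j basis_closed[OF b] by (simp add:act_one)
 also have "... = lincomb M d (%i. mone R d i j) e" using j basis_closed[OF b] by (simp add:lincomb_unit)
 finally show "lincomb M d (%i. \<rho> 1@G i j) e = lincomb M d (%i. mone R d i j) e" .
qed

lemma acts_by_change:
 assumes b:"is_basis R M d e" and a:"acts_by R G M d e \<rho>"
  and P:"P\<in>rmat R d d" and PT:"!!g. g<:G==>\<tau> g\<in>rmat R d d"
  "!!g. g<:G==>mmul R d (\<rho> g) P = mmul R d P (\<tau> g)"
 shows "acts_by R G M d (%j. lincomb M d (%i. P i j) e) \<tau>"
 unfolding acts_by_def
proof (intro ballI conjI allI impI PT(1))
 fix g j assume g:"g<:G" and j:"j < d"
 note ec = basis_closed[OF b]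
 have "act M g (lincomb M d (%i. P i j) e) = lincomb M d (mat_vec R d (\<rho> g) (%i. P i j)) e"
  by (rule acts_by_lincomb[OF b a g]) (use rmatD[OF P] in auto)
 also have "mat_vec R d (\<rho> g) (%i. P i j) = mat_vec R d P (%i. \<tau> g i j)"
  using PT(2)[OF g] by (auto simp:fun_eq_iff mmul_col)
 also have "lincomb M d (mat_vec R d P (%i. \<tau> g i j)) e = lincomb M d (%i. \<tau> g i j) (%j. lincomb M d (%i. P i j) e)"
  by (rule lincomb_mat) (use rmatD[OF P] rmatD[OF PT(1)[OF g]] ec in auto)
 finally show "act M g (lincomb M d (%i. P i j) e) = lincomb M d (%i. \<tau> g i j) (%j. lincomb M d (%i. P i j) e)" .
qed

lemma acts_by_cong:
 "acts_by R G M d e \<rho>==>(!!g. g<:G==>\<tau> g = \<rho> g)==>acts_by R G M d e \<tau>"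
 by (simp add:acts_by_def)

lemma giso_of_same_matrices:
 assumes N:"group_module R G N" and b:"is_basis R M d e" "acts_by R G M d e \<rho>"
  and b': "is_basis R N d e'" "acts_by R G N d e' \<rho>"
 obtains f where "f\<in>gisos R G M N" "!!j. j < d==>f (e j) = e' j"
proof
 interpret N: group_module R G N by (rule N)
 let ?f = "\<lambda>x\<in>car M. lincomb N d (coords R M d e x) e'"
 note ec = basis_closed[OF b(1)] and ec' = N.basis_closed[OF b'(1)]
 have l:"?f\<in>lin_maps R M N" by (rule basis_map(1)[OF N.module_axioms b(1) ec'])
 show fe:"?f (e j) = e' j" if "j < d" for j by (rule basis_map(2)[OF N.module_axioms b(1) ec' that])
 have "?f (act M g x) = act N g (?f x)" if g:"g<:G" and x:"x<:M" for g x
 proof -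
  let ?c = "coords R M d e x"
  have s:"\<rho> g\<in>rmat R d d" using b(2) g by (simp add:acts_by_def)
  have cv:"?c\<in>vecs R d" by (rule coords_vecs[OF b(1) x])
  have mv:"mat_vec R d (\<rho> g) ?c i<:R" for i
  by (rule R.mat_vec_closed) (use rmatD[OF s] vecsD[OF cv] in auto)
  have "act M g x = lincomb M d (mat_vec R d (\<rho> g) ?c) e"
  using acts_by_lincomb[OF b g,of ?c] vecsD[OF cv] by (simp add:lincomb_coords[OF b(1) x])
  then have "?f (act M g x) = lincomb N d (mat_vec R d (\<rho> g) ?c) (%j. ?f (e j))"
  using lin_maps_lincomb[OF N.module_axioms l,of d "mat_vec R d (\<rho> g) ?c" e] mv ec by simp
  also have "... = lincomb N d (mat_vec R d (\<rho> g) ?c) e'"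
  by (rule lincomb_cong[OF N.module_axioms]) (use mv fe ec' in auto)
  also have "... = act N g (lincomb N d ?c e')"
  using N.acts_by_lincomb[OF b' g,of ?c] vecsD[OF cv] by simp
  finally show ?thesis using x by simp
 qed
 then have "?f\<in>ghoms R G M N" using l unfolding ghoms_def by blast
 then show "?f\<in>gisos R G M N"
  unfolding gisos_def using basis_map(3)[OF N.module_axioms b(1) ec' b'(1)] by simp
qed

lemma giso_basis:
 assumes N:"group_module R G N" and f:"f\<in>gisos R G M N" and b:"is_basis R M d e" 
 shows "is_basis R N d (%j. f (e j))" "acts_by R G M d e \<rho>==>acts_by R G N d (%j. f (e j)) \<rho>"
proof -
 interpret N: group_module R G N by (rule N)
 have l:"f\<in>lin_maps R M N" and bij:"bij_betw f (car M) (car N)"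
  and eq:"!!g x. g<:G==>x<:M==>f (act M g x) = act N g (f x)"
  using f by (auto simp:gisos_def ghoms_def)
 note ec = basis_closed[OF b]
 have fc:"f x<:N" if "x<:M" for x using bij that by (auto simp:bij_betw_def)
 show "is_basis R N d (%j. f (e j))"
 proof (rule N.is_basisI)
  fix y assume "y<:N"
  then obtain x where x:"x<:M" "y = f x" using bij by (auto simp:bij_betw_def)
  have "y = lincomb N d (coords R M d e x) (%j. f (e j))"
  using lin_maps_lincomb[OF N.module_axioms l,of d "coords R M d e x" e] x ec vecsD[OF coords_vecs[OF b x(1)]]
  by (simp add:lincomb_coords[OF b x(1)])
  then show "\<exists>c\<in>vecs R d. y = lincomb N d c (%j. f (e j))" using coords_vecs[OF b x(1)] by blast
 next
  fix c assume c:"c\<in>vecs R d" and z:"lincomb N d c (%j. f (e j)) = 0@N"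
  have "f (lincomb M d c e) = 0@N"
  using lin_maps_lincomb[OF N.module_axioms l,of d c e] z vecsD[OF c] ec by simp
  moreover have "f (lincomb M d (%i. \<zero>) e) = lincomb N d (%i. \<zero>) (%j. f (e j))"
  by (rule lin_maps_lincomb[OF N.module_axioms l]) (use ec in auto)
  moreover have "lincomb N d (%i. \<zero>) (%j. f (e j)) = 0@N" by (rule N.lincomb_zero) (use ec fc in auto)
  ultimately have "lincomb M d c e = lincomb M d (%i. \<zero>) e"
  using bij lincomb_closed[of d c e] lincomb_closed[of d "%i. \<zero>" e] vecsD[OF c] ec
  by (auto simp:bij_betw_def inj_on_def)
  note e0 = this
  have zv:"(%i. \<zero>)\<in>vecs R d" by (simp add:vecs_def)
  show "c = (%i. \<zero>)"
  using coords_unique[OF b c] unfolding e0 coords_unique[OF b zv] by (rule sym)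
 qed (use ec fc in auto)
 assume a:"acts_by R G M d e \<rho>"
 show "acts_by R G N d (%j. f (e j)) \<rho>"
  unfolding acts_by_def
 proof (intro ballI conjI allI impI)
  fix g assume g:"g<:G"
  show s:"\<rho> g\<in>rmat R d d" using a g by (simp add:acts_by_def)
  fix j assume j:"j < d"
  have "act N g (f (e j)) = f (lincomb M d (%i. \<rho> g i j) e)"
  using eq[OF g ec[OF j]] a g j by (simp add:acts_by_def)
  also have "... = lincomb N d (%i. \<rho> g i j) (%j. f (e j))"
  by (rule lin_maps_lincomb[OF N.module_axioms l]) (use ec rmatD[OF s] in auto)
  finally show "act N g (f (e j)) = lincomb N d (%i. \<rho> g i j) (%j. f (e j))" .
 qed
qed

end

section \<open>Column vectors\<close>

definition std_gmodule :: "('a,'m) ring_scheme => nat => ('g => nat => nat => 'a) => ('a,nat => 'a,'g) gmodule" where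
 "std_gmodule R d \<rho> = \<lparr>carrier = vecs R d,monoid.mult = undefined,monoid.one = undefined,
  ring.zero = (%i. 0@R),ring.add = (%c c' i. c i+.R c' i),smult = (%a c i. a*.R c i),
  act = (%g. mat_vec R d (\<rho> g))\<rparr>"

lemma std_gmodule_sel [simp]:
 "car (std_gmodule R d \<rho>) = vecs R d" "0@(std_gmodule R d \<rho>) = (%i. 0@R)"
 "c+.(std_gmodule R d \<rho>) c' = (%i. c i+.R c' i)" "a*:(std_gmodule R d \<rho>) c = (%i. a*.R c i)"
 "act (std_gmodule R d \<rho>) g = mat_vec R d (\<rho> g)"
 by (simp_all add: std_gmodule_def)

context cring
begin

lemma module_std:"module R (std_gmodule R d \<rho>)"
proof (rule moduleI)
 show "cring R" by unfold_locales
 show "abelian_group (std_gmodule R d \<rho>)"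
 proof (rule abelian_groupI)
  fix c assume "c<:(std_gmodule R d \<rho>)"
  then show "\<exists>y\<in>car (std_gmodule R d \<rho>). y+.(std_gmodule R d \<rho>) c = 0@(std_gmodule R d \<rho>)"
  by (intro bexI[of _ "%i. \<ominus> c i"]) (auto simp:vecs_def l_neg)
 qed (auto simp:vecs_def a_ac)
qed (auto simp:vecs_def l_distr r_distr m_assoc)

lemma lincomb_std:
 assumes "!!i. i < m==>c i<:R" "!!i. i < m==>e i\<in>vecs R d"
 shows "lincomb (std_gmodule R d \<rho>) m c e l = (\<Oplus>i\<in>{..<m}. c i \<otimes> e i l)"
proof -
 interpret S: module R "std_gmodule R d \<rho>" by (rule module_std)
 show ?thesis using assms
 proof (induction m)
  case 0 show ?case by (simp add:lincomb_def)
 next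
  case (Suc m)
  have ins:"{..<Suc m} = insert m {..<m}" by auto
  have "lincomb (std_gmodule R d \<rho>) (Suc m) c e = c m*:(std_gmodule R d \<rho>) e m+.(std_gmodule R d \<rho>) lincomb (std_gmodule R d \<rho>) m c e"
  unfolding lincomb_def ins by (rule S.M.finsum_insert) (use Suc.prems in \<open>auto simp:vecs_def\<close>)
  moreover have "(\<Oplus>i\<in>{..<Suc m}. c i \<otimes> e i l) = c m \<otimes> e m l \<oplus> (\<Oplus>i\<in>{..<m}. c i \<otimes> e i l)"
  unfolding ins by (rule finsum_insert) (use Suc.prems in \<open>auto simp:vecs_def\<close>)
  ultimately show ?case using Suc by simp
 qed
qed

lemma std_unit_vecs:"(%i. mone R d i j)\<in>vecs R d"
 by (rule rmat_col[OF mone_rmat])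

lemma lincomb_std_unit:
 assumes c:"c\<in>vecs R d" shows "lincomb (std_gmodule R d \<rho>) d c (%j i. mone R d i j) = c"
proof
 fix l
 have "lincomb (std_gmodule R d \<rho>) d c (%j i. mone R d i j) l = (\<Oplus>i\<in>{..<d}. c i \<otimes> mone R d l i)"
  by (rule lincomb_std) (use vecsD[OF c] std_unit_vecs in auto)
 also have "... = mat_vec R d (mone R d) c l"
  unfolding mat_vec_def by (rule finsum_cong') (use vecsD[OF c] in \<open>auto simp:mone_def\<close>)
 finally show "lincomb (std_gmodule R d \<rho>) d c (%j i. mone R d i j) l = c l" by (simp add:mone_vec[OF c])
qed

lemma std_basis:"is_basis R (std_gmodule R d \<rho>) d (%j i. mone R d i j)"
 unfolding is_basis_def by (auto simp:std_unit_vecs lincomb_std_unit intro!: ex1I)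

lemma mat_vec_vecs:"A\<in>rmat R a b==>(!!i. c i<:R)==>mat_vec R e A c\<in>vecs R a"
 unfolding vecs_def mat_vec_def rmat_def by (auto intro!: finsum_closed simp: finsum_zero cong: finsum_cong)

lemma group_module_std:
 assumes G:"group G" and s:"!!g. g<:G==>\<rho> g\<in>rmat R d d"
  and s1:"\<rho> 1@G = mone R d"
  and sm:"!!g h. g<:G==>h<:G==>\<rho> (g*.G h) = mmul R d (\<rho> g) (\<rho> h)"
 shows "group_module R G (std_gmodule R d \<rho>)"
proof (intro group_module.intro group_module_axioms.intro module_std G)
 note sc = rmatD[OF s]
 fix g c assume g:"g<:G" and c:"c<:(std_gmodule R d \<rho>)"
 have cc:"c i<:R" for i using c by (simp add:vecs_def)
 show "act (std_gmodule R d \<rho>) g c<:(std_gmodule R d \<rho>)"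
  by simp (rule mat_vec_vecs[OF s[OF g] cc])
 show "act (std_gmodule R d \<rho>) g (a*:(std_gmodule R d \<rho>) c) = a*:(std_gmodule R d \<rho>) act (std_gmodule R d \<rho>) g c"
  if a:"a<:R" for a
  using a cc sc[OF g] by (simp add:mat_vec_def finsum_rdistr m_lcomm)
 show "act (std_gmodule R d \<rho>) (g*.G h) c = act (std_gmodule R d \<rho>) g (act (std_gmodule R d \<rho>) h c)"
  if h:"h<:G" for h
  using cc sc[OF g] sc[OF h] by (simp add:sm[OF g h] mat_vec_assoc)
 fix c' assume c': "c'<:(std_gmodule R d \<rho>)"
 have "c' i<:R" for i using c' by (simp add:vecs_def)
 then show "act (std_gmodule R d \<rho>) g (c+.(std_gmodule R d \<rho>) c') =
  act (std_gmodule R d \<rho>) g c+.(std_gmodule R d \<rho>) act (std_gmodule R d \<rho>) g c'"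
  using cc sc[OF g] by (simp add:mat_vec_def r_distr finsum_addf)
qed (simp add:s1 mone_vec)

lemma std_acts_by:
 assumes s:"!!g. g<:G==>\<rho> g\<in>rmat R d d"
 shows "acts_by R G (std_gmodule R d \<rho>) d (%j i. mone R d i j) \<rho>"
 unfolding acts_by_def
proof (intro ballI conjI allI impI s)
 fix g j assume g:"g<:G" and j:"j < d"
 have "mat_vec R d (\<rho> g) (%i. mone R d i j) = (%i. \<rho> g i j)"
  using mmul_one[OF s[OF g]] by (simp add:fun_eq_iff mmul_col)
 then show "act (std_gmodule R d \<rho>) g (%i. mone R d i j) =
  lincomb (std_gmodule R d \<rho>) d (%i. \<rho> g i j) (%j i. mone R d i j)"
  using lincomb_std_unit[OF rmat_col[OF s[OF g]],where \<rho> = \<rho>] by simp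
qed

end

section \<open>Extension of scalars\<close>

locale scalar_extension = h: ring_hom_cring B C f + N: group_module B G N
 for B :: "('a,'m) ring_scheme" and C :: "('c,'l) ring_scheme" and f
  and G :: "('g,'n) monoid_scheme" and N :: "('a,'b,'g) gmodule"
begin

abbreviation "FA \<equiv> free_Abelian_group (car C \<times> car N)"
abbreviation "TR \<equiv> tensor_relations B C f N"
abbreviation "E \<equiv> ext_scalars B C f N"
abbreviation "tens \<equiv> pure_tensor B C f N"

definition cos :: "('c \<times> 'b \<Rightarrow>\<^sub>0 int) => ('c \<times> 'b \<Rightarrow>\<^sub>0 int) set" where
 "cos a = (%t. t + a) ` TR"

definition gens :: "('c \<times> 'b \<Rightarrow>\<^sub>0 int) set" where
 "gens = {frag_of (c+.C d,x) - frag_of (c,x) - frag_of (d,x) | c d x.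
  c<:C & d<:C & x\<in>car N} \<union>
  {frag_of (c,x+.N y) - frag_of (c,x) - frag_of (c,y) | c x y.
  c<:C & x<:N & y\<in>car N} \<union>
  {frag_of (c*.C f b,x) - frag_of (c,b*:N x) | b c x.
  b<:B & c<:C & x\<in>car N}"

lemma FA_diff:"a<:FA==>b<:FA==>a - b<:FA"
 using Poly_Mapping.keys_diff[of a b] by auto

lemma FA_add:"a<:FA==>b<:FA==>a + b<:FA"
 using Poly_Mapping.keys_add[of a b] by auto

lemma FA_of:"c<:C==>x<:N==>frag_of (c,x)<:FA"
 by (simp add:keys_frag_of)

lemma gens_FA:"gens <= car FA"
 unfolding gens_def by (auto simp del: carrier_free_Abelian_group_iff intro!: FA_diff FA_of)

lemma TR_generate:"TR = generate FA gens"
 by (simp add:tensor_relations_def gens_def)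

lemma TR_FA:"TR <= car FA"
 unfolding TR_generate by (rule group.generate_incl[OF group_free_Abelian_group gens_FA])

lemma TR_subgroup:"subgroup TR FA"
 unfolding TR_generate by (rule group.generate_is_subgroup[OF group_free_Abelian_group gens_FA])

lemma TR_0:"0\<in>TR" using subgroup.one_closed[OF TR_subgroup] by simp

lemma TR_add:"a\<in>TR==>b\<in>TR==>a + b\<in>TR"
 using subgroup.m_closed[OF TR_subgroup,of a b] by simp

lemma TR_uminus:"a\<in>TR==>- a\<in>TR"
 using subgroup.m_inv_closed[OF TR_subgroup,of a] TR_FA by (auto simp:subset_iff)

lemma TR_diff:"a\<in>TR==>b\<in>TR==>a - b\<in>TR"
 using TR_add[of a "- b"] TR_uminus by simp

lemma gens_TR:"a\<in>gens==>a\<in>TR" unfolding TR_generate by (rule generate.incl)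

lemma TR_induct:
 assumes "a\<in>TR" and T:"!!a b. T (a - b) = T a - T b" and g:"!!a. a\<in>gens==>T a\<in>S"
  and S:"0\<in>S" "!!a b. a\<in>S==>b\<in>S==>a - b\<in>(S :: 'z::ab_group_add set)"
 shows "T a\<in>S"
proof -
 have T0:"T 0 = 0" using T[of 0 0] by simp
 have Tm:"T (- a) = 0 - T a" for a using T[of 0 a] T0 by simp
 have Ta:"T (a + b) = T a - (0 - T b)" for a b using T[of a "- b"] Tm by simp
 have "a\<in>generate FA gens" using assms(1) by (simp add:TR_generate)
 then show ?thesis
 proof (induction rule: generate.induct)
  case one then show ?case using S T0 by simp
 next
  case (incl h) then show ?case by (rule g)
 next
  case (inv h)
  then have "~.FA h = - h" using gens_FA by auto
  then show ?case using S(2)[OF S(1) g[OF inv]] Tm by metis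
 next
  case (eng h1 h2)
  then have "T h1 - (0 - T h2)\<in>S" using S by blast
  then show ?case by (simp only: mult_free_Abelian_group Ta)
 qed
qed

lemma cos_rcoset:"TR #>\<^bsub>FA\<^esub> a = cos a"
 by (auto simp:r_coset_def cos_def)

lemma cos_eq:"cos a = cos b \<longleftrightarrow> a - b\<in>TR"
proof
 assume "cos a = cos b"
 moreover have "a\<in>cos a" unfolding cos_def using TR_0 by (auto intro!: image_eqI[of _ _ 0])
 ultimately have "a\<in>cos b" by simp
 then show "a - b\<in>TR" by (auto simp:cos_def)
next
 assume ab:"a - b\<in>TR"
 have "t + a\<in>cos b" if "t\<in>TR" for t
  unfolding cos_def using TR_add[OF that ab] by (auto intro!: image_eqI[of _ _ "t + (a - b)"])
 moreover have "t + b\<in>cos a" if "t\<in>TR" for t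
  unfolding cos_def using TR_diff[OF that ab] by (auto intro!: image_eqI[of _ _ "t - (a - b)"])
 ultimately show "cos a = cos b" by (auto simp:cos_def)
qed

lemma cos_0:"cos 0 = TR" by (simp add:cos_def)

lemma tens_cos:"tens c x = cos (frag_of (c,x))"
 by (simp add:pure_tensor_def cos_rcoset)

lemma E_carrier:"Z<:E \<longleftrightarrow> (\<exists>a\<in>car FA. Z = cos a)"
 by (auto simp:ext_scalars_def Let_def RCOSETS_def cos_rcoset simp del: carrier_free_Abelian_group_iff)

lemma E_zero:"0@E = cos 0"
 by (simp add:ext_scalars_def Let_def cos_0)

lemma cos_set_mult:"TR <#>\<^bsub>FA\<^esub> S = (\<Union>s\<in>S. cos s)"
 by (auto simp:set_mult_def cos_def)

lemma E_add:"cos a+.E cos b = cos (a + b)"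
proof -
 have "cos a <#>\<^bsub>FA\<^esub> cos b = cos (a + b)"
 proof
  show "cos a <#>\<^bsub>FA\<^esub> cos b <= cos (a + b)"
  using TR_add by (force simp: set_mult_def cos_def algebra_simps)
  show "cos (a + b) <= cos a <#>\<^bsub>FA\<^esub> cos b"
  proof
  fix z assume "z\<in>cos (a + b)"
  then obtain t where t:"t\<in>TR" "z = (t + a) + (0 + b)" by (auto simp:cos_def algebra_simps)
  then show "z\<in>cos a <#>\<^bsub>FA\<^esub> cos b" using TR_0 unfolding set_mult_def cos_def mult_free_Abelian_group by blast
  qed
 qed
 then show ?thesis by (simp add:ext_scalars_def Let_def)
qed

lemma cos_apply:
 assumes T:"!!a b. T (a - b) = T a - T b" and TR:"!!a. a\<in>gens==>T a\<in>TR"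
 shows "TR <#>\<^bsub>FA\<^esub> (T ` cos a) = cos (T a)"
proof -
 have TT:"T t\<in>TR" if "t\<in>TR" for t
  by (rule TR_induct[OF that T TR TR_0 TR_diff])
 have T0:"T 0 = 0" using T[of 0 0] by simp
 have Ta:"T (a + b) = T a + T b" for a b using T[of a "- b"] T[of 0 b] T0 by simp
 have "cos (T s) = cos (T a)" if s:"s\<in>cos a" for s
 proof -
  obtain t where "t\<in>TR" "s = t + a" using s by (auto simp:cos_def)
  then show ?thesis using TT by (simp add:cos_eq Ta)
 qed
 moreover have "a\<in>cos a" unfolding cos_def using TR_0 by (auto intro!: image_eqI[of _ _ 0])
 ultimately show ?thesis unfolding cos_set_mult by blast
qed

definition scale :: "'c => ('c \<times> 'b \<Rightarrow>\<^sub>0 int) => ('c \<times> 'b \<Rightarrow>\<^sub>0 int)" where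
 "scale d = frag_extend (%(c,x). frag_of (d*.C c,x))"

definition move :: "'g => ('c \<times> 'b \<Rightarrow>\<^sub>0 int) => ('c \<times> 'b \<Rightarrow>\<^sub>0 int)" where
 "move g = frag_extend (%(c,x). frag_of (c,act N g x))"

lemma scale_diff:"scale d (a - b) = scale d a - scale d b" by (simp add:scale_def frag_extend_diff)
lemma move_diff:"move d (a - b) = move d a - move d b" by (simp add:move_def frag_extend_diff)
lemma scale_add:"scale d (a + b) = scale d a + scale d b" by (simp add:scale_def frag_extend_add)
lemma move_add:"move d (a + b) = move d a + move d b" by (simp add:move_def frag_extend_add)
lemma scale_of:"scale d (frag_of (c,x)) = frag_of (d*.C c,x)" by (simp add:scale_def)
lemma move_of:"move g (frag_of (c,x)) = frag_of (c,act N g x)" by (simp add:move_def)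

lemma scale_gens: assumes d:"d<:C" and a:"a\<in>gens" shows "scale d a\<in>gens"
proof -
 have "(EX c e x. a = frag_of (c+.C e,x) - frag_of (c,x) - frag_of (e,x) & c<:C & e<:C & x<:N) \<or>
  (EX c x y. a = frag_of (c,x+.N y) - frag_of (c,x) - frag_of (c,y) & c<:C & x<:N & y<:N) \<or>
  (EX b c x. a = frag_of (c*.C f b,x) - frag_of (c,b*:N x) & b<:B & c<:C & x<:N)"
  using a unfolding gens_def by blast
 then show ?thesis
 proof (elim disjE exE conjE)
  fix c e x assume *: "a = frag_of (c+.C e,x) - frag_of (c,x) - frag_of (e,x)" "c<:C" "e<:C" "x<:N"
  have "scale d a = frag_of (d*.C c+.C d*.C e,x) - frag_of (d*.C c,x) - frag_of (d*.C e,x)"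
  using * d by (simp add:scale_diff scale_of h.S.r_distr)
  then show ?thesis unfolding gens_def using * d h.S.m_closed by blast
 next
  fix c x y assume *: "a = frag_of (c,x+.N y) - frag_of (c,x) - frag_of (c,y)" "c<:C" "x<:N" "y<:N"
  have "scale d a = frag_of (d*.C c,x+.N y) - frag_of (d*.C c,x) - frag_of (d*.C c,y)"
  using * d by (simp add:scale_diff scale_of)
  then show ?thesis unfolding gens_def using * d h.S.m_closed by blast
 next
  fix b c x assume *: "a = frag_of (c*.C f b,x) - frag_of (c,b*:N x)" "b<:B" "c<:C" "x<:N"
  have "scale d a = frag_of (d*.C c*.C f b,x) - frag_of (d*.C c,b*:N x)"
  using * d by (simp add:scale_diff scale_of h.S.m_assoc)
  then show ?thesis unfolding gens_def using * d h.S.m_closed by blast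
 qed
qed

lemma move_gens: assumes g:"g<:G" and a:"a\<in>gens" shows "move g a\<in>gens"
proof -
 have "(EX c e x. a = frag_of (c+.C e,x) - frag_of (c,x) - frag_of (e,x) & c<:C & e<:C & x<:N) \<or>
  (EX c x y. a = frag_of (c,x+.N y) - frag_of (c,x) - frag_of (c,y) & c<:C & x<:N & y<:N) \<or>
  (EX b c x. a = frag_of (c*.C f b,x) - frag_of (c,b*:N x) & b<:B & c<:C & x<:N)"
  using a unfolding gens_def by blast
 then show ?thesis
 proof (elim disjE exE conjE)
  fix c e x assume *: "a = frag_of (c+.C e,x) - frag_of (c,x) - frag_of (e,x)" "c<:C" "e<:C" "x<:N"
  have "move g a = frag_of (c+.C e,act N g x) - frag_of (c,act N g x) - frag_of (e,act N g x)"
  using * g by (simp add:move_diff move_of)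
  then show ?thesis unfolding gens_def using * N.act_closed[OF g] by blast
 next
  fix c x y assume *: "a = frag_of (c,x+.N y) - frag_of (c,x) - frag_of (c,y)" "c<:C" "x<:N" "y<:N"
  have "move g a = frag_of (c,act N g x+.N act N g y) - frag_of (c,act N g x) - frag_of (c,act N g y)"
  using * g by (simp add:move_diff move_of N.act_add)
  then show ?thesis unfolding gens_def using * N.act_closed[OF g] by blast
 next
  fix b c x assume *: "a = frag_of (c*.C f b,x) - frag_of (c,b*:N x)" "b<:B" "c<:C" "x<:N"
  have "move g a = frag_of (c*.C f b,act N g x) - frag_of (c,b*:N act N g x)"
  using * g by (simp add:move_diff move_of N.act_smult)
  then show ?thesis unfolding gens_def using * N.act_closed[OF g] by blast
 qed
qed

lemma E_smult:"d<:C==>d*:E cos a = cos (scale d a)"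
 using cos_apply[of "scale d" a] scale_diff scale_gens gens_TR
 by (simp add:ext_scalars_def Let_def scale_def)

lemma E_act:"g<:G==>act E g (cos a) = cos (move g a)"
 using cos_apply[of "move g" a] move_diff move_gens gens_TR
 by (simp add:ext_scalars_def Let_def move_def)

text \<open>An additive operation on representatives takes values in the relations as soon as it does
 so on pure tensors.\<close>

lemma FA_induct:
 assumes a:"a<:FA" and T:"!!a b. T (a - b) = T a - T b"
  and S:"!!c x. c<:C==>x<:N==>T (frag_of (c,x))\<in>S"
  and S0:"0\<in>S" "!!a b. a\<in>S==>b\<in>S==>a - b\<in>(S :: 'z::ab_group_add set)"
 shows "T a\<in>S"
proof (rule frag_induction[of a "car C \<times> car N"])
 show "Poly_Mapping.keys a <= car C \<times> car N" using a by simp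
 show "T 0\<in>S" using T[of 0 0] S0 by simp
 show "T (frag_of z)\<in>S" if "z\<in>car C \<times> car N" for z using S that by (cases z) auto
 show "T (a - b)\<in>S" if "T a\<in>S" "T b\<in>S" for a b using S0(2)[OF that] T by simp
qed

lemma scale_FA:"d<:C==>a<:FA==>scale d a<:FA"
 by (rule FA_induct[where T = "scale d"]) (simp_all only: scale_diff scale_of FA_of h.S.m_closed FA_diff,simp)

lemma move_FA:"g<:G==>a<:FA==>move g a<:FA"
 by (rule FA_induct[where T = "move g"]) (simp_all only: move_diff move_of FA_of N.act_closed FA_diff,simp)

lemma group_module_E:"group_module C G E"
proof (intro group_module.intro group_module_axioms.intro moduleI)
 show "cring C" by unfold_locales
 show "group G" by unfold_locales
 show "abelian_group E"
 proof (rule abelian_groupI)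
  show "0@E<:E" unfolding E_carrier E_zero by (intro bexI[of _ 0]) auto
  fix x assume "x<:E"
  then obtain a where a:"a<:FA" "x = cos a" unfolding E_carrier by blast
  show "0@E+.E x = x" by (simp add:a E_zero E_add)
  have "- a<:FA" using a by simp
  then show "\<exists>y\<in>car E. y+.E x = 0@E"
  by (intro bexI[of _ "cos (- a)"]) (auto simp:a E_zero E_add E_carrier simp del: carrier_free_Abelian_group_iff)
  fix y assume "y<:E"
  then obtain b where b:"b<:FA" "y = cos b" unfolding E_carrier by blast
  show "x+.E y<:E" unfolding a b E_add E_carrier using FA_add[OF a(1) b(1)] by blast
  show "x+.E y = y+.E x" unfolding a b E_add by (simp add:add.commute)
  fix z assume "z<:E"
  then obtain c where c:"c<:FA" "z = cos c" unfolding E_carrier by blast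
  show "x+.E y+.E z = x+.E (y+.E z)" unfolding a b c E_add by (simp add:add.assoc)
 qed
 fix x assume "x<:E"
 then obtain a where a:"a<:FA" "x = cos a" unfolding E_carrier by blast
 have diffI:"cos (S a) = cos (T a)"
  if "!!a b. S (a - b) = S a - S b" "!!a b. T (a - b) = T a - T b"
  "!!c x. c<:C==>x<:N==>S (frag_of (c,x)) - T (frag_of (c,x))\<in>TR" for S T :: "('c \<times> 'b \<Rightarrow>\<^sub>0 int) => ('c \<times> 'b \<Rightarrow>\<^sub>0 int)"
  unfolding cos_eq
  by (rule FA_induct[OF a(1),where T = "%a. S a - T a"]) (use that TR_0 TR_diff in auto)
 show "1@C*:E x = x"
  unfolding a(2) E_smult[OF h.S.one_closed]
  by (rule diffI[of _ "%a. a"]) (simp_all add: scale_diff scale_of TR_0)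
 show "act E 1@G x = x"
  unfolding a(2) E_act[OF N.one_closed]
  by (rule diffI[of _ "%a. a"]) (simp_all add: move_diff move_of TR_0 N.act_one)
 fix d assume d:"d<:C"
 show "d*:E x<:E" unfolding a(2) E_smult[OF d] E_carrier using scale_FA[OF d a(1)] by blast
 show "d*:E (x+.E y) = d*:E x+.E d*:E y" if "y<:E" for y
  using that d unfolding E_carrier a(2) by (auto simp:E_add E_smult scale_add)
 fix e assume e:"e<:C"
 have "scale (d+.C e) (frag_of (c,x)) - (scale d (frag_of (c,x)) + scale e (frag_of (c,x)))\<in>TR"
  if c:"c<:C" "x<:N" for c x
 proof (rule gens_TR)
  have "scale (d+.C e) (frag_of (c,x)) - (scale d (frag_of (c,x)) + scale e (frag_of (c,x)))
  = frag_of (d*.C c+.C e*.C c,x) - frag_of (d*.C c,x) - frag_of (e*.C c,x)"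
  using c d e by (simp add:scale_of h.S.l_distr)
  then show "scale (d+.C e) (frag_of (c,x)) - (scale d (frag_of (c,x)) + scale e (frag_of (c,x)))\<in>gens"
  unfolding gens_def using c d e h.S.m_closed by blast
 qed
 then show "(d+.C e)*:E x = d*:E x+.E e*:E x"
  unfolding a(2) E_smult[OF h.S.a_closed[OF d e]] E_smult[OF d] E_smult[OF e] E_add
  by (intro diffI[of _ "%a. scale d a + scale e a"]) (simp_all add: scale_diff)
 show "(d*.C e)*:E x = d*:E (e*:E x)"
  unfolding a(2) E_smult[OF h.S.m_closed[OF d e]] E_smult[OF d] E_smult[OF e]
  by (rule diffI[of _ "%a. scale d (scale e a)"]) (simp_all add: scale_diff scale_of h.S.m_assoc d e TR_0)
next
 fix g x assume g:"g<:G" and "x<:E"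
 then obtain a where a:"a<:FA" "x = cos a" unfolding E_carrier by blast
 have diffI:"cos (S a) = cos (T a)"
  if "!!a b. S (a - b) = S a - S b" "!!a b. T (a - b) = T a - T b"
  "!!c x. c<:C==>x<:N==>S (frag_of (c,x)) - T (frag_of (c,x))\<in>TR" for S T :: "('c \<times> 'b \<Rightarrow>\<^sub>0 int) => ('c \<times> 'b \<Rightarrow>\<^sub>0 int)"
  unfolding cos_eq
  by (rule FA_induct[OF a(1),where T = "%a. S a - T a"]) (use that TR_0 TR_diff in auto)
 show "act E g x<:E" unfolding a(2) E_act[OF g] E_carrier using move_FA[OF g a(1)] by blast
 show "act E g (x+.E y) = act E g x+.E act E g y" if "y<:E" for y
  using that g unfolding E_carrier a(2) by (auto simp:E_add E_act move_add)
 show "act E g (d*:E x) = d*:E act E g x" if d:"d<:C" for d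
  unfolding a(2) E_smult[OF d] E_act[OF g]
  by (rule diffI[of "%a. move g (scale d a)" "%a. scale d (move g a)"])
  (simp_all add: scale_diff scale_of move_diff move_of TR_0)
 show "act E (g*.G g') x = act E g (act E g' x)" if g': "g'<:G" for g'
  unfolding a(2) E_act[OF g] E_act[OF g'] E_act[OF N.m_closed[OF g g']]
  by (rule diffI[of _ "%a. move g (move g' a)"])
  (simp_all add: move_diff move_of TR_0 N.act_mult g g')
qed

sublocale E: group_module C G E by (rule group_module_E)

lemma tens_closed:"c<:C==>x<:N==>tens c x<:E"
 unfolding tens_cos E_carrier using FA_of by blast

lemma tens_add_right:"c<:C==>x<:N==>y<:N==>tens c (x+.N y) = tens c x+.E tens c y"
 unfolding tens_cos E_add cos_eq by (rule gens_TR) (auto simp:gens_def diff_diff_eq)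

lemma tens_balanced:"b<:B==>c<:C==>x<:N==>tens c (b*:N x) = tens (c*.C f b) x"
 unfolding tens_cos by (rule sym) (auto simp:cos_eq gens_def intro!: gens_TR)

lemma tens_smult:"d<:C==>d*:E tens c x = tens (d*.C c) x"
 unfolding tens_cos by (simp add:E_smult scale_of)

lemma tens_act:"g<:G==>act E g (tens c x) = tens c (act N g x)"
 unfolding tens_cos by (simp add:E_act move_of)

lemma E_induct:
 assumes Z:"Z<:E" and t:"!!c x. c<:C==>x<:N==>P (tens c x)"
  and z:"P 0@E" and a:"!!x y. x<:E==>y<:E==>P x==>P y==>P (x+.E (-:C 1@C)*:E y)"
 shows "P Z"
proof -
 obtain a where a': "a<:FA" "Z = cos a" using Z unfolding E_carrier by blast
 have minus:"cos (a - b) = cos a+.E (-:C 1@C)*:E cos b" if "a<:FA" "b<:FA" for a b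
 proof -
  have c:"cos a<:E" "cos b<:E" "cos (a - b)<:E"
  using that FA_diff[OF that] unfolding E_carrier by blast+
  have "cos (a - b)+.E cos b = cos a" by (simp add:E_add)
  then have "cos (a - b) = cos a-.E cos b" using c by (intro E.M.eq_minusI) auto
  then show ?thesis using c by (simp add:a_minus_def E.smult_l_minus)
 qed
 have "a<:FA & P (cos a)"
 proof (rule frag_induction[of a "car C \<times> car N"])
  show "Poly_Mapping.keys a <= car C \<times> car N" using a' by simp
  show "0<:FA & P (cos 0)" using z by (simp add:E_zero)
  show "frag_of q<:FA & P (cos (frag_of q))" if "q\<in>car C \<times> car N" for q
  using t that FA_of by (cases q) (auto simp:tens_cos simp del: carrier_free_Abelian_group_iff)
  show "a - b<:FA & P (cos (a - b))"
  if "a<:FA & P (cos a)" "b<:FA & P (cos b)" for a b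
  proof -
  have "cos a<:E" "cos b<:E" using that unfolding E_carrier by blast+
  then show ?thesis using that a[of "cos a" "cos b"] minus FA_diff by simp
  qed
 qed
 then show ?thesis using a' by simp
qed

text \<open>The universal property of the tensor product as an abelian group, for balanced biadditive maps.\<close>
lemma E_universal:
 assumes P:"comm_group P" and \<beta>: "!!c x. c<:C==>x<:N==>\<beta> c x<:P"
  and b1:"!!c d x. c<:C==>d<:C==>x<:N==>\<beta> (c+.C d) x = \<beta> c x*.P \<beta> d x"
  and b2:"!!c x y. c<:C==>x<:N==>y<:N==>\<beta> c (x+.N y) = \<beta> c x*.P \<beta> c y"
  and b3:"!!b c x. b<:B==>c<:C==>x<:N==>\<beta> c (b*:N x) = \<beta> (c*.C f b) x"
 obtains F where "!!Z. Z<:E==>F Z<:P"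
  "!!Y Z. Y<:E==>Z<:E==>F (Y+.E Z) = F Y*.P F Z"
  "!!c x. c<:C==>x<:N==>F (tens c x) = \<beta> c x"
proof -
 interpret P: comm_group P by (rule P)
 have "case_prod \<beta> ` (car C \<times> car N) <= car P" using \<beta> by auto
 then obtain h where h:"h\<in>hom FA P" "!!z. z\<in>car C \<times> car N==>h (frag_of z) = case_prod \<beta> z"
  using P.free_Abelian_group_universal by blast
 interpret gh: group_hom FA P h
  by (intro group_hom.intro group_free_Abelian_group P.group_axioms group_hom_axioms.intro h(1))
 have hf:"h (frag_of (c,x)) = \<beta> c x" if "c<:C" "x<:N" for c x using h(2)[of "(c,x)"] that by simp
 have ha:"h (a + b) = h a*.P h b" if "a<:FA" "b<:FA" for a b
  using gh.hom_mult[OF that] by simp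
 have hm:"h (a - b) = h a*.P ~.P h b" if "a<:FA" "b<:FA" for a b
 proof -
  have "- b<:FA" using that by simp
  moreover have "h (- b) = ~.P h b" using gh.hom_inv[OF that(2)] that by simp
  ultimately show ?thesis using ha[of a "- b"] that by simp
 qed
 have "gens <= kernel FA P h"
 proof
  fix a assume a:"a\<in>gens"
  have "h a = 1@P"
  using a unfolding gens_def
  by (auto simp del: carrier_free_Abelian_group_iff simp: hm FA_diff FA_of hf b1 b2 b3 \<beta> P.m_assoc P.inv_mult_group[symmetric] P.m_comm)
  (simp_all add: \<beta> P.m_assoc[symmetric])?
  then show "a\<in>kernel FA P h" using gens_FA a by (auto simp:kernel_def simp del: carrier_free_Abelian_group_iff)
 qed
 then have TRk:"TR <= kernel FA P h"
  unfolding TR_generate by (rule group.generate_subgroup_incl[OF group_free_Abelian_group _ gh.subgroup_kernel])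
 define F where "F Z = h (SOME a. a<:FA & Z = cos a)" for Z
 have F:"F (cos a) = h a" if a:"a<:FA" for a
 proof -
  define b where "b = (SOME b. b<:FA & cos a = cos b)"
  have "b<:FA & cos a = cos b" unfolding b_def by (rule someI[of _ a]) (use a in blast)
  then have b:"b<:FA" "a - b\<in>TR" by (auto simp only: cos_eq)
  have "h (a - b) = 1@P" using TRk b by (auto simp:kernel_def)
  then have "h a*.P ~.P h b = 1@P" using hm[OF a b(1)] by simp
  then have "h a = h b" using gh.hom_closed[OF a] gh.hom_closed[OF b(1)] P.inv_solve_right'[of "1@P" "h a" "h b"] by simp
  then show ?thesis unfolding F_def b_def[symmetric] by simp
 qed
 show ?thesis
 proof (rule that[of F])
  show "F Z<:P" if "Z<:E" for Z
  using that F gh.hom_closed unfolding E_carrier by auto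
  show "F (Y+.E Z) = F Y*.P F Z" if "Y<:E" "Z<:E" for Y Z
  using that unfolding E_carrier by (auto simp del: carrier_free_Abelian_group_iff simp: E_add F FA_add ha)
  show "F (tens c x) = \<beta> c x" if "c<:C" "x<:N" for c x
  using F[OF FA_of[OF that]] hf[OF that] by (simp add:tens_cos)
 qed
qed

end

context scalar_extension
begin

lemma tens_zero: assumes c:"c<:C" shows "tens c 0@N = 0@E"
proof -
 have "tens c 0@N = tens c (0@B*:N 0@N)" by simp
 also have "... = tens (c*.C f 0@B) 0@N" by (rule tens_balanced) (use c in auto)
 also have "... = 0@C*:E tens c 0@N" using c by (simp add:tens_smult)
 also have "... = 0@E" using tens_closed[OF c N.M.zero_closed] by simp
 finally show ?thesis .
qed

lemma tens_lincomb:
 assumes c:"c<:C" and b:"!!j. j < d==>b j<:B" and e:"!!j. j < d==>e j<:N"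
 shows "tens c (lincomb N d b e) = lincomb E d (%j. c*.C f (b j)) (%j. tens 1@C (e j))"
 using b e
proof (induction d)
 case 0 show ?case by (simp add:lincomb_def tens_zero c)
next
 case (Suc d)
 have ins:"{..<Suc d} = insert d {..<d}" by auto
 have 1:"lincomb N (Suc d) b e = b d*:N e d+.N lincomb N d b e"
  unfolding lincomb_def ins by (rule N.M.finsum_insert) (use Suc.prems in auto)
 have 2:"lincomb E (Suc d) (%j. c*.C f (b j)) (%j. tens 1@C (e j)) =
  (c*.C f (b d))*:E tens 1@C (e d)+.E lincomb E d (%j. c*.C f (b j)) (%j. tens 1@C (e j))"
  unfolding lincomb_def ins by (rule E.M.finsum_insert) (use Suc.prems c in \<open>auto intro!: E.smult_closed tens_closed\<close>)
 have l:"lincomb N d b e<:N" by (rule N.lincomb_closed) (use Suc.prems in auto)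
 show ?case unfolding 1 2 using Suc c l by (simp add:tens_add_right tens_balanced tens_smult)
qed

lemmas E_induct_cases = E_induct[consumes 1,case_names tens zero minus]

lemma ext_basis:
 assumes b:"is_basis B N d e"
 shows "is_basis C E d (%j. tens 1@C (e j))"
proof (rule E.is_basisI)
 note ec = N.basis_closed[OF b]
 show t1:"tens 1@C (e j)<:E" if "j < d" for j using ec[OF that] by (simp add:tens_closed)
 fix Z assume Z:"Z<:E"
 show "\<exists>c\<in>vecs C d. Z = lincomb E d c (%j. tens 1@C (e j))"
  using Z
 proof (rule E_induct)
  fix c x assume c:"c<:C" and x:"x<:N"
  note cv = N.coords_vecs[OF b x]
  have "tens c x = lincomb E d (%j. c*.C f (coords B N d e x j)) (%j. tens 1@C (e j))"
  using tens_lincomb[OF c,of d "coords B N d e x" e] vecsD[OF cv] ec by (simp add:N.lincomb_coords[OF b x])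
  moreover have "(%j. c*.C f (coords B N d e x j))\<in>vecs C d" using cv c by (auto simp:vecs_def)
  ultimately show "\<exists>c'\<in>vecs C d. tens c x = lincomb E d c' (%j. tens 1@C (e j))" by blast
 next
  show "\<exists>c\<in>vecs C d. 0@E = lincomb E d c (%j. tens 1@C (e j))"
  by (rule bexI[of _ "%i. 0@C"]) (auto simp:E.lincomb_zero t1 vecs_def)
  fix x y assume "\<exists>c\<in>vecs C d. x = lincomb E d c (%j. tens 1@C (e j))" "\<exists>c\<in>vecs C d. y = lincomb E d c (%j. tens 1@C (e j))"
  then obtain c c' where c:"c\<in>vecs C d" "x = lincomb E d c (%j. tens 1@C (e j))"
  "c'\<in>vecs C d" "y = lincomb E d c' (%j. tens 1@C (e j))" by blast
  have "x+.E (-:C 1@C)*:E y = lincomb E d (%i. c i+.C (-:C 1@C)*.C c' i) (%j. tens 1@C (e j))"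
  unfolding c(2,4) using vecsD[OF c(1)] vecsD[OF c(3)] t1 by (simp add:E.lincomb_add E.lincomb_smult)
  moreover have "(%i. c i+.C (-:C 1@C)*.C c' i)\<in>vecs C d" using c by (auto simp:vecs_def)
  ultimately show "\<exists>c\<in>vecs C d. x+.E (-:C 1@C)*:E y = lincomb E d c (%j. tens 1@C (e j))" by blast
 qed
next
 note ec = N.basis_closed[OF b]
 have t1:"tens 1@C (e j)<:E" if "j < d" for j using ec[OF that] by (simp add:tens_closed)
 fix c assume c:"c\<in>vecs C d" and z:"lincomb E d c (%j. tens 1@C (e j)) = 0@E"
 let ?S = "std_gmodule C d (%(_::unit) _ _. 0@C)"
 interpret S: module C ?S by (rule h.S.module_std)
 let ?b = "%c x i. c*.C f (coords B N d e x i)"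
 have cx:"coords B N d e x i<:B" if "x<:N" for x i using vecsD[OF N.coords_vecs[OF b that]] .
 obtain F where F:"!!Z. Z<:E==>F Z<:(add_monoid ?S)"
  "!!Y Z. Y<:E==>Z<:E==>F (Y+.E Z) = F Y*.(add_monoid ?S) F Z"
  "!!c x. c<:C==>x<:N==>F (tens c x) = ?b c x"
 proof (rule E_universal[where P = "add_monoid ?S" and \<beta> = ?b])
  show "comm_group (add_monoid ?S)" by (rule S.M.a_comm_group)
  show "?b c x<:(add_monoid ?S)" if "c<:C" "x<:N" for c x
  using that N.coords_vecs[OF b that(2)] by (auto simp:vecs_def)
 qed (auto simp:h.S.l_distr h.S.r_distr h.S.m_assoc N.coords_add[OF b] N.coords_smult[OF b] cx)
 have F1:"F Z\<in>vecs C d" if "Z<:E" for Z using F(1)[OF that] by simp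
 have F2:"F (Y+.E Z) = F Y+.?S F Z" if "Y<:E" "Z<:E" for Y Z using F(2)[OF that] by simp
 have F3:"F (a*:E Z) = a*:?S F Z" if a:"a<:C" and Z:"Z<:E" for a Z
  using Z a
 proof (induction arbitrary: a rule: E_induct_cases)
  case (tens c x) then show ?case by (simp add:tens_smult F(3) h.S.m_assoc cx)
 next
  case zero
  have "F 0@E = F (tens 0@C 0@N)" by (simp add:tens_zero)
  also have "... = (%i. 0@C)" by (subst F(3)) (simp_all add: cx)
  finally show ?case using zero by simp
 next
  case (minus x y)
  have mo:"-:C 1@C<:C" by simp
  have "F (a*:E (x+.E (-:C 1@C)*:E y)) = F (a*:E x+.E (a*.C (-:C 1@C))*:E y)"
  using minus.hyps minus.prems mo by (simp add:E.smult_r_distr E.smult_assoc1)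
  also have "... = F (a*:E x)+.?S F ((a*.C (-:C 1@C))*:E y)"
  by (rule F2) (use minus.hyps minus.prems mo in auto)
  also have "... = a*:?S F x+.?S (a*.C (-:C 1@C))*:?S F y"
  using minus.IH(1)[OF minus.prems] minus.IH(2)[OF h.S.m_closed[OF minus.prems mo]] by simp
  also have "... = a*:?S (F x+.?S (-:C 1@C)*:?S F y)"
  using vecsD[OF F1[OF minus.hyps(1)]] vecsD[OF F1[OF minus.hyps(2)]] minus.prems mo by (simp add:h.S.r_distr h.S.m_assoc)
  also have "F x+.?S (-:C 1@C)*:?S F y = F (x+.E (-:C 1@C)*:E y)"
  using F2[OF minus.hyps(1) E.smult_closed[OF mo minus.hyps(2)]] minus.IH(2)[OF mo] by simp
  finally show ?case .
 qed
 have l:"(\<lambda>Z\<in>car E. F Z)\<in>lin_maps C E ?S"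
  unfolding lin_maps_def using F1 F2 F3 by auto
 have "(\<lambda>Z\<in>car E. F Z) (lincomb E d c (%j. tens 1@C (e j))) = lincomb ?S d c (%j. (\<lambda>Z\<in>car E. F Z) (tens 1@C (e j)))"
  by (rule E.lin_maps_lincomb[OF S.module_axioms l]) (use vecsD[OF c] t1 in auto)
 also have "... = lincomb ?S d c (%j i. mone C d i j)"
 proof (rule lincomb_cong[OF S.module_axioms])
  fix j assume j:"j < d"
  have "F (tens 1@C (e j)) = (%i. f (mone B d i j))"
  using F(3)[OF h.S.one_closed ec[OF j]] by (simp add:N.coords_basis[OF b j] mone_def)
  also have "... = (%i. mone C d i j)" by (auto simp:mone_def)
  finally show "(\<lambda>Z\<in>car E. F Z) (tens 1@C (e j)) = (%i. mone C d i j)" using t1[OF j] by simp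
 qed (use vecsD[OF c] h.S.std_unit_vecs in auto)
 also have "... = c" by (rule h.S.lincomb_std_unit[OF c])
 finally have "F (lincomb E d c (%j. tens 1@C (e j))) = c"
  using E.lincomb_closed[of d c "%j. tens 1@C (e j)"] vecsD[OF c] t1 by simp
 moreover have "F 0@E = (%i. 0@C)"
  using F3[OF h.S.zero_closed E.M.zero_closed] vecsD[OF F1[OF E.M.zero_closed]] by simp
 ultimately show "c = (%i. 0@C)" using z by simp
qed

lemma ext_acts_by:
 assumes b:"is_basis B N d e" and a:"acts_by B G N d e \<rho>"
 shows "acts_by C G E d (%j. tens 1@C (e j)) (%g. mmap f (\<rho> g))"
 unfolding acts_by_def
proof (intro ballI conjI allI impI)
 note ec = N.basis_closed[OF b]
 fix g assume g:"g<:G"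
 have s:"\<rho> g\<in>rmat B d d" using a g by (simp add:acts_by_def)
 then show "mmap f (\<rho> g)\<in>rmat C d d" by (rule h.mmap_rmat)
 fix j assume j:"j < d"
 have "act E g (tens 1@C (e j)) = tens 1@C (lincomb N d (%i. \<rho> g i j) e)"
  using a g j by (simp add:tens_act acts_by_def)
 also have "... = lincomb E d (%i. 1@C*.C f (\<rho> g i j)) (%j. tens 1@C (e j))"
  by (rule tens_lincomb) (use rmatD[OF s] ec in auto)
 also have "... = lincomb E d (%i. mmap f (\<rho> g) i j) (%j. tens 1@C (e j))"
  using rmatD[OF s] by (simp add:mmap_def)
 finally show "act E g (tens 1@C (e j)) = lincomb E d (%i. mmap f (\<rho> g) i j) (%j. tens 1@C (e j))" .
qed

end

section \<open>Lifts in coordinates\<close>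

text \<open>A representation together with a basis and the matrices \<open>\<tau>\<close> of the action in it.\<close>
locale framed_representation = U: group_module k \<Gamma> U + k: field k
 for k :: "('k,'l) ring_scheme" and \<Gamma> :: "('g,'l') monoid_scheme" and U :: "('k,'v,'g) gmodule" +
 fixes d :: nat and v :: "nat => 'v" and \<tau> :: "'g => nat => nat => 'k"
 assumes v_basis:"is_basis k U d v" and v_acts:"acts_by k \<Gamma> U d v \<tau>"
begin

text \<open>A basis of the lift that reduces to the fixed basis, and the matrices of the action in it.\<close>
definition adapted :: "('b,nat => 'k,'k) walg => ('g => nat => nat => 'b) => ('b,'n,'g,'k,'v) lift => (nat => 'n) => bool" where
 "adapted B \<rho> L e \<longleftrightarrow> group_module B \<Gamma> (fst L) & snd L\<in>gisos k \<Gamma> (residual k B (fst L)) U \<and>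
  is_basis B (fst L) d e & acts_by B \<Gamma> (fst L) d e \<rho> \<and>
  (\<forall>j<d. snd L (residual_tensor k B (fst L) 1@k (e j)) = v j)"

definition represents :: "('b,nat => 'k,'k) walg => ('g => nat => nat => 'b) => ('b,'n,'g,'k,'v) lift => bool" where
 "represents B \<rho> L \<longleftrightarrow> (EX e. adapted B \<rho> L e)"

lemma residual_extension:
 assumes "local_over B k (resmap B)" "group_module B \<Gamma> N"
 shows "scalar_extension B k (resmap B) \<Gamma> N"
proof -
 interpret B: local_over B k "resmap B" by (rule assms)
 show ?thesis by (intro scalar_extension.intro B.r.ring_hom_cring_axioms assms)
qed

lemma giso_lin:"\<phi>\<in>gisos k \<Gamma> N U==>\<phi>\<in>lin_maps k N U"
 by (simp add:gisos_def ghoms_def)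

lemma adapted_residual:
 assumes B:"local_over B k (resmap B)" and a:"adapted B \<rho> L e"
  and c:"c<:k" and b:"!!j. j < d==>b j<:B"
 shows "snd L (residual_tensor k B (fst L) c (lincomb (fst L) d b e)) = lincomb U d (%j. c*.k resmap B (b j)) v"
proof -
 let ?N = "fst L" and ?\<phi> = "snd L"
 interpret B: local_over B k "resmap B" by (rule B)
 interpret X: scalar_extension B k "resmap B" \<Gamma> ?N
  by (rule residual_extension[OF B]) (use a in \<open>simp add:adapted_def\<close>)
 have bs:"is_basis B ?N d e" and \<phi>: "?\<phi>\<in>gisos k \<Gamma> X.E U" and v:"!!j. j < d==>?\<phi> (X.tens 1@k (e j)) = v j"
  using a by (auto simp:adapted_def residual_def)
 note ec = X.N.basis_closed[OF bs]
 have cb:"c*.k resmap B (b j)<:k" if "j < d" for j using c b[OF that] by simp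
 have "?\<phi> (X.tens c (lincomb ?N d b e)) = ?\<phi> (lincomb X.E d (%j. c*.k resmap B (b j)) (%j. X.tens 1@k (e j)))"
  using X.tens_lincomb[OF c,of d b e] b ec by simp
 also have "... = lincomb U d (%j. c*.k resmap B (b j)) (%j. ?\<phi> (X.tens 1@k (e j)))"
  by (rule X.E.lin_maps_lincomb[OF U.module_axioms giso_lin[OF \<phi>]]) (use cb ec X.tens_closed in auto)
 also have "... = lincomb U d (%j. c*.k resmap B (b j)) v"
  by (rule lincomb_cong[OF U.module_axioms]) (use v cb U.basis_closed[OF v_basis] in auto)
 finally show ?thesis .
qed

lemma adapted_reduces:
 assumes B:"local_over B k (resmap B)" and a:"adapted B \<rho> L e" and g:"g<:\<Gamma>"
 shows "\<rho> g\<in>rmat B d d" "mmap (resmap B) (\<rho> g) = \<tau> g"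
proof -
 let ?N = "fst L" and ?\<phi> = "snd L"
 interpret B: local_over B k "resmap B" by (rule B)
 interpret X: scalar_extension B k "resmap B" \<Gamma> ?N
  by (rule residual_extension[OF B]) (use a in \<open>simp add:adapted_def\<close>)
 have bs:"is_basis B ?N d e" "acts_by B \<Gamma> ?N d e \<rho>" and \<phi>: "?\<phi>\<in>gisos k \<Gamma> X.E U" and v:"!!j. j < d==>?\<phi> (X.tens 1@k (e j)) = v j"
  using a by (auto simp:adapted_def residual_def)
 show s:"\<rho> g\<in>rmat B d d" using bs(2) g by (simp add:acts_by_def)
 have 1:"acts_by k \<Gamma> U d (%j. ?\<phi> (X.tens 1@k (e j))) (%g. mmap (resmap B) (\<rho> g))"
  by (rule X.E.giso_basis(2)[OF U.group_module_axioms \<phi> X.ext_basis[OF bs(1)] X.ext_acts_by[OF bs]])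
 show "mmap (resmap B) (\<rho> g) = \<tau> g"
 proof (rule U.rmat_eqI_lincomb[OF v_basis])
  show m:"mmap (resmap B) (\<rho> g)\<in>rmat k d d" by (rule B.r.mmap_rmat[OF s])
  show "\<tau> g\<in>rmat k d d" using v_acts g by (simp add:acts_by_def)
  fix j assume j:"j < d"
  have "lincomb U d (%i. mmap (resmap B) (\<rho> g) i j) v = lincomb U d (%i. mmap (resmap B) (\<rho> g) i j) (%j. ?\<phi> (X.tens 1@k (e j)))"
  by (rule lincomb_cong[OF U.module_axioms]) (use v rmatD[OF m] U.basis_closed[OF v_basis] in auto)
  also have "... = act U g (v j)" using 1 g j v by (simp add:acts_by_def)
  also have "... = lincomb U d (%i. \<tau> g i j) v" using v_acts g j by (simp add:acts_by_def)
  finally show "lincomb U d (%i. mmap (resmap B) (\<rho> g) i j) v = lincomb U d (%i. \<tau> g i j) v" .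
 qed
qed

lemma represents_isomorphic:
 assumes B:"local_over B k (resmap B)" and 1:"represents B \<rho> L" and 2:"represents B \<rho> L'"
 shows "lift_isomorphic k \<Gamma> B L L'"
proof -
 obtain e e' where a:"adapted B \<rho> L e" and a': "adapted B \<rho> L' e'" using 1 2 by (auto simp:represents_def)
 let ?N = "fst L" and ?N' = "fst L'"
 interpret N: group_module B \<Gamma> ?N using a by (simp add:adapted_def)
 interpret N': group_module B \<Gamma> ?N' using a' by (simp add:adapted_def)
 have bs:"is_basis B ?N d e" "acts_by B \<Gamma> ?N d e \<rho>" "is_basis B ?N' d e'" "acts_by B \<Gamma> ?N' d e' \<rho>"
  using a a' by (auto simp:adapted_def)
 obtain f where f:"f\<in>gisos B \<Gamma> ?N ?N'" "!!j. j < d==>f (e j) = e' j"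
  by (rule N.giso_of_same_matrices[OF N'.group_module_axioms bs]) (rule that)
 have fl:"f\<in>lin_maps B ?N ?N'" using f by (simp add:gisos_def ghoms_def)
 have "snd L' (residual_tensor k B ?N' c (f x)) = snd L (residual_tensor k B ?N c x)"
  if c:"c<:k" and x:"x<:?N" for c x
 proof -
  let ?b = "coords B ?N d e x"
  note bc = vecsD[OF N.coords_vecs[OF bs(1) x]]
  have "f (lincomb ?N d ?b e) = lincomb ?N' d ?b (%j. f (e j))"
  by (rule N.lin_maps_lincomb[OF N'.module_axioms fl]) (use bc N.basis_closed[OF bs(1)] in auto)
  also have "... = lincomb ?N' d ?b e'"
  by (rule lincomb_cong[OF N'.module_axioms]) (use f bc N'.basis_closed[OF bs(3)] in auto)
  finally have fx:"f x = lincomb ?N' d ?b e'" by (simp add:N.lincomb_coords[OF bs(1) x])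
  show ?thesis
  using adapted_residual[OF B a c,of ?b] adapted_residual[OF B a' c,of ?b] bc
  by (simp add:fx N.lincomb_coords[OF bs(1) x])
 qed
 then show ?thesis
  using f(1) by (cases L; cases L') auto
qed

lemma represents_transfer:
 assumes B:"local_over B k (resmap B)" and 1:"represents B \<rho> L" and iso:"lift_isomorphic k \<Gamma> B L L'"
  and L': "group_module B \<Gamma> (fst L')" "snd L'\<in>gisos k \<Gamma> (residual k B (fst L')) U"
 shows "represents B \<rho> L'"
proof -
 obtain e where a:"adapted B \<rho> L e" using 1 by (auto simp:represents_def)
 let ?N = "fst L" and ?N' = "fst L'"
 interpret N: group_module B \<Gamma> ?N using a by (simp add:adapted_def)
 interpret B: local_over B k "resmap B" by (rule B)
 have bs:"is_basis B ?N d e" "acts_by B \<Gamma> ?N d e \<rho>" using a by (auto simp:adapted_def)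
 obtain f where f:"f\<in>gisos B \<Gamma> ?N ?N'"
  "!!c x. c<:k==>x<:?N==>snd L' (residual_tensor k B ?N' c (f x)) = snd L (residual_tensor k B ?N c x)"
  using iso by (cases L; cases L') auto
 have "snd L' (residual_tensor k B ?N' 1@k (f (e j))) = v j" if "j < d" for j
  using f(2)[of "1@k" "e j"] N.basis_closed[OF bs(1) that] a that by (simp add:adapted_def)
 then have "adapted B \<rho> L' (%j. f (e j))"
  unfolding adapted_def using L' N.giso_basis[OF L'(1) f(1) bs(1)] bs(2) by simp
 then show ?thesis unfolding represents_def by blast
qed

lemma represents_exists:
 fixes B :: "('b,nat => 'k,'k) walg"
 assumes B:"local_over B k (resmap B)"
  and \<rho>: "!!g. g<:\<Gamma>==>\<rho> g\<in>rmat B d d" "\<rho> 1@\<Gamma> = mone B d"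
  "!!g h. g<:\<Gamma>==>h<:\<Gamma>==>\<rho> (g*.\<Gamma> h) = mmul B d (\<rho> g) (\<rho> h)"
  "!!g. g<:\<Gamma>==>mmap (resmap B) (\<rho> g) = \<tau> g"
 shows "\<exists>L :: ('b,nat => 'b,'g,'k,'v) lift. is_lift k \<Gamma> U B L & represents B \<rho> L"
proof -
 interpret B: local_over B k "resmap B" by (rule B)
 let ?N = "std_gmodule B d \<rho>"
 let ?e = "%j i. mone B d i j"
 have N:"group_module B \<Gamma> ?N" by (rule B.group_module_std[OF U.is_group \<rho>(1-3)])
 interpret N: group_module B \<Gamma> ?N by (rule N)
 interpret X: scalar_extension B k "resmap B" \<Gamma> ?N by (rule residual_extension[OF B N])
 have bs:"is_basis B ?N d ?e" "acts_by B \<Gamma> ?N d ?e \<rho>" by (rule B.std_basis,rule B.std_acts_by[OF \<rho>(1)])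
 have "acts_by k \<Gamma> U d v (%g. mmap (resmap B) (\<rho> g))"
  by (rule U.acts_by_cong[OF v_acts]) (rule \<rho>(4))
 then obtain \<phi> where \<phi>: "\<phi>\<in>gisos k \<Gamma> X.E U" "!!j. j < d==>\<phi> (X.tens 1@k (?e j)) = v j"
  using X.E.giso_of_same_matrices[OF U.group_module_axioms X.ext_basis[OF bs(1)] X.ext_acts_by[OF bs] v_basis] by metis
 have "1@B ~= 0@B" using B.r.hom_one B.r.hom_zero k.one_not_zero by metis
 then have "free_of_rank B ?N d" by (rule N.is_basis_imp_free_of_rank[OF bs(1)])
 then have "is_lift k \<Gamma> U B (?N,\<phi>)" using N \<phi>(1) by (auto simp:residual_def)
 moreover have "represents B \<rho> (?N,\<phi>)"
  unfolding represents_def adapted_def using N bs \<phi> by (auto simp:residual_def)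
 ultimately show ?thesis by blast
qed

text \<open>Lift the basis of the residual module to the lift; it is again a basis because the base-change matrix is
 invertible modulo the maximal ideal.\<close>
lemma lift_represented:
 assumes B:"local_over B k (resmap B)" and L:"is_lift k \<Gamma> U B L"
 shows "EX \<rho>. represents B \<rho> L"
proof -
 interpret B: local_over B k "resmap B" by (rule B)
 obtain N \<phi> where L_eq:"L = (N,\<phi>)" by (cases L)
 obtain d' where N:"group_module B \<Gamma> N" and fr:"free_of_rank B N d'" and \<phi>: "\<phi>\<in>gisos k \<Gamma> (residual k B N) U"
  using L by (auto simp:L_eq)
 interpret X: scalar_extension B k "resmap B" \<Gamma> N by (rule residual_extension[OF B N])
 obtain s where s:"is_basis B N d' s" using X.N.free_of_rank_imp_basis[OF fr] by blast
 note sc = X.N.basis_closed[OF s]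
 have \<phi>': "\<phi>\<in>gisos k \<Gamma> X.E U" using \<phi> by (simp add:residual_def)
 let ?s = "%j. \<phi> (X.tens 1@k (s j))"
 have s': "is_basis k U d' ?s" by (rule X.E.giso_basis(1)[OF U.group_module_axioms \<phi>' X.ext_basis[OF s]])
 define A where "A = (%i j. if j < d then coords k U d' ?s (v j) i else 0@k)"
 define Y where "Y = (%i j. if j < d' then coords k U d v (?s j) i else 0@k)"
 have vc:"v j<:U" if "j < d" for j using U.basis_closed[OF v_basis that] .
 have sc': "?s j<:U" if "j < d'" for j using U.basis_closed[OF s' that] .
 have A:"A\<in>rmat k d' d" using U.coords_vecs[OF s' vc] by (auto simp:A_def rmat_def vecs_def)
 have Y:"Y\<in>rmat k d d'" using U.coords_vecs[OF v_basis sc'] by (auto simp:Y_def rmat_def vecs_def)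
 have Av:"lincomb U d' (%i. A i j) ?s = v j" if "j < d" for j
  using that U.lincomb_coords[OF s' vc[OF that]] by (simp add:A_def)
 have Ys:"lincomb U d (%i. Y i j) v = ?s j" if "j < d'" for j
  using that U.lincomb_coords[OF v_basis sc'[OF that]] by (simp add:Y_def)
 have AY:"mmul k d A Y = mone k d'"
 proof (rule U.rmat_eqI_lincomb[OF s' U.R.mmul_rmat[OF A Y] U.R.mone_rmat])
  fix j assume j:"j < d'"
  have "lincomb U d' (%i. mmul k d A Y i j) ?s = lincomb U d (%i. Y i j) (%j. lincomb U d' (%i. A i j) ?s)"
  unfolding mmul_col by (rule U.lincomb_mat) (use rmatD[OF A] rmatD[OF Y] sc' in auto)
  also have "... = lincomb U d (%i. Y i j) v"
  by (rule lincomb_cong[OF U.module_axioms]) (use Av rmatD[OF Y] vc in auto)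
  also have "... = lincomb U d' (%i. mone k d' i j) ?s" using Ys[OF j] U.lincomb_unit[OF sc' j] by simp
  finally show "lincomb U d' (%i. mmul k d A Y i j) ?s = lincomb U d' (%i. mone k d' i j) ?s" .
 qed
 have YA:"mmul k d' Y A = mone k d"
 proof (rule U.rmat_eqI_lincomb[OF v_basis U.R.mmul_rmat[OF Y A] U.R.mone_rmat])
  fix j assume j:"j < d"
  have "lincomb U d (%i. mmul k d' Y A i j) v = lincomb U d' (%i. A i j) (%j. lincomb U d (%i. Y i j) v)"
  unfolding mmul_col by (rule U.lincomb_mat) (use rmatD[OF A] rmatD[OF Y] vc in auto)
  also have "... = lincomb U d' (%i. A i j) ?s"
  by (rule lincomb_cong[OF U.module_axioms]) (use Ys rmatD[OF A] sc' in auto)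
  also have "... = lincomb U d (%i. mone k d i j) v" using Av[OF j] U.lincomb_unit[OF vc j] by simp
  finally show "lincomb U d (%i. mmul k d' Y A i j) v = lincomb U d (%i. mone k d i j) v" .
 qed
 obtain A' where A': "A'\<in>rmat B d' d" "mmap (resmap B) A' = A" using B.r.rmat_lift[OF B.r_surj A] by blast
 obtain Z where Z:"Z\<in>rmat B d d'" "mmul B d A' Z = mone B d'" "mmul B d' Z A' = mone B d"
  using B.rect_inverse_mod[OF A'(1) Y] AY YA unfolding A'(2) by blast
 let ?e = "%j. lincomb N d' (%i. A' i j) s"
 have e:"is_basis B N d ?e" by (rule X.N.is_basis_change[OF s A'(1) Z])
 obtain \<rho> where \<rho>: "acts_by B \<Gamma> N d ?e \<rho>" using X.N.acts_by_exists[OF e] by blast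
 have "\<phi> (X.tens 1@k (?e j)) = v j" if j:"j < d" for j
 proof -
  have "X.tens 1@k (?e j) = lincomb X.E d' (%i. 1@k*.k resmap B (A' i j)) (%j. X.tens 1@k (s j))"
  by (rule X.tens_lincomb) (use rmatD[OF A'(1)] sc in auto)
  also have "(%i. 1@k*.k resmap B (A' i j)) = (%i. A i j)"
  proof
  fix i
  have "resmap B (A' i j) = A i j" using fun_cong[OF fun_cong[OF A'(2)],of i j] by (simp add:mmap_def)
  then show "1@k*.k resmap B (A' i j) = A i j" using rmatD[OF A,of i j] by simp
  qed
  finally have "\<phi> (X.tens 1@k (?e j)) = \<phi> (lincomb X.E d' (%i. A i j) (%j. X.tens 1@k (s j)))" by simp
  also have "... = lincomb U d' (%i. A i j) ?s"
  by (rule X.E.lin_maps_lincomb[OF U.module_axioms giso_lin[OF \<phi>']]) (use rmatD[OF A] sc X.tens_closed in auto)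
  finally show ?thesis using Av[OF j] by simp
 qed
 then have "adapted B \<rho> L ?e"
  unfolding adapted_def L_eq using N \<phi> e \<rho> by simp
 then show ?thesis unfolding represents_def by blast
qed

lemma represents_conjugate:
 assumes B:"local_over B k (resmap B)" and 1:"represents B \<rho> L"
  and P:"P\<in>rmat B d d" "mmap (resmap B) P = mone k d"
  and \<rho>': "!!g. g<:\<Gamma>==>\<rho>' g\<in>rmat B d d"
  "!!g. g<:\<Gamma>==>mmul B d (\<rho> g) P = mmul B d P (\<rho>' g)"
 shows "represents B \<rho>' L"
proof -
 obtain e where a:"adapted B \<rho> L e" using 1 by (auto simp:represents_def)
 interpret N: group_module B \<Gamma> "fst L" using a by (simp add:adapted_def)
 interpret B: local_over B k "resmap B" by (rule B)
 have bs:"is_basis B (fst L) d e" "acts_by B \<Gamma> (fst L) d e \<rho>" using a by (auto simp:adapted_def)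
 obtain Q where Q:"Q\<in>rmat B d d" "mmul B d P Q = mone B d" "mmul B d Q P = mone B d"
  using B.inverse_mod[OF P] by blast
 let ?e = "%j. lincomb (fst L) d (%i. P i j) e"
 have "snd L (residual_tensor k B (fst L) 1@k (?e j)) = v j" if j:"j < d" for j
 proof -
  have "snd L (residual_tensor k B (fst L) 1@k (?e j)) = lincomb U d (%i. 1@k*.k resmap B (P i j)) v"
  by (rule adapted_residual[OF B a]) (use rmatD[OF P(1)] in auto)
  also have "(%i. 1@k*.k resmap B (P i j)) = (%i. mone k d i j)"
  proof
  fix i
  have "resmap B (P i j) = mone k d i j" using fun_cong[OF fun_cong[OF P(2)],of i j] by (simp add:mmap_def)
  then show "1@k*.k resmap B (P i j) = mone k d i j" using rmatD[OF U.R.mone_rmat,of d i j] by simp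
  qed
  also have "lincomb U d (%i. mone k d i j) v = v j" by (rule U.lincomb_unit) (use U.basis_closed[OF v_basis] j in auto)
  finally show ?thesis .
 qed
 then have "adapted B \<rho>' L ?e"
  unfolding adapted_def
  using a N.is_basis_change[OF bs(1) P(1) Q(1,2,3)] N.acts_by_change[OF bs P(1) \<rho>'] by (auto simp:adapted_def)
 then show ?thesis unfolding represents_def by blast
qed

text \<open>Two adapted bases of one lift differ by a matrix congruent to 1.\<close>
lemma represents_compare:
 assumes B:"local_over B k (resmap B)" and 1:"represents B \<rho> L" and 2:"represents B \<rho>' L"
 shows "\<exists>P\<in>rmat B d d. mmap (resmap B) P = mone k d \<and>
  (\<forall>g\<in>car \<Gamma>. mmul B d (\<rho> g) P = mmul B d P (\<rho>' g))"
proof -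
 obtain e e' where a:"adapted B \<rho> L e" and a': "adapted B \<rho>' L e'" using 1 2 by (auto simp:represents_def)
 interpret N: group_module B \<Gamma> "fst L" using a by (simp add:adapted_def)
 interpret B: local_over B k "resmap B" by (rule B)
 have bs:"is_basis B (fst L) d e" "acts_by B \<Gamma> (fst L) d e \<rho>" "is_basis B (fst L) d e'" "acts_by B \<Gamma> (fst L) d e' \<rho>'"
  using a a' by (auto simp:adapted_def)
 note ec = N.basis_closed[OF bs(1)] and ec' = N.basis_closed[OF bs(3)]
 define P where "P = (%i j. if j < d then coords B (fst L) d e (e' j) i else 0@B)"
 have P:"P\<in>rmat B d d" using N.coords_vecs[OF bs(1) ec'] by (auto simp:P_def rmat_def vecs_def)
 have Pe:"lincomb (fst L) d (%i. P i j) e = e' j" if "j < d" for j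
  using that N.lincomb_coords[OF bs(1) ec'[OF that]] by (simp add:P_def)
 have "mmap (resmap B) P = mone k d"
 proof (rule U.rmat_eqI_lincomb[OF v_basis B.r.mmap_rmat[OF P] U.R.mone_rmat])
  fix j assume j:"j < d"
  have "snd L (residual_tensor k B (fst L) 1@k (lincomb (fst L) d (%i. P i j) e)) = lincomb U d (%i. 1@k*.k resmap B (P i j)) v"
  by (rule adapted_residual[OF B a]) (use rmatD[OF P] in auto)
  then have "v j = lincomb U d (%i. 1@k*.k resmap B (P i j)) v" using a' j unfolding Pe[OF j] adapted_def by simp
  moreover have "(%i. 1@k*.k resmap B (P i j)) = (%i. mmap (resmap B) P i j)"
  using rmatD[OF P,of _ j] by (simp add:mmap_def)
  ultimately show "lincomb U d (%i. mmap (resmap B) P i j) v = lincomb U d (%i. mone k d i j) v"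
  using U.lincomb_unit[of d v j] U.basis_closed[OF v_basis] j by simp
 qed
 moreover have "mmul B d (\<rho> g) P = mmul B d P (\<rho>' g)" if g:"g<:\<Gamma>" for g
 proof -
  have s:"\<rho> g\<in>rmat B d d" "\<rho>' g\<in>rmat B d d" using bs g by (auto simp:acts_by_def)
  show ?thesis
  proof (rule N.rmat_eqI_lincomb[OF bs(1) N.R.mmul_rmat[OF s(1) P] N.R.mmul_rmat[OF P s(2)]])
  fix j assume j:"j < d"
  have "lincomb (fst L) d (%i. mmul B d (\<rho> g) P i j) e = act (fst L) g (lincomb (fst L) d (%i. P i j) e)"
  unfolding mmul_col by (rule N.acts_by_lincomb[OF bs(1,2) g,symmetric]) (use rmatD[OF P] in auto)
  also have "... = act (fst L) g (e' j)" unfolding Pe[OF j] ..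
  also have "... = lincomb (fst L) d (%i. \<rho>' g i j) e'" using bs(4) g j by (simp add:acts_by_def)
  also have "... = lincomb (fst L) d (%i. \<rho>' g i j) (%j. lincomb (fst L) d (%i. P i j) e)"
  by (rule lincomb_cong[OF N.module_axioms]) (simp_all only: Pe rmatD[OF s(2)] ec')
  also have "... = lincomb (fst L) d (%i. mmul B d P (\<rho>' g) i j) e"
  unfolding mmul_col by (rule N.lincomb_mat[symmetric]) (use rmatD[OF P] rmatD[OF s(2)] ec in auto)
  finally show "lincomb (fst L) d (%i. mmul B d (\<rho> g) P i j) e = lincomb (fst L) d (%i. mmul B d P (\<rho>' g) i j) e" .
  qed
 qed
 ultimately show ?thesis using P by blast
qed

lemma represents_ext_lift:
 assumes B:"local_over B k (resmap B)" and C:"local_over C k (resmap C)"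
  and f:"f\<in>ring_hom B C" and fr:"!!b. b<:B==>resmap C (f b) = resmap B b"
  and L:"represents B \<rho> L"
 shows "represents C (%g. mmap f (\<rho> g)) (ext_lift k \<Gamma> U B C f L)"
proof -
 obtain e where a:"adapted B \<rho> L e" using L by (auto simp:represents_def)
 obtain N \<phi> where L_eq:"L = (N,\<phi>)" by (cases L)
 interpret B: local_over B k "resmap B" by (rule B)
 interpret C: local_over C k "resmap C" by (rule C)
 have N:"group_module B \<Gamma> N" and bs:"is_basis B N d e" "acts_by B \<Gamma> N d e \<rho>"
  using a by (auto simp:adapted_def L_eq)
 interpret X: scalar_extension B C f \<Gamma> N
  by (intro scalar_extension.intro ring_hom_cringI[OF B.is_cring C.is_cring f] N)
 interpret Y: scalar_extension C k "resmap C" \<Gamma> X.E by (rule residual_extension[OF C X.group_module_E])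
 note ec = X.N.basis_closed[OF bs(1)]
 note b1 = X.ext_basis[OF bs(1)] X.ext_acts_by[OF bs]
 note b2 = Y.ext_basis[OF b1(1)] Y.ext_acts_by[OF b1]
 have "acts_by k \<Gamma> U d v (%g. mmap (resmap C) (mmap f (\<rho> g)))"
 proof (rule U.acts_by_cong[OF v_acts])
  fix g assume g:"g<:\<Gamma>"
  have "mmap (resmap C) (mmap f (\<rho> g)) = mmap (resmap B) (\<rho> g)"
  using rmatD[OF adapted_reduces(1)[OF B a g]] by (simp add:mmap_def fr)
  then show "mmap (resmap C) (mmap f (\<rho> g)) = \<tau> g" using adapted_reduces(2)[OF B a g] by simp
 qed
 then obtain \<phi>' where \<phi>': "\<phi>'\<in>gisos k \<Gamma> Y.E U" "!!j. j < d==>\<phi>' (Y.tens 1@k (X.tens 1@C (e j))) = v j"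
  using Y.E.giso_of_same_matrices[OF U.group_module_axioms b2 v_basis] by metis
 have vc:"v j<:U" if "j < d" for j using U.basis_closed[OF v_basis that] .
 have form:"\<phi>' (Y.tens c' (X.tens c x)) = \<phi> (residual_tensor k B N (c'*.k resmap C c) x)"
  if c': "c'<:k" and c:"c<:C" and x:"x<:N" for c' c x
 proof -
  define b where "b = coords B N d e x"
  have bc:"b j<:B" for j unfolding b_def by (rule vecsD[OF X.N.coords_vecs[OF bs(1) x]])
  have xb:"x = lincomb N d b e" unfolding b_def by (simp add:X.N.lincomb_coords[OF bs(1) x])
  have 1:"X.tens c x = lincomb X.E d (%j. c*.C f (b j)) (%j. X.tens 1@C (e j))"
  unfolding xb by (rule X.tens_lincomb[OF c]) (use bc ec in auto)
  have "Y.tens c' (X.tens c x) = lincomb Y.E d (%j. c'*.k resmap C (c*.C f (b j))) (%j. Y.tens 1@k (X.tens 1@C (e j)))"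
  unfolding 1 by (rule Y.tens_lincomb[OF c']) (use bc c ec X.tens_closed in auto)
  also have "\<phi>' ... = lincomb U d (%j. c'*.k resmap C (c*.C f (b j))) (%j. \<phi>' (Y.tens 1@k (X.tens 1@C (e j))))"
  by (rule Y.E.lin_maps_lincomb[OF U.module_axioms giso_lin[OF \<phi>'(1)]]) (use bc c c' ec X.tens_closed Y.tens_closed in auto)
  also have "... = lincomb U d (%j. (c'*.k resmap C c)*.k resmap B (b j)) v"
  by (rule lincomb_cong[OF U.module_axioms]) (use \<phi>'(2) bc c c' vc fr in \<open>auto simp:U.R.m_assoc\<close>)
  also have "... = \<phi> (residual_tensor k B N (c'*.k resmap C c) x)"
  using adapted_residual[OF B a,of "c'*.k resmap C c" b] bc c c' by (simp add:L_eq xb)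
  finally show ?thesis .
 qed
 have ext:"ext_lift k \<Gamma> U B C f L = (X.E,\<phi>')"
 proof -
  let ?Q = "%\<phi>'. \<phi>'\<in>ghoms k \<Gamma> (residual k C X.E) U \<and>
  (\<forall>a\<in>car k. \<forall>c\<in>car C. \<forall>x\<in>car N.
  \<phi>' (residual_tensor k C X.E a (X.tens c x)) = \<phi> (residual_tensor k B N (a*.k resmap C c) x))"
  have Q': "?Q \<phi>'" using \<phi>'(1) form by (auto simp:gisos_def residual_def)
  have "(THE \<phi>'. ?Q \<phi>') = \<phi>'"
  proof (rule the_equality)
  show "?Q \<phi>'" by (rule Q')
  next
  fix \<chi> assume \<chi>: "?Q \<chi>"
  show "\<chi> = \<phi>'"
  proof (rule lin_maps_eqI[OF Y.E.module_axioms U.module_axioms _ _ b2(1)])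
  show "\<chi>\<in>lin_maps k Y.E U" using \<chi> by (simp add:ghoms_def residual_def)
  show "\<phi>'\<in>lin_maps k Y.E U" by (rule giso_lin[OF \<phi>'(1)])
  fix j assume j:"j < d"
  show "\<chi> (Y.tens 1@k (X.tens 1@C (e j))) = \<phi>' (Y.tens 1@k (X.tens 1@C (e j)))"
  using \<chi> Q' ec[OF j] U.R.one_closed C.one_closed by simp
  qed
  qed
  then show ?thesis by (simp add:L_eq Let_def)
 qed
 have "adapted C (%g. mmap f (\<rho> g)) (X.E,\<phi>') (%j. X.tens 1@C (e j))"
  unfolding adapted_def using X.group_module_E \<phi>' b1 by (simp add:residual_def)
 then show ?thesis unfolding ext represents_def by blast
qed

end

section \<open>Functionals applied to matrices\<close>

lemma (in ring) finsum_hom: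
 assumes S:"abelian_group S" and h:"!!x. x<:R==>h x<:S"
  "!!x y. x<:R==>y<:R==>h (x \<oplus> y) = h x+.S h y" and g:"g\<in>A \<rightarrow> car R"
 shows "h (finsum R g A) = finsum S (%i. h (g i)) A"
proof -
 interpret S: abelian_group S by (rule S)
 have "h \<zero> +.S h \<zero> = h \<zero> +.S 0@S" using h(2)[of \<zero> \<zero>] h(1)[of \<zero>] by simp
 then have h0:"h \<zero> = 0@S" using h(1)[of \<zero>] by (simp only: S.add.l_cancel zero_closed S.zero_closed)
 show ?thesis
  using g
 proof (induction A rule: infinite_finite_induct)
  case (insert x A)
  have "finsum R g A<:R" by (rule finsum_closed) (use insert in auto)
  moreover have "(%i. h (g i))\<in>A \<rightarrow> car S" using insert h(1) by auto
  ultimately show ?case using insert h by (simp add:finsum_insert S.finsum_insert Pi_def)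
 qed (simp_all add: h0)
qed

context local_over
begin

lemma functionalD:
 assumes "functional I l"
 shows "x\<in>I==>l x<:k" "x\<in>I==>y\<in>I==>l (x \<oplus> y) = l x+.k l y"
  "b<:B==>x\<in>I==>l (b \<otimes> x) = r b*.k l x"
 using assms by (auto simp:functional_def)

context
 fixes I l assumes I:"ideal I B" and l:"functional I l"
begin

interpretation I: ideal I B by (rule I)

lemma functional_r: assumes "b<:B" "x\<in>I" shows "l (x \<otimes> b) = l x*.k r b"
 using functionalD(3)[OF l assms] functionalD(1)[OF l assms(2)] assms I.Icarr[OF assms(2)] by (simp add:B.m_comm k.m_comm)

lemma functional_zero:"l \<zero> = 0@k"
 using functionalD(3)[OF l B.zero_closed I.zero_closed] functionalD(1)[OF l I.zero_closed] by simp

lemma functional_uminus: assumes "x\<in>I" shows "l (\<ominus> x) = -:k l x"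
proof -
 have "l ((\<ominus> \<one>) \<otimes> x) = -:k l x"
  using functionalD(3)[OF l _ assms,of "\<ominus> \<one>"] functionalD(1)[OF l assms] by (simp add:k.l_minus)
 then show ?thesis using I.Icarr[OF assms] by (simp add:B.l_minus)
qed

lemma functional_finsum:
 assumes "!!i. i < m==>f i\<in>I"
 shows "(\<Oplus>i\<in>{..<m::nat}. f i)\<in>I" "l (\<Oplus>i\<in>{..<m::nat}. f i) = (\<Oplus>\<^bsub>k\<^esub>i\<in>{..<m}. l (f i))"
proof -
 have "(\<Oplus>i\<in>{..<m}. f i)\<in>I & l (\<Oplus>i\<in>{..<m}. f i) = (\<Oplus>\<^bsub>k\<^esub>i\<in>{..<m}. l (f i))"
  using assms
 proof (induction m)
  case 0 then show ?case by (simp add:functional_zero)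
 next
  case (Suc m)
  have ins:"{..<Suc m} = insert m {..<m}" by auto
  have IH:"(\<Oplus>i\<in>{..<m}. f i)\<in>I" "l (\<Oplus>i\<in>{..<m}. f i) = (\<Oplus>\<^bsub>k\<^esub>i\<in>{..<m}. l (f i))"
  using Suc by auto
  have 1:"(\<Oplus>i\<in>{..<Suc m}. f i) = f m \<oplus> (\<Oplus>i\<in>{..<m}. f i)"
  unfolding ins by (rule B.finsum_insert) (use Suc.prems I.Icarr in auto)
  have 2:"(\<Oplus>\<^bsub>k\<^esub>i\<in>{..<Suc m}. l (f i)) = l (f m)+.k (\<Oplus>\<^bsub>k\<^esub>i\<in>{..<m}. l (f i))"
  unfolding ins by (rule k.finsum_insert) (use Suc.prems functionalD(1)[OF l] in auto)
  have fm:"f m\<in>I" using Suc.prems by simp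
  show ?case unfolding 1 2 using IH fm functionalD(2)[OF l fm IH(1)] I.a_closed[OF fm IH(1)] by simp
 qed
 then show "(\<Oplus>i\<in>{..<m}. f i)\<in>I" "l (\<Oplus>i\<in>{..<m}. f i) = (\<Oplus>\<^bsub>k\<^esub>i\<in>{..<m}. l (f i))" by auto
qed

lemma functional_mat_left:
 assumes A:"!!i j. A i j<:B" and D:"!!i j. D i j\<in>I"
 shows "mmul B d A D i j\<in>I" "l (mmul B d A D i j) = mmul k d (mmap r A) (mmap l D) i j"
proof -
 have 1:"A i m \<otimes> D m j\<in>I" for m using I.I_l_closed[OF D A] .
 show "mmul B d A D i j\<in>I" unfolding mmul_def by (rule functional_finsum(1)) (rule 1)
 show "l (mmul B d A D i j) = mmul k d (mmap r A) (mmap l D) i j"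
  unfolding mmul_def mmap_def
  by (subst functional_finsum(2)[OF 1]) (simp add:functionalD(3)[OF l A D])
qed

lemma functional_mat_right:
 assumes A:"!!i j. A i j<:B" and D:"!!i j. D i j\<in>I"
 shows "mmul B d D A i j\<in>I" "l (mmul B d D A i j) = mmul k d (mmap l D) (mmap r A) i j"
proof -
 have 1:"D i m \<otimes> A m j\<in>I" for m using I.I_r_closed[OF D A] .
 show "mmul B d D A i j\<in>I" unfolding mmul_def by (rule functional_finsum(1)) (rule 1)
 show "l (mmul B d D A i j) = mmul k d (mmap l D) (mmap r A) i j"
  unfolding mmul_def mmap_def
  by (subst functional_finsum(2)[OF 1]) (simp add:functional_r[OF A D])
qed

end

end

lemma (in cring) mmul_zero:
 assumes "!!i j. A i j<:R"
 shows "mmul R d A (%i j. \<zero>) = (%i j. \<zero>)" "mmul R d (%i j. \<zero>) A = (%i j. \<zero>)"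
 unfolding mmul_def using assms by (simp_all add: finsum_zero cong: finsum_cong)

lemma (in cring) mmul_add_left:
 assumes "!!i j. A i j<:R" "!!i j. A' i j<:R" "!!i j. D i j<:R"
 shows "mmul R d (%i j. A i j \<oplus> A' i j) D = (%i j. mmul R d A D i j \<oplus> mmul R d A' D i j)"
 unfolding mmul_def using assms by (simp add:l_distr finsum_addf)

lemma (in cring) mmul_add_right:
 assumes "!!i j. A i j<:R" "!!i j. A' i j<:R" "!!i j. D i j<:R"
 shows "mmul R d D (%i j. A i j \<oplus> A' i j) = (%i j. mmul R d D A i j \<oplus> mmul R d D A' i j)"
 unfolding mmul_def using assms by (simp add:r_distr finsum_addf)

section \<open>The deformation problem in coordinates\<close>

text \<open>What the hypotheses of the theorem give, in terms of matrices over \<open>W\<close>. The matrix \<open>\<theta>\<close> witnesses that \<open>V\<close> is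
 projective: its conjugates under \<open>G\<close> sum to 1.\<close>
locale deformation_data = W: p_ring W k res p + G: group G + V': group_module Z G V'
 for W :: "('w,'mw) ring_scheme" and k :: "('k,'l) ring_scheme" and res p
  and G :: "('g,'lg) monoid_scheme" and Z :: "('z,'mz) ring_scheme" and V' :: "('z,'x,'g) gmodule" +
 fixes n d :: nat and \<rho> :: "'g => nat => nat => 'w" and \<psi> :: "'x => nat => nat => 'w" and \<theta> :: "nat => nat => 'k"
 assumes finG:"finite (car G)" and n:"n \<ge> 1"
  and \<rho>_mat:"g<:G==>\<rho> g\<in>rmat W d d"
  and \<rho>_one:"\<rho> 1@G = mone W d"
  and \<rho>_mult:"[|g\<in>car G; h\<in>car G|]==>\<rho> (g*.G h) = mmul W d (\<rho> g) (\<rho> h)"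
  and \<psi>_mat:"x<:V'==>\<psi> x\<in>rmat W d d"
  and \<psi>_add:"[|x\<in>car V'; y\<in>car V'|] ==>
  \<psi> (x+.V' y) i j-.W (\<psi> x i j+.W \<psi> y i j)\<in>W.Pp n"
  and \<psi>_equiv:"[|g\<in>car G; x\<in>car V'|] ==>
  mmul W d (\<rho> g) (\<psi> x) i j-.W mmul W d (\<psi> (act V' g x)) (\<rho> g) i j\<in>W.Pp n"
  and commutator:"\<exists>x\<in>car V'. \<exists>y\<in>car V'. \<exists>i j.
  res (mmul W d (\<psi> x) (\<psi> y) i j) ~= res (mmul W d (\<psi> y) (\<psi> x) i j)"
  and exponent:"x<:V'==>add_pow V' (p ^ n) x = 0@V'"
  and homs_scalar:"[|!!x. x<:V'==>J x\<in>rmat k d d;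
  !!x y. x<:V'==>y<:V'==>J (x+.V' y) = (%a b. J x a b+.k J y a b);
  !!g x. g<:G==>x<:V' ==>
  mmul k d (mmap res (\<rho> g)) (J x) = mmul k d (J (act V' g x)) (mmap res (\<rho> g))|] ==>
  \<exists>c\<in>car k. \<forall>x\<in>car V'. J x = smat k c (mmap res (\<psi> x))"
  and commutant_scalar:"[|A\<in>rmat k d d; !!g. g<:G ==>
  mmul k d (mmap res (\<rho> g)) A = mmul k d A (mmap res (\<rho> g))|] ==>
  \<exists>c\<in>car k. A = smat k c (mone k d)"
  and \<theta>_mat:"\<theta>\<in>rmat k d d"
  and \<theta>_trace:"(\<Oplus>\<^bsub>Mat k d\<^esub>g\<in>car G. mmul k d (mmul k d (mmap res (\<rho> g)) \<theta>)
  (mmap res (\<rho> (~.G g)))) = mone k d"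
begin

lemma unit_entry:"\<exists>x\<in>car V'. EX i j. res (\<psi> x i j) ~= 0@k"
proof (rule ccontr)
 assume "\<not> ?thesis"
 then have z:"mmap res (\<psi> x) = (%i j. 0@k)" if "x<:V'" for x
  using that by (auto simp:mmap_def)
 have kz:"mmul k d (%i j. 0@k) (%i j. 0@k) = (%i j. 0@k)"
  by (rule W.k.mmul_zero) simp
 have "res (mmul W d (\<psi> x) (\<psi> y) i j) = 0@k" if "x<:V'" "y<:V'" for x y i j
 proof -
  have "mmap res (mmul W d (\<psi> x) (\<psi> y)) = mmul k d (mmap res (\<psi> x)) (mmap res (\<psi> y))"
  by (rule W.res.map_mmul) (use rmatD[OF \<psi>_mat] that in auto)
  then show ?thesis using z that kz by (simp add:mmap_def fun_eq_iff)
 qed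
 then show False using commutator by metis
qed

lemma d_pos:"d > 0"
proof (rule ccontr)
 assume "\<not> d > 0"
 then have "\<psi> x i j = 0@W" if "x<:V'" for x i j using \<psi>_mat[OF that] by (simp add:rmat_def)
 then show False using unit_entry W.res.hom_zero by metis
qed

end

locale deformation_over = deformation_data + B: local_over B k r
 for B :: "('b,'mb) ring_scheme" and r +
 fixes \<iota>
 assumes noeth:"noetherian_ring B" and \<iota>_hom:"\<iota>\<in>ring_hom W B"
  and \<iota>_res:"w<:W==>r (\<iota> w) = res w"
begin

sublocale \<iota>: ring_hom_cring W B \<iota>
 by (rule ring_hom_cringI[OF W.is_cring B.is_cring \<iota>_hom])

definition \<rho>B where "\<rho>B g = mmap \<iota> (\<rho> g)"
definition \<psi>B where "\<psi>B x = mmap \<iota> (\<psi> x)"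

lemma \<rho>B_mat:"g<:G==>\<rho>B g\<in>rmat B d d"
 unfolding \<rho>B_def by (rule \<iota>.mmap_rmat[OF \<rho>_mat])

lemma \<psi>B_mat:"x<:V'==>\<psi>B x\<in>rmat B d d"
 unfolding \<psi>B_def by (rule \<iota>.mmap_rmat[OF \<psi>_mat])

lemma r_\<rho>B:"g<:G==>mmap r (\<rho>B g) = mmap res (\<rho> g)"
 using rmatD[OF \<rho>_mat] by (simp add:\<rho>B_def mmap_def \<iota>_res)

lemma r_\<psi>B:"x<:V'==>mmap r (\<psi>B x) = mmap res (\<psi> x)"
 using rmatD[OF \<psi>_mat] by (simp add:\<psi>B_def mmap_def \<iota>_res)

lemma \<rho>B_one:"\<rho>B 1@G = mone B d"
 by (simp add:\<rho>B_def \<rho>_one \<iota>.mmap_one)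

lemma \<rho>B_mult:"g<:G==>h<:G==>\<rho>B (g*.G h) = mmul B d (\<rho>B g) (\<rho>B h)"
 unfolding \<rho>B_def by (subst \<iota>.map_mmul[symmetric]) (auto simp:rmatD[OF \<rho>_mat] \<rho>_mult)

abbreviation pn where "pn \<equiv> \<iota> (W.unif ^.W n)"

lemma pn_closed:"pn<:B" by simp

lemma pn_eq:"pn = add_pow B (p ^ n) 1@B"
proof -
 have "\<iota> (add_pow W m 1@W) = add_pow B m 1@B" for m :: nat
  by (induction m) simp_all
 then show ?thesis by (simp flip: W.unif_pow_eq)
qed

lemma \<iota>_Pp: assumes "w\<in>W.Pp n" shows "\<exists>b\<in>car B. \<iota> w = pn*.B b"
proof -
 obtain v where "v<:W" "w = W.unif ^.W n*.W v" using assms by (auto simp:W.Pp_iff)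
 then show ?thesis by (intro bexI[of _ "\<iota> v"]) auto
qed

lemma \<psi>B_add: assumes "x<:V'" "y<:V'"
 shows "\<exists>b\<in>car B. \<psi>B (x+.V' y) i j = (\<psi>B x i j+.B \<psi>B y i j)+.B pn*.B b"
proof -
 obtain b where b:"b<:B" "\<iota> (\<psi> (x+.V' y) i j-.W (\<psi> x i j+.W \<psi> y i j)) = pn*.B b"
  using \<iota>_Pp[OF \<psi>_add[OF assms]] by blast
 have c:"\<psi> x i j<:W" "\<psi> y i j<:W" "\<psi> (x+.V' y) i j<:W"
  using assms rmatD[OF \<psi>_mat] by auto
 have "\<iota> (\<psi> (x+.V' y) i j)-.B (\<iota> (\<psi> x i j)+.B \<iota> (\<psi> y i j)) = pn*.B b"
  using b c by (simp add:a_minus_def)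
 moreover have "z = u+.B (z-.B u)" if "z<:B" "u<:B" for z u using that by algebra
 ultimately show ?thesis using b(1) c unfolding \<psi>B_def mmap_def
  by (metis \<iota>.hom_closed B.a_closed)
qed

lemma \<psi>B_equiv: assumes g:"g<:G" and x:"x<:V'"
 shows "\<exists>b\<in>car B. mmul B d (\<rho>B g) (\<psi>B x) i j = mmul B d (\<psi>B (act V' g x)) (\<rho>B g) i j+.B pn*.B b"
proof -
 let ?a = "mmul W d (\<rho> g) (\<psi> x) i j" and ?b = "mmul W d (\<psi> (act V' g x)) (\<rho> g) i j"
 note gx = V'.act_closed[OF g x]
 obtain b where b:"b<:B" "\<iota> (?a-.W ?b) = pn*.B b"
  using \<iota>_Pp[OF \<psi>_equiv[OF assms]] by blast
 note c = rmatD[OF \<rho>_mat[OF g]] rmatD[OF \<psi>_mat[OF x]] rmatD[OF \<psi>_mat[OF gx]]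
 have ab:"?a<:W" "?b<:W" by (rule W.mmul_entry_closed; rule c)+
 have "\<iota> ?a-.B \<iota> ?b = pn*.B b" using b ab by (simp add:a_minus_def)
 moreover have "z = u+.B (z-.B u)" if "z<:B" "u<:B" for z u using that by algebra
 moreover have "\<iota> ?a = mmul B d (\<rho>B g) (\<psi>B x) i j" "\<iota> ?b = mmul B d (\<psi>B (act V' g x)) (\<rho>B g) i j"
  using \<iota>.map_mmul[OF c(1,2)] \<iota>.map_mmul[OF c(3,1)] by (simp_all add: \<rho>B_def \<psi>B_def mmap_def fun_eq_iff)
 ultimately show ?thesis using b(1) ab by (metis \<iota>.hom_closed)
qed

text \<open>The heart of the argument: a map \<open>a\<close> for which \<open>x \<mapsto> 1 + a x\<close> is multiplicative and \<open>G\<close>-equivariant is \<open>s \<psi>\<close>.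
 The proof tests \<open>s^2\<close>, \<open>p^n s\<close> and the entries of \<open>D = a - s \<psi>\<close> with functionals \<open>l\<close> on the ideal they generate.\<close>
lemma nilpotent_part:
 assumes a:"!!x. x<:V'==>a x\<in>rmat B d d" and ra:"!!x. x<:V'==>mmap r (a x) = (%i j. 0@k)"
  and a0:"a 0@V' = (%i j. 0@B)"
  and aa:"!!x y. x<:V'==>y<:V' ==>
  a (x+.V' y) = (%i j. (a x i j+.B a y i j)+.B mmul B d (a x) (a y) i j)"
  and ga:"!!g x. g<:G==>x<:V'==>mmul B d (\<rho>B g) (a x) = mmul B d (a (act V' g x)) (\<rho>B g)"
 shows "\<exists>s\<in>car B. r s = 0@k & s*.B s = 0@B & pn*.B s = 0@B \<and>
  (\<forall>x\<in>car V'. a x = smat B s (\<psi>B x))"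
proof -
 obtain x0 i0 j0 where x0:"x0<:V'" and u:"res (\<psi> x0 i0 j0) ~= 0@k" using unit_entry by blast
 define u0 where "u0 = \<psi>B x0 i0 j0"
 have u0c:"u0<:B" unfolding u0_def by (rule rmatD[OF \<psi>B_mat[OF x0]])
 have ru0:"r u0 = res (\<psi> x0 i0 j0)" using r_\<psi>B[OF x0] by (simp add:u0_def mmap_def fun_eq_iff)
 obtain w where w:"w<:B" "u0*.B w = 1@B" using B.r_unit[OF u0c] u ru0 by auto
 define s where "s = a x0 i0 j0*.B w"
 have ac:"a x i j<:B" if "x<:V'" for x i j by (rule rmatD[OF a[OF that]])
 have \<psi>c:"\<psi>B x i j<:B" if "x<:V'" for x i j by (rule rmatD[OF \<psi>B_mat[OF that]])
 have rac:"r (a x i j) = 0@k" if "x<:V'" for x i j using ra[OF that] by (simp add:mmap_def fun_eq_iff)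
 have s:"s<:B" using ac[OF x0] w by (simp add:s_def)
 have rs:"r s = 0@k" using ac[OF x0] w rac[OF x0] by (simp add:s_def)
 have su:"s*.B u0 = a x0 i0 j0"
  using ac[OF x0,of i0 j0] w u0c by (simp add:s_def B.m_assoc B.m_comm[of w u0])
 define D where "D x = (%i j. a x i j-.B s*.B \<psi>B x i j)" for x
 have Dc:"D x i j<:B" if "x<:V'" for x i j using ac[OF that] \<psi>c[OF that] s by (simp add:D_def)
 have D_mat:"D x\<in>rmat B d d" if "x<:V'" for x
  using a[OF that] \<psi>B_mat[OF that] s by (auto simp:D_def rmat_def a_minus_def)
 have aD:"a x i j = D x i j+.B smat B s (\<psi>B x) i j" if "x<:V'" for x i j
  using ac[OF that,of i j] \<psi>c[OF that,of i j] s by (simp add:D_def smat_def a_minus_def B.a_assoc B.l_neg)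
 have aDf:"a x = (%i j. D x i j+.B smat B s (\<psi>B x) i j)" if "x<:V'" for x
  by (intro ext) (rule aD[OF that])
 define X0 where "X0 = {D x i j | x i j. x\<in>car V'} \<union> {s*.B s,pn*.B s}"
 have X0c:"X0 <= car B" using Dc s by (auto simp:X0_def)
 have "X0 <= {0@B}"
 proof (rule B.zero_by_functionals[OF noeth X0c])
  fix l x' assume l:"B.functional (Idl\<^bsub>B\<^esub> X0) l" and x': "x'\<in>X0"
  define I where "I = Idl\<^bsub>B\<^esub> X0"
  have I:"ideal I B" unfolding I_def by (rule B.genideal_ideal[OF X0c])
  interpret I: ideal I B by (rule I)
  have X0I:"X0 <= I" unfolding I_def by (rule B.genideal_self[OF X0c])
  have l:"B.functional I l" using l by (simp add:I_def)
  have DI:"D x i j\<in>I" if "x<:V'" for x i j using X0I that unfolding X0_def by blast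
  have ssI:"s*.B s\<in>I" and psI:"pn*.B s\<in>I" using X0I by (auto simp:X0_def)
  note ladd = B.functionalD(2)[OF l] and lsm = B.functionalD(3)[OF l] and lc = B.functionalD(1)[OF l]
  have lmc:"mmap l (D x) i j<:k" if "x<:V'" for x i j using lc[OF DI[OF that]] by (simp add:mmap_def)
  have \<psi>\<psi>c:"mmul B d (\<psi>B x) (\<psi>B y) i j<:B" if "x<:V'" "y<:V'" for x y i j
  by (rule B.mmul_entry_closed) (use \<psi>c that in auto)
  have prod:"mmul B d (a x) (a y) i j\<in>I \<and>
  l (mmul B d (a x) (a y) i j) = l (s*.B s)*.k r (mmul B d (\<psi>B x) (\<psi>B y) i j)"
  if x:"x<:V'" and y:"y<:V'" for x y i j
  proof -
  let ?S = "%x. smat B s (\<psi>B x)"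
  have Sc:"?S x i j<:B" if "x<:V'" for x i j using \<psi>c[OF that] s by (simp add:smat_def)
  have "mmul B d (a x) (a y) = mmul B d (%i j. D x i j+.B ?S x i j) (a y)" by (rule arg_cong[OF aDf[OF x],of "%A. mmul B d A (a y)"])
  also have "... = (%i j. mmul B d (D x) (a y) i j+.B mmul B d (?S x) (a y) i j)"
  by (rule B.mmul_add_left) (use Dc[OF x] Sc[OF x] ac[OF y] in auto)
  finally have e1:"mmul B d (a x) (a y) i j = mmul B d (D x) (a y) i j+.B mmul B d (?S x) (a y) i j"
  by (simp add:fun_eq_iff)
  have "mmul B d (?S x) (a y) = mmul B d (?S x) (%i j. D y i j+.B ?S y i j)" by (rule arg_cong[OF aDf[OF y]])
  also have "... = (%i j. mmul B d (?S x) (D y) i j+.B mmul B d (?S x) (?S y) i j)"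
  by (rule B.mmul_add_right) (use Dc[OF y] Sc[OF x] Sc[OF y] in auto)
  finally have e2:"mmul B d (?S x) (a y) i j = mmul B d (?S x) (D y) i j+.B mmul B d (?S x) (?S y) i j"
  by (simp add:fun_eq_iff)
  have "mmul B d (?S x) (?S y) = smat B s (smat B s (mmul B d (\<psi>B x) (\<psi>B y)))"
  using B.smmul_l[OF s \<psi>c[OF x] Sc[OF y]] B.smmul_r[OF s \<psi>c[OF x] \<psi>c[OF y]] by simp
  then have e3:"mmul B d (?S x) (?S y) i j = mmul B d (\<psi>B x) (\<psi>B y) i j*.B (s*.B s)"
  using \<psi>\<psi>c[OF x y] s by (simp add:smat_def B.m_ac)
  have m1:"mmul B d (D x) (a y) i j\<in>I" "l (mmul B d (D x) (a y) i j) = 0@k"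
  proof -
  show "mmul B d (D x) (a y) i j\<in>I" by (rule B.functional_mat_right(1)[OF I l ac[OF y] DI[OF x]])
  have "mmul k d (mmap l (D x)) (%i j. 0@k) i j = 0@k"
  using W.k.mmul_zero(1)[of "mmap l (D x)" d] lmc[OF x] by (simp add:fun_eq_iff)
  then show "l (mmul B d (D x) (a y) i j) = 0@k"
  using B.functional_mat_right(2)[OF I l ac[OF y] DI[OF x],where d = d and i = i and j = j] by (simp add:ra[OF y])
  qed
  have rS:"mmap r (?S x) = (%i j. 0@k)" using \<psi>c[OF x] s rs by (simp add:smat_def mmap_def)
  have m2:"mmul B d (?S x) (D y) i j\<in>I" "l (mmul B d (?S x) (D y) i j) = 0@k"
  proof -
  show "mmul B d (?S x) (D y) i j\<in>I" by (rule B.functional_mat_left(1)[OF I l Sc[OF x] DI[OF y]])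
  have "mmul k d (%i j. 0@k) (mmap l (D y)) i j = 0@k"
  using W.k.mmul_zero(2)[of "mmap l (D y)" d] lmc[OF y] by (simp add:fun_eq_iff)
  then show "l (mmul B d (?S x) (D y) i j) = 0@k"
  using B.functional_mat_left(2)[OF I l Sc[OF x] DI[OF y],where d = d and i = i and j = j] by (simp add:rS)
  qed
  have m3:"mmul B d (?S x) (?S y) i j\<in>I" "l (mmul B d (?S x) (?S y) i j) = r (mmul B d (\<psi>B x) (\<psi>B y) i j)*.k l (s*.B s)"
  unfolding e3 by (rule I.I_l_closed[OF ssI \<psi>\<psi>c[OF x y]],rule lsm[OF \<psi>\<psi>c[OF x y] ssI])
  have m4:"mmul B d (?S x) (a y) i j\<in>I" unfolding e2 by (rule I.a_closed[OF m2(1) m3(1)])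
  show ?thesis
  proof
  show "mmul B d (a x) (a y) i j\<in>I" unfolding e1 by (rule I.a_closed[OF m1(1) m4])
  have "l (mmul B d (a x) (a y) i j) = 0@k+.k (0@k+.k r (mmul B d (\<psi>B x) (\<psi>B y) i j)*.k l (s*.B s))"
  unfolding e1 ladd[OF m1(1) m4] m1(2) unfolding e2 ladd[OF m2(1) m3(1)] m2(2) m3(2) ..
  then show "l (mmul B d (a x) (a y) i j) = l (s*.B s)*.k r (mmul B d (\<psi>B x) (\<psi>B y) i j)"
  using lc[OF ssI] \<psi>\<psi>c[OF x y] by (simp add:W.k.m_comm)
  qed
  qed
  have r\<psi>\<psi>: "r (mmul B d (\<psi>B x) (\<psi>B y) i j) = res (mmul W d (\<psi> x) (\<psi> y) i j)"
  if x:"x<:V'" and y:"y<:V'" for x y i j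
  proof -
  note c = rmatD[OF \<psi>_mat[OF x]] rmatD[OF \<psi>_mat[OF y]]
  have "mmul B d (\<psi>B x) (\<psi>B y) i j = \<iota> (mmul W d (\<psi> x) (\<psi> y) i j)"
  using \<iota>.map_mmul[OF c,of d] by (simp add:\<psi>B_def mmap_def fun_eq_iff)
  then show ?thesis using \<iota>_res[OF W.mmul_entry_closed[OF c]] by simp
  qed
  have ls2:"l (s*.B s) = 0@k"
  proof -
  obtain x y i j where xy:"x<:V'" "y<:V'"
  "res (mmul W d (\<psi> x) (\<psi> y) i j) ~= res (mmul W d (\<psi> y) (\<psi> x) i j)" using commutator by blast
  have mc:"mmul B d (a x) (a y) i j<:B" "mmul B d (a y) (a x) i j<:B"
  using prod[OF xy(1,2),of i j] prod[OF xy(2,1),of i j] I.Icarr by blast+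
  have "a (x+.V' y) i j = a (y+.V' x) i j" using xy by (simp add:V'.M.a_comm)
  then have "(a x i j+.B a y i j)+.B mmul B d (a x) (a y) i j = (a x i j+.B a y i j)+.B mmul B d (a y) (a x) i j"
  unfolding aa[OF xy(1,2)] aa[OF xy(2,1)] using ac xy by (simp add:B.a_comm)
  then have "mmul B d (a x) (a y) i j = mmul B d (a y) (a x) i j"
  using ac[OF xy(1),of i j] ac[OF xy(2),of i j] mc by simp
  then have e:"l (s*.B s)*.k res (mmul W d (\<psi> x) (\<psi> y) i j) = l (s*.B s)*.k res (mmul W d (\<psi> y) (\<psi> x) i j)"
  using prod[OF xy(1,2),of i j] prod[OF xy(2,1),of i j] r\<psi>\<psi>[OF xy(1,2)] r\<psi>\<psi>[OF xy(2,1)] by simp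
  have rc:"res (mmul W d (\<psi> x) (\<psi> y) i j)<:k" "res (mmul W d (\<psi> y) (\<psi> x) i j)<:k"
  by (rule W.res.hom_closed,rule W.mmul_entry_closed; rule rmatD[OF \<psi>_mat]; rule xy)+
  show ?thesis using e rc xy(3) lc[OF ssI] W.k.m_lcancel by blast
  qed
  have prod0:"mmul B d (a x) (a y) i j\<in>I" "l (mmul B d (a x) (a y) i j) = 0@k"
  if "x<:V'" "y<:V'" for x y i j
  using prod[OF that,of i j] ls2 \<psi>\<psi>c[OF that] by simp_all
  have lps:"l (pn*.B s) = 0@k"
  proof -
  have mult:"\<exists>q\<in>I. l q = 0@k & a (add_pow V' m x0) i0 j0 = (add_pow B m 1@B*.B a x0 i0 j0)+.B q" for m :: nat
  proof (induction m)
  case 0 then show ?case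
  using B.functional_zero[OF I l] ac[OF x0] by (intro bexI[of _ "0@B"]) (simp_all add: a0)
  next
  case (Suc m)
  then obtain q where q:"q\<in>I" "l q = 0@k" "a (add_pow V' m x0) i0 j0 = (add_pow B m 1@B*.B a x0 i0 j0)+.B q" by blast
  have mx:"add_pow V' m x0<:V'" using x0 by simp
  let ?t = "mmul B d (a (add_pow V' m x0)) (a x0) i0 j0"
  have t:"?t\<in>I" "l ?t = 0@k" by (rule prod0[OF mx x0])+
  have "a (add_pow V' (Suc m) x0) i0 j0 = (a (add_pow V' m x0) i0 j0+.B a x0 i0 j0)+.B ?t"
  using aa[OF mx x0] by simp
  also have "... = ((add_pow B m 1@B*.B a x0 i0 j0+.B q)+.B a x0 i0 j0)+.B ?t" unfolding q(3) ..
  also have "... = (add_pow B (Suc m) 1@B*.B a x0 i0 j0)+.B (q+.B ?t)"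
  proof -
  have "((c*.B y+.B q)+.B y)+.B z = ((c+.B 1@B)*.B y)+.B (q+.B z)"
  if "c<:B" "y<:B" "q<:B" "z<:B" for c y q z
  using that by algebra
  then show ?thesis using ac[OF x0,of i0 j0] I.Icarr[OF q(1)] I.Icarr[OF t(1)] by simp
  qed
  finally show ?case
  using I.a_closed[OF q(1) t(1)] ladd[OF q(1) t(1)] q(2) t(2) by (intro bexI[of _ "q+.B ?t"]) simp_all
  qed
  obtain q where q:"q\<in>I" "l q = 0@k" "0@B = (pn*.B a x0 i0 j0)+.B q"
  using mult[of "p ^ n"] exponent[OF x0] a0 unfolding pn_eq by auto
  have pa:"pn*.B a x0 i0 j0 = u0*.B (pn*.B s)"
  unfolding su[symmetric] using s u0c pn_closed by algebra
  have paI:"u0*.B (pn*.B s)\<in>I" by (rule I.I_l_closed[OF psI u0c])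
  have "0@k = l (u0*.B (pn*.B s)+.B q)" using q(3) B.functional_zero[OF I l] unfolding pa by metis
  also have "... = r u0*.k l (pn*.B s)" using ladd[OF paI q(1)] q(2) lsm[OF u0c psI] lc[OF psI] u0c by simp
  finally show ?thesis using u ru0 lc[OF psI] u0c W.k.integral[of "r u0" "l (pn*.B s)"] by (metis B.r.hom_closed)
  qed
  have lpsb:"(pn*.B s)*.B b\<in>I" "l ((pn*.B s)*.B b) = 0@k" if "b<:B" for b
  using I.I_r_closed[OF psI that] B.functional_r[OF I l that psI] lps that by simp_all
  have lmin:"l (-:B x) = -:k l x" if "x\<in>I" for x by (rule B.functional_uminus[OF I l that])
  define J where "J x = mmap l (D x)" for x
  have Jij:"J x i j = l (D x i j)" for x i j by (simp add:J_def mmap_def)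
  have J_mat:"J x\<in>rmat k d d" if x:"x<:V'" for x
  using D_mat[OF x] lc[OF DI[OF x]] B.functional_zero[OF I l] by (auto simp:rmat_def Jij)
  have J_add:"J (x+.V' y) = (%i j. J x i j+.k J y i j)" if x:"x<:V'" and y:"y<:V'" for x y
  proof (intro ext)
  fix i j
  have xy:"x+.V' y<:V'" using x y by simp
  obtain b where b:"b<:B" "\<psi>B (x+.V' y) i j = (\<psi>B x i j+.B \<psi>B y i j)+.B pn*.B b"
  using \<psi>B_add[OF x y] by blast
  let ?t = "mmul B d (a x) (a y) i j"
  have t:"?t\<in>I" "l ?t = 0@k" by (rule prod0[OF x y])+
  have "D (x+.V' y) i j = ((a x i j+.B a y i j)+.B ?t)-.B s*.B ((\<psi>B x i j+.B \<psi>B y i j)+.B pn*.B b)"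
  unfolding D_def b(2) aa[OF x y] ..
  also have "... = (D x i j+.B D y i j)+.B (?t+.B -:B ((pn*.B s)*.B b))"
  proof -
  have "((a1+.B a2)+.B t)-.B s*.B ((c1+.B c2)+.B q*.B b) =
  ((a1-.B s*.B c1)+.B (a2-.B s*.B c2))+.B (t+.B -:B ((q*.B s)*.B b))"
  if "a1<:B" "a2<:B" "t<:B" "c1<:B" "c2<:B" "q<:B" for a1 a2 t c1 c2 q
  using that s b(1) by algebra
  note alg = this
  show ?thesis unfolding D_def by (rule alg[OF ac[OF x] ac[OF y] I.Icarr[OF t(1)] \<psi>c[OF x] \<psi>c[OF y] pn_closed])
  qed
  finally have e:"D (x+.V' y) i j = (D x i j+.B D y i j)+.B (?t+.B -:B ((pn*.B s)*.B b))" .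
  have m:"-:B ((pn*.B s)*.B b)\<in>I" "l (-:B ((pn*.B s)*.B b)) = 0@k"
  using I.a_inv_closed[OF lpsb(1)[OF b(1)]] lmin[OF lpsb(1)[OF b(1)]] lpsb(2)[OF b(1)] by simp_all
  show "J (x+.V' y) i j = J x i j+.k J y i j"
  unfolding Jij e ladd[OF I.a_closed[OF DI[OF x] DI[OF y]] I.a_closed[OF t(1) m(1)]] ladd[OF t(1) m(1)] ladd[OF DI[OF x] DI[OF y]] t(2) m(2)
  using lc[OF DI[OF x]] lc[OF DI[OF y]] by simp
  qed
  have J_equiv:"mmul k d (mmap res (\<rho> g)) (J x) = mmul k d (J (act V' g x)) (mmap res (\<rho> g))"
  if g:"g<:G" and x:"x<:V'" for g x
  proof (intro ext)
  fix i j
  have gx:"act V' g x<:V'" by (rule V'.act_closed[OF g x])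
  note \<rho>c = rmatD[OF \<rho>B_mat[OF g]]
  obtain b where b:"b<:B" "mmul B d (\<rho>B g) (\<psi>B x) i j = mmul B d (\<psi>B (act V' g x)) (\<rho>B g) i j+.B pn*.B b"
  using \<psi>B_equiv[OF g x] by blast
  define z1 z2 z3 z4 z5 where z:"z1 = mmul B d (\<rho>B g) (D x) i j" "z2 = mmul B d (D (act V' g x)) (\<rho>B g) i j"
  "z3 = mmul B d (\<rho>B g) (\<psi>B x) i j" "z4 = mmul B d (\<psi>B (act V' g x)) (\<rho>B g) i j" "z5 = mmul B d (\<rho>B g) (a x) i j"
  have zc:"z1<:B" "z2<:B" "z3<:B" "z4<:B"
  unfolding z by (rule B.mmul_entry_closed; use \<rho>c Dc[OF x] Dc[OF gx] \<psi>c[OF x] \<psi>c[OF gx] in auto)+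
  have "z5 = z1+.B s*.B z3"
  proof -
  have "mmul B d (\<rho>B g) (a x) = mmul B d (\<rho>B g) (%i j. D x i j+.B smat B s (\<psi>B x) i j)" by (rule arg_cong[OF aDf[OF x]])
  also have "... = (%i j. mmul B d (\<rho>B g) (D x) i j+.B mmul B d (\<rho>B g) (smat B s (\<psi>B x)) i j)"
  by (rule B.mmul_add_right) (use \<rho>c Dc[OF x] \<psi>c[OF x] s in \<open>auto simp:smat_def\<close>)
  finally show ?thesis using B.smmul_r[OF s \<rho>c \<psi>c[OF x]] by (simp add:z smat_def)
  qed
  moreover have "z5 = z2+.B s*.B z4"
  proof -
  have "mmul B d (a (act V' g x)) (\<rho>B g) = mmul B d (%i j. D (act V' g x) i j+.B smat B s (\<psi>B (act V' g x)) i j) (\<rho>B g)" by (rule arg_cong[OF aDf[OF gx],of "%A. mmul B d A (\<rho>B g)"])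
  also have "... = (%i j. mmul B d (D (act V' g x)) (\<rho>B g) i j+.B mmul B d (smat B s (\<psi>B (act V' g x))) (\<rho>B g) i j)"
  by (rule B.mmul_add_left) (use \<rho>c Dc[OF gx] \<psi>c[OF gx] s in \<open>auto simp:smat_def\<close>)
  finally show ?thesis using B.smmul_l[OF s \<psi>c[OF gx] \<rho>c] ga[OF g x] by (simp add:z smat_def)
  qed
  moreover have "z3 = z4+.B pn*.B b" using b(2) by (simp add:z)
  ultimately have "z1+.B s*.B (z4+.B pn*.B b) = z2+.B s*.B z4" by simp
  moreover have "z1+.B s*.B (z4+.B pn*.B b) = (z1+.B (pn*.B s)*.B b)+.B s*.B z4"
  using zc s b(1) pn_closed by algebra
  ultimately have z12:"z1+.B (pn*.B s)*.B b = z2" using zc s b(1) by simp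
  have z1:"z1\<in>I" "l z1 = mmul k d (mmap res (\<rho> g)) (J x) i j"
  unfolding z J_def r_\<rho>B[OF g,symmetric] by (rule B.functional_mat_left[OF I l \<rho>c DI[OF x]])+
  have z2:"l z2 = mmul k d (J (act V' g x)) (mmap res (\<rho> g)) i j"
  unfolding z J_def r_\<rho>B[OF g,symmetric] by (rule B.functional_mat_right(2)[OF I l \<rho>c DI[OF gx]])
  have "l z2 = l z1" unfolding z12[symmetric] ladd[OF z1(1) lpsb(1)[OF b(1)]] lpsb(2)[OF b(1)] using lc[OF z1(1)] by simp
  then show "mmul k d (mmap res (\<rho> g)) (J x) i j = mmul k d (J (act V' g x)) (mmap res (\<rho> g)) i j"
  unfolding z1 z2 by simp
  qed
  obtain c where c:"c<:k" "!!x. x<:V'==>J x = smat k c (mmap res (\<psi> x))"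
  using homs_scalar[OF J_mat J_add J_equiv] by blast
  have "D x0 i0 j0 = 0@B" using su ac[OF x0,of i0 j0] by (simp add:D_def u0_def[symmetric] a_minus_def B.r_neg)
  then have "c*.k res (\<psi> x0 i0 j0) = 0@k"
  using c(2)[OF x0] B.functional_zero[OF I l] Jij[of x0 i0 j0] by (simp add:smat_def mmap_def)
  then have c0:"c = 0@k" using u c(1) W.k.integral W.res.hom_closed[OF rmatD[OF \<psi>_mat[OF x0]]] by blast
  have "l (D x i j) = 0@k" if x:"x<:V'" for x i j
  using c(2)[OF x] W.res.hom_closed[OF rmatD[OF \<psi>_mat[OF x]]] unfolding Jij[symmetric] by (simp add:c0 smat_def mmap_def)
  then show "l x' = 0@k" using x' ls2 lps by (auto simp:X0_def)
 qed
 then have z:"D x i j = 0@B" "s*.B s = 0@B" "pn*.B s = 0@B" if "x<:V'" for x i j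
  using that unfolding X0_def by blast+
 have "a x = smat B s (\<psi>B x)" if x:"x<:V'" for x
  using aD[OF x] z(1)[OF x] \<psi>c[OF x] s by (simp add:fun_eq_iff smat_def)
 then show ?thesis using s rs z(2,3)[OF x0] by blast
qed

end

section \<open>Deformations of the inflated representation\<close>

lemma semidirect_sel:
 "car (semidirect K G \<delta>) = car K \<times> car G"
 "(x,g)*.(semidirect K G \<delta>) (y,h) = (x*.K \<delta> g y,g*.G h)"
 "1@(semidirect K G \<delta>) = (1@K,1@G)"
 by (simp_all add: semidirect_def)

context group_module
begin

lemma act_zero: assumes g:"g<:G" shows "act M g 0@M = 0@M"
proof -
 have "act M g 0@M = act M g (\<zero> *:M 0@M)" by simp
 also have "... = 0@M" using act_closed[OF g M.zero_closed] by (simp only: act_smult[OF g R.zero_closed M.zero_closed] smult_l_null)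
 finally show ?thesis .
qed

lemma group_semidirect:"group (semidirect (add_monoid M) G (act M))"
proof (rule groupI)
 fix a assume "a<:(semidirect (add_monoid M) G (act M))"
 then obtain x g where a:"a = (x,g)" "x<:M" "g<:G" by (auto simp:semidirect_sel)
 show "1@(semidirect (add_monoid M) G (act M))*.(semidirect (add_monoid M) G (act M)) a = a"
  using a by (simp add:semidirect_sel act_one)
 have "act M (~.G g) (-:M x)+.M act M (~.G g) x = act M (~.G g) (-:M x+.M x)"
  using a by (simp add:act_add)
 also have "... = 0@M" using a by (simp add:M.l_neg act_zero)
 finally show "\<exists>b\<in>car (semidirect (add_monoid M) G (act M)). b*.(semidirect (add_monoid M) G (act M)) a = 1@(semidirect (add_monoid M) G (act M))"
  using a by (intro bexI[of _ "(act M (~.G g) (-:M x),~.G g)"]) (auto simp:semidirect_sel act_closed)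
 fix b assume "b<:(semidirect (add_monoid M) G (act M))"
 then obtain y h where b:"b = (y,h)" "y<:M" "h<:G" by (auto simp:semidirect_sel)
 show "a*.(semidirect (add_monoid M) G (act M)) b<:(semidirect (add_monoid M) G (act M))"
  using a b by (simp add:semidirect_sel act_closed)
 fix c assume "c<:(semidirect (add_monoid M) G (act M))"
 then obtain z l where c:"c = (z,l)" "z<:M" "l<:G" by (auto simp:semidirect_sel)
 show "a*.(semidirect (add_monoid M) G (act M)) b*.(semidirect (add_monoid M) G (act M)) c =
  a*.(semidirect (add_monoid M) G (act M)) (b*.(semidirect (add_monoid M) G (act M)) c)"
  using a b c by (simp add:semidirect_sel act_closed act_add act_mult M.a_assoc G.m_assoc)
qed (auto simp:semidirect_sel)

end

lemma (in ring) unipotent_mult: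
 assumes "A<:R" "C<:R" "S<:R" "T<:R" "T'<:R"
  and AT:"A \<otimes> T = T' \<otimes> A" and ST:"S \<otimes> T' = \<zero>"
 shows "((\<one> \<oplus> S) \<otimes> A) \<otimes> ((\<one> \<oplus> T) \<otimes> C) = (\<one> \<oplus> (S \<oplus> T')) \<otimes> (A \<otimes> C)"
proof -
 have "((\<one> \<oplus> S) \<otimes> A) \<otimes> ((\<one> \<oplus> T) \<otimes> C) = (\<one> \<oplus> S) \<otimes> ((A \<oplus> A \<otimes> T) \<otimes> C)" using assms(1-5) by algebra
 also have "... = ((\<one> \<oplus> S) \<oplus> (T' \<oplus> S \<otimes> T')) \<otimes> (A \<otimes> C)" unfolding AT using assms(1-5) by algebra
 also have "... = (\<one> \<oplus> (S \<oplus> T')) \<otimes> (A \<otimes> C)" unfolding ST using assms(1-5) by algebra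
 finally show ?thesis .
qed

lemma (in ring) one_plus_mult:
 assumes "A<:R" "C<:R"
 shows "A \<otimes> C \<ominus> \<one> = ((A \<ominus> \<one>) \<oplus> (C \<ominus> \<one>)) \<oplus> (A \<ominus> \<one>) \<otimes> (C \<ominus> \<one>)"
proof -
 have "(A \<ominus> \<one>) \<otimes> (C \<ominus> \<one>) = A \<otimes> C \<oplus> ((\<ominus> (A \<otimes> \<one>) \<ominus> C) \<oplus> \<one>)" using assms by algebra
 then show ?thesis unfolding r_one[OF assms(1)] using assms by algebra
qed

lemma (in ring) conj_minus_one:
 assumes "A<:R" "C<:R" "D<:R" "A \<otimes> C = D \<otimes> A"
 shows "A \<otimes> (C \<ominus> \<one>) = (D \<ominus> \<one>) \<otimes> A"
 using assms by (simp add:a_minus_def r_distr l_distr r_minus l_minus)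

text \<open>Averaging over a finite group turns any matrix into an intertwiner.\<close>

lemma (in cring) averaged_intertwiner:
 assumes G:"group G" "finite (car G)"
  and \<alpha>: "!!g. g<:G==>\<alpha> g\<in>rmat R d d"
  "!!g h. g<:G==>h<:G==>\<alpha> (g*.G h) = mmul R d (\<alpha> g) (\<alpha> h)"
  and \<beta>: "!!g. g<:G==>\<beta> g\<in>rmat R d d"
  "!!g h. g<:G==>h<:G==>\<beta> (g*.G h) = mmul R d (\<beta> g) (\<beta> h)"
  and T:"T\<in>rmat R d d"
 defines "P \<equiv> (\<Oplus>\<^bsub>Mat R d\<^esub>g\<in>car G. mmul R d (mmul R d (\<alpha> g) T) (\<beta> (~.G g)))"
 shows "P\<in>rmat R d d" "h<:G==>mmul R d (\<alpha> h) P = mmul R d P (\<beta> h)"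
proof -
 interpret G: group G by (rule G)
 interpret M: ring "Mat R d" by (rule ring_Mat)
 let ?M = "Mat R d"
 define F where "F g = mmul R d (mmul R d (\<alpha> g) T) (\<beta> (~.G g))" for g
 have F:"F g<:?M" if "g<:G" for g
  unfolding F_def using that by (auto intro!: mmul_rmat[where b = d and b' = d] \<alpha> \<beta> T)
 have P_eq:"P = finsum ?M F (car G)" unfolding P_def F_def by simp
 show P:"P\<in>rmat R d d"
  unfolding P_eq using M.finsum_closed[of F "car G"] F by auto
 assume h:"h<:G"
 have "mmul R d (\<alpha> h) P = \<alpha> h*.?M finsum ?M F (car G)" by (simp add:P_eq)
 also have "... = finsum ?M (%g. \<alpha> h*.?M F g) (car G)"
  by (rule M.finsum_rdistr) (use G F \<alpha>(1)[OF h] in auto)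
 also have "... = finsum ?M (%g. F (h*.G g)*.?M \<beta> h) (car G)"
 proof (rule M.finsum_cong'[OF refl])
  show "(%g. F (h*.G g)*.?M \<beta> h)\<in>car G \<rightarrow> car ?M"
  using F \<beta>(1)[OF h] h M.m_closed by (auto simp del: Mat_sel(2))
  fix g assume g:"g<:G"
  have hg:"h*.G g<:G" using g h by simp
  have "\<beta> (~.G (h*.G g))*.?M \<beta> h = \<beta> (~.G (h*.G g)*.G h)"
  using h g by (simp add:\<beta>(2))
  also have "~.G (h*.G g)*.G h = ~.G g" using h g by (simp add:G.inv_mult_group G.m_assoc)
  finally have b:"\<beta> (~.G (h*.G g))*.?M \<beta> h = \<beta> (~.G g)" .
  have a:"\<alpha> h*.?M \<alpha> g = \<alpha> (h*.G g)" using h g by (simp add:\<alpha>(2))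
  have cl:"\<alpha> h<:?M" "\<alpha> g<:?M" "T<:?M" "\<alpha> (h*.G g)<:?M" "\<beta> h<:?M"
  "\<beta> (~.G g)<:?M" "\<beta> (~.G (h*.G g))<:?M"
  using g h hg by (auto intro: \<alpha> \<beta> T)
  have Fg:"F g = (\<alpha> g*.?M T)*.?M \<beta> (~.G g)" for g by (simp add:F_def)
  have "\<alpha> h*.?M F g = ((\<alpha> h*.?M \<alpha> g)*.?M T)*.?M \<beta> (~.G g)"
  unfolding Fg using cl by (simp only: M.m_assoc M.m_closed)
  also have "... = F (h*.G g)*.?M \<beta> h"
  unfolding Fg a b[symmetric] using cl by (simp only: M.m_assoc M.m_closed)
  finally show "\<alpha> h*.?M F g = F (h*.G g)*.?M \<beta> h" .
 qed
 also have "... = finsum ?M (%g. F g*.?M \<beta> h) ((%g. h*.G g) ` car G)"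
  by (rule M.finsum_reindex[symmetric])
  (use F \<beta>(1)[OF h] h M.m_closed in \<open>auto simp del: Mat_sel(2) intro!: inj_onI\<close>)
 also have "(%g. h*.G g) ` car G = car G" using G.surj_const_mult[OF h] .
 also have "finsum ?M (%g. F g*.?M \<beta> h) (car G) = finsum ?M F (car G)*.?M \<beta> h"
  by (rule M.finsum_ldistr[symmetric]) (use G F \<beta>(1)[OF h] in auto)
 finally show "mmul R d (\<alpha> h) P = mmul R d P (\<beta> h)" by (simp add:P_eq)
qed

context deformation_over
begin

abbreviation "\<Gamma> \<equiv> semidirect (add_monoid V') G (act V')"

sublocale MB: ring "Mat B d" by (rule B.ring_Mat)

text \<open>The representation \<open>(x, g) \<mapsto> (1 + s \<psi>(x)) \<rho>(g)\<close>.\<close>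
definition sig where
 "sig s \<gamma> = mmul B d (%i j. mone B d i j+.B smat B s (\<psi>B (fst \<gamma>)) i j) (\<rho>B (snd \<gamma>))"

definition admissible where
 "admissible s \<longleftrightarrow> s<:B & r s = 0@k & s*.B s = 0@B & pn*.B s = 0@B"

lemma sig_ring:"sig s (x,g) = (1@(Mat B d)+.(Mat B d) smat B s (\<psi>B x))*.(Mat B d) \<rho>B g"
 by (simp add:sig_def)

context
 fixes s assumes s:"admissible s"
begin

lemma s_closed:"s<:B" using s by (simp add:admissible_def)

lemma S_mat:"x<:V'==>smat B s (\<psi>B x)\<in>rmat B d d"
 by (rule B.smat_rmat[OF s_closed \<psi>B_mat])

lemma S_mult: assumes x:"x<:V'" and y:"y<:V'"
 shows "mmul B d (smat B s (\<psi>B x)) (smat B s (\<psi>B y)) = (%i j. 0@B)"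
proof -
 note c = rmatD[OF \<psi>B_mat[OF x]] rmatD[OF \<psi>B_mat[OF y]]
 have m:"mmul B d (\<psi>B x) (\<psi>B y) i j<:B" for i j by (rule B.mmul_entry_closed; rule c)
 have "mmul B d (smat B s (\<psi>B x)) (smat B s (\<psi>B y)) = smat B s (smat B s (mmul B d (\<psi>B x) (\<psi>B y)))"
  using B.smmul_l[OF s_closed c(1) rmatD[OF S_mat[OF y]]] B.smmul_r[OF s_closed c] by simp
 also have "... = smat B (s*.B s) (mmul B d (\<psi>B x) (\<psi>B y))"
  by (rule B.smat_smat[OF s_closed s_closed m])
 finally show ?thesis using s m by (simp add:admissible_def smat_def)
qed

lemma S_pn:"b<:B==>s*.B (pn*.B b) = 0@B"
proof -
 assume b:"b<:B"
 have "s*.B (pn*.B b) = (pn*.B s)*.B b" using b s_closed pn_closed by algebra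
 then show ?thesis using s b by (simp add:admissible_def)
qed

lemma S_add: assumes x:"x<:V'" and y:"y<:V'"
 shows "smat B s (\<psi>B (x+.V' y)) = smat B s (\<psi>B x)+.(Mat B d) smat B s (\<psi>B y)"
proof -
 have "s*.B \<psi>B (x+.V' y) i j = s*.B \<psi>B x i j+.B s*.B \<psi>B y i j" for i j
 proof -
  obtain b where b:"b<:B" "\<psi>B (x+.V' y) i j = (\<psi>B x i j+.B \<psi>B y i j)+.B pn*.B b"
  using \<psi>B_add[OF x y] by blast
  show ?thesis unfolding b(2)
  using rmatD[OF \<psi>B_mat[OF x],of i j] rmatD[OF \<psi>B_mat[OF y],of i j] b(1) s_closed S_pn[OF b(1)] pn_closed by (simp add:B.r_distr)
 qed
 then show ?thesis by (simp add:smat_def)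
qed

lemma S_equiv: assumes g:"g<:G" and x:"x<:V'"
 shows "\<rho>B g*.(Mat B d) smat B s (\<psi>B x) = smat B s (\<psi>B (act V' g x))*.(Mat B d) \<rho>B g"
proof -
 have gx:"act V' g x<:V'" by (rule V'.act_closed[OF g x])
 note c = rmatD[OF \<rho>B_mat[OF g]] rmatD[OF \<psi>B_mat[OF x]] rmatD[OF \<psi>B_mat[OF gx]]
 have "s*.B mmul B d (\<rho>B g) (\<psi>B x) i j = s*.B mmul B d (\<psi>B (act V' g x)) (\<rho>B g) i j" for i j
 proof -
  obtain b where b:"b<:B" "mmul B d (\<rho>B g) (\<psi>B x) i j = mmul B d (\<psi>B (act V' g x)) (\<rho>B g) i j+.B pn*.B b"
  using \<psi>B_equiv[OF g x] by blast
  have m:"mmul B d (\<psi>B (act V' g x)) (\<rho>B g) i j<:B" by (rule B.mmul_entry_closed; rule c)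
  show ?thesis unfolding b(2) using b(1) s_closed m S_pn[OF b(1)] pn_closed by (simp add:B.r_distr)
 qed
 then show ?thesis
  by (simp add:B.smmul_r[OF s_closed c(1,2)] B.smmul_l[OF s_closed c(3,1)]) (simp add:smat_def)
qed

lemma S_zero:"smat B s (\<psi>B 0@V') = 0@(Mat B d)"
proof -
 have "smat B s (\<psi>B 0@V')+.(Mat B d) smat B s (\<psi>B 0@V') = smat B s (\<psi>B 0@V')"
  using S_add[of "0@V'" "0@V'"] by simp
 moreover have "smat B s (\<psi>B 0@V')<:(Mat B d)" using S_mat by simp
 ultimately show ?thesis by (metis MB.add.l_cancel_one')
qed

lemma sig_zero: assumes "g<:G" shows "sig s (0@V',g) = \<rho>B g"
proof -
 have "\<rho>B g<:(Mat B d)" using \<rho>B_mat[OF assms] by simp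
 then show ?thesis unfolding sig_ring S_zero by (simp only: MB.r_zero MB.one_closed MB.l_one)
qed

lemma sig_mat: assumes "\<gamma><:\<Gamma>" shows "sig s \<gamma>\<in>rmat B d d"
proof -
 obtain x g where g:"\<gamma> = (x,g)" "x<:V'" "g<:G" using assms by (auto simp:semidirect_sel)
 have "sig s (x,g)<:(Mat B d)"
  unfolding sig_ring by (intro MB.m_closed MB.a_closed MB.one_closed) (use S_mat \<rho>B_mat g in auto)
 then show ?thesis by (simp add:g)
qed

lemma sig_one:"sig s 1@\<Gamma> = mone B d"
 using sig_zero[OF G.one_closed] by (simp add:semidirect_sel \<rho>B_one)

lemma sig_mult:
 assumes "\<gamma><:\<Gamma>" "\<delta><:\<Gamma>"
 shows "sig s (\<gamma> *.\<Gamma> \<delta>) = mmul B d (sig s \<gamma>) (sig s \<delta>)"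
proof -
 obtain x g where g:"\<gamma> = (x,g)" "x<:V'" "g<:G" using assms by (auto simp:semidirect_sel)
 obtain y h where h:"\<delta> = (y,h)" "y<:V'" "h<:G" using assms by (auto simp:semidirect_sel)
 have gy:"act V' g y<:V'" by (rule V'.act_closed[OF g(3) h(2)])
 have "sig s (x,g)*.(Mat B d) sig s (y,h) =
  (1@(Mat B d)+.(Mat B d) (smat B s (\<psi>B x)+.(Mat B d) smat B s (\<psi>B (act V' g y))))*.(Mat B d) (\<rho>B g*.(Mat B d) \<rho>B h)"
  unfolding sig_ring
  by (rule MB.unipotent_mult) (use S_mat[OF g(2)] S_mat[OF h(2)] S_mat[OF gy] \<rho>B_mat[OF g(3)] \<rho>B_mat[OF h(3)] S_equiv[OF g(3) h(2)] S_mult[OF g(2) gy] in auto)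
 also have "\<rho>B g*.(Mat B d) \<rho>B h = \<rho>B (g*.G h)" using g h by (simp add:\<rho>B_mult)
 also have "smat B s (\<psi>B x)+.(Mat B d) smat B s (\<psi>B (act V' g y)) = smat B s (\<psi>B (x+.V' act V' g y))"
  by (rule S_add[OF g(2) gy,symmetric])
 finally show ?thesis unfolding sig_ring[symmetric] by (simp add:g h semidirect_sel)
qed

lemma sig_reduces: assumes "\<gamma><:\<Gamma>" shows "mmap r (sig s \<gamma>) = mmap res (\<rho> (snd \<gamma>))"
proof -
 obtain x g where g:"\<gamma> = (x,g)" "x<:V'" "g<:G" using assms by (auto simp:semidirect_sel)
 note c = rmatD[OF \<psi>B_mat[OF g(2)]] rmatD[OF \<rho>B_mat[OF g(3)]]
 have oc:"mone B d i j<:B" "mone k d i j<:k" for i j by (simp_all add: mone_def)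
 let ?U = "%i j. mone B d i j+.B smat B s (\<psi>B x) i j"
 have "mmap r ?U = mone k d"
  using oc c(1) s s_closed fun_cong[OF fun_cong[OF B.r.mmap_one[of d]]]
  by (simp add:mmap_def smat_def admissible_def fun_eq_iff)
 then have "mmap r (mmul B d ?U (\<rho>B g)) = mmul k d (mone k d) (mmap r (\<rho>B g))"
  using oc c s_closed by (subst B.r.map_mmul) (auto simp:smat_def)
 also have "... = mmap r (\<rho>B g)" by (rule W.k.mone_mult[OF B.r.mmap_rmat[OF \<rho>B_mat[OF g(3)]]])
 finally show ?thesis by (simp add:g sig_def r_\<rho>B)
qed

end

text \<open>Subtract from \<open>P\<close> its corner entry times 1. A functional on the ideal generated by the entries of the difference gives
 an endomorphism of \<open>V\<close>, that is, a scalar matrix, whose corner entry is 0.\<close>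
lemma commutant_scalar_B:
 assumes P:"P\<in>rmat B d d" and comm:"!!g. g<:G==>mmul B d (\<rho>B g) P = mmul B d P (\<rho>B g)"
 shows "P = smat B (P 0 0) (mone B d)"
proof -
 note Pc = rmatD[OF P]
 define D where "D = (%i j. P i j-.B smat B (P 0 0) (mone B d) i j)"
 have oc:"mone B d i j<:B" for i j by (simp add:mone_def)
 have Sm:"smat B (P 0 0) (mone B d)\<in>rmat B d d" by (rule B.smat_rmat[OF Pc B.mone_rmat])
 note Sc = rmatD[OF Sm]
 have D_ring:"D = P-.(Mat B d) smat B (P 0 0) (mone B d)"
  unfolding D_def by (intro ext) (rule B.Mat_minus[OF P Sm,symmetric])
 have D:"D\<in>rmat B d d" using MB.minus_closed[of P "smat B (P 0 0) (mone B d)"] P Sm unfolding D_ring by simp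
 note Dc = rmatD[OF D]
 have Dcomm:"mmul B d (\<rho>B g) D = mmul B d D (\<rho>B g)" if g:"g<:G" for g
 proof -
  note \<rho>c = rmatD[OF \<rho>B_mat[OF g]]
  have 1:"\<rho>B g*.(Mat B d) smat B (P 0 0) (mone B d) = smat B (P 0 0) (mone B d)*.(Mat B d) \<rho>B g"
  using B.smmul_r[OF Pc \<rho>c oc] B.smmul_l[OF Pc oc \<rho>c] B.mmul_one[OF \<rho>B_mat[OF g]] B.mone_mult[OF \<rho>B_mat[OF g]] by simp
  have 2:"\<rho>B g*.(Mat B d) P = P*.(Mat B d) \<rho>B g" using comm[OF g] by simp
  have cl:"\<rho>B g<:(Mat B d)" "P<:(Mat B d)" "smat B (P 0 0) (mone B d)<:(Mat B d)"
  using \<rho>B_mat[OF g] P Sm by auto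
  have "\<rho>B g*.(Mat B d) D = D*.(Mat B d) \<rho>B g"
  unfolding D_ring using cl 1 2 by (simp add:a_minus_def MB.r_distr MB.l_distr MB.r_minus MB.l_minus del: Mat_sel)
  then show ?thesis by simp
 qed
 have D00:"D 0 0 = 0@B"
  using d_pos Pc[of 0 0] by (simp add:D_def smat_def mone_def a_minus_def B.r_neg)
 let ?X = "{D i j | i j. True}"
 have Xc:"?X <= car B" using Dc by auto
 have "?X <= {0@B}"
 proof (rule B.zero_by_functionals[OF noeth Xc])
  fix l y assume l': "B.functional (Idl\<^bsub>B\<^esub> ?X) l" and y:"y\<in>?X"
  define I where "I = Idl\<^bsub>B\<^esub> ?X"
  have I:"ideal I B" unfolding I_def by (rule B.genideal_ideal[OF Xc])
  have l:"B.functional I l" using l' by (simp add:I_def)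
  have DI:"D i j\<in>I" for i j using B.genideal_self[OF Xc] unfolding I_def by blast
  have lm:"mmap l D\<in>rmat k d d"
  using D B.functionalD(1)[OF l DI] B.functional_zero[OF I l] by (auto simp:rmat_def mmap_def)
  have "mmul k d (mmap res (\<rho> g)) (mmap l D) = mmul k d (mmap l D) (mmap res (\<rho> g))"
  if g:"g<:G" for g
  proof (intro ext)
  fix i j
  note \<rho>c = rmatD[OF \<rho>B_mat[OF g]]
  show "mmul k d (mmap res (\<rho> g)) (mmap l D) i j = mmul k d (mmap l D) (mmap res (\<rho> g)) i j"
  using B.functional_mat_left(2)[where A = "\<rho>B g" and D = D and d = d and i = i and j = j,OF I l \<rho>c DI]
  B.functional_mat_right(2)[where A = "\<rho>B g" and D = D and d = d and i = i and j = j,OF I l \<rho>c DI]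
  unfolding Dcomm[OF g] r_\<rho>B[OF g] by (rule trans[OF sym])
  qed
  then obtain c where c:"c<:k" "mmap l D = smat k c (mone k d)"
  using commutant_scalar[OF lm] by blast
  have "mmap l D 0 0 = c" using c d_pos unfolding c(2) by (simp add:smat_def mone_def)
  moreover have "mmap l D 0 0 = 0@k" using B.functional_zero[OF I l] by (simp add:mmap_def D00)
  ultimately have "l (D i j) = 0@k" for i j
  using fun_cong[OF fun_cong[OF c(2)],of i j] by (simp add:mmap_def smat_def mone_def)
  then show "l y = 0@k" using y by auto
 qed
 then have "D i j = 0@B" for i j by blast
 then have "P i j = smat B (P 0 0) (mone B d) i j" for i j
  using B.r_right_minus_eq[OF Pc[of i j] Sc[of i j]] unfolding D_def by blast
 then show ?thesis by (intro ext)
qed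

lemma sig_unique:
 assumes s:"admissible s" "admissible t" and P:"P\<in>rmat B d d" "mmap r P = mone k d"
  and eq:"!!\<gamma>. \<gamma><:\<Gamma>==>mmul B d (sig s \<gamma>) P = mmul B d P (sig t \<gamma>)"
 shows "s = t"
proof -
 have comm:"mmul B d (\<rho>B g) P = mmul B d P (\<rho>B g)" if g:"g<:G" for g
  using eq[of "(0@V',g)"] g by (simp add:sig_zero[OF s(1) g] sig_zero[OF s(2) g] semidirect_sel)
 define c where "c = P 0 0"
 have cc:"c<:B" unfolding c_def by (rule rmatD[OF P(1)])
 have Pc:"P = smat B c (mone B d)" using commutant_scalar_B[OF P(1) comm] by (simp add:c_def)
 have "r c = 1@k" using fun_cong[OF fun_cong[OF P(2)],of 0 0] d_pos by (simp add:c_def mmap_def mone_def)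
 then obtain w where w:"w<:B" "c*.B w = 1@B" using B.r_unit[OF cc] by auto
 obtain x i j where x:"x<:V'" and u:"res (\<psi> x i j) ~= 0@k" using unit_entry by blast
 have uc:"\<psi>B x i j<:B" by (rule rmatD[OF \<psi>B_mat[OF x]])
 have "r (\<psi>B x i j) = res (\<psi> x i j)" using r_\<psi>B[OF x] by (simp add:mmap_def fun_eq_iff)
 then obtain v where v:"v<:B" "\<psi>B x i j*.B v = 1@B" using B.r_unit[OF uc] u by auto
 have g:"(x,1@G)<:\<Gamma>" using x by (simp add:semidirect_sel)
 have oc:"mone B d i j<:B" for i j by (simp add:mone_def)
 have sg:"sig s (x,1@G) i j = mone B d i j+.B s*.B \<psi>B x i j" if s:"admissible s" for s
 proof -
  have "smat B s (\<psi>B x)<:(Mat B d)" using S_mat[OF s x] by simp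
  then have "(1@(Mat B d)+.(Mat B d) smat B s (\<psi>B x))*.(Mat B d) 1@(Mat B d) = 1@(Mat B d)+.(Mat B d) smat B s (\<psi>B x)"
  by (intro MB.r_one MB.a_closed MB.one_closed)
  then have "sig s (x,1@G) = 1@(Mat B d)+.(Mat B d) smat B s (\<psi>B x)"
  unfolding sig_ring \<rho>B_one by simp
  then show ?thesis by (simp add:smat_def)
 qed
 note c1 = rmatD[OF sig_mat[OF s(1) g]] rmatD[OF sig_mat[OF s(2) g]]
 have "smat B c (sig s (x,1@G)) = smat B c (sig t (x,1@G))"
  using eq[OF g] unfolding Pc B.smmul_r[OF cc c1(1) oc] B.smmul_l[OF cc oc c1(2)]
  B.mmul_one[OF sig_mat[OF s(1) g]] B.mone_mult[OF sig_mat[OF s(2) g]] .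
 then have e:"c*.B (mone B d i j+.B s*.B \<psi>B x i j) = c*.B (mone B d i j+.B t*.B \<psi>B x i j)"
  unfolding smat_def sg[OF s(1),symmetric] sg[OF s(2),symmetric] by meson
 note sc = s_closed[OF s(1)] s_closed[OF s(2)]
 have inj:"z = ((w*.B (c*.B (q+.B z*.B \<psi>B x i j)))-.B q)*.B v" if z:"z<:B" "q<:B" for z q
 proof -
  have "((w*.B (c*.B (q+.B z*.B \<psi>B x i j)))-.B q)*.B v
  = (((c*.B w)*.B (q+.B z*.B \<psi>B x i j))-.B q)*.B v" using z w(1) v(1) cc uc by algebra
  also have "... = z*.B (\<psi>B x i j*.B v)" unfolding w(2) using z v(1) uc by algebra
  finally show ?thesis using z v by simp
 qed
 show ?thesis using inj[OF sc(1) oc,of i j] inj[OF sc(2) oc,of i j] unfolding e by (rule trans[OF _ sym])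
qed

text \<open>Averaging \<open>\<theta>\<close> conjugates the restriction to \<open>G\<close> into \<open>\<rho>\<close>; what is left on \<open>K\<close> is covered by \<open>nilpotent_part\<close>.\<close>
lemma sig_exists:
 assumes \<sigma>: "!!\<gamma>. \<gamma><:\<Gamma>==>\<chi> \<gamma>\<in>rmat B d d" and \<sigma>1:"\<chi> 1@\<Gamma> = mone B d"
  and \<sigma>m:"!!\<gamma> \<delta>. \<gamma><:\<Gamma>==>\<delta><:\<Gamma>==>\<chi> (\<gamma> *.\<Gamma> \<delta>) = mmul B d (\<chi> \<gamma>) (\<chi> \<delta>)"
  and \<sigma>r:"!!\<gamma>. \<gamma><:\<Gamma>==>mmap r (\<chi> \<gamma>) = mmap res (\<rho> (snd \<gamma>))"
 shows "EX P s. admissible s & P\<in>rmat B d d & mmap r P = mone k d \<and>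
  (\<forall>\<gamma>\<in>car \<Gamma>. mmul B d (\<chi> \<gamma>) P = mmul B d P (sig s \<gamma>))"
proof -
 obtain T where T:"T\<in>rmat B d d" "mmap r T = \<theta>" using B.r.rmat_lift[OF B.r_surj \<theta>_mat] by blast
 define \<alpha> where "\<alpha> g = \<chi> (0@V',g)" for g
 have z\<Gamma>: "(0@V',g)<:\<Gamma>" if "g<:G" for g using that by (simp add:semidirect_sel)
 have \<alpha>: "\<alpha> g\<in>rmat B d d" if "g<:G" for g unfolding \<alpha>_def by (rule \<sigma>[OF z\<Gamma>[OF that]])
 have \<alpha>m:"\<alpha> (g*.G h) = mmul B d (\<alpha> g) (\<alpha> h)" if "g<:G" "h<:G" for g h
  using \<sigma>m[OF z\<Gamma>[OF that(1)] z\<Gamma>[OF that(2)]] V'.act_zero[OF that(1)] by (simp add:\<alpha>_def semidirect_sel)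
 define P where "P = (\<Oplus>\<^bsub>Mat B d\<^esub>g\<in>car G. mmul B d (mmul B d (\<alpha> g) T) (\<rho>B (~.G g)))"
 have P:"P\<in>rmat B d d" and P\<alpha>: "!!h. h<:G==>mmul B d (\<alpha> h) P = mmul B d P (\<rho>B h)"
  unfolding P_def by (rule B.averaged_intertwiner[OF G.is_group finG \<alpha> \<alpha>m \<rho>B_mat \<rho>B_mult T(1)]; assumption)+
 have rP:"mmap r P = mone k d"
 proof -
  interpret Mk: ring "Mat k d" by (rule W.k.ring_Mat)
  have t:"mmul B d (mmul B d (\<alpha> g) T) (\<rho>B (~.G g))\<in>rmat B d d" if "g<:G" for g
  using that by (auto intro!: B.mmul_rmat[where b = d and b' = d] \<alpha> T \<rho>B_mat)
  have "mmap r P = (\<Oplus>\<^bsub>Mat k d\<^esub>g\<in>car G. mmap r (mmul B d (mmul B d (\<alpha> g) T) (\<rho>B (~.G g))))"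
  unfolding P_def
  proof (rule MB.finsum_hom[OF Mk.is_abelian_group])
  show "mmap r x<:(Mat k d)" if "x<:(Mat B d)" for x
  using B.r.mmap_rmat that by simp
  show "mmap r (x+.(Mat B d) y) = mmap r x+.(Mat k d) mmap r y"
  if "x<:(Mat B d)" "y<:(Mat B d)" for x y
  using that rmatD[of x B d d] rmatD[of y B d d] by (simp add:mmap_def)
  show "(%g. mmul B d (mmul B d (\<alpha> g) T) (\<rho>B (~.G g)))\<in>car G \<rightarrow> car (Mat B d)"
  using t by simp
  qed
  also have "... = (\<Oplus>\<^bsub>Mat k d\<^esub>g\<in>car G. mmul k d (mmul k d (mmap res (\<rho> g)) \<theta>)
  (mmap res (\<rho> (~.G g))))"
  proof (rule Mk.finsum_cong'[OF refl])
  fix g assume g:"g<:G"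
  have gi:"~.G g<:G" using g by simp
  note c = rmatD[OF \<alpha>[OF g]] rmatD[OF T(1)] rmatD[OF \<rho>B_mat[OF gi]]
  have m:"mmul B d (\<alpha> g) T i j<:B" for i j by (rule B.mmul_entry_closed; rule c)
  show "mmap r (mmul B d (mmul B d (\<alpha> g) T) (\<rho>B (~.G g))) =
  mmul k d (mmul k d (mmap res (\<rho> g)) \<theta>) (mmap res (\<rho> (~.G g)))"
  unfolding B.r.map_mmul[OF m c(3)] B.r.map_mmul[OF c(1,2)] r_\<rho>B[OF gi] T(2)
  using \<sigma>r[OF z\<Gamma>[OF g]] by (simp add:\<alpha>_def)
  next
  show "(%g. mmul k d (mmul k d (mmap res (\<rho> g)) \<theta>) (mmap res (\<rho> (~.G g))))\<in>car G \<rightarrow> car (Mat k d)"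
  by (auto intro!: W.k.mmul_rmat[where b = d and b' = d] W.res.mmap_rmat \<rho>_mat \<theta>_mat)
  qed
  finally show ?thesis by (simp add:\<theta>_trace)
 qed
 obtain Q where Q:"Q\<in>rmat B d d" "mmap r Q = mone k d" "mmul B d P Q = mone B d" "mmul B d Q P = mone B d"
  using B.inverse_mod[OF P rP] by blast
 let ?M = "Mat B d"
 have cl:"P<:?M" "Q<:?M" "!!\<gamma>. \<gamma><:\<Gamma>==>\<chi> \<gamma><:?M" "!!g. g<:G==>\<rho>B g<:?M"
  using P Q \<sigma> \<rho>B_mat by auto
 have PQ:"P*.?M Q = 1@?M" "Q*.?M P = 1@?M" using Q by simp_all
 define \<tau> where "\<tau> \<gamma> = Q*.?M (\<chi> \<gamma> *.?M P)" for \<gamma>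
 have \<tau>c:"\<tau> \<gamma><:?M" if "\<gamma><:\<Gamma>" for \<gamma> unfolding \<tau>_def by (intro MB.m_closed cl that)
 have PQz:"P*.?M (Q*.?M z) = z" if "z<:?M" for z
  using MB.m_assoc[OF cl(1,2) that] MB.l_one[OF that] unfolding PQ by simp
 have QPz:"Q*.?M (P*.?M z) = z" if "z<:?M" for z
  using MB.m_assoc[OF cl(2,1) that] MB.l_one[OF that] unfolding PQ by simp
 have P\<tau>: "\<chi> \<gamma> *.?M P = P*.?M \<tau> \<gamma>" if "\<gamma><:\<Gamma>" for \<gamma>
  unfolding \<tau>_def by (rule PQz[symmetric]) (intro MB.m_closed cl that)
 have \<tau>m:"\<tau> (\<gamma> *.\<Gamma> \<delta>) = \<tau> \<gamma> *.?M \<tau> \<delta>" if g:"\<gamma><:\<Gamma>" "\<delta><:\<Gamma>" for \<gamma> \<delta>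
 proof -
  have "\<chi> (\<gamma> *.\<Gamma> \<delta>) = \<chi> \<gamma> *.?M \<chi> \<delta>" using \<sigma>m[OF g] by simp
  then have "\<tau> (\<gamma> *.\<Gamma> \<delta>) = Q*.?M (\<chi> \<gamma> *.?M (\<chi> \<delta> *.?M P))"
  unfolding \<tau>_def using cl g by (simp only: MB.m_assoc)
  also have "... = Q*.?M ((\<chi> \<gamma> *.?M P)*.?M \<tau> \<delta>)"
  unfolding P\<tau>[OF g(2)] using cl \<tau>c g by (simp only: MB.m_assoc)
  also have "... = \<tau> \<gamma> *.?M \<tau> \<delta>" unfolding \<tau>_def[of \<gamma>]
  by (rule MB.m_assoc[symmetric]) (intro MB.m_closed cl \<tau>c g)+
  finally show ?thesis .
 qed
 have \<tau>z:"\<tau> (0@V',g) = \<rho>B g" if g:"g<:G" for g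
 proof -
  have "\<chi> (0@V',g)*.?M P = P*.?M \<rho>B g" using P\<alpha>[OF g] by (simp add:\<alpha>_def)
  then show ?thesis unfolding \<tau>_def using QPz[OF cl(4)[OF g]] by simp
 qed
 have x\<Gamma>: "(x,1@G)<:\<Gamma>" if "x<:V'" for x using that by (simp add:semidirect_sel)
 have \<tau>r:"mmap r (\<tau> \<gamma>) = mmap res (\<rho> (snd \<gamma>))" if g:"\<gamma><:\<Gamma>" for \<gamma>
 proof -
  note c = rmatD[OF Q(1)] rmatD[OF \<sigma>[OF g]] rmatD[OF P]
  have m:"mmul B d (\<chi> \<gamma>) P i j<:B" for i j by (rule B.mmul_entry_closed; rule c)
  have rm:"mmap r (\<chi> \<gamma>)\<in>rmat k d d" by (rule B.r.mmap_rmat[OF \<sigma>[OF g]])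
  have "mmap r (\<tau> \<gamma>) = mmul k d (mone k d) (mmul k d (mmap r (\<chi> \<gamma>)) (mone k d))"
  unfolding \<tau>_def Mat_sel B.r.map_mmul[OF c(1) m] B.r.map_mmul[OF c(2,3)] Q(2) rP ..
  then show ?thesis unfolding W.k.mmul_one[OF rm] W.k.mone_mult[OF rm] by (rule trans[OF _ \<sigma>r[OF g]])
 qed
 define a where "a x = \<tau> (x,1@G)-.?M 1@?M" for x
 have ac:"a x<:?M" if "x<:V'" for x unfolding a_def by (intro MB.minus_closed \<tau>c x\<Gamma> that MB.one_closed)
 have \<tau>a:"\<tau> (x,1@G) = 1@?M+.?M a x" if x:"x<:V'" for x
 proof -
  have t:"\<tau> (x,1@G)<:?M" by (rule \<tau>c[OF x\<Gamma>[OF x]])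
  show ?thesis unfolding a_def a_minus_def
  using t MB.one_closed by (simp only: MB.a_comm[of "1@?M"] MB.a_assoc MB.l_neg MB.r_zero MB.a_inv_closed MB.a_closed)
 qed
 have "\<exists>s\<in>car B. r s = 0@k & s*.B s = 0@B & pn*.B s = 0@B & (\<forall>x\<in>car V'. a x = smat B s (\<psi>B x))"
 proof (rule nilpotent_part)
  show "a x\<in>rmat B d d" if "x<:V'" for x using ac[OF that] by simp
  show "mmap r (a x) = (%i j. 0@k)" if x:"x<:V'" for x
  proof (intro ext)
  fix i j
  have t:"\<tau> (x,1@G)\<in>rmat B d d" using \<tau>c[OF x\<Gamma>[OF x]] by simp
  have "r (\<tau> (x,1@G) i j) = mone k d i j"
  using fun_cong[OF fun_cong[OF \<tau>r[OF x\<Gamma>[OF x]]],of i j] by (simp add:\<rho>_one W.res.mmap_one) (simp add:mmap_def)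
  moreover have "r (mone B d i j) = mone k d i j" using fun_cong[OF fun_cong[OF B.r.mmap_one[of d]],of i j] by (simp add:mmap_def)
  moreover have "mone k d i j<:k" "mone B d i j<:B" by (simp_all add: mone_def)
  ultimately show "mmap r (a x) i j = 0@k"
  using rmatD[OF t,of i j]
  by (simp add:mmap_def a_def B.Mat_minus[OF t B.mone_rmat])
  qed
  have "\<tau> (0@V',1@G) = 1@?M" using \<tau>z[OF G.one_closed] by (simp add:\<rho>B_one)
  then show "a 0@V' = (%i j. 0@B)" unfolding a_def using MB.r_right_minus_eq[OF MB.one_closed MB.one_closed] by simp
  show "a (x+.V' y) = (%i j. (a x i j+.B a y i j)+.B mmul B d (a x) (a y) i j)"
  if x:"x<:V'" and y:"y<:V'" for x y
  proof -
  have "\<tau> (x+.V' y,1@G) = \<tau> (x,1@G)*.?M \<tau> (y,1@G)"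
  using \<tau>m[OF x\<Gamma>[OF x] x\<Gamma>[OF y]] y by (simp add:semidirect_sel V'.act_one)
  then have "a (x+.V' y) = (a x+.?M a y)+.?M (a x*.?M a y)"
  unfolding a_def using MB.one_plus_mult[OF \<tau>c[OF x\<Gamma>[OF x]] \<tau>c[OF x\<Gamma>[OF y]]] by simp
  then show ?thesis by simp
  qed
  show "mmul B d (\<rho>B g) (a x) = mmul B d (a (act V' g x)) (\<rho>B g)"
  if g:"g<:G" and x:"x<:V'" for g x
  proof -
  have gx:"act V' g x<:V'" by (rule V'.act_closed[OF g x])
  have "\<tau> (0@V',g)*.?M \<tau> (x,1@G) = \<tau> (act V' g x,g)"
  using \<tau>m[OF z\<Gamma>[OF g] x\<Gamma>[OF x]] g gx by (simp add:semidirect_sel)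
  also have "... = \<tau> (act V' g x,1@G)*.?M \<tau> (0@V',g)"
  using \<tau>m[OF x\<Gamma>[OF gx] z\<Gamma>[OF g]] g gx by (simp add:semidirect_sel V'.act_one)
  finally have "\<rho>B g*.?M a x = a (act V' g x)*.?M \<rho>B g"
  unfolding \<tau>z[OF g] a_def by (rule MB.conj_minus_one[OF cl(4)[OF g] \<tau>c[OF x\<Gamma>[OF x]] \<tau>c[OF x\<Gamma>[OF gx]]])
  then show ?thesis by simp
  qed
 qed
 then obtain s where s:"admissible s" "!!x. x<:V'==>a x = smat B s (\<psi>B x)"
  unfolding admissible_def by blast
 have "\<tau> \<gamma> = sig s \<gamma>" if \<gamma>: "\<gamma><:\<Gamma>" for \<gamma>
 proof -
  obtain x g where g:"\<gamma> = (x,g)" "x<:V'" "g<:G"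
  using \<gamma> by (cases \<gamma>) (simp add:semidirect_sel)
  have "\<tau> (x,g) = \<tau> (x,1@G)*.?M \<tau> (0@V',g)"
  using \<tau>m[OF x\<Gamma>[OF g(2)] z\<Gamma>[OF g(3)]] g by (simp add:semidirect_sel V'.act_one)
  then show ?thesis unfolding g(1) sig_ring \<tau>z[OF g(3)] \<tau>a[OF g(2)] s(2)[OF g(2)] .
 qed
 then have "\<forall>\<gamma>\<in>car \<Gamma>. mmul B d (\<chi> \<gamma>) P = mmul B d P (sig s \<gamma>)"
  using P\<tau> by simp
 then show ?thesis using s(1) P rP by blast
qed

end

section \<open>Lifting approximate representations\<close>

locale filtered_ring = ring +
 fixes J :: "nat => 'a set"
 assumes J_ideal:"ideal (J i) R" and J_0:"J 0 = car R"
  and J_mult:"[|a\<in>J i; b\<in>J j|]==>a \<otimes> b\<in>J (i + j)"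
  and J_mono:"J (Suc i) <= J i"
  and J_separated:"[|a\<in>car R; !!i. a\<in>J i|]==>a = \<zero>"
  and J_complete:"[|!!i. x i\<in>car R; !!i. x (Suc i) \<ominus> x i\<in>J i|]==>\<exists>y\<in>car R. ALL i. y \<ominus> x i\<in>J i"
begin

lemma J_closed:"a\<in>J i==>a<:R" using ideal.Icarr[OF J_ideal] .
lemma J_l:"a<:R==>b\<in>J i==>a \<otimes> b\<in>J i" using ideal.I_l_closed[OF J_ideal] .
lemma J_r:"b\<in>J i==>a<:R==>b \<otimes> a\<in>J i" using ideal.I_r_closed[OF J_ideal] .
lemma J_add:"a\<in>J i==>b\<in>J i==>a \<oplus> b\<in>J i" using additive_subgroup.a_closed[OF ideal.axioms(1)[OF J_ideal]] .
lemma J_uminus:"a\<in>J i==>\<ominus> a\<in>J i" using additive_subgroup.a_inv_closed[OF ideal.axioms(1)[OF J_ideal]] .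
lemma J_zero:"\<zero>\<in>J i" using additive_subgroup.zero_closed[OF ideal.axioms(1)[OF J_ideal]] .
lemma J_minus:"a\<in>J i==>b\<in>J i==>a \<ominus> b\<in>J i" unfolding a_minus_def by (intro J_add J_uminus)

lemma J_le:"i \<le> j==>a\<in>J j==>a\<in>J i"
 by (induction j rule: dec_induct) (use J_mono in auto)

lemma J_finsum:"(!!x. x\<in>S==>f x\<in>J i)==>(\<Oplus>x\<in>S. f x)\<in>J i"
proof (induction S rule: infinite_finite_induct)
 case (insert x S)
 then show ?case using J_closed by (subst finsum_insert) (auto intro: J_add)
qed (simp_all add: J_zero)

lemma J_diff_mult:
 assumes "a<:R" "b<:R" "a'<:R" "b'<:R" "a \<ominus> a'\<in>J i" "b \<ominus> b'\<in>J i"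
 shows "a \<otimes> b \<ominus> a' \<otimes> b'\<in>J i"
proof -
 have "a \<otimes> b \<ominus> a' \<otimes> b' = a \<otimes> (b \<ominus> b') \<oplus> (a \<ominus> a') \<otimes> b'" using assms(1-4) by algebra
 then show ?thesis using J_add[OF J_l[OF assms(1,6)] J_r[OF assms(5,4)]] by simp
qed

lemma J_diff_trans:
 assumes "a<:R" "b<:R" "c<:R" "a \<ominus> b\<in>J i" "b \<ominus> c\<in>J i"
 shows "a \<ominus> c\<in>J i"
proof -
 have "a \<ominus> c = (a \<ominus> b) \<oplus> (b \<ominus> c)" using assms(1-3) by algebra
 then show ?thesis using J_add[OF assms(4,5)] by simp
qed

end

text \<open>The conjugates of \<open>T\<close> will sum to 1 modulo \<open>J 1\<close>; such an element makes the obstruction classes in \<open>H^2\<close> vanish explicitly.\<close>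
locale almost_representation = filtered_ring + G: group G for G :: "('g,'l) monoid_scheme" +
 fixes T
 assumes finG:"finite (car G)" and T:"T<:R"
begin

definition almost where
 "almost i r \<longleftrightarrow> (\<forall>g\<in>car G. r g<:R) \<and>
  (\<forall>g\<in>car G. \<forall>h\<in>car G. r g \<otimes> r h \<ominus> r (g*.G h)\<in>J i) \<and>
  (\<Oplus>l\<in>car G. r l \<otimes> (T \<otimes> r (~.G l))) \<ominus> \<one>\<in>J 1"

lemma correction_identity:
 assumes "a<:R" "e<:R" "s<:R" "s'<:R" "s''<:R" "b<:R" "c<:R"
 shows "(a \<ominus> s) \<otimes> (b \<ominus> s') \<ominus> (c \<ominus> s'') = ((a \<otimes> b \<ominus> c) \<ominus> ((a \<otimes> s' \<oplus> s \<otimes> b) \<ominus> s'')) \<oplus> s \<otimes> s'"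
 using assms by algebra

lemma cocycle_identity:
 assumes "g<:R" "h<:R" "l<:R" "hl<:R" "gh<:R" "ghl<:R"
  "T<:R" "m<:R" "k<:R"
 shows "(g \<otimes> ((h \<otimes> l \<ominus> hl) \<otimes> (T \<otimes> m)) \<oplus> ((g \<otimes> hl \<ominus> ghl) \<otimes> (T \<otimes> k)) \<otimes> h) \<ominus> (gh \<otimes> l \<ominus> ghl) \<otimes> (T \<otimes> m) =
  (g \<otimes> h \<ominus> gh) \<otimes> (l \<otimes> (T \<otimes> m)) \<oplus> (g \<otimes> hl \<ominus> ghl) \<otimes> (T \<otimes> (k \<otimes> h \<ominus> m))"
 using assms by algebra

text \<open>Let \<open>e g h = r g r h - r (g h)\<close>, a 2-cocycle up to higher order. Subtracting the cochain
 \<open>s g = \<Sum>l. e g l T r(l^-1)\<close> from \<open>r\<close> removes \<open>e\<close> up to \<open>J (i+1)\<close>, since \<open>\<Sum>l. r l T r(l^-1)\<close> is 1 up to \<open>J 1\<close>.\<close>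
lemma improve:
 assumes i:"i \<ge> 1" and r:"almost i r"
 shows "EX r'. almost (Suc i) r' & (\<forall>g\<in>car G. r' g \<ominus> r g\<in>J i)"
proof -
 have rc:"r g<:R" if "g<:G" for g using r that by (simp add:almost_def)
 have ri:"r (~.G g)<:R" if "g<:G" for g using rc that by simp
 define e where "e g h = r g \<otimes> r h \<ominus> r (g*.G h)" for g h
 have eJ:"e g h\<in>J i" if "g<:G" "h<:G" for g h using r that by (simp add:almost_def e_def)
 note ec = J_closed[OF eJ]
 define s where "s g = (\<Oplus>l\<in>car G. e g l \<otimes> (T \<otimes> r (~.G l)))" for g
 have sJ:"s g\<in>J i" if "g<:G" for g
  unfolding s_def by (rule J_finsum) (intro J_r eJ that m_closed T ri)
 note sc = J_closed[OF sJ]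
 define r' where "r' g = r g \<ominus> s g" for g
 define N where "N = (\<Oplus>l\<in>car G. r l \<otimes> (T \<otimes> r (~.G l)))"
 have Nc:"N<:R" unfolding N_def by (rule finsum_closed) (simp add:Pi_def rc ri T)
 have NJ:"N \<ominus> \<one>\<in>J 1" using r by (simp add:almost_def N_def)
 have r'c:"r' g<:R" if "g<:G" for g unfolding r'_def using rc sc that by simp
 have diff:"r' g \<ominus> r g\<in>J i" if g:"g<:G" for g
 proof -
  have "r' g \<ominus> r g = \<ominus> s g" unfolding r'_def using rc[OF g] sc[OF g] by algebra
  then show ?thesis using J_uminus[OF sJ[OF g]] by simp
 qed
 have err:"r' g \<otimes> r' h \<ominus> r' (g*.G h)\<in>J (Suc i)" if g:"g<:G" and h:"h<:G" for g h
 proof -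
  let ?gh = "g*.G h"
  define F where "F l = e g l \<otimes> (T \<otimes> r (~.G l))" for l
  define H where "H l = e g (h*.G l) \<otimes> (T \<otimes> e (~.G (h*.G l)) h)" for l
  define a where "a l = e h l \<otimes> (T \<otimes> r (~.G l))" for l
  define b where "b l = e ?gh l \<otimes> (T \<otimes> r (~.G l))" for l
  define q where "q l = r l \<otimes> (T \<otimes> r (~.G l))" for l
  have gh:"?gh<:G" using g h by simp
  have hl:"h*.G l<:G" if "l<:G" for l using h that by simp
  have Fc:"F l<:R" and ac:"a l<:R" and bc:"b l<:R" and qc:"q l<:R"
  if "l<:G" for l
  unfolding F_def a_def b_def q_def using that g h gh ec rc ri T by simp_all
  have HJ:"H l\<in>J (i + i)" if "l<:G" for l
  unfolding H_def by (intro J_mult J_l T eJ g h hl G.inv_closed that)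
  note Hc = J_closed[OF HJ]
  have bij:"bij_betw (%l. h*.G l) (car G) (car G)"
  by (rule bij_betw_byWitness[where f' = "%l. ~.G h*.G l"])
  (use h in \<open>auto simp:G.m_assoc[symmetric]\<close>)
  have sg:"s g = (\<Oplus>l\<in>car G. F (h*.G l))"
  unfolding s_def F_def[symmetric]
  using finsum_reindex[of F "%l. h*.G l" "car G"] bij Fc by (auto simp:bij_betw_def)
  have sg': "s g \<otimes> r h = (\<Oplus>l\<in>car G. F (h*.G l) \<otimes> r h)"
  unfolding sg by (rule finsum_ldistr[OF finG rc[OF h]]) (use Fc hl in auto)
  have sh:"r g \<otimes> s h = (\<Oplus>l\<in>car G. r g \<otimes> a l)"
  unfolding s_def a_def[symmetric] by (rule finsum_rdistr[OF finG rc[OF g]]) (use ac in auto)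
  have summand:"(r g \<otimes> a l \<oplus> F (h*.G l) \<otimes> r h) \<ominus> b l = e g h \<otimes> q l \<oplus> H l" if l:"l<:G" for l
  proof -
  have "~.G (h*.G l)*.G h = ~.G l"
  using h l by (simp add:G.inv_mult_group G.m_assoc)
  then show ?thesis
  unfolding F_def H_def a_def b_def q_def e_def
  using cocycle_identity[OF rc[OF g] rc[OF h] rc[OF l] rc[OF hl[OF l]] rc[OF gh] _ T ri[OF l] ri[OF hl[OF l]],of "r (g*.G (h*.G l))"]
  g h l rc by (simp add:G.m_assoc)
  qed
  have "(r g \<otimes> s h \<oplus> s g \<otimes> r h) \<ominus> s ?gh = (\<Oplus>l\<in>car G. (r g \<otimes> a l \<oplus> F (h*.G l) \<otimes> r h) \<oplus> \<ominus> b l)"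
  proof -
  have "s ?gh = (\<Oplus>l\<in>car G. b l)" by (simp add:s_def b_def)
  moreover have "\<ominus> (\<Oplus>l\<in>car G. b l) = (\<Oplus>l\<in>car G. \<ominus> b l)"
  using finsum_hom[OF is_abelian_group,of "a_inv R" b "car G"] bc by (simp add:minus_add a_ac)
  ultimately show ?thesis unfolding sg' sh a_minus_def
  using ac bc Fc hl rc g h by (subst finsum_addf; simp add:Pi_def)+
  qed
  also have "... = (\<Oplus>l\<in>car G. e g h \<otimes> q l \<oplus> H l)"
  using summand Hc qc ec[OF g h] by (intro finsum_cong') (auto simp:a_minus_def)
  also have "... = (\<Oplus>l\<in>car G. e g h \<otimes> q l) \<oplus> (\<Oplus>l\<in>car G. H l)"
  by (rule finsum_addf) (use Hc qc ec[OF g h] in auto)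
  also have "(\<Oplus>l\<in>car G. e g h \<otimes> q l) = e g h \<otimes> N"
  unfolding N_def q_def[symmetric] by (rule finsum_rdistr[symmetric,OF finG ec[OF g h]]) (use qc in auto)
  finally have Y:"(r g \<otimes> s h \<oplus> s g \<otimes> r h) \<ominus> s ?gh = e g h \<otimes> N \<oplus> (\<Oplus>l\<in>car G. H l)" .
  have HS:"(\<Oplus>l\<in>car G. H l)\<in>J (i + i)" by (rule J_finsum[OF HJ])
  have alg:"u \<ominus> (u \<otimes> v \<oplus> w) = \<ominus> (u \<otimes> (v \<ominus> \<one>)) \<ominus> w"
  if "u<:R" "v<:R" "w<:R" for u v w
  proof -
  have "\<ominus> (u \<otimes> (v \<ominus> \<one>)) \<ominus> w = (u \<otimes> \<one>) \<ominus> (u \<otimes> v \<oplus> w)" using that by algebra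
  then show ?thesis using that by simp
  qed
  have "r' g \<otimes> r' h \<ominus> r' ?gh = (e g h \<ominus> (e g h \<otimes> N \<oplus> (\<Oplus>l\<in>car G. H l))) \<oplus> s g \<otimes> s h"
  using correction_identity[OF rc[OF g] _ sc[OF g] sc[OF h] sc[OF gh] rc[OF h] rc[OF gh],of \<zero>]
  unfolding r'_def e_def[symmetric] Y by simp
  also have "... = (\<ominus> (e g h \<otimes> (N \<ominus> \<one>)) \<ominus> (\<Oplus>l\<in>car G. H l)) \<oplus> s g \<otimes> s h"
  unfolding alg[OF ec[OF g h] Nc J_closed[OF HS]] ..
  also have "... \<in> J (Suc i)"
  proof (intro J_add J_minus J_uminus)
  show "e g h \<otimes> (N \<ominus> \<one>)\<in>J (Suc i)" using J_mult[OF eJ[OF g h] NJ] by simp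
  show "(\<Oplus>l\<in>car G. H l)\<in>J (Suc i)" by (rule J_le[OF _ HS]) (use i in simp)
  show "s g \<otimes> s h\<in>J (Suc i)" by (rule J_le[OF _ J_mult[OF sJ[OF g] sJ[OF h]]]) (use i in simp)
  qed
  finally show ?thesis .
 qed
 have tr:"(\<Oplus>l\<in>car G. r' l \<otimes> (T \<otimes> r' (~.G l))) \<ominus> \<one>\<in>J 1"
 proof (rule J_diff_trans[OF _ Nc one_closed _ NJ])
  define q where "q l = r' l \<otimes> (T \<otimes> r' (~.G l))" for l
  define q0 where "q0 l = r l \<otimes> (T \<otimes> r (~.G l))" for l
  have qc:"q l<:R" "q0 l<:R" if "l<:G" for l
  unfolding q_def q0_def using that rc r'c T by simp_all
  show "(\<Oplus>l\<in>car G. r' l \<otimes> (T \<otimes> r' (~.G l)))<:R"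
  unfolding q_def[symmetric] by (rule finsum_closed) (use qc in auto)
  have d:"q l \<ominus> q0 l\<in>J 1" if l:"l<:G" for l
  proof -
  have z:"T \<ominus> T\<in>J 1" using T J_zero by (simp add:a_minus_def r_neg)
  note d = J_le[OF i diff]
  have li:"~.G l<:G" using l by simp
  show ?thesis unfolding q_def q0_def
  by (intro J_diff_mult m_closed T rc r'c l li d z)
  qed
  have "(\<Oplus>l\<in>car G. q l) = (\<Oplus>l\<in>car G. q0 l \<oplus> (q l \<ominus> q0 l))"
  proof (rule finsum_cong'[OF refl])
  fix l assume "l<:G" then show "q l = q0 l \<oplus> (q l \<ominus> q0 l)" using qc[of l] by algebra
  qed (use qc in auto)
  also have "... = N \<oplus> (\<Oplus>l\<in>car G. q l \<ominus> q0 l)"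
  unfolding N_def q0_def[symmetric] by (rule finsum_addf) (use qc in auto)
  finally have *: "(\<Oplus>l\<in>car G. q l) = N \<oplus> (\<Oplus>l\<in>car G. q l \<ominus> q0 l)" .
  have DJ:"(\<Oplus>l\<in>car G. q l \<ominus> q0 l)\<in>J 1" by (rule J_finsum[OF d])
  have "(N \<oplus> D) \<ominus> N = D" if "D<:R" for D using that Nc by algebra
  then show "(\<Oplus>l\<in>car G. r' l \<otimes> (T \<otimes> r' (~.G l))) \<ominus> N\<in>J 1"
  unfolding q_def[symmetric] * using DJ J_closed[OF DJ] by simp
 qed
 show ?thesis using r'c err tr diff by (intro exI[of _ r']) (simp add:almost_def)
qed

text \<open>The limit of successive improvements is multiplicative. The image of the identity is an idempotent congruent to 1,
 hence 1 by separation.\<close>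
lemma lift_representation:
 assumes n:"n \<ge> 1" and r:"almost n r" and r1:"r 1@G \<ominus> \<one>\<in>J n"
 shows "EX y. (\<forall>g\<in>car G. y g<:R & y g \<ominus> r g\<in>J n) & y 1@G = \<one> \<and>
  (\<forall>g\<in>car G. \<forall>h\<in>car G. y (g*.G h) = y g \<otimes> y h)"
proof -
 have "EX x. x 0 = r & (ALL m. almost (n + m) (x m) & (\<forall>g\<in>car G. x (Suc m) g \<ominus> x m g\<in>J (n + m)))"
 proof -
  define nx where "nx m q = (SOME q'. almost (Suc (n + m)) q' & (\<forall>g\<in>car G. q' g \<ominus> q g\<in>J (n + m)))" for m q
  have nx:"almost (Suc (n + m)) (nx m q) & (\<forall>g\<in>car G. nx m q g \<ominus> q g\<in>J (n + m))" if "almost (n + m) q" for m q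
  unfolding nx_def using someI_ex[OF improve[OF _ that]] n by simp
  define x where "x = rec_nat r nx"
  have x:"x 0 = r" "x (Suc m) = nx m (x m)" for m by (simp_all add: x_def)
  have "almost (n + m) (x m)" for m by (induction m) (use r nx x in auto)
  then show ?thesis using nx x by (intro exI[of _ x]) auto
 qed
 then obtain x where x0:"x 0 = r" and x:"!!m. almost (n + m) (x m)"
  and xs:"!!m g. g<:G==>x (Suc m) g \<ominus> x m g\<in>J (n + m)" by blast
 have xc:"x m g<:R" if "g<:G" for m g using x[of m] that by (simp add:almost_def)
 have xn:"x m g \<ominus> r g\<in>J n" if g:"g<:G" for m g
 proof (induction m)
  case 0 show ?case using xc[OF g,of 0] J_zero by (simp add:x0 a_minus_def r_neg)
 next
  case (Suc m)
  show ?case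
  by (rule J_diff_trans[OF xc[OF g] xc[OF g,of m] _ J_le[OF _ xs[OF g]] Suc])
  (use xc[OF g,of 0] in \<open>simp_all add: x0\<close>)
 qed
 have "EX y. y<:R & (ALL m. y \<ominus> x m g\<in>J m)" if g:"g<:G" for g
  using J_complete[of "%m. x m g"] xc[OF g] J_le[OF _ xs[OF g]] by (metis le_add2)
 then obtain y where y:"!!g. g<:G==>y g<:R"
  "!!g m. g<:G==>y g \<ominus> x m g\<in>J m" by metis
 have yr:"y g \<ominus> r g\<in>J n" if g:"g<:G" for g
  by (rule J_diff_trans[OF y(1)[OF g] xc[OF g,of n] _ y(2)[OF g] xn[OF g]]) (use xc[OF g,of 0] in \<open>simp add:x0\<close>)
 have flip:"b \<ominus> a\<in>J m" if "a \<ominus> b\<in>J m" "a<:R" "b<:R" for a b m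
 proof -
  have "b \<ominus> a = \<ominus> (a \<ominus> b)" using that(2,3) by algebra
  then show ?thesis using J_uminus[OF that(1)] by simp
 qed
 have mult:"y (g*.G h) = y g \<otimes> y h" if g:"g<:G" and h:"h<:G" for g h
 proof -
  have gh:"g*.G h<:G" using g h by simp
  have "y g \<otimes> y h \<ominus> y (g*.G h)\<in>J m" for m
  proof (rule J_diff_trans)
  show "y g \<otimes> y h \<ominus> x m g \<otimes> x m h\<in>J m" by (intro J_diff_mult y xc g h)
  show "x m g \<otimes> x m h \<ominus> y (g*.G h)\<in>J m"
  proof (rule J_diff_trans)
  show "x m g \<otimes> x m h \<ominus> x m (g*.G h)\<in>J m"
  by (rule J_le[of m "n + m"]) (use x[of m] g h in \<open>simp_all add: almost_def\<close>)
  show "x m (g*.G h) \<ominus> y (g*.G h)\<in>J m" by (rule flip[OF y(2)[OF gh] y(1)[OF gh] xc[OF gh]])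
  qed (use y xc g h gh in auto)
  qed (use y xc g h gh in auto)
  then have "y g \<otimes> y h \<ominus> y (g*.G h) = \<zero>" by (intro J_separated) (use y g h gh in auto)
  then show ?thesis using r_right_minus_eq[of "y g \<otimes> y h" "y (g*.G h)"] y g h gh by simp
 qed
 have one:"y 1@G = \<one>"
 proof -
  let ?o = "1@G"
  have oc:"?o<:G" by simp
  define f where "f = \<one> \<ominus> y ?o"
  have yc:"y ?o<:R" by (rule y(1)[OF oc])
  have fc:"f<:R" unfolding f_def using yc by simp
  have yy:"y ?o \<otimes> y ?o = y ?o" using mult[OF oc oc] by simp
  have "(\<one> \<ominus> z) \<otimes> (\<one> \<ominus> z) = (\<one> \<ominus> z \<otimes> \<one>) \<ominus> (z \<ominus> z \<otimes> z)" if "z<:R" for z using that by algebra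
  from this[OF yc] have ff:"f \<otimes> f = f" unfolding yy f_def r_one[OF yc] using yc by (simp add:a_minus_def r_neg)
  have "y ?o \<ominus> \<one>\<in>J n"
  by (rule J_diff_trans[OF yc _ one_closed yr[OF oc] r1]) (use xc[OF oc,of 0] in \<open>simp add:x0\<close>)
  then have f1:"f\<in>J 1" unfolding f_def by (rule J_le[OF n flip]) (use yc in auto)
  have "f\<in>J m" for m
  proof (induction m)
  case 0 show ?case using fc by (simp add:J_0)
  next
  case (Suc m) show ?case using J_mult[OF f1 Suc] by (simp add:ff)
  qed
  then have "f = \<zero>" by (rule J_separated[OF fc])
  then show ?thesis unfolding f_def using r_right_minus_eq[OF one_closed yc] by simp
 qed
 show ?thesis using y(1) yr mult one by blast
qed

end

section \<open>Projective modules\<close>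

locale framed_module = group_module R G M
 for R :: "('a,'m) ring_scheme" (structure) and G :: "('g,'l) monoid_scheme" (structure)
  and M :: "('a,'b,'g) gmodule" (structure) +
 fixes d :: nat and e :: "nat => 'b" and \<rho> :: "'g => nat => nat => 'a"
 assumes basis:"is_basis R M d e" and acts:"acts_by R G M d e \<rho>"
begin

lemmas ec = basis_closed[OF basis]

definition lmap :: "(nat => nat => 'a) => 'b => 'b" where
 "lmap A = (\<lambda>x\<in>car M. lincomb M d (coords R M d e x) (%j. lincomb M d (%i. A i j) e))"

lemma col_closed:"A\<in>rmat R d d==>lincomb M d (%i. A i j) e<:M"
 by (rule lincomb_closed) (use rmatD ec in auto)

lemma lmap_lin:"A\<in>rmat R d d==>lmap A\<in>lin_maps R M M"
 unfolding lmap_def by (rule basis_map(1)[OF module_axioms basis col_closed])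

lemma lmap_closed:"A\<in>rmat R d d==>x<:M==>lmap A x<:M"
 using lmap_lin[of A] by (auto simp:lin_maps_def)

lemma lmap_e:"A\<in>rmat R d d==>j < d==>lmap A (e j) = lincomb M d (%i. A i j) e"
 unfolding lmap_def by (rule basis_map(2)[OF module_axioms basis col_closed])

lemma lmap_lincomb:
 assumes A:"A\<in>rmat R d d" and c:"c\<in>vecs R d"
 shows "lmap A (lincomb M d c e) = lincomb M d (mat_vec R d A c) e"
proof -
 have "lincomb M d c e<:M" by (rule lincomb_closed) (use vecsD[OF c] ec in auto)
 then have "lmap A (lincomb M d c e) = lincomb M d c (%j. lincomb M d (%i. A i j) e)"
  by (simp add:lmap_def coords_unique[OF basis c])
 then show ?thesis using lincomb_mat[of d d A c e] rmatD[OF A] vecsD[OF c] ec by simp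
qed

lemma lmap_surj: assumes f:"f\<in>lin_maps R M M" shows "\<exists>A\<in>rmat R d d. f = lmap A"
proof
 let ?A = "%i j. if j < d then coords R M d e (f (e j)) i else 0@R"
 have fc:"f (e j)<:M" if "j < d" for j using f ec[OF that] by (auto simp:lin_maps_def)
 show A:"?A\<in>rmat R d d" using coords_vecs[OF basis fc] by (auto simp:rmat_def vecs_def)
 show "f = lmap ?A"
  by (rule lin_maps_eqI[OF module_axioms module_axioms f lmap_lin[OF A] basis])
  (simp add:lmap_e[OF A] lincomb_coords[OF basis fc])
qed

lemma lmap_inj: assumes "A\<in>rmat R d d" "A'\<in>rmat R d d" "!!x. x<:M==>lmap A x = lmap A' x" shows "A = A'"
 by (rule rmat_eqI_lincomb[OF basis assms(1,2)]) (use assms lmap_e ec in metis)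

lemma lmap_add: assumes A:"A\<in>rmat R d d" "A'\<in>rmat R d d" and x:"x<:M"
 shows "lmap (%i j. A i j+.R A' i j) x = lmap A x+.M lmap A' x"
proof -
 have "(%j. lincomb M d (%i. A i j+.R A' i j) e) =
  (%j. lincomb M d (%i. A i j) e+.M lincomb M d (%i. A' i j) e)"
  by (rule ext,rule lincomb_add) (use rmatD A ec in auto)
 then show ?thesis using x vecsD[OF coords_vecs[OF basis x]] col_closed A by (simp add:lmap_def lincomb_add_right)
qed

lemma lmap_mult: assumes A:"A\<in>rmat R d d" "Y\<in>rmat R d d" and x:"x<:M"
 shows "lmap (mmul R d A Y) x = lmap A (lmap Y x)"
proof -
 let ?c = "coords R M d e x"
 have c:"?c\<in>vecs R d" and xe:"x = lincomb M d ?c e" using coords_vecs[OF basis x] lincomb_coords[OF basis x] by simp_all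
 have "mat_vec R d Y ?c\<in>vecs R d"
  by (rule R.mat_vec_vecs[OF A(2)]) (use vecsD[OF c] in auto)
 then have "lmap A (lmap Y (lincomb M d ?c e)) = lmap (mmul R d A Y) (lincomb M d ?c e)"
  using c A rmatD[OF A(1)] rmatD[OF A(2)] vecsD[OF c]
  by (simp add:lmap_lincomb R.mmul_rmat[OF A] R.mat_vec_assoc)
 then show ?thesis using xe by simp
qed

lemma lmap_smone: assumes a:"a<:R" and x:"x<:M" shows "lmap (smat R a (mone R d)) x = a*:M x"
proof -
 let ?S = "smat R a (mone R d)"
 have S:"?S\<in>rmat R d d" using R.smat_rmat[OF a R.mone_rmat] .
 have "(\<lambda>x\<in>car M. a*:M x)\<in>lin_maps R M M"
  using a by (auto simp:lin_maps_def smult_r_distr smult_assoc1[symmetric] R.m_comm)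
 then have "lmap ?S = (\<lambda>x\<in>car M. a*:M x)"
 proof (rule lin_maps_eqI[OF module_axioms module_axioms lmap_lin[OF S] _ basis])
  fix j assume j:"j < d"
  have "lincomb M d (%i. a*.R mone R d i j) e = a*:M lincomb M d (%i. mone R d i j) e"
  by (rule lincomb_smult[OF a]) (use ec in \<open>auto simp:mone_def\<close>)
  then show "lmap ?S (e j) = (\<lambda>x\<in>car M. a*:M x) (e j)"
  using lincomb_unit[of d e,OF ec j] ec[OF j] unfolding lmap_e[OF S j] by (simp add:smat_def)
 qed
 then show ?thesis using x by simp
qed

lemma lmap_one:"x<:M==>lmap (mone R d) x = x"
 using lmap_smone[OF R.one_closed,of x] rmatD[OF R.mone_rmat] by (simp add:R.smone)

lemma lmap_smat: assumes a:"a<:R" and A:"A\<in>rmat R d d" and x:"x<:M"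
 shows "lmap (smat R a A) x = a*:M lmap A x"
proof -
 have "smat R a A = mmul R d (smat R a (mone R d)) A"
  using R.smmul_l[OF a rmatD[OF R.mone_rmat] rmatD[OF A]] R.mone_mult[OF A] by simp
 then show ?thesis using lmap_mult[OF R.smat_rmat[OF a R.mone_rmat] A x] lmap_smone[OF a lmap_closed[OF A x]] by simp
qed

lemma \<rho>_rmat:"g<:G==>\<rho> g\<in>rmat R d d" using acts by (simp add:acts_by_def)

lemma lmap_act: assumes g:"g<:G" and x:"x<:M" shows "lmap (\<rho> g) x = act M g x"
 using acts_by_lincomb[OF basis acts g,of "coords R M d e x"] lmap_lincomb[OF \<rho>_rmat[OF g] coords_vecs[OF basis x]]
  vecsD[OF coords_vecs[OF basis x]] lincomb_coords[OF basis x] by simp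

text \<open>In a free module the conjugates of the projection to the coordinates at \<open>1 \<in> G\<close> sum to 1: the conjugate by \<open>g\<close> is the
 projection to the coordinates at \<open>g\<close>. Compressing to a direct summand preserves this.\<close>
lemma projective_trace:
 assumes P:"projective_gmodule R G M" and finG:"finite (car G)"
 shows "\<exists>\<theta>\<in>rmat R d d. (\<Oplus>\<^bsub>Mat R d\<^esub>g\<in>car G. mmul R d (mmul R d (\<rho> g) \<theta>) (\<rho> (~.G g))) = mone R d"
proof -
 obtain I :: "'b set" and i r where i:"i\<in>ghoms R G M (free_gmodule R G I)"
  and r:"r\<in>ghoms R G (free_gmodule R G I) M" and ri:"!!x. x<:M==>r (i x) = x"
  using P unfolding projective_gmodule_def by blast
 let ?F = "free_gmodule R G I"
 define rs where "rs S f = (%(z,h). if h\<in>S then f (z,h) else 0@R)" for S :: "'g set" and f :: "'b \<times> 'g => 'a"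
 have rs:"rs S f<:?F" if "f<:?F" for S f
 proof -
  have "{z. rs S f z ~= 0@R} <= {z. f z ~= 0@R}" by (auto simp:rs_def split: if_splits)
  then show ?thesis using that by (auto simp:free_gmodule_def rs_def intro: finite_subset)
 qed
 have ic:"i x<:?F" if "x<:M" for x using i that by (auto simp:ghoms_def lin_maps_def)
 have rc:"r f<:M" if "f<:?F" for f using r that by (auto simp:ghoms_def lin_maps_def)
 have ra:"r (f+.?F h) = r f+.M r h" if "f<:?F" "h<:?F" for f h
  using r that by (auto simp:ghoms_def lin_maps_def)
 have rm:"r (a*:?F f) = a*:M r f" if "f<:?F" "a<:R" for f a
  using r that by (auto simp:ghoms_def lin_maps_def)
 have rg:"r (act ?F g f) = act M g (r f)" if "f<:?F" "g<:G" for f g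
  using r that by (auto simp:ghoms_def)
 have ig:"i (act M g x) = act ?F g (i x)" if "x<:M" "g<:G" for x g
  using i that by (auto simp:ghoms_def)
 have ia:"i (x+.M y) = i x+.?F i y" if "x<:M" "y<:M" for x y
  using i that by (auto simp:ghoms_def lin_maps_def)
 have im:"i (a*:M x) = a*:?F i x" if "x<:M" "a<:R" for x a
  using i that by (auto simp:ghoms_def lin_maps_def)
 let ?t = "\<lambda>x\<in>car M. r (rs {1@G} (i x))"
 have rs_add:"rs S (f+.?F h) = rs S f+.?F rs S h" for S f h
  by (auto simp:rs_def free_gmodule_def)
 have rs_smult:"rs S (a*:?F f) = a*:?F rs S f" if "a<:R" for S a f
  using that by (auto simp:rs_def free_gmodule_def)
 have t:"?t\<in>lin_maps R M M"
  using rc rs ic by (auto simp:lin_maps_def ia im ra rm rs_add rs_smult)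
 obtain \<theta> where \<theta>: "\<theta>\<in>rmat R d d" "?t = lmap \<theta>" using lmap_surj[OF t] by blast
 interpret MR: ring "Mat R d" by (rule R.ring_Mat)
 define q where "q g = mmul R d (mmul R d (\<rho> g) \<theta>) (\<rho> (~.G g))" for g
 have q:"q g\<in>rmat R d d" if "g<:G" for g unfolding q_def
  using that by (auto intro!: R.mmul_rmat[where b = d and b' = d] \<theta> \<rho>_rmat)
 have lq:"lmap (q g) x = r (rs {g} (i x))" if g:"g<:G" and x:"x<:M" for g x
 proof -
  have gi:"~.G g<:G" using g by simp
  have "lmap (q g) x = act M g (lmap \<theta> (act M (~.G g) x))"
  unfolding q_def using g gi x
  by (simp add:lmap_mult R.mmul_rmat[OF \<rho>_rmat \<theta>(1)] \<rho>_rmat \<theta>(1) lmap_act act_closed lmap_closed)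
  also have "... = r (act ?F g (rs {1@G} (act ?F (~.G g) (i x))))"
  using g gi x by (simp add:\<theta>(2)[symmetric] act_closed rg rs ig[symmetric] ic)
  also have "act ?F g (rs {1@G} (act ?F (~.G g) (i x))) = rs {g} (i x)"
  proof
  fix z :: "'b \<times> 'g" obtain y h where z:"z = (y,h)" by (cases z)
  have "i x (y,h) = 0@R" if "h \<notin> car G" for y and h :: 'g using ic[OF x] that by (auto simp:free_gmodule_def)
  moreover have "~.G g*.G h = 1@G \<longleftrightarrow> h = g" if "h<:G" for h :: 'g
  using that g by (metis G.inv_equality G.inv_inv G.inv_closed G.l_inv)
  ultimately show "act ?F g (rs {1@G} (act ?F (~.G g) (i x))) z = rs {g} (i x) z"
  using g by (auto simp:z free_gmodule_def rs_def)
  qed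
  finally show ?thesis .
 qed
 have sum:"(\<Oplus>\<^bsub>Mat R d\<^esub>g\<in>S. q g)\<in>rmat R d d & lmap (\<Oplus>\<^bsub>Mat R d\<^esub>g\<in>S. q g) x = r (rs S (i x))"
  if "finite S" "S <= car G" and x:"x<:M" for S x
  using that(1,2)
 proof (induction S rule: finite_induct)
  case empty
  have "rs {} (i x) = 0@R*:?F i x" using ic[OF x] by (auto simp:rs_def free_gmodule_def)
  then have "r (rs {} (i x)) = 0@M" using rm[OF ic[OF x] R.zero_closed] rc[OF ic[OF x]] by simp
  moreover have "lmap (%a b. 0@R) x = 0@M"
  using lmap_smat[OF R.zero_closed R.mone_rmat x] lmap_one[OF x] x rmatD[OF R.mone_rmat] by (simp add:smat_def)
  ultimately show ?case by (simp add:rmat_def)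
 next
  case (insert g S)
  have "rs (insert g S) (i x) = rs {g} (i x)+.?F rs S (i x)"
  using ic[OF x] insert(2) by (auto simp:rs_def free_gmodule_def)
  then have "r (rs (insert g S) (i x)) = r (rs {g} (i x))+.M r (rs S (i x))" using ra rs ic[OF x] by simp
  moreover have "(\<Oplus>\<^bsub>Mat R d\<^esub>g\<in>insert g S. q g) = (%a b. q g a b+.R (\<Oplus>\<^bsub>Mat R d\<^esub>g\<in>S. q g) a b)"
  using MR.finsum_insert[OF insert(1,2),of q] q insert(4) by (auto simp:Pi_def subset_iff)
  moreover have "(%a b. q g a b+.R (\<Oplus>\<^bsub>Mat R d\<^esub>g\<in>S. q g) a b)\<in>rmat R d d"
  using MR.a_closed[of "q g" "\<Oplus>\<^bsub>Mat R d\<^esub>g\<in>S. q g"] q insert by simp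
  ultimately show ?case using insert q lq[OF _ x,of g] x by (simp add:lmap_add)
 qed
 have "(\<Oplus>\<^bsub>Mat R d\<^esub>g\<in>car G. q g) = mone R d"
 proof (rule lmap_inj)
  show "(\<Oplus>\<^bsub>Mat R d\<^esub>g\<in>car G. q g)\<in>rmat R d d" using MR.finsum_closed[of q "car G"] q by auto
  fix x assume x:"x<:M"
  have "rs (car G) (i x) = i x" using ic[OF x] by (auto simp:rs_def free_gmodule_def)
  then show "lmap (\<Oplus>\<^bsub>Mat R d\<^esub>g\<in>car G. q g) x = lmap (mone R d) x"
  using sum[OF finG subset_refl x] ri[OF x] lmap_one[OF x] by simp
 qed simp
 then show ?thesis using \<theta>(1) unfolding q_def by blast
qed

end

lemma (in p_ring) filtered_ring_Mat:"filtered_ring (Mat W d) (%i. {A\<in>rmat W d d. ALL a b. A a b\<in>Pp i})"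
proof -
 interpret MW: ring "Mat W d" by (rule ring_Mat)
 show ?thesis
 proof (intro filtered_ring.intro filtered_ring_axioms.intro MW.ring_axioms)
  have sum:"(\<Oplus>\<^bsub>W\<^esub>l\<in>S. f l)\<in>Pp i" if "finite S" "!!l. l\<in>S==>f l\<in>Pp i" for f i and S :: "nat set"
  using that
  proof (induction S rule: finite_induct)
  case (insert x F)
  then have "f x\<in>Pp i" "(\<Oplus>\<^bsub>W\<^esub>l\<in>F. f l)\<in>Pp i" by simp_all
  moreover have "f\<in>F \<rightarrow> car W" "f x<:W" using insert.prems Pp_closed by blast+
  ultimately show ?case using insert by (simp add:Pp_add)
  qed simp
  have prod:"mmul W d A C a b\<in>Pp (i + j)"
  if "!!a b. A a b\<in>Pp i" "!!a b. C a b\<in>Pp j" for A C i j a b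
  unfolding mmul_def by (intro sum Pp_mult that) simp
  have P0:"A a b\<in>Pp 0" if "A\<in>rmat W d d" for A a b using rmatD[OF that] by simp
  show "ideal {A\<in>rmat W d d. ALL a b. A a b\<in>Pp i} (Mat W d)" for i
  proof (rule idealI[OF MW.ring_axioms])
  show "subgroup {A\<in>rmat W d d. ALL a b. A a b\<in>Pp i} (add_monoid (Mat W d))"
  proof (rule MW.add.subgroupI)
  show "{A\<in>rmat W d d. ALL a b. A a b\<in>Pp i} ~= {}"
  using MW.zero_closed by (auto intro!: exI[of _ "%a b. \<zero>"])
  show "-:(Mat W d) A\<in>{A\<in>rmat W d d. ALL a b. A a b\<in>Pp i}"
  if "A\<in>{A\<in>rmat W d d. ALL a b. A a b\<in>Pp i}" for A
  using that MW.a_inv_closed[of A] Mat_uminus[of A d] Pp_uminus by simp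
  qed (auto simp:Pp_add intro: rmatD MW.a_closed[simplified])
  qed (use prod[of _ 0 _ i] prod[of _ i _ 0] P0 mmul_rmat in auto)
  show "{A\<in>rmat W d d. ALL a b. A a b\<in>Pp 0} = car (Mat W d)" using rmatD by auto
  show "A*.(Mat W d) C\<in>{A\<in>rmat W d d. ALL a b. A a b\<in>Pp (i + j)}"
  if "A\<in>{A\<in>rmat W d d. ALL a b. A a b\<in>Pp i}" "C\<in>{A\<in>rmat W d d. ALL a b. A a b\<in>Pp j}" for A C i j
  using that mmul_rmat prod by auto
  show "{A\<in>rmat W d d. ALL a b. A a b\<in>Pp (Suc i)} <= {A\<in>rmat W d d. ALL a b. A a b\<in>Pp i}" for i
  using Pp_mono[of i "Suc i"] by auto
  show "A = 0@(Mat W d)" if "A<:(Mat W d)" "!!i. A\<in>{A\<in>rmat W d d. ALL a b. A a b\<in>Pp i}" for A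
  proof (intro ext)
  fix a b show "A a b = 0@(Mat W d) a b"
  using Pp_separated[of "A a b" 0] that rmatD[of A W d d] by simp
  qed
  show "\<exists>y\<in>car (Mat W d). ALL i. y-.(Mat W d) x i\<in>{A\<in>rmat W d d. ALL a b. A a b\<in>Pp i}"
  if x:"!!i. x i<:(Mat W d)"
  and "!!i. x (Suc i)-.(Mat W d) x i\<in>{A\<in>rmat W d d. ALL a b. A a b\<in>Pp i}" for x
  proof -
  have xm:"x i\<in>rmat W d d" for i using x by simp
  have "\<exists>y\<in>car W. ALL i. y \<ominus> x i a b\<in>Pp i" for a b
  using that(2) Mat_minus[OF xm xm] by (intro Pp_complete rmatD[OF xm]) auto
  then obtain y where y:"y a b<:W" "y a b \<ominus> x i a b\<in>Pp i" for a b i by metis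
  let ?y = "%a b. if a < d & b < d then y a b else \<zero>"
  have ym:"?y\<in>rmat W d d" using y(1) by (auto simp:rmat_def)
  have "?y a b \<ominus> x i a b\<in>Pp i" for a b i
  using y(2)[of a b i] xm[of i] by (auto simp:rmat_def a_minus_def)
  then show ?thesis
  using ym xm MW.minus_closed[of ?y] by (intro bexI[of _ ?y]) (auto simp:Mat_minus[OF ym xm])
  qed
 qed
qed

section \<open>Modules over truncated Witt rings\<close>

locale truncation = W: p_ring W k res p + q: ring_hom_cring W A q
 for W :: "('w,'mw) ring_scheme" and k :: "('k,'l) ring_scheme" and res p
  and A :: "('a,'ma) ring_scheme" and q +
 fixes \<epsilon> :: "'a => 'k" and n :: nat
 assumes n:"n \<ge> 1" and q_surj:"q ` car W = car A"
  and q_ker:"w<:W==>q w = 0@A \<longleftrightarrow> w\<in>W.Pp n"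
  and \<epsilon>_q:"w<:W==>\<epsilon> (q w) = res w"
begin

lemma q_eq:"a<:W==>b<:W==>q a = q b \<longleftrightarrow> a-.W b\<in>W.Pp n"
 using q_ker[of "a-.W b"] q.S.r_right_minus_eq[of "q a" "q b"] by (simp add:a_minus_def)

lemma q_obtain: assumes "a<:A" obtains w where "w<:W" "a = q w"
 using assms q_surj by blast

lemma \<epsilon>_hom:"\<epsilon>\<in>ring_hom A k"
proof (rule ring_hom_memI)
 fix x y assume x:"x<:A" and y:"y<:A"
 obtain v w where v:"v<:W" "x = q v" and w:"w<:W" "y = q w"
  using q_obtain[OF x] q_obtain[OF y] by metis
 show "\<epsilon> x<:k" by (simp add:v \<epsilon>_q)
 have "\<epsilon> (q (v*.W w)) = \<epsilon> (q v)*.k \<epsilon> (q w)" using v w by (simp only: \<epsilon>_q W.m_closed W.res.hom_mult)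
 then show "\<epsilon> (x*.A y) = \<epsilon> x*.k \<epsilon> y" using v w by simp
 have "\<epsilon> (q (v+.W w)) = \<epsilon> (q v)+.k \<epsilon> (q w)" using v w by (simp only: \<epsilon>_q W.a_closed W.res.hom_add)
 then show "\<epsilon> (x+.A y) = \<epsilon> x+.k \<epsilon> y" using v w by simp
next
 show "\<epsilon> 1@A = 1@k" using \<epsilon>_q[OF W.one_closed] by simp
qed

sublocale A: local_over A k \<epsilon>
proof (intro local_over.intro local_over_axioms.intro q.S.is_cring W.k.field_axioms \<epsilon>_hom)
 have "\<epsilon> ` car A = res ` car W" unfolding q_surj[symmetric] image_image using \<epsilon>_q by (rule image_cong[OF refl])
 then show "\<epsilon> ` car A = car k" by (simp add:W.res_surj)
 fix b assume b:"b<:A" "\<epsilon> b ~= 0@k"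
 obtain w where w:"w<:W" "b = q w" by (rule q_obtain[OF b(1)])
 obtain v where v:"v<:W" "w*.W v = 1@W" using W.unit_if_res[OF w(1)] b(2) w \<epsilon>_q by auto
 have "q w*.A q v = 1@A" using q.hom_mult[OF w(1) v(1)] v(2) by simp
 then show "\<exists>c\<in>car A. b*.A c = 1@A" using v(1) w(2) by (intro bexI[of _ "q v"]) auto
qed

lemma \<epsilon>_zero: assumes "a<:A" "\<epsilon> a = 0@k" shows "\<exists>c\<in>car A. a = q W.unif*.A c"
proof -
 obtain w where w:"w<:W" "a = q w" by (rule q_obtain[OF assms(1)])
 obtain v where v:"v<:W" "w = W.unif*.W v"
  using W.res_ker[OF w(1)] assms(2) w \<epsilon>_q by (auto simp:W.unif_def)
 show ?thesis using v w by (intro bexI[of _ "q v"]) simp_all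
qed

lemma unif_pow_torsion:
 assumes "a<:A" "q (W.unif ^.W m)*.A a = 0@A" "m < n" shows "\<epsilon> a = 0@k"
proof -
 obtain w where w:"w<:W" "a = q w" by (rule q_obtain[OF assms(1)])
 have "q (W.unif ^.W m*.W w) = 0@A" using w assms(2) by simp
 then have "W.unif ^.W m*.W w\<in>W.Pp (m + (n - m))" using q_ker[of "W.unif ^.W m*.W w"] w assms(3) by simp
 then have "w\<in>W.Pp (n - m)" by (rule W.Pp_cancel[OF w(1)])
 then show ?thesis using W.Pp_res[of "n - m" w] assms(3) w \<epsilon>_q by simp
qed

end

lemma (in module) add_pow_smult:"x<:M==>add_pow M (m::nat) x = add_pow R m \<one> *:M x"
 by (induction m) (simp_all add: smult_l_distr M.add.nat_pow_Suc R.add.nat_pow_Suc)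

locale reduced_module = truncation W k res p A q \<epsilon> n + N: group_module A G N + V: group_module k G V
 for W :: "('w,'mw) ring_scheme" and k :: "('k,'l) ring_scheme" and res p
  and A :: "('a,'ma) ring_scheme" and q \<epsilon> n and G :: "('g,'lg) monoid_scheme" and N :: "('a,'u,'g) gmodule" and V :: "('k,'v,'g) gmodule" +
 fixes \<Phi> d v
 assumes proj:"projective_gmodule A G N" and \<Phi>: "\<Phi>\<in>gisos k G (ext_scalars A k \<epsilon> N) V"
  and v:"is_basis k V d v"
begin

sublocale X: scalar_extension A k \<epsilon> G N
 by (intro scalar_extension.intro A.r.ring_hom_cring_axioms N.group_module_axioms)

definition red where "red x = \<Phi> (X.tens 1@k x)"

lemma \<Phi>_lin:"\<Phi>\<in>lin_maps k X.E V" and \<Phi>_bij:"bij_betw \<Phi> (car X.E) (car V)"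
 using \<Phi> by (auto simp:gisos_def ghoms_def)

lemma tens_one:"x<:N==>X.tens 1@k x<:X.E" by (rule X.tens_closed[OF W.k.one_closed])

lemma red_closed:"x<:N==>red x<:V"
 unfolding red_def using \<Phi>_lin tens_one by (auto simp:lin_maps_def)

lemma red_add:"x<:N==>y<:N==>red (x+.N y) = red x+.V red y"
 unfolding red_def using \<Phi>_lin tens_one by (simp add:X.tens_add_right lin_maps_def)

lemma tens_scalar:"a<:A==>x<:N==>X.tens 1@k (a*:N x) = \<epsilon> a*:X.E X.tens 1@k x"
 by (simp add:X.tens_balanced X.tens_smult)

lemma red_smult:"a<:A==>x<:N==>red (a*:N x) = \<epsilon> a*:V red x"
 unfolding red_def using \<Phi>_lin tens_one by (simp add:tens_scalar lin_maps_def)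

lemma red_lincomb:
 assumes "!!j. j < m==>c j<:A" "!!j. j < m==>x j<:N"
 shows "red (lincomb N m c x) = lincomb V m (%j. \<epsilon> (c j)) (%j. red (x j))"
proof -
 have "X.tens 1@k (lincomb N m c x) = lincomb X.E m (%j. 1@k*.k \<epsilon> (c j)) (%j. X.tens 1@k (x j))"
  using X.tens_lincomb[OF W.k.one_closed,of m c x] assms by simp
 also have "... = lincomb X.E m (%j. \<epsilon> (c j)) (%j. X.tens 1@k (x j))"
  by (rule lincomb_cong[OF X.E.module_axioms]) (use assms tens_one in auto)
 finally show ?thesis unfolding red_def
  using X.E.lin_maps_lincomb[OF V.module_axioms \<Phi>_lin,of m "%j. \<epsilon> (c j)" "%j. X.tens 1@k (x j)"] assms tens_one by simp
qed

lemma red_surj: assumes "y<:V" shows "\<exists>x\<in>car N. red x = y"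
proof -
 obtain Z where Z:"Z<:X.E" "y = \<Phi> Z" using assms \<Phi>_bij by (auto simp:bij_betw_def)
 have sc:"\<exists>a\<in>car A. \<epsilon> a = c" if "c<:k" for c using A.r_surj that by (metis imageE)
 have "\<exists>x\<in>car N. Z = X.tens 1@k x" using Z(1)
 proof (rule X.E_induct)
  fix c x assume c:"c<:k" and x:"x<:N"
  obtain a where a:"a<:A" "\<epsilon> a = c" using sc[OF c] by blast
  show "\<exists>y\<in>car N. X.tens c x = X.tens 1@k y"
  using a c x by (intro bexI[of _ "a*:N x"]) (simp_all add: tens_scalar X.tens_smult)
 next
  have "X.tens 1@k 0@N = 0@X.E"
  using tens_scalar[OF q.S.zero_closed N.M.zero_closed] tens_one[OF N.M.zero_closed] by simp
  then show "\<exists>x\<in>car N. 0@X.E = X.tens 1@k x" by (intro bexI[of _ "0@N"]) simp_all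
 next
  fix z y assume zy:"\<exists>x\<in>car N. z = X.tens 1@k x" "\<exists>x\<in>car N. y = X.tens 1@k x"
  obtain x where x:"x<:N" "z = X.tens 1@k x" using zy(1) by blast
  obtain x' where x': "x'<:N" "y = X.tens 1@k x'" using zy(2) by blast
  obtain a where a:"a<:A" "\<epsilon> a = -:k 1@k" using sc[of "-:k 1@k"] by auto
  show "\<exists>x\<in>car N. z+.X.E (-:k 1@k)*:X.E y = X.tens 1@k x"
  using x x' a by (intro bexI[of _ "x+.N a*:N x'"]) (simp_all add: X.tens_add_right tens_scalar)
 qed
 then show ?thesis using Z(2) by (auto simp:red_def)
qed

text \<open>Coordinates in a free module containing \<open>N\<close> as a summand: they detect divisibility by scalars. Flatness of \<open>N\<close> is used in this form.\<close>
lemma coordinate_functionals: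
 obtains f :: "'u \<times> 'g => 'u => 'a"
 where "!!z x. x<:N==>f z x<:A"
  "!!z x y. x<:N==>y<:N==>f z (x+.N y) = f z x+.A f z y"
  "!!z a x. a<:A==>x<:N==>f z (a*:N x) = a*.A f z x"
  "!!a x. a<:A==>x<:N==>(!!z. \<exists>c\<in>car A. f z x = a*.A c)==>\<exists>y\<in>car N. x = a*:N y"
proof -
 obtain I :: "'u set" and i r where i:"i\<in>ghoms A G N (free_gmodule A G I)"
  and r:"r\<in>ghoms A G (free_gmodule A G I) N" and ri:"!!x. x<:N==>r (i x) = x"
  using proj unfolding projective_gmodule_def by blast
 let ?F = "free_gmodule A G I"
 have ic:"i x<:?F" if "x<:N" for x using i that by (auto simp:ghoms_def lin_maps_def)
 show ?thesis
 proof (rule that[of "%z x. i x z"])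
  show "i x z<:A" if "x<:N" for z x
  using ic[OF that] by (cases z) (simp add:free_gmodule_def)
  show "i (x+.N y) z = i x z+.A i y z" if "x<:N" "y<:N" for x y z
  using i that by (simp add:ghoms_def lin_maps_def free_gmodule_def)
  show "i (a*:N x) z = a*.A i x z" if "a<:A" "x<:N" for a x z
  using i that by (simp add:ghoms_def lin_maps_def free_gmodule_def)
  fix a x assume a:"a<:A" and x:"x<:N" and "!!z. \<exists>c\<in>car A. i x z = a*.A c"
  then obtain c where c:"!!z. c z<:A" "!!z. i x z = a*.A c z" by metis
  define h where "h z = (if i x z = 0@A then 0@A else c z)" for z
  have sub:"{z. h z ~= 0@A} <= {z. i x z ~= 0@A}" by (auto simp:h_def)
  have h:"h<:?F" using ic[OF x] c(1) finite_subset[OF sub] by (auto simp:free_gmodule_def h_def)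
  have "i x = a*:?F h" using c a by (auto simp:free_gmodule_def h_def)
  then have "x = r (a*:?F h)" using ri[OF x] by simp
  also have "... = a*:N r h" using r a h by (simp add:ghoms_def lin_maps_def)
  finally show "\<exists>y\<in>car N. x = a*:N y" using r h by (auto simp:ghoms_def lin_maps_def)
 qed
qed

text \<open>A coordinate functional followed by reduction factors through the tensor product, so it vanishes on \<open>x\<close>.\<close>
lemma red_kernel: assumes x:"x<:N" and 0:"red x = 0@V" shows "\<exists>y\<in>car N. x = q W.unif*:N y"
proof -
 obtain f :: "'u \<times> 'g => 'u => 'a" where f:"!!z x. x<:N==>f z x<:A"
  "!!z x y. x<:N==>y<:N==>f z (x+.N y) = f z x+.A f z y"
  "!!z a x. a<:A==>x<:N==>f z (a*:N x) = a*.A f z x"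
  and div:"!!a x. a<:A==>x<:N==>(!!z. \<exists>c\<in>car A. f z x = a*.A c)==>\<exists>y\<in>car N. x = a*:N y"
  by (rule coordinate_functionals) blast
 have "\<Phi> 0@X.E = 0@V"
 proof -
  have "\<Phi> (0@k*:X.E 0@X.E) = 0@k*:V \<Phi> 0@X.E"
  using \<Phi>_lin X.E.M.zero_closed W.k.zero_closed unfolding lin_maps_def by blast
  moreover have "\<Phi> 0@X.E<:V" using \<Phi>_lin by (auto simp:lin_maps_def)
  ultimately show ?thesis by simp
 qed
 then have t0:"X.tens 1@k x = 0@X.E"
  using inj_onD[OF bij_betw_imp_inj_on[OF \<Phi>_bij] _ tens_one[OF x] X.E.M.zero_closed] 0 unfolding red_def by simp
 have e0:"\<epsilon> (f z x) = 0@k" for z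
 proof (rule X.E_universal[where P = "add_monoid k" and \<beta> = "%c y. c*.k \<epsilon> (f z y)"])
  show "comm_group (add_monoid k)" by (rule W.k.a_comm_group)
  fix F assume F:"!!Z. Z<:X.E==>F Z<:(add_monoid k)"
  "!!Y Z. Y<:X.E==>Z<:X.E==>F (Y+.X.E Z) = F Y*.(add_monoid k) F Z"
  "!!c x. c<:k==>x<:N==>F (X.tens c x) = c*.k \<epsilon> (f z x)"
  have "F 0@X.E = F 0@X.E+.k F 0@X.E" using F(2)[of "0@X.E" "0@X.E"] by simp
  then have "F 0@X.E = 0@k" using F(1)[of "0@X.E"] by simp
  then show ?thesis using F(3)[OF W.k.one_closed x] t0 f(1)[OF x] by simp
 qed (use f in \<open>simp_all add: W.k.l_distr W.k.r_distr W.k.m_assoc\<close>)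
 show ?thesis by (rule div[OF _ x]) (use \<epsilon>_zero[OF f(1)[OF x] e0] in auto)
qed

lemma torsion_red:
 assumes x:"x<:N" and 0:"q (W.unif ^.W m)*:N x = 0@N" and m:"m < n" shows "red x = 0@V"
proof -
 obtain f :: "'u \<times> 'g => 'u => 'a" where f:"!!z x. x<:N==>f z x<:A"
  "!!z x y. x<:N==>y<:N==>f z (x+.N y) = f z x+.A f z y"
  "!!z a x. a<:A==>x<:N==>f z (a*:N x) = a*.A f z x"
  and div:"!!a x. a<:A==>x<:N==>(!!z. \<exists>c\<in>car A. f z x = a*.A c)==>\<exists>y\<in>car N. x = a*:N y"
  by (rule coordinate_functionals) blast
 have f0:"f z 0@N = 0@A" for z using f(3)[OF q.S.zero_closed N.M.zero_closed,of z] f(1)[OF N.M.zero_closed,of z] by simp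
 have "q (W.unif ^.W m)*.A f z x = 0@A" for z using f(3)[of "q (W.unif ^.W m)" x z] x 0 f0 by simp
 then have "\<exists>y\<in>car N. x = q W.unif*:N y"
  by (intro div[OF _ x]) (use \<epsilon>_zero[OF f(1)[OF x]] unif_pow_torsion[OF f(1)[OF x] _ m] in auto)
 then show ?thesis using red_closed by (auto simp:red_smult \<epsilon>_q W.res_unif)
qed

text \<open>Lifts of a basis generate because \<open>p\<close> is nilpotent. A relation among them is divisible by every power of \<open>p\<close> up to \<open>p^n = 0\<close>:
 divide it by the power found so far and reduce.\<close>
lemma basis_lift:"EX e. is_basis A N d e"
proof -
 note vc = V.basis_closed[OF v]
 have "EX x. j < d \<longrightarrow> x<:N & red x = v j" for j using red_surj[OF vc] by blast
 then obtain e where e:"!!j. j < d==>e j<:N" "!!j. j < d==>red (e j) = v j" by metis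
 have red_e:"red (lincomb N d c e) = lincomb V d (%j. \<epsilon> (c j)) v" if "!!j. j < d==>c j<:A" for c
  by (subst red_lincomb) (use that e vc in \<open>auto intro!: lincomb_cong[OF V.module_axioms]\<close>)
 have approx:"\<exists>c\<in>vecs A d. \<exists>y\<in>car N. x = lincomb N d c e+.N q W.unif*:N y" if x:"x<:N" for x
 proof -
  let ?b = "coords k V d v (red x)"
  note b = V.coords_vecs[OF v red_closed[OF x]]
  have "EX a. a<:A & \<epsilon> a = ?b j" for j using A.r_surj vecsD[OF b,of j] by (metis imageE)
  then obtain a where a:"!!j. a j<:A" "!!j. \<epsilon> (a j) = ?b j" by metis
  define c where "c j = (if j < d then a j else 0@A)" for j
  have c:"c\<in>vecs A d" using a by (simp add:vecs_def c_def)
  have lc:"lincomb N d c e<:N" by (rule N.lincomb_closed) (use vecsD[OF c] e in auto)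
  have "red (lincomb N d c e) = lincomb V d ?b v"
  by (subst red_e) (use a vc vecsD[OF b] in \<open>auto simp:c_def intro!: lincomb_cong[OF V.module_axioms]\<close>)
  then have rl:"red (lincomb N d c e) = red x" by (simp add:V.lincomb_coords[OF v red_closed[OF x]])
  define z where "z = x+.N (-:A 1@A)*:N lincomb N d c e"
  have zm:"z = x-.N lincomb N d c e" unfolding z_def using lc by (simp add:N.smult_l_minus a_minus_def)
  have zc:"z<:N" unfolding zm using x lc by simp
  have "red z = 0@V"
  unfolding z_def using x lc red_closed[OF x] by (simp add:red_add red_smult rl V.smult_l_minus V.M.r_neg)
  then obtain y where y:"y<:N" "z = q W.unif*:N y" using red_kernel[OF zc] by blast
  have "x = lincomb N d c e+.N z" unfolding zm using x lc
  by (simp add:a_minus_def N.M.a_lcomm N.M.r_neg)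
  then show ?thesis using y c by blast
 qed
 have span:"\<exists>c\<in>vecs A d. \<exists>y\<in>car N. x = lincomb N d c e+.N q (W.unif ^.W (m::nat))*:N y"
  if x:"x<:N" for x m
 proof (induction m)
  case 0
  show ?case using x e(1) by (intro bexI[of _ "%i. 0@A"] bexI[of _ x]) (simp_all add: N.lincomb_zero vecs_def)
 next
  case (Suc m)
  let ?u = "q (W.unif ^.W m)"
  have u:"?u<:A" "q W.unif<:A" by simp_all
  obtain c y where c:"c\<in>vecs A d" and y:"y<:N" and xe:"x = lincomb N d c e+.N ?u*:N y"
  using Suc by blast
  obtain c' y' where c': "c'\<in>vecs A d" and y': "y'<:N" and ye:"y = lincomb N d c' e+.N q W.unif*:N y'"
  using approx[OF y] by blast
  have lc:"lincomb N d c e<:N" "lincomb N d c' e<:N"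
  by (rule N.lincomb_closed; use vecsD[OF c] vecsD[OF c'] e in auto)+
  have "x = (lincomb N d c e+.N ?u*:N lincomb N d c' e)+.N (?u*.A q W.unif)*:N y'"
  unfolding xe ye using lc y' u by (simp add:N.smult_r_distr N.smult_assoc1 N.M.a_assoc)
  also have "lincomb N d c e+.N ?u*:N lincomb N d c' e = lincomb N d (%i. c i+.A ?u*.A c' i) e"
  using N.lincomb_add[of d c "%i. ?u*.A c' i" e] N.lincomb_smult[OF u(1),of d c' e] vecsD[OF c] vecsD[OF c'] e(1) u by simp
  also have "?u*.A q W.unif = q (W.unif ^.W Suc m)" by simp
  finally have "x = lincomb N d (%i. c i+.A ?u*.A c' i) e+.N q (W.unif ^.W Suc m)*:N y'" .
  moreover have "(%i. c i+.A ?u*.A c' i)\<in>vecs A d" using c c' u by (simp add:vecs_def)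
  ultimately show ?case using y' by blast
 qed
 have un:"q (W.unif ^.W n) = 0@A" by (rule q_ker[THEN iffD2]) (use W.PpI[OF W.one_closed,of n] in simp_all)
 show ?thesis
 proof (intro exI N.is_basisI)
  show "e j<:N" if "j < d" for j using e that by simp
  fix x assume x:"x<:N"
  obtain c y where c:"c\<in>vecs A d" and y:"y<:N" "x = lincomb N d c e+.N q (W.unif ^.W n)*:N y"
  using span[OF x,of n] by blast
  have "lincomb N d c e<:N" by (rule N.lincomb_closed) (use vecsD[OF c] e in auto)
  then show "\<exists>c\<in>vecs A d. x = lincomb N d c e" using c y un by auto
 next
  fix c assume c:"c\<in>vecs A d" and 0:"lincomb N d c e = 0@N"
  have "\<exists>b\<in>vecs A d. c = (%i. q (W.unif ^.W m)*.A b i)" if "m \<le> n" for m using that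
  proof (induction m)
  case 0 show ?case using vecsD[OF c] by (intro bexI[of _ c] ext) (simp_all add: c)
  next
  case (Suc m)
  let ?u = "q (W.unif ^.W m)"
  obtain b where b:"b\<in>vecs A d" and cb:"c = (%i. ?u*.A b i)" using Suc by auto
  have lb:"lincomb N d b e<:N" by (rule N.lincomb_closed) (use vecsD[OF b] e in auto)
  have "?u*:N lincomb N d b e = 0@N"
  using N.lincomb_smult[of ?u d b e] vecsD[OF b] e(1) 0 by (simp add:cb)
  then have "lincomb V d (%j. \<epsilon> (b j)) v = 0@V"
  using torsion_red[OF lb,of m] Suc.prems red_e[of b] vecsD[OF b] by simp
  then have "(%j. \<epsilon> (b j)) = (%j. 0@k)"
  using V.coords_unique[OF v,of "%j. \<epsilon> (b j)"] V.coords_unique[OF v,of "%j. 0@k"]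
  A.r.map_vecs[OF b] V.lincomb_zero[of d v,OF vc] by (simp add:vecs_def)
  then have "EX a. a<:A & b j = q W.unif*.A a" for j
  using \<epsilon>_zero[OF vecsD[OF b]] by (auto simp:fun_eq_iff)
  then obtain a where a:"!!j. a j<:A" "!!j. b j = q W.unif*.A a j" by metis
  let ?a = "%j. if j < d then a j else 0@A"
  have "c j = q (W.unif ^.W Suc m)*.A ?a j" for j
  proof (cases "j < d")
  case True then show ?thesis unfolding cb a(2) using a(1)[of j] by (simp add:q.S.m_assoc)
  next
  case False then show ?thesis using c by (simp add:vecs_def)
  qed
  then show ?case using a(1) by (intro bexI[of _ ?a] ext) (simp_all add: vecs_def)
  qed
  from this[OF order_refl] obtain b where b:"b\<in>vecs A d" "c = (%i. q (W.unif ^.W n)*.A b i)" by blast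
  then show "c = (%i. 0@A)" using vecsD[OF b(1)] by (simp add:b(2) un)
 qed
qed

end

section \<open>Homomorphisms into the endomorphism module\<close>

text \<open>For a structure not known to be an abelian monoid, a sum over a singleton still has its recursive value.\<close>
lemma finsum_singleton_raw:
 fixes H (structure)
 assumes "\<zero><:H" "f s \<oplus> \<zero><:H" shows "(\<Oplus>i\<in>{s}. f i) = f s \<oplus> \<zero>"
proof -
 let ?F = "monoid.mult (add_monoid H) \<circ> f"
 have "foldD (car H) ?F \<zero> {s} = ?F s \<zero>"
  unfolding foldD_def
 proof (rule the_equality)
  show "({s},?F s \<zero>)\<in>foldSetD (car H) ?F \<zero>"
  using assms by (intro foldSetD.intros) simp_all
  fix y assume "({s},y)\<in>foldSetD (car H) ?F \<zero>"
  then show "y = ?F s \<zero>"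
  proof (cases rule: foldSetD.cases)
  case (insertI x A z)
  then have "x = s" "A = {}" by auto
  then show ?thesis using insertI by (auto elim: empty_foldSetDE)
  qed simp
 qed
 then show ?thesis by (simp add:finsum_def finprod_def)
qed

locale adjoint_homs = N: framed_module A G N d e \<rho> + V': group_module Z G V'
 for A :: "('a,'ma) ring_scheme" and G :: "('g,'lg) monoid_scheme" and N :: "('a,'u,'g) gmodule" and d e \<rho>
  and Z :: "int ring" and V' :: "(int,'x,'g) gmodule" +
 fixes P :: nat
 assumes Z:"Z = residue_ring (int P)" and P:"P > 1"
begin

abbreviation "M \<equiv> End_gmodule A G N"
abbreviation "MZ \<equiv> restrict_scalars (%z::int. add_pow A z 1@A) M"

lemma M_sel:"0@M = (\<lambda>x\<in>car N. 0@N)" "f+.M h = (\<lambda>x\<in>car N. f x+.N h x)"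
 "a*:M f = (\<lambda>x\<in>car N. a*:N f x)"
 by (simp_all add: End_gmodule_def map_module_def module.defs gmodule.defs)

lemma MZ_sel:"car MZ = lin_maps A N N" "f+.MZ h = (\<lambda>x\<in>car N. f x+.N h x)"
 "z*:MZ f = (\<lambda>x\<in>car N. add_pow A z 1@A*:N f x)"
 "act MZ g f = (\<lambda>x\<in>car N. act N g (f (act N (~.G g) x)))"
 by (simp_all add: restrict_scalars_def End_gmodule_def map_module_def ring.defs module.defs gmodule.defs)

lemma Z_add_pow:"add_pow Z (m::nat) 1@Z = int m mod int P"
proof (induction m)
 case (Suc m)
 then show ?case using V'.R.add.nat_pow_Suc[of m "1@Z"] by (simp add:Z residue_ring_def mod_add_left_eq) (simp add:add.commute)
qed (use V'.R.add.nat_pow_0[of "1@Z"] in \<open>simp add:Z residue_ring_def\<close>)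

lemma Z_smult: assumes z:"z<:Z" and x:"x<:V'" shows "z*:V' x = add_pow V' (nat z) x"
proof -
 have "0 \<le> z" "z < int P" using z by (auto simp:Z residue_ring_def)
 then have "add_pow Z (nat z) 1@Z = z" by (simp add:Z_add_pow)
 then show ?thesis using V'.add_pow_smult[OF x,of "nat z"] by simp
qed

lemma exponent: assumes "x<:V'" shows "add_pow V' P x = 0@V'"
proof -
 have "add_pow Z P 1@Z = 0@Z" unfolding Z_add_pow by (simp add:Z residue_ring_def)
 then show ?thesis using V'.add_pow_smult[OF assms,of P] assms by simp
qed

definition compatible where
 "compatible F \<longleftrightarrow> (\<forall>x\<in>car V'. F x\<in>rmat A d d) \<and>
  (\<forall>x\<in>car V'. \<forall>y\<in>car V'. F (x+.V' y) = (%a b. F x a b+.A F y a b)) \<and>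
  (\<forall>g\<in>car G. \<forall>x\<in>car V'. mmul A d (\<rho> g) (F x) = mmul A d (F (act V' g x)) (\<rho> g))"

lemma compatibleD:
 assumes "compatible F"
 shows "x<:V'==>F x\<in>rmat A d d"
  "x<:V'==>y<:V'==>F (x+.V' y) = (%a b. F x a b+.A F y a b)"
  "g<:G==>x<:V'==>mmul A d (\<rho> g) (F x) = mmul A d (F (act V' g x)) (\<rho> g)"
 using assms unfolding compatible_def by blast+

lemma compatible_smat: assumes F:"compatible F" and c:"c<:A" shows "compatible (%x. smat A c (F x))"
proof -
 note r = rmatD[OF compatibleD(1)[OF F]] rmatD[OF N.\<rho>_rmat]
 show ?thesis unfolding compatible_def
  using F c r by (simp add:N.R.smat_rmat compatibleD N.R.smat_add N.R.smmul_l N.R.smmul_r V'.act_closed)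
qed

lemma compatible_add_pow: assumes F:"compatible F" and x:"x<:V'"
 shows "F (add_pow V' (m::nat) x) = smat A (add_pow A m 1@A) (F x)"
proof (induction m)
 case 0
 have z:"0@V'<:V'" by simp
 have "F 0@V' a b = 0@A" for a b
 proof -
  have c:"F 0@V' a b<:A" by (rule rmatD[OF compatibleD(1)[OF F z]])
  have "F 0@V' a b = F 0@V' a b+.A F 0@V' a b"
  using fun_cong[OF fun_cong[OF compatibleD(2)[OF F z z]],of a b] by simp
  then show ?thesis using N.R.add.r_cancel_one'[OF c c] by simp
 qed
 then show ?case using rmatD[OF compatibleD(1)[OF F x]] by (intro ext) (simp add:smat_def)
next
 case (Suc m)
 have "add_pow V' m x<:V'" using x by simp
 then show ?case using Suc x rmatD[OF compatibleD(1)[OF F x]]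
  by (simp add:V'.M.add.nat_pow_Suc N.R.add.nat_pow_Suc compatibleD(2)[OF F])
  (simp add:smat_def N.R.l_distr)
qed

lemma ghom_of_matrices: assumes F:"compatible F" shows "(\<lambda>x\<in>car V'. N.lmap (F x))\<in>ghoms Z G V' MZ"
proof -
 note Fc = compatibleD(1)[OF F]
 have ext:"N.lmap B = (\<lambda>y\<in>car N. h y)" if "!!y. y<:N==>N.lmap B y = h y" for B h
  using that by (auto simp:N.lmap_def fun_eq_iff)
 have add:"N.lmap (F (x+.V' y)) = N.lmap (F x)+.MZ N.lmap (F y)" if "x<:V'" "y<:V'" for x y
  unfolding MZ_sel by (rule ext) (simp add:that compatibleD(2)[OF F] N.lmap_add Fc)
 have smult:"N.lmap (F (z*:V' x)) = z*:MZ N.lmap (F x)" if z:"z<:Z" and x:"x<:V'" for z x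
 proof -
  have "0 \<le> z" using z by (simp add:Z residue_ring_def)
  then have "add_pow A z 1@A = add_pow A (nat z) 1@A" unfolding add_pow_def int_pow_def2 by simp
  then show ?thesis unfolding MZ_sel
  by (intro ext) (simp add:Z_smult[OF z x] compatible_add_pow[OF F x] N.lmap_smat Fc[OF x])
 qed
 have eqv:"N.lmap (F (act V' g x)) = act MZ g (N.lmap (F x))" if g:"g<:G" and x:"x<:V'" for g x
  unfolding MZ_sel
 proof (rule ext)
  fix y assume y:"y<:N"
  let ?y = "act N (~.G g) y"
  have y': "?y<:N" using g y by (simp add:N.act_closed)
  have gx:"act V' g x<:V'" using g x by (simp add:V'.act_closed)
  have "y = N.lmap (\<rho> g) ?y" using g y y' by (simp add:N.lmap_act N.act_mult[symmetric] N.act_one)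
  then have "N.lmap (F (act V' g x)) y = N.lmap (F (act V' g x)) (N.lmap (\<rho> g) ?y)" by simp
  also have "... = N.lmap (mmul A d (\<rho> g) (F x)) ?y"
  unfolding compatibleD(3)[OF F g x] by (rule N.lmap_mult[symmetric,OF Fc[OF gx] N.\<rho>_rmat[OF g] y'])
  also have "... = act N g (N.lmap (F x) ?y)"
  by (simp add:N.lmap_mult[OF N.\<rho>_rmat[OF g] Fc[OF x] y'] N.lmap_act[OF g] N.lmap_closed[OF Fc[OF x] y'])
  finally show "N.lmap (F (act V' g x)) y = act N g (N.lmap (F x) ?y)" .
 qed
 have "N.lmap (F x)<:MZ" if "x<:V'" for x unfolding MZ_sel by (rule N.lmap_lin[OF Fc[OF that]])
 then show ?thesis using add smult eqv by (simp add:ghoms_def lin_maps_def[of Z] V'.act_closed)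
qed

lemma matrices_of_ghom:
 assumes f:"f\<in>ghoms Z G V' MZ" shows "EX F. compatible F & f = (\<lambda>x\<in>car V'. N.lmap (F x))"
proof -
 have fc:"f x\<in>lin_maps A N N" if "x<:V'" for x using f that MZ_sel(1) by (auto simp:ghoms_def lin_maps_def[of Z])
 have "EX B. x<:V' \<longrightarrow> B\<in>rmat A d d & f x = N.lmap B" for x using N.lmap_surj[OF fc] by blast
 then obtain F where F:"!!x. x<:V'==>F x\<in>rmat A d d" "!!x. x<:V'==>f x = N.lmap (F x)" by metis
 have sum:"(%a b. F x a b+.A F y a b)\<in>rmat A d d" if "x<:V'" "y<:V'" for x y
  using F(1)[OF that(1)] F(1)[OF that(2)] by (auto simp:rmat_def)
 have "F (x+.V' y) = (%a b. F x a b+.A F y a b)" if x:"x<:V'" and y:"y<:V'" for x y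
 proof (rule N.lmap_inj)
  have "f (x+.V' y) = f x+.MZ f y" using f x y by (simp add:ghoms_def lin_maps_def[of Z])
  then show "N.lmap (F (x+.V' y)) z = N.lmap (%a b. F x a b+.A F y a b) z" if "z<:N" for z
  using that x y by (simp add:F MZ_sel N.lmap_add)
 qed (use x y F sum in auto)
 moreover have "mmul A d (\<rho> g) (F x) = mmul A d (F (act V' g x)) (\<rho> g)"
  if g:"g<:G" and x:"x<:V'" for g x
 proof (rule N.lmap_inj)
  have gx:"act V' g x<:V'" using g x by (simp add:V'.act_closed)
  note m = F(1)[OF x] F(1)[OF gx] N.\<rho>_rmat[OF g]
  show "mmul A d (\<rho> g) (F x)\<in>rmat A d d" "mmul A d (F (act V' g x)) (\<rho> g)\<in>rmat A d d"
  by (rule N.R.mmul_rmat; rule m)+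
  have eq:"f (act V' g x) = act MZ g (f x)" using f g x by (simp add:ghoms_def)
  fix z assume z:"z<:N"
  have gz:"act N g z<:N" using g z by (simp add:N.act_closed)
  have "act N (~.G g) (act N g z) = z" using g z by (simp add:N.act_mult[symmetric] N.act_one)
  then have "N.lmap (F (act V' g x)) (act N g z) = act N g (N.lmap (F x) z)"
  using fun_cong[OF eq,of "act N g z"] gz by (simp add:F(2)[OF x] F(2)[OF gx] MZ_sel)
  then show "N.lmap (mmul A d (\<rho> g) (F x)) z = N.lmap (mmul A d (F (act V' g x)) (\<rho> g)) z"
  by (simp add:N.lmap_mult[OF m(3,1) z] N.lmap_mult[OF m(2,3) z] N.lmap_act[OF g] z N.lmap_closed[OF m(1) z])
 qed
 moreover have "f = (\<lambda>x\<in>car V'. N.lmap (F x))"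
  using f F(2) by (auto simp:ghoms_def lin_maps_def[of Z] PiE_def extensional_def fun_eq_iff)
 ultimately show ?thesis using F(1) unfolding compatible_def by blast
qed

lemma compatible_proportional:
 assumes free:"free_of_rank A (Hom_module Z G V' MZ M) 1"
 shows "EX F0. compatible F0 & (ALL F. compatible F \<longrightarrow> (\<exists>c\<in>car A. \<forall>x\<in>car V'. F x = smat A c (F0 x)))"
proof -
 let ?H = "Hom_module Z G V' MZ M"
 have Hs:"car ?H = ghoms Z G V' MZ" "f+.?H h = (\<lambda>x\<in>car V'. f x+.M h x)" "0@?H = (\<lambda>x\<in>car V'. 0@M)"
  "a*:?H f = (\<lambda>x\<in>car V'. a*:M f x)" for f h a
  by (simp_all add: Hom_module_def map_module_def)
 obtain S where S:"S <= car ?H" "card S = 1"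
  and ex1:"\<forall>f\<in>car ?H. \<exists>!c. c\<in>S \<rightarrow>\<^sub>E car A & f = (\<Oplus>\<^bsub>?H\<^esub>s\<in>S. c s*:?H s)"
  using free unfolding free_of_rank_def by blast
 note S = S ex1_implies_ex[OF bspec[OF ex1]]
 obtain f0 where f0:"S = {f0}" using S(2) by (rule card_1_singletonE)
 obtain F0 where F0:"compatible F0" "f0 = (\<lambda>x\<in>car V'. N.lmap (F0 x))"
  using matrices_of_ghom[of f0] S(1) by (auto simp:f0 Hs)
 have cf:"c*:?H f0+.?H 0@?H = (\<lambda>x\<in>car V'. N.lmap (smat A c (F0 x)))" if c:"c<:A" for c
 proof -
  have "(\<lambda>y\<in>car N. (c*:M N.lmap (F0 x)) y+.N 0@M y) = N.lmap (smat A c (F0 x))" if x:"x<:V'" for x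
  proof
  fix y
  have F:"F0 x\<in>rmat A d d" by (rule compatibleD(1)[OF F0(1) x])
  show "(\<lambda>y\<in>car N. (c*:M N.lmap (F0 x)) y+.N 0@M y) y = N.lmap (smat A c (F0 x)) y"
  proof (cases "y<:N")
  case True
  then show ?thesis by (simp add:M_sel N.lmap_smat[OF c F True] N.lmap_closed[OF F True] c)
  qed (simp add:N.lmap_def)
  qed
  then show ?thesis unfolding Hs F0(2) by (intro restrict_ext) (simp add:M_sel(2) F0(2))
 qed
 have H0:"0@?H<:?H"
 proof -
  have "(\<lambda>x\<in>car V'. N.lmap (smat A 0@A (F0 x))) = 0@?H"
  unfolding Hs
  proof (intro restrict_ext ext)
  fix x y assume x:"x<:V'"
  note F = compatibleD(1)[OF F0(1) x]
  show "N.lmap (smat A 0@A (F0 x)) y = 0@M y"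
  using N.lmap_smat[OF N.R.zero_closed F,of y] N.lmap_closed[OF F,of y] by (cases "y<:N") (simp_all add: M_sel N.lmap_def)
  qed
  then show ?thesis using ghom_of_matrices[OF compatible_smat[OF F0(1) N.R.zero_closed]] by (simp add:Hs(1))
 qed
 have "\<exists>c\<in>car A. \<forall>x\<in>car V'. F x = smat A c (F0 x)" if F:"compatible F" for F
 proof -
  obtain c where c:"c\<in>S \<rightarrow>\<^sub>E car A" "(\<lambda>x\<in>car V'. N.lmap (F x)) = (\<Oplus>\<^bsub>?H\<^esub>s\<in>S. c s*:?H s)"
  using S(3)[of "\<lambda>x\<in>car V'. N.lmap (F x)"] ghom_of_matrices[OF F] unfolding Hs(1) by blast
  let ?c = "c f0"
  have cc:"?c<:A" using c(1) by (auto simp:f0)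
  have "(\<Oplus>\<^bsub>?H\<^esub>s\<in>{f0}. c s*:?H s) = ?c*:?H f0+.?H 0@?H"
  by (rule finsum_singleton_raw[OF H0,where f = "%s. c s*:?H s"])
  (use ghom_of_matrices[OF compatible_smat[OF F0(1) cc]] in \<open>simp add:cf[OF cc] Hs(1)\<close>)
  then have eq:"(\<lambda>x\<in>car V'. N.lmap (F x)) = (\<lambda>x\<in>car V'. N.lmap (smat A ?c (F0 x)))"
  using c(2) unfolding f0 cf[OF cc] by simp
  have "F x = smat A ?c (F0 x)" if x:"x<:V'" for x
  by (rule N.lmap_inj[OF compatibleD(1)[OF F x] N.R.smat_rmat[OF cc compatibleD(1)[OF F0(1) x]]])
  (use fun_cong[OF eq,of x] x in simp)
  then show ?thesis using cc by blast
 qed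
 then show ?thesis using F0(1) by blast
qed

end

section \<open>Matrix data from the hypotheses\<close>

context truncation
begin

lemma map_q_eq:
 assumes "B\<in>rmat W d d" "C\<in>rmat W d d"
 shows "mmap q B = mmap q C \<longleftrightarrow> (ALL i j. B i j-.W C i j\<in>W.Pp n)"
 using q_eq[OF rmatD[OF assms(1)] rmatD[OF assms(2)]] by (simp add:mmap_def fun_eq_iff)

lemma map_\<epsilon>_q:"B\<in>rmat W d d==>mmap \<epsilon> (mmap q B) = mmap res B"
 using \<epsilon>_q rmatD[of B W d d] by (simp add:mmap_def fun_eq_iff)

lemma q_add_pow:"q (add_pow W (m::nat) 1@W) = add_pow A m 1@A"
 by (induction m) (simp_all add: W.add.nat_pow_Suc q.S.add.nat_pow_Suc)

lemma lift_projective_representation: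
 assumes G:"group G" "finite (car G)"
  and \<rho>0:"!!g. g<:G==>\<rho>0 g\<in>rmat W d d"
  "!!g h. g<:G==>h<:G==>mmap q (\<rho>0 (g*.G h)) = mmap q (mmul W d (\<rho>0 g) (\<rho>0 h))"
  "mmap q (\<rho>0 1@G) = mone A d"
  and \<theta>: "\<theta>\<in>rmat k d d" "(\<Oplus>\<^bsub>Mat k d\<^esub>g\<in>car G. mmul k d (mmul k d (mmap res (\<rho>0 g)) \<theta>)
  (mmap res (\<rho>0 (~.G g)))) = mone k d"
 shows "EX \<rho>. (\<forall>g\<in>car G. \<rho> g\<in>rmat W d d & mmap q (\<rho> g) = mmap q (\<rho>0 g)) & \<rho> 1@G = mone W d \<and>
  (\<forall>g\<in>car G. \<forall>h\<in>car G. \<rho> (g*.G h) = mmul W d (\<rho> g) (\<rho> h))"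
proof -
 interpret G: group G by (rule G)
 obtain T where T:"T\<in>rmat W d d" "mmap res T = \<theta>" using W.res.rmat_lift[OF W.res_surj \<theta>(1)] by blast
 let ?J = "%i. {B\<in>rmat W d d. ALL a b. B a b\<in>W.Pp i}"
 interpret F: filtered_ring "Mat W d" ?J by (rule W.filtered_ring_Mat)
 interpret L: almost_representation "Mat W d" ?J G T
  by (intro almost_representation.intro almost_representation_axioms.intro F.filtered_ring_axioms) (use G T in auto)
 interpret Mk: ring "Mat k d" by (rule W.k.ring_Mat)
 have close:"B-.(Mat W d) C\<in>?J n \<longleftrightarrow> mmap q B = mmap q C" if "B\<in>rmat W d d" "C\<in>rmat W d d" for B C
  using F.minus_closed[of B C] that by (simp add:W.Mat_minus[OF that] map_q_eq[OF that])
 have mm:"mmul W d B C\<in>rmat W d d" if "B\<in>rmat W d d" "C\<in>rmat W d d" for B C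
  by (rule W.mmul_rmat[OF that])
 define u where "u g = mmul W d (\<rho>0 g) (mmul W d T (\<rho>0 (~.G g)))" for g
 have u:"u g\<in>rmat W d d" if "g<:G" for g unfolding u_def by (intro mm \<rho>0 T that G.inv_closed)
 have "mmap res (\<Oplus>\<^bsub>Mat W d\<^esub>g\<in>car G. u g) = (\<Oplus>\<^bsub>Mat k d\<^esub>g\<in>car G. mmap res (u g))"
 proof (rule F.finsum_hom[OF Mk.is_abelian_group])
  show "mmap res x<:(Mat k d)" if "x<:(Mat W d)" for x
  using W.res.mmap_rmat that by simp
  show "mmap res (x+.(Mat W d) y) = mmap res x+.(Mat k d) mmap res y"
  if "x<:(Mat W d)" "y<:(Mat W d)" for x y
  using that rmatD[of x W d d] rmatD[of y W d d] by (simp add:mmap_def)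
 qed (use u in auto)
 also have "... = (\<Oplus>\<^bsub>Mat k d\<^esub>g\<in>car G. mmul k d (mmul k d (mmap res (\<rho>0 g)) \<theta>) (mmap res (\<rho>0 (~.G g))))"
 proof (rule Mk.finsum_cong'[OF refl])
  show "(%g. mmul k d (mmul k d (mmap res (\<rho>0 g)) \<theta>) (mmap res (\<rho>0 (~.G g))))\<in>car G \<rightarrow> car (Mat k d)"
  by (auto intro!: W.k.mmul_rmat[where b = d and b' = d] W.res.mmap_rmat \<rho>0 \<theta>)
  fix g assume g:"g<:G"
  have gi:"~.G g<:G" using g by simp
  note c = rmatD[OF \<rho>0(1)[OF g]] rmatD[OF T(1)] rmatD[OF \<rho>0(1)[OF gi]]
  note c' = rmatD[OF W.res.mmap_rmat[OF \<rho>0(1)[OF g]]] rmatD[OF \<theta>(1)] rmatD[OF W.res.mmap_rmat[OF \<rho>0(1)[OF gi]]]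
  show "mmap res (u g) = mmul k d (mmul k d (mmap res (\<rho>0 g)) \<theta>) (mmap res (\<rho>0 (~.G g)))"
  unfolding u_def W.res.map_mmul[OF c(1) rmatD[OF mm[OF T(1) \<rho>0(1)[OF gi]]]] W.res.map_mmul[OF c(2,3)] T(2)
  by (rule W.k.mmul_assoc[symmetric,OF c'])
 qed
 finally have r:"mmap res (\<Oplus>\<^bsub>Mat W d\<^esub>g\<in>car G. u g) = mone k d" unfolding \<theta>(2) .
 define U where "U = (\<Oplus>\<^bsub>Mat W d\<^esub>g\<in>car G. u g)"
 have U:"U\<in>rmat W d d" unfolding U_def using F.finsum_closed[of u "car G"] u by auto
 have "res (U a b) = res (mone W d a b)" for a b
  using fun_cong[OF fun_cong[OF r],of a b] fun_cong[OF fun_cong[OF W.res.mmap_one[of d]],of a b] by (simp add:U_def mmap_def)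
 then have "U a b-.W mone W d a b\<in>W.Pp 1" for a b
  unfolding W.Pp_1 using rmatD[OF U] rmatD[OF W.mone_rmat] W.k.r_neg by (simp add:a_minus_def)
 then have tr:"U-.(Mat W d) mone W d\<in>?J 1"
  using F.minus_closed[of U "mone W d"] U by (simp add:W.Mat_minus[OF U W.mone_rmat])
 have "L.almost n \<rho>0"
  unfolding L.almost_def using \<rho>0 tr close[OF mm \<rho>0(1)] by (simp add:U_def u_def del: mem_Collect_eq)
 moreover have "\<rho>0 1@G-.(Mat W d) 1@(Mat W d)\<in>?J n"
  using close[OF \<rho>0(1)[OF G.one_closed] W.mone_rmat] \<rho>0(3) q.mmap_one by (simp del: mem_Collect_eq)
 ultimately obtain y where y:"\<forall>g\<in>car G. y g<:(Mat W d) & y g-.(Mat W d) \<rho>0 g\<in>?J n" "y 1@G = 1@(Mat W d)"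
  "\<forall>g\<in>car G. \<forall>h\<in>car G. y (g*.G h) = y g*.(Mat W d) y h"
  using L.lift_representation[OF n] by blast
 have "\<forall>g\<in>car G. y g\<in>rmat W d d & mmap q (y g) = mmap q (\<rho>0 g)"
 proof
  fix g assume g:"g<:G"
  then have "y g\<in>rmat W d d" "y g-.(Mat W d) \<rho>0 g\<in>?J n" using y(1) by auto
  then show "y g\<in>rmat W d d & mmap q (y g) = mmap q (\<rho>0 g)" using close[OF _ \<rho>0(1)[OF g]] by blast
 qed
 then show ?thesis using y(2,3) by (intro exI[of _ y]) simp
qed

end

text \<open>\<open>Hom(V', M)\<close> is free of rank one; to deduce \<open>homs_scalar\<close>, multiply a homomorphism to \<open>End(V)\<close> by \<open>p^(n-1)\<close>: this embeds \<open>End(V)\<close> into \<open>M\<close>. Both it and \<open>\<psi>\<close>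
 are multiples of a generator, the factor of \<open>\<psi>\<close> is a unit because some entry of \<open>\<psi>\<close> is, and comparing at that entry shows
 that the other factor is divisible by \<open>p^(n-1)\<close>.\<close>
lemma (in reduced_module) deformation_data_exists:
 fixes V' :: "(int,'x,'g) gmodule"
 defines "Z \<equiv> residue_ring (int (p ^ n))"
 defines "M \<equiv> End_gmodule A G N"
 defines "MZ \<equiv> restrict_scalars (%z::int. add_pow A z 1@A) M"
 assumes finG:"finite (car G)" and p:"p > 1" and V_proj:"projective_gmodule k G V"
  and V_End:"bij_betw (%c. \<lambda>x\<in>car V. c*:V x) (car k) (ghoms k G V V)"
  and V': "group_module Z G V'" and free:"free_of_rank A (Hom_module Z G V' MZ M) 1"
  and \<psi>: "\<psi>\<in>ghoms Z G V' MZ"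
  and comm:"\<exists>\<tau>\<in>\<psi> ` car V'. \<exists>\<mu>\<in>\<psi> ` car V'. \<exists>x\<in>car N.
  \<tau> (\<mu> x)-.N \<mu> (\<tau> x) \<notin> {add_pow N p x | x. x\<in>car N}"
 shows "EX \<rho> \<psi>' \<theta> v'. deformation_data W k res p G Z V' n d \<rho> \<psi>' \<theta> & is_basis k V d v' \<and>
  acts_by k G V d v' (%g. mmap res (\<rho> g))"
proof -
 obtain e where e:"is_basis A N d e" using basis_lift by blast
 obtain \<rho>A where \<rho>A:"acts_by A G N d e \<rho>A" using N.acts_by_exists[OF e] by blast
 have P1:"p ^ n > 1" using p n by (intro one_less_power) auto
 interpret H: adjoint_homs A G N d e \<rho>A Z V' "p ^ n"
  by (intro adjoint_homs.intro framed_module.intro framed_module_axioms.intro adjoint_homs_axioms.intro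
  N.group_module_axioms e \<rho>A V' P1 Z_def[THEN meta_eq_to_obj_eq])
 define v' where "v' j = red (e j)" for j
 have v': "is_basis k V d v'" "acts_by k G V d v' (%g. mmap \<epsilon> (\<rho>A g))"
  using X.E.giso_basis[OF V.group_module_axioms \<Phi> X.ext_basis[OF e]] X.ext_acts_by[OF e \<rho>A]
  unfolding v'_def red_def by blast+
 have "EX Y. g<:G \<longrightarrow> Y\<in>rmat W d d & mmap q Y = \<rho>A g" for g
  using q.rmat_lift[OF q_surj H.N.\<rho>_rmat] by blast
 then obtain \<rho>0 where \<rho>0:"!!g. g<:G==>\<rho>0 g\<in>rmat W d d" "!!g. g<:G==>mmap q (\<rho>0 g) = \<rho>A g"
  by metis
 have \<rho>0_res:"mmap \<epsilon> (\<rho>A g) = mmap res (\<rho>0 g)" if "g<:G" for g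
  using map_\<epsilon>_q[OF \<rho>0(1)[OF that]] \<rho>0(2)[OF that] by simp
 interpret FV: framed_module k G V d v' "%g. mmap res (\<rho>0 g)"
  by (intro framed_module.intro framed_module_axioms.intro V.group_module_axioms v'(1) V.acts_by_cong[OF v'(2)])
  (simp add:\<rho>0_res)
 obtain \<theta> where \<theta>: "\<theta>\<in>rmat k d d" "(\<Oplus>\<^bsub>Mat k d\<^esub>g\<in>car G. mmul k d (mmul k d (mmap res (\<rho>0 g)) \<theta>)
  (mmap res (\<rho>0 (~.G g)))) = mone k d"
  using FV.projective_trace[OF V_proj finG] by blast
 have "EX \<rho>. (\<forall>g\<in>car G. \<rho> g\<in>rmat W d d & mmap q (\<rho> g) = mmap q (\<rho>0 g)) & \<rho> 1@G = mone W d \<and>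
  (\<forall>g\<in>car G. \<forall>h\<in>car G. \<rho> (g*.G h) = mmul W d (\<rho> g) (\<rho> h))"
 proof (rule lift_projective_representation[OF N.is_group finG \<rho>0(1) _ _ \<theta>])
  show "mmap q (\<rho>0 (g*.G h)) = mmap q (mmul W d (\<rho>0 g) (\<rho>0 h))" if g:"g<:G" and h:"h<:G" for g h
  using q.map_mmul[OF rmatD[OF \<rho>0(1)[OF g]] rmatD[OF \<rho>0(1)[OF h]],of d] N.acts_by_mult[OF e \<rho>A g h] g h by (simp add:\<rho>0(2))
  show "mmap q (\<rho>0 1@G) = mone A d" using N.acts_by_one[OF e \<rho>A] by (simp add:\<rho>0(2))
 qed
 then obtain \<rho> where \<rho>_mat:"!!g. g<:G==>\<rho> g\<in>rmat W d d" and \<rho>q:"!!g. g<:G==>mmap q (\<rho> g) = \<rho>A g"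
  and \<rho>1:"\<rho> 1@G = mone W d"
  and \<rho>m:"!!g h. g<:G==>h<:G==>\<rho> (g*.G h) = mmul W d (\<rho> g) (\<rho> h)"
  using \<rho>0(2) by (metis (no_types,lifting))
 have \<rho>r:"mmap res (\<rho> g) = mmap res (\<rho>0 g)" if "g<:G" for g
  using map_\<epsilon>_q[OF \<rho>_mat[OF that]] \<rho>q[OF that] \<rho>0_res[OF that] by simp
 obtain F where F:"H.compatible F" "\<psi> = (\<lambda>x\<in>car V'. H.N.lmap (F x))"
  using H.matrices_of_ghom[of \<psi>] \<psi> unfolding MZ_def M_def by blast
 have "EX Y. x<:V' \<longrightarrow> Y\<in>rmat W d d & mmap q Y = F x" for x
  using q.rmat_lift[OF q_surj H.compatibleD(1)[OF F(1)]] by blast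
 then obtain \<psi>' where \<psi>': "!!x. x<:V'==>\<psi>' x\<in>rmat W d d" "!!x. x<:V'==>mmap q (\<psi>' x) = F x"
  by metis
 have Fq:"F x i j = q (\<psi>' x i j)" if "x<:V'" for x i j
  using \<psi>'(2)[OF that] by (simp add:mmap_def fun_eq_iff)
 have q_mult:"mmap q (mmul W d B C) = mmul A d (mmap q B) (mmap q C)"
  if "B\<in>rmat W d d" "C\<in>rmat W d d" for B C using q.map_mmul rmatD that by blast
 have res_mult:"mmap res (mmul W d B C) = mmul k d (mmap res B) (mmap res C)"
  if "B\<in>rmat W d d" "C\<in>rmat W d d" for B C using W.res.map_mmul rmatD that by blast
 have red_lmap:"red (H.N.lmap B x) = FV.lmap (mmap \<epsilon> B) (red x)" if B:"B\<in>rmat A d d" and x:"x<:N" for B x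
 proof -
  let ?c = "coords A N d e x"
  note c = N.coords_vecs[OF e x]
  have r:"red (lincomb N d b e) = lincomb V d (%j. \<epsilon> (b j)) v'" if "b\<in>vecs A d" for b
  using red_lincomb[of d b e] vecsD[OF that] N.basis_closed[OF e] by (simp add:v'_def[abs_def])
  have Bc:"mat_vec A d B ?c\<in>vecs A d" by (rule q.S.mat_vec_vecs[OF B vecsD[OF c]])
  have "red (H.N.lmap B (lincomb N d ?c e)) = FV.lmap (mmap \<epsilon> B) (red (lincomb N d ?c e))"
  unfolding H.N.lmap_lincomb[OF B c] r[OF Bc] r[OF c] FV.lmap_lincomb[OF A.r.mmap_rmat[OF B] A.r.map_vecs[OF c]]
  using A.r.mmap_vec[OF rmatD[OF B] vecsD[OF c]] by simp
  then show ?thesis by (simp add:N.lincomb_coords[OF e x])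
 qed
 have commutator:"\<exists>x\<in>car V'. \<exists>y\<in>car V'. \<exists>i j.
  res (mmul W d (\<psi>' x) (\<psi>' y) i j) ~= res (mmul W d (\<psi>' y) (\<psi>' x) i j)"
 proof (rule ccontr)
  assume nc:"\<not> ?thesis"
  obtain x y w where x:"x<:V'" and y:"y<:V'" and w:"w<:N"
  and c:"\<psi> x (\<psi> y w)-.N \<psi> y (\<psi> x w) \<notin> {add_pow N p x | x. x\<in>car N}" using comm by blast
  note Fx = H.compatibleD(1)[OF F(1) x] and Fy = H.compatibleD(1)[OF F(1) y]
  have m:"mmap \<epsilon> (mmul A d (F a) (F b)) = mmap res (mmul W d (\<psi>' a) (\<psi>' b))"
  if "a<:V'" "b<:V'" for a b
  using map_\<epsilon>_q[OF W.mmul_rmat[OF \<psi>'(1)[OF that(1)] \<psi>'(1)[OF that(2)],where e = d]]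
  unfolding q_mult[OF \<psi>'(1)[OF that(1)] \<psi>'(1)[OF that(2)]] \<psi>'(2)[OF that(1)] \<psi>'(2)[OF that(2)] .
  have "mmap \<epsilon> (mmul A d (F x) (F y)) = mmap \<epsilon> (mmul A d (F y) (F x))"
  unfolding m[OF x y] m[OF y x] using nc x y by (auto simp:mmap_def fun_eq_iff)
  then have eq:"red (\<psi> x (\<psi> y w)) = red (\<psi> y (\<psi> x w))"
  using red_lmap[OF q.S.mmul_rmat[OF Fx Fy,where e = d] w] red_lmap[OF q.S.mmul_rmat[OF Fy Fx,where e = d] w] x y
  by (simp add:F(2) H.N.lmap_mult[OF Fx Fy w] H.N.lmap_mult[OF Fy Fx w])
  let ?a = "\<psi> x (\<psi> y w)" and ?b = "\<psi> y (\<psi> x w)"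
  have ab:"?a<:N" "?b<:N" using x y w Fx Fy by (simp_all add: F(2) H.N.lmap_closed)
  have s:"?a-.N ?b = ?a+.N (-:A 1@A)*:N ?b" using ab by (simp add:N.smult_l_minus a_minus_def)
  have "red (?a-.N ?b) = 0@V"
  unfolding s using ab red_closed[OF ab(2)] by (simp add:red_add red_smult eq V.smult_l_minus V.M.r_neg)
  then obtain z where z:"z<:N" "?a-.N ?b = q W.unif*:N z" using red_kernel[of "?a-.N ?b"] ab by auto
  have "?a-.N ?b = add_pow N p z" using z N.add_pow_smult[OF z(1),of p] by (simp add:W.unif_def q_add_pow)
  then show False using c z(1) by blast
 qed
 have homs:"\<exists>c\<in>car k. \<forall>x\<in>car V'. J x = smat k c (mmap res (\<psi>' x))"
  if J:"!!x. x<:V'==>J x\<in>rmat k d d"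
  and J_add:"!!x y. x<:V'==>y<:V'==>J (x+.V' y) = (%a b. J x a b+.k J y a b)"
  and J_eqv:"!!g x. g<:G==>x<:V' ==>
  mmul k d (mmap res (\<rho> g)) (J x) = mmul k d (J (act V' g x)) (mmap res (\<rho> g))" for J
 proof -
  have "EX Y. x<:V' \<longrightarrow> Y\<in>rmat W d d & mmap res Y = J x" for x
  using W.res.rmat_lift[OF W.res_surj J] by blast
  then obtain J' where J': "!!x. x<:V'==>J' x\<in>rmat W d d" "!!x. x<:V'==>mmap res (J' x) = J x"
  by metis
  have rJ:"res (J' x a b) = J x a b" if "x<:V'" for x a b
  using J'(2)[OF that] by (simp add:mmap_def fun_eq_iff)
  define m where "m = n - 1"
  have nm:"n = m + 1" using n by (simp add:m_def)
  let ?u = "W.unif ^.W m"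
  have uc:"?u<:W" by simp
  have scaled:"q (?u*.W a) = q (?u*.W b)" if "a<:W" "b<:W" "res a = res b" for a b
  proof -
  have "a-.W b\<in>W.Pp 1" unfolding W.Pp_1 using that by (simp add:a_minus_def W.k.r_neg)
  moreover have "?u\<in>W.Pp m" using W.PpI[OF W.one_closed,of m] by simp
  ultimately have "?u*.W (a-.W b)\<in>W.Pp n" using W.Pp_mult[of ?u m _ 1] nm by simp
  moreover have "?u*.W (a-.W b) = ?u*.W a-.W ?u*.W b" using that uc by algebra
  ultimately show ?thesis using q_eq[of "?u*.W a" "?u*.W b"] that uc by simp
  qed
  define S where "S B = mmap q (smat W ?u B)" for B
  have S_rmat:"S B\<in>rmat A d d" if "B\<in>rmat W d d" for B
  unfolding S_def by (rule q.mmap_rmat[OF W.smat_rmat[OF uc that]])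
  have S_cong:"S B = S C" if "B\<in>rmat W d d" "C\<in>rmat W d d" "mmap res B = mmap res C" for B C
  unfolding S_def using scaled[OF rmatD[OF that(1)] rmatD[OF that(2)]] that(3) by (simp add:mmap_def smat_def fun_eq_iff)
  have SJ:"H.compatible (%x. S (J' x))"
  unfolding H.compatible_def
  proof (intro conjI ballI)
  show "S (J' x)\<in>rmat A d d" if "x<:V'" for x by (rule S_rmat[OF J'(1)[OF that]])
  show "S (J' (x+.V' y)) = (%a b. S (J' x) a b+.A S (J' y) a b)" if x:"x<:V'" and y:"y<:V'" for x y
  proof -
  have xy:"x+.V' y<:V'" using x y by simp
  note c = rmatD[OF J'(1)[OF x]] rmatD[OF J'(1)[OF y]]
  have s:"(%a b. J' x a b+.W J' y a b)\<in>rmat W d d" using J'(1)[OF x] J'(1)[OF y] by (auto simp:rmat_def)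
  have "S (J' (x+.V' y)) = S (%a b. J' x a b+.W J' y a b)"
  by (rule S_cong[OF J'(1)[OF xy] s]) (simp add:mmap_def rJ x y xy J_add c)
  then show ?thesis using c by (simp add:S_def mmap_def smat_def W.r_distr)
  qed
  show "mmul A d (\<rho>A g) (S (J' x)) = mmul A d (S (J' (act V' g x))) (\<rho>A g)" if g:"g<:G" and x:"x<:V'" for g x
  proof -
  have gx:"act V' g x<:V'" using g x by (simp add:H.V'.act_closed)
  note m = \<rho>_mat[OF g] J'(1)[OF x] J'(1)[OF gx]
  note c = rmatD[OF m(1)] rmatD[OF m(2)] rmatD[OF m(3)]
  have "mmul A d (\<rho>A g) (S (J' x)) = S (mmul W d (\<rho> g) (J' x))"
  unfolding S_def W.smmul_r[OF uc c(1,2),symmetric] q_mult[OF m(1) W.smat_rmat[OF uc m(2)]] \<rho>q[OF g] ..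
  also have "... = S (mmul W d (J' (act V' g x)) (\<rho> g))"
  by (rule S_cong[OF W.mmul_rmat[OF m(1,2)] W.mmul_rmat[OF m(3,1)]])
  (simp only: res_mult m J'(2)[OF x] J'(2)[OF gx] J_eqv[OF g x])
  also have "... = mmul A d (S (J' (act V' g x))) (\<rho>A g)"
  unfolding S_def W.smmul_l[OF uc c(3,1),symmetric] q_mult[OF W.smat_rmat[OF uc m(3)] m(1)] \<rho>q[OF g] ..
  finally show ?thesis .
  qed
  qed
  obtain F0 where F0:"H.compatible F0" "!!F. H.compatible F==>\<exists>c\<in>car A. \<forall>x\<in>car V'. F x = smat A c (F0 x)"
  using H.compatible_proportional free unfolding MZ_def M_def by blast
  obtain b where b:"b<:A" "!!x. x<:V'==>F x = smat A b (F0 x)" using F0(2)[OF F(1)] by blast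
  obtain a where a:"a<:A" "!!x. x<:V'==>S (J' x) = smat A a (F0 x)" using F0(2)[OF SJ] by blast
  have "EX x0 i0 j0. x0<:V' & res (\<psi>' x0 i0 j0) ~= 0@k"
  proof (rule ccontr)
  assume "\<not> ?thesis"
  then have z:"res (\<psi>' x i j) = 0@k" if "x<:V'" for x i j using that by blast
  have "res (mmul W d (\<psi>' x) (\<psi>' y) i j) = 0@k" if "x<:V'" "y<:V'" for x y i j
  using fun_cong[OF fun_cong[OF res_mult[OF \<psi>'(1)[OF that(1)] \<psi>'(1)[OF that(2)]]],of i j] z[OF that(1)] z[OF that(2)]
  by (simp add:mmap_def mmul_def W.k.finsum_zero)
  then show False using commutator by auto
  qed
  then obtain x0 i0 j0 where x0:"x0<:V'" and u0:"res (\<psi>' x0 i0 j0) ~= 0@k" by blast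
  have p0:"\<psi>' x0 i0 j0<:W" and f0:"F0 x i j<:A" if "x<:V'" for x i j
  using rmatD[OF \<psi>'(1)[OF x0]] rmatD[OF H.compatibleD(1)[OF F0(1) that]] by auto
  note p0 = p0[OF x0]
  have "\<epsilon> (b*.A F0 x0 i0 j0) ~= 0@k"
  using u0 fun_cong[OF fun_cong[OF b(2)[OF x0]],of i0 j0] by (simp add:Fq[OF x0] smat_def \<epsilon>_q[OF p0,symmetric])
  then have "\<epsilon> b ~= 0@k" using b(1) f0[OF x0] by auto
  then obtain bi where bi:"bi<:A" "b*.A bi = 1@A" using A.r_unit[OF b(1)] by blast
  obtain w where w:"w<:W" "a*.A bi = q w" using q_obtain[of "a*.A bi"] a(1) bi(1) by auto
  have key:"?u*.W J' x i j-.W w*.W \<psi>' x i j\<in>W.Pp n" if x:"x<:V'" for x i j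
  proof -
  have c:"J' x i j<:W" "\<psi>' x i j<:W" using rmatD[OF J'(1)[OF x]] rmatD[OF \<psi>'(1)[OF x]] by auto
  have alg:"a*.A f = (a*.A bi)*.A (b*.A f)" if f:"f<:A" for f
  proof -
  have "(a*.A bi)*.A (b*.A f) = (b*.A bi)*.A (a*.A f)" using a(1) b(1) bi(1) f by algebra
  then show ?thesis using bi(2) a(1) f by simp
  qed
  have "q (?u*.W J' x i j) = a*.A F0 x i j"
  using fun_cong[OF fun_cong[OF a(2)[OF x]],of i j] unfolding S_def mmap_def smat_def .
  also have "... = q w*.A F x i j" using alg[OF f0[OF x]] unfolding w(2) b(2)[OF x] smat_def .
  also have "... = q (w*.W \<psi>' x i j)" using w(1) c by (simp add:Fq[OF x])
  finally show ?thesis using q_eq[of "?u*.W J' x i j" "w*.W \<psi>' x i j"] c w(1) by simp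
  qed
  have "\<exists>w'\<in>car W. w = ?u*.W w'"
  proof -
  obtain s where s:"s<:W" "\<psi>' x0 i0 j0*.W s = 1@W" using W.unit_if_res[OF p0 u0] by blast
  have c:"J' x0 i0 j0<:W" using rmatD[OF J'(1)[OF x0]] by auto
  have 1:"?u*.W J' x0 i0 j0-.W w*.W \<psi>' x0 i0 j0\<in>W.Pp m" by (rule W.Pp_mono[OF _ key[OF x0]]) (simp add:nm)
  have 2:"?u*.W J' x0 i0 j0\<in>W.Pp m" by (rule W.PpI[OF c])
  have "w*.W \<psi>' x0 i0 j0 = ?u*.W J' x0 i0 j0-.W (?u*.W J' x0 i0 j0-.W w*.W \<psi>' x0 i0 j0)"
  using uc c w(1) p0 by algebra
  then have "w*.W \<psi>' x0 i0 j0\<in>W.Pp m" using W.Pp_minus[OF 2 1] by simp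
  then have "w*.W \<psi>' x0 i0 j0*.W s\<in>W.Pp m" by (rule W.Pp_mult_r[OF _ s(1)])
  then show ?thesis using w(1) p0 s by (simp add:W.m_assoc W.Pp_iff)
  qed
  then obtain w' where w': "w'<:W" "w = ?u*.W w'" by blast
  have "J x i j = res w'*.k res (\<psi>' x i j)" if x:"x<:V'" for x i j
  proof -
  have c:"J' x i j<:W" "\<psi>' x i j<:W" using rmatD[OF J'(1)[OF x]] rmatD[OF \<psi>'(1)[OF x]] by auto
  have "?u*.W J' x i j-.W w*.W \<psi>' x i j = ?u*.W (J' x i j-.W w'*.W \<psi>' x i j)"
  unfolding w'(2) using uc c w'(1) by algebra
  then have "?u*.W (J' x i j-.W w'*.W \<psi>' x i j)\<in>W.Pp (m + 1)" using key[OF x,of i j] nm by simp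
  then have "J' x i j-.W w'*.W \<psi>' x i j\<in>W.Pp 1" using W.Pp_cancel[of "J' x i j-.W w'*.W \<psi>' x i j" m 1] c w'(1) by simp
  then have "res (J' x i j)-.k res w'*.k res (\<psi>' x i j) = 0@k"
  unfolding W.Pp_1 using c w'(1) by (simp add:a_minus_def)
  then show ?thesis using W.k.r_right_minus_eq[of "res (J' x i j)" "res w'*.k res (\<psi>' x i j)"] c w'(1) rmatD[OF J[OF x]]
  by (simp add:rJ[OF x])
  qed
  then show ?thesis using w'(1) by (intro bexI[of _ "res w'"]) (auto simp:smat_def mmap_def fun_eq_iff)
 qed
 have scalar:"\<exists>c\<in>car k. B = smat k c (mone k d)"
  if B:"B\<in>rmat k d d" and Bc:"!!g. g<:G==>mmul k d (mmap res (\<rho> g)) B = mmul k d B (mmap res (\<rho> g))" for B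
 proof -
  have "FV.lmap B (act V g x) = act V g (FV.lmap B x)" if g:"g<:G" and x:"x<:V" for g x
  proof -
  note r = FV.\<rho>_rmat[OF g]
  have "FV.lmap B (act V g x) = FV.lmap (mmul k d B (mmap res (\<rho>0 g))) x"
  unfolding FV.lmap_mult[OF B r x] FV.lmap_act[OF g x] ..
  also have "... = FV.lmap (mmul k d (mmap res (\<rho>0 g)) B) x" using Bc[OF g] unfolding \<rho>r[OF g] by simp
  also have "... = act V g (FV.lmap B x)" unfolding FV.lmap_mult[OF r B x] FV.lmap_act[OF g FV.lmap_closed[OF B x]] ..
  finally show ?thesis .
  qed
  then have "FV.lmap B\<in>ghoms k G V V" using FV.lmap_lin[OF B] by (simp add:ghoms_def)
  then obtain c where c:"c<:k" "FV.lmap B = (\<lambda>x\<in>car V. c*:V x)" using V_End by (auto simp:bij_betw_def)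
  have "B = smat k c (mone k d)"
  by (rule FV.lmap_inj[OF B W.k.smat_rmat[OF c(1) W.k.mone_rmat]]) (simp add:c FV.lmap_smone)
  then show ?thesis using c(1) by blast
 qed
 have "deformation_data W k res p G Z V' n d \<rho> \<psi>' \<theta>"
 proof (intro deformation_data.intro deformation_data_axioms.intro W.p_ring_axioms N.is_group V' finG n \<rho>_mat \<rho>1 \<rho>m \<psi>'(1) commutator H.exponent \<theta>(1))
  show "\<psi>' (x+.V' y) i j-.W (\<psi>' x i j+.W \<psi>' y i j)\<in>W.Pp n" if x:"x<:V'" and y:"y<:V'" for x y i j
  proof -
  have xy:"x+.V' y<:V'" using x y by simp
  note c = rmatD[OF \<psi>'(1)[OF x]] rmatD[OF \<psi>'(1)[OF y]] rmatD[OF \<psi>'(1)[OF xy]]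
  have "q (\<psi>' (x+.V' y) i j) = q (\<psi>' x i j+.W \<psi>' y i j)"
  using fun_cong[OF fun_cong[OF H.compatibleD(2)[OF F(1) x y]],of i j] c by (simp add:Fq x y xy)
  then show ?thesis using q_eq[of "\<psi>' (x+.V' y) i j" "\<psi>' x i j+.W \<psi>' y i j"] c by simp
  qed
  show "mmul W d (\<rho> g) (\<psi>' x) i j-.W mmul W d (\<psi>' (act V' g x)) (\<rho> g) i j\<in>W.Pp n"
  if g:"g<:G" and x:"x<:V'" for g x i j
  proof -
  have gx:"act V' g x<:V'" using g x by (simp add:H.V'.act_closed)
  note m = \<rho>_mat[OF g] \<psi>'(1)[OF x] \<psi>'(1)[OF gx]
  have "mmap q (mmul W d (\<rho> g) (\<psi>' x)) = mmap q (mmul W d (\<psi>' (act V' g x)) (\<rho> g))"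
  unfolding q_mult[OF m(1,2)] q_mult[OF m(3,1)] \<rho>q[OF g] \<psi>'(2)[OF x] \<psi>'(2)[OF gx] by (rule H.compatibleD(3)[OF F(1) g x])
  then show ?thesis using map_q_eq[OF W.mmul_rmat[OF m(1,2)] W.mmul_rmat[OF m(3,1)]] by simp
  qed
  show "(\<Oplus>\<^bsub>Mat k d\<^esub>g\<in>car G. mmul k d (mmul k d (mmap res (\<rho> g)) \<theta>)
  (mmap res (\<rho> (~.G g)))) = mone k d"
  proof -
  interpret Mk: ring "Mat k d" by (rule W.k.ring_Mat)
  have "(\<Oplus>\<^bsub>Mat k d\<^esub>g\<in>car G. mmul k d (mmul k d (mmap res (\<rho> g)) \<theta>) (mmap res (\<rho> (~.G g)))) =
  (\<Oplus>\<^bsub>Mat k d\<^esub>g\<in>car G. mmul k d (mmul k d (mmap res (\<rho>0 g)) \<theta>) (mmap res (\<rho>0 (~.G g))))"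
  by (rule Mk.finsum_cong'[OF refl])
  (auto simp:\<rho>r intro!: W.k.mmul_rmat[where b = d and b' = d] W.res.mmap_rmat \<rho>0 \<theta>)
  then show ?thesis using \<theta>(2) by simp
  qed
 qed (use homs scalar in blast)+
 moreover have "acts_by k G V d v' (%g. mmap res (\<rho> g))"
  by (rule V.acts_by_cong[OF v'(2)]) (simp add:\<rho>r \<rho>0_res)
 ultimately show ?thesis using v'(1) by blast
qed

section \<open>Universality\<close>

text \<open>Local homomorphisms are automatically continuous.\<close>
lemma max_ideal_pow_image:
 assumes B:"cring B" "maximalideal (max_ideal B) B" and C:"cring C" "maximalideal (max_ideal C) C"
  and f:"f\<in>ring_hom B C" and m:"f ` max_ideal B <= max_ideal C"
 shows "f ` max_ideal_pow B i <= max_ideal_pow C i"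
proof (induction i)
 case 0 show ?case using ring_hom_closed[OF f] by (auto simp:ideals_set_def)
next
 case (Suc i)
 interpret B: cring B by (rule B)
 interpret IB: semiring "ideals_set B" by (rule B.ideals_set_is_semiring)
 have mB:"max_ideal B<:(ideals_set B)" using maximalideal.axioms(1)[OF B(2)] by (simp add:ideals_set_def)
 have c:"max_ideal_pow B i <= car B" "max_ideal B <= car B"
  using IB.nat_pow_closed[OF mB,of i] mB ideal.Icarr by (auto simp:ideals_set_def)
 have p:"max_ideal_pow B (Suc i) = ideal_prod B (max_ideal_pow B i) (max_ideal B)"
  "max_ideal_pow C (Suc i) = ideal_prod C (max_ideal_pow C i) (max_ideal C)" by (simp_all add: ideals_set_def)
 have "x<:B & f x\<in>ideal_prod C (max_ideal_pow C i) (max_ideal C)"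
  if "x\<in>ideal_prod B (max_ideal_pow B i) (max_ideal B)" for x
  using that
 proof (induction rule: ideal_prod.induct)
  case (prod a b)
  then have "a<:B" "b<:B" "f a\<in>max_ideal_pow C i" "f b\<in>max_ideal C" using c Suc.IH m by auto
  then show ?case using ideal_prod.prod[of "f a" _ "f b" _ C] by (simp add:ring_hom_mult[OF f])
 next
  case (sum a b)
  then show ?case using ideal_prod.sum[of "f a" C _ _ "f b"] by (simp add:ring_hom_add[OF f])
 qed
 then show ?case unfolding p by blast
qed

lemma Chat_homsI:
 assumes k:"field k" and B:"in_Chat p k B" and C:"in_Chat p k C" and f:"f\<in>car B \<rightarrow>\<^sub>E car C" "f\<in>ring_hom B C"
  and fs:"!!w. w<:(Witt p k)==>f (structmap B w) = structmap C w"
  and fr:"!!b. b<:B==>resmap C (f b) = resmap B b"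
 shows "f\<in>Chat_homs p k B C"
proof -
 have BC:"cring B" "maximalideal (max_ideal B) B" "cring C" "maximalideal (max_ideal C) C"
  using B C theI'[of "%m. maximalideal m B"] theI'[of "%m. maximalideal m C"] by (auto simp:in_Chat_def max_ideal_def)
 have "f ` max_ideal B <= max_ideal C"
  using in_ChatD(5)[OF B k] in_ChatD(5)[OF C k] fr f(1) by auto
 then have "f ` max_ideal_pow B i <= max_ideal_pow C i" for i by (rule max_ideal_pow_image[OF BC f(2)])
 then show ?thesis using f fs fr by (auto simp:Chat_homs_def)
qed

context deformation_over
begin

lemma hom_of_admissible:
 assumes s:"admissible s"
 shows "EX h. h\<in>car (W.Rring n) \<rightarrow>\<^sub>E car B & h\<in>ring_hom (W.Rring n) B \<and>
  (\<forall>a\<in>car W. \<forall>b\<in>car W. h (W.Rel n a b) = \<iota> a+.B \<iota> b*.B s)"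
proof -
 have s': "s<:B" "s*.B s = 0@B" "pn*.B s = 0@B" using s by (auto simp:admissible_def)
 define P where "P z y \<longleftrightarrow> (\<exists>a\<in>car W. \<exists>b\<in>car W. z = W.Rel n a b & y = \<iota> a+.B \<iota> b*.B s)" for z y
 define h where "h = (\<lambda>z\<in>car (W.Rring n). SOME y. P z y)"
 have h:"h (W.Rel n a b) = \<iota> a+.B \<iota> b*.B s" if ab:"a<:W" "b<:W" for a b
 proof -
  have "P (W.Rel n a b) (SOME y. P (W.Rel n a b) y)" by (rule someI_ex) (use ab P_def in blast)
  then obtain a' b' where ab': "a'<:W" "b'<:W" "W.Rel n a b = W.Rel n a' b'"
  "(SOME y. P (W.Rel n a b) y) = \<iota> a'+.B \<iota> b'*.B s" unfolding P_def by blast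
  then have e:"a = a'" "b-.W b'\<in>W.Pp n" using W.Rel_eq ab by auto
  obtain c where c:"c<:B" "\<iota> (b-.W b') = pn*.B c" using \<iota>_Pp[OF e(2)] by blast
  have "b = b'+.W (b-.W b')" using ab ab' by algebra
  then have "\<iota> b = \<iota> b'+.B pn*.B c"
  using \<iota>.hom_add[of b' "b-.W b'"] ab ab' unfolding c(2)[symmetric] by simp
  also have "... *.B s = \<iota> b'*.B s+.B c*.B (pn*.B s)"
  using ab' c(1) s'(1) pn_closed \<iota>.hom_closed[of b'] by algebra
  finally have "\<iota> b*.B s = \<iota> b'*.B s" using s' c(1) ab' by simp
  then show ?thesis using ab' e(1) W.Rel_closed[OF ab'(1,2)] by (simp add:h_def)
 qed
 have "h\<in>ring_hom (W.Rring n) B"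
 proof (rule ring_hom_memI)
  fix x y assume "x<:(W.Rring n)" "y<:(W.Rring n)"
  then obtain a b c e where x:"a<:W" "b<:W" "x = W.Rel n a b"
  and y:"c<:W" "e<:W" "y = W.Rel n c e" by (metis W.Rring_cases)
  note cl = \<iota>.hom_closed[OF x(1)] \<iota>.hom_closed[OF x(2)] \<iota>.hom_closed[OF y(1)] \<iota>.hom_closed[OF y(2)] s'(1)
  show "h x<:B" using x s' by (simp add:h)
  have alg:"(u+.B v*.B s)+.B (w+.B z*.B s) = (u+.B w)+.B (v+.B z)*.B s"
  if "u<:B" "v<:B" "w<:B" "z<:B" for u v w z using that s'(1) by algebra
  show "h (x+.(W.Rring n) y) = h x+.B h y"
  unfolding x(3) y(3) W.Rel_add[OF x(1,2) y(1,2)] h[OF x(1,2)] h[OF y(1,2)] alg[OF cl(1-4)]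
  using x y by (simp add:h)
  have alg:"(u+.B v*.B s)*.B (w+.B z*.B s) = (u*.B w+.B (u*.B z+.B v*.B w)*.B s)+.B (v*.B z)*.B (s*.B s)"
  if "u<:B" "v<:B" "w<:B" "z<:B" for u v w z using that s'(1) by algebra
  show "h (x*.(W.Rring n) y) = h x*.B h y"
  unfolding x(3) y(3) W.Rel_mult[OF x(1,2) y(1,2)] h[OF x(1,2)] h[OF y(1,2)] alg[OF cl(1-4)] s'(2)
  using x y cl by (simp add:h)
 next
  show "h 1@(W.Rring n) = 1@B" unfolding W.Rel_one using s' by (simp add:h)
 qed
 moreover have "h\<in>extensional (car (W.Rring n))" by (simp add:h_def)
 ultimately show ?thesis using h by (intro exI[of _ h]) (auto simp:PiE_def ring_hom_closed)
qed

text \<open>That \<open>s\<close> reduces to 0 follows from \<open>s^2 = 0\<close>, because \<open>k\<close> is a field.\<close>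
lemma hom_admissible:
 assumes h:"h\<in>ring_hom (W.Rring n) B" and hs:"!!w. w<:W==>h (W.Rel n w 0@W) = \<iota> w"
 defines "s \<equiv> h (W.Rel n 0@W 1@W)"
 shows "admissible s" "a<:W==>b<:W==>h (W.Rel n a b) = \<iota> a+.B \<iota> b*.B s"
proof -
 let ?R = "W.Rring n" and ?t = "W.Rel n 0@W 1@W"
 note c = W.Rel_closed
 have t:"?t<:?R" by (simp add:c)
 have sc:"s<:B" unfolding s_def by (rule ring_hom_closed[OF h t])
 have h0:"h (W.Rel n 0@W 0@W) = 0@B" using hs[of "0@W"] by simp
 have "W.Rel n 0@W 1@W*.?R W.Rel n 0@W 1@W = W.Rel n 0@W 0@W" by (simp add:W.Rel_mult)
 then have ss:"s*.B s = 0@B" using ring_hom_mult[OF h t t] h0 by (simp add:s_def)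
 have uc:"W.unif ^.W n<:W" by simp
 have bt:"W.Rel n b 0@W*.?R ?t = W.Rel n 0@W b" if "b<:W" for b using that by (simp add:W.Rel_mult)
 then have hb:"h (W.Rel n 0@W b) = \<iota> b*.B s" if "b<:W" for b
  using ring_hom_mult[OF h c[OF that W.zero_closed] t] hs[OF that] that by (simp add:s_def)
 have "W.Rel n 0@W (W.unif ^.W n) = W.Rel n 0@W 0@W"
  using W.PpI[OF W.one_closed,of n] uc by (subst W.Rel_eq) (simp_all add: a_minus_def)
 then have ps:"pn*.B s = 0@B" using hb[OF uc] h0 by simp
 have "r s*.k r s = 0@k" using B.r.hom_mult[OF sc sc] ss by simp
 then have "r s = 0@k" using W.k.integral[of "r s" "r s"] sc by auto
 then show "admissible s" using sc ss ps by (simp add:admissible_def)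
 assume ab:"a<:W" "b<:W"
 have "W.Rel n a 0@W+.?R W.Rel n 0@W b = W.Rel n a b" using ab by (simp add:W.Rel_add)
 then show "h (W.Rel n a b) = \<iota> a+.B \<iota> b*.B s"
  using ring_hom_add[OF h c[OF ab(1) W.zero_closed] c[OF W.zero_closed ab(2)]] hs[OF ab(1)] hb[OF ab(2)] by simp
qed

end

lemma inflate_sel:
 "car (inflate \<pi> N) = car N" "0@(inflate \<pi> N) = 0@N" "ring.add (inflate \<pi> N) = ring.add N"
 "smult (inflate \<pi> N) = smult N" "act (inflate \<pi> N) h = act N (\<pi> h)"
 by (simp_all add: inflate_def module.defs gmodule.defs)

lemma lincomb_inflate:"lincomb (inflate \<pi> N) = lincomb N"
 by (intro ext) (simp add:lincomb_def finsum_def finprod_def inflate_sel)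

lemma (in group_module) group_module_inflate:
 assumes H:"group H" and \<pi>: "\<pi>\<in>hom H G"
 shows "group_module R H (inflate \<pi> M)"
proof -
 interpret H: group H by (rule H)
 interpret h: group_hom H G \<pi> by (intro group_hom.intro group_hom_axioms.intro H G.is_group \<pi>)
 have "abelian_group (inflate \<pi> M)"
 proof (rule abelian_groupI)
  show "\<exists>y\<in>car (inflate \<pi> M). y+.(inflate \<pi> M) x = 0@(inflate \<pi> M)" if "x<:(inflate \<pi> M)" for x
  using that by (intro bexI[of _ "-:M x"]) (simp_all add: inflate_sel M.l_neg)
 qed (simp_all add: inflate_sel M.a_ac)
 then have "module R (inflate \<pi> M)"
  by (intro module.intro R.is_cring module_axioms.intro) (simp_all add: inflate_sel smult_l_distr smult_r_distr smult_assoc1)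
 then show ?thesis
  by (intro group_module.intro group_module_axioms.intro H)
  (simp_all add: inflate_sel act_closed act_add act_smult act_one act_mult)
qed

locale inflated_deformation = deformation_data "Witt p k" k Witt_residue p G Z V' n d \<rho> \<psi> \<theta> + V: group_module k G V
 for p and k :: "'k ring" and G :: "'g monoid" and Z :: "int ring" and V' :: "(int,'x,'g) gmodule" and n d \<rho> \<psi> \<theta>
  and V :: "('k,'v,'g) gmodule" +
 fixes v
 assumes v:"is_basis k V d v" "acts_by k G V d v (%g. mmap Witt_residue (\<rho> g))"
begin

abbreviation "\<Gamma> \<equiv> semidirect (add_monoid V') G (act V')"
abbreviation "Vt \<equiv> inflate snd V :: ('k,'v,'x \<times> 'g) gmodule"
abbreviation "R \<equiv> W_t_mod p n k"
abbreviation "t \<equiv> W.Rel n 0@(Witt p k) 1@(Witt p k)"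

lemma R_eq:"R = W.Rring n" by (rule W_t_mod_eq[OF W.p_ring_axioms])

lemma field_k:"field k" by (rule W.k.field_axioms)

sublocale U: framed_representation k \<Gamma> Vt d v "%\<gamma>. mmap Witt_residue (\<rho> (snd \<gamma>))"
proof (intro framed_representation.intro framed_representation_axioms.intro field_k)
 have "snd\<in>hom \<Gamma> G" by (auto simp:hom_def semidirect_def)
 then show "group_module k \<Gamma> Vt" by (rule V.group_module_inflate[OF V'.group_semidirect])
 show "is_basis k Vt d v" using v(1) by (simp add:is_basis_def inflate_sel lincomb_inflate)
 show "acts_by k \<Gamma> Vt d v (%\<gamma>. mmap Witt_residue (\<rho> (snd \<gamma>)))"
  using v(2) by (auto simp:acts_by_def inflate_sel lincomb_inflate semidirect_def)
qed

definition rep :: "('b,nat => 'k,'k) walg => 'b => 'x \<times> 'g => nat => nat => 'b" where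
 "rep B s \<gamma> = mmul B d (%i j. mone B d i j+.B s*.B structmap B (\<psi> (fst \<gamma>) i j)) (mmap (structmap B) (\<rho> (snd \<gamma>)))"

lemma over: assumes B:"in_Chat p k B"
 shows "deformation_over (Witt p k) k Witt_residue p G Z V' n d \<rho> \<psi> \<theta> B (resmap B) (structmap B)"
 by (intro deformation_over.intro deformation_over_axioms.intro deformation_data_axioms in_ChatD[OF B field_k])

lemma rep_sig: assumes B:"in_Chat p k B"
 shows "rep B = deformation_over.sig d \<rho> \<psi> B (structmap B)"
proof -
 interpret D: deformation_over "Witt p k" k Witt_residue p G Z V' n d \<rho> \<psi> \<theta> B "resmap B" "structmap B" by (rule over[OF B])
 show ?thesis by (intro ext) (simp add:rep_def D.sig_def D.\<psi>B_def D.\<rho>B_def smat_def mmap_def)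
qed

lemma Chat_hom_eval:
 assumes B:"in_Chat p k B" and h:"h\<in>Chat_homs p k R B"
 shows "h t<:B" "deformation_over.admissible (Witt p k) k p n B (resmap B) (structmap B) (h t)"
  "a<:(Witt p k)==>b<:(Witt p k)==>h (W.Rel n a b) = structmap B a+.B structmap B b*.B h t"
proof -
 interpret D: deformation_over "Witt p k" k Witt_residue p G Z V' n d \<rho> \<psi> \<theta> B "resmap B" "structmap B" by (rule over[OF B])
 have hr:"h\<in>ring_hom (W.Rring n) B" and hs:"!!w. w<:(Witt p k)==>h (W.Rel n w 0@(Witt p k)) = structmap B w"
  using h W.structmap_Rring unfolding Chat_homs_def R_eq by auto
 show "D.admissible (h t)" by (rule D.hom_admissible(1)[OF hr hs])
 then show "h t<:B" by (rule D.s_closed)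
 show "a<:(Witt p k)==>b<:(Witt p k)==>h (W.Rel n a b) = structmap B a+.B structmap B b*.B h t"
  by (rule D.hom_admissible(2)[OF hr hs])
qed

definition \<eta> :: "('b,nat => 'k,'k) walg => ((nat => nat => 'k) set => 'b) => ('b,nat => 'b,'x \<times> 'g,'k,'v) lift set" where
 "\<eta> B h = {L\<in>lifts k \<Gamma> Vt B. U.represents B (rep B (h t)) L}"

lemma lift_group_module:
 "L\<in>lifts k \<Gamma> Vt B==>group_module B \<Gamma> (fst L)" "L\<in>lifts k \<Gamma> Vt B==>snd L\<in>gisos k \<Gamma> (residual k B (fst L)) Vt"
 by (cases L; simp add:lifts_def)+

text \<open>The lifts with matrices \<open>\<chi>\<close> in some adapted basis form one isomorphism class.\<close>
lemma represented_class:
 assumes B:"in_Chat p k B" and L:"L\<in>lifts k \<Gamma> Vt B" "U.represents B \<chi> L"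
 shows "{L'\<in>lifts k \<Gamma> Vt B. U.represents B \<chi> L'} =
  {(L,L'). L\<in>lifts k \<Gamma> Vt B & L'\<in>lifts k \<Gamma> Vt B & lift_isomorphic k \<Gamma> B L L'} `` {L}"
 using U.represents_isomorphic[OF in_ChatD(1)[OF B field_k] L(2)] U.represents_transfer[OF in_ChatD(1)[OF B field_k] L(2)]
  lift_group_module L(1) by blast

lemma \<eta>_nonempty:
 fixes B :: "('b,nat => 'k,'k) walg"
 assumes B:"in_Chat p k B" and h:"h\<in>Chat_homs p k R B"
 shows "\<exists>L\<in>lifts k \<Gamma> Vt B. U.represents B (rep B (h t)) L"
proof -
 interpret D: deformation_over "Witt p k" k Witt_residue p G Z V' n d \<rho> \<psi> \<theta> B "resmap B" "structmap B" by (rule over[OF B])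
 note s = Chat_hom_eval(2)[OF B h]
 have "EX L. is_lift k \<Gamma> Vt B L & U.represents B (D.sig (h t)) (L :: ('b,nat => 'b,'x \<times> 'g,'k,'v) lift)"
  by (rule U.represents_exists[OF in_ChatD(1)[OF B field_k]])
  (use D.sig_mat[OF s] D.sig_one[OF s] D.sig_mult[OF s] D.sig_reduces[OF s] in auto)
 then show ?thesis by (auto simp:rep_sig[OF B] lifts_def)
qed

lemma \<eta>_bij: assumes B:"in_Chat p k B" shows "bij_betw (\<eta> B) (Chat_homs p k R B) (Def k \<Gamma> Vt B)"
proof -
 interpret D: deformation_over "Witt p k" k Witt_residue p G Z V' n d \<rho> \<psi> \<theta> B "resmap B" "structmap B" by (rule over[OF B])
 note loc = in_ChatD(1)[OF B field_k]
 have RC:"in_Chat p k R" by (rule in_Chat_W_t_mod[OF W.p_ring_axioms])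
 have inj:"inj_on (\<eta> B) (Chat_homs p k R B)"
 proof (rule inj_onI)
  fix h h' assume h:"h\<in>Chat_homs p k R B" and h': "h'\<in>Chat_homs p k R B" and eq:"\<eta> B h = \<eta> B h'"
  obtain L where L:"L\<in>lifts k \<Gamma> Vt B" "U.represents B (rep B (h t)) L" using \<eta>_nonempty[OF B h] by blast
  then have "U.represents B (rep B (h' t)) L" using eq unfolding \<eta>_def by blast
  then obtain P where P:"P\<in>rmat B d d" "mmap (resmap B) P = mone k d"
  "\<forall>\<gamma>\<in>car \<Gamma>. mmul B d (D.sig (h t) \<gamma>) P = mmul B d P (D.sig (h' t) \<gamma>)"
  using U.represents_compare[OF loc L(2)] unfolding rep_sig[OF B] by blast
  have t:"h t = h' t" by (rule D.sig_unique[OF Chat_hom_eval(2)[OF B h] Chat_hom_eval(2)[OF B h'] P(1,2)]) (use P(3) in blast)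
  have "h z = h' z" if z:"z<:(W.Rring n)" for z
  proof -
  obtain a b where ab:"a<:(Witt p k)" "b<:(Witt p k)" "z = W.Rel n a b" using z by (rule W.Rring_cases)
  show ?thesis unfolding ab(3) Chat_hom_eval(3)[OF B h ab(1,2)] Chat_hom_eval(3)[OF B h' ab(1,2)] t ..
  qed
  then have "h z = h' z" if "z<:R" for z using that unfolding R_eq .
  then show "h = h'" using h h' by (intro extensionalityI[of _ "car R"]) (auto simp:Chat_homs_def PiE_def)
 qed
 have "\<eta> B h\<in>Def k \<Gamma> Vt B" if h:"h\<in>Chat_homs p k R B" for h
 proof -
  obtain L where L:"L\<in>lifts k \<Gamma> Vt B" "U.represents B (rep B (h t)) L" using \<eta>_nonempty[OF B h] by blast
  show ?thesis unfolding \<eta>_def represented_class[OF B L] Def_def by (rule quotientI[OF L(1)])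
 qed
 moreover have "\<exists>h\<in>Chat_homs p k R B. Y = \<eta> B h" if Y:"Y\<in>Def k \<Gamma> Vt B" for Y
 proof -
  obtain L where L:"L\<in>lifts k \<Gamma> Vt B"
  "Y = {(L,L'). L\<in>lifts k \<Gamma> Vt B & L'\<in>lifts k \<Gamma> Vt B & lift_isomorphic k \<Gamma> B L L'} `` {L}"
  using Y unfolding Def_def by (rule quotientE)
  obtain \<chi> where \<chi>: "U.represents B \<chi> L" using U.lift_represented[OF loc] L(1) unfolding lifts_def by blast
  then obtain e where e:"U.adapted B \<chi> L e" unfolding U.represents_def by blast
  interpret L: group_module B \<Gamma> "fst L" by (rule lift_group_module(1)[OF L(1)])
  have be:"is_basis B (fst L) d e" "acts_by B \<Gamma> (fst L) d e \<chi>" using e by (auto simp:U.adapted_def)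
  obtain P s where s:"D.admissible s" and P:"P\<in>rmat B d d" "mmap (resmap B) P = mone k d"
  and Ps:"\<forall>\<gamma>\<in>car \<Gamma>. mmul B d (\<chi> \<gamma>) P = mmul B d P (D.sig s \<gamma>)"
  using D.sig_exists[OF U.adapted_reduces(1)[OF loc e] L.acts_by_one[OF be] L.acts_by_mult[OF be] U.adapted_reduces(2)[OF loc e]] by blast
  obtain h where h:"h\<in>car R \<rightarrow>\<^sub>E car B" "h\<in>ring_hom R B"
  "!!a b. a<:(Witt p k)==>b<:(Witt p k)==>h (W.Rel n a b) = structmap B a+.B structmap B b*.B s"
  using D.hom_of_admissible[OF s] unfolding R_eq by blast
  have sc:"s<:B" "resmap B s = 0@k" using s by (auto simp:D.admissible_def)
  have hC:"h\<in>Chat_homs p k R B"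
  proof (rule Chat_homsI[OF field_k RC B h(1,2)])
  show "h (structmap R w) = structmap B w" if "w<:(Witt p k)" for w
  using that sc by (simp add:R_eq W.structmap_Rring h(3))
  show "resmap B (h z) = resmap R z" if "z<:R" for z
  using that unfolding R_eq by (elim W.Rring_cases) (simp add:h(3) sc W.resmap_Rring D.\<iota>_res)
  qed
  have ht:"h t = s" using sc by (simp add:h(3))
  have "U.represents B (D.sig s) L"
  by (rule U.represents_conjugate[OF loc \<chi> P]) (use D.sig_mat[OF s] Ps in auto)
  then have "Y = \<eta> B h" unfolding \<eta>_def ht rep_sig[OF B] L(2) by (rule represented_class[OF B L(1),symmetric])
  then show ?thesis using hC by blast
 qed
 ultimately show ?thesis unfolding bij_betw_def using inj by blast
qed

lemma rep_map:
 assumes B:"in_Chat p k B" and C:"in_Chat p k C" and f:"f\<in>Chat_homs p k B C" and s:"s<:B" and \<gamma>: "\<gamma><:\<Gamma>"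
 shows "mmap f (rep B s \<gamma>) = rep C (f s) \<gamma>"
proof -
 interpret D: deformation_over "Witt p k" k Witt_residue p G Z V' n d \<rho> \<psi> \<theta> B "resmap B" "structmap B" by (rule over[OF B])
 interpret E: deformation_over "Witt p k" k Witt_residue p G Z V' n d \<rho> \<psi> \<theta> C "resmap C" "structmap C" by (rule over[OF C])
 interpret f: ring_hom_cring B C f
  by (rule ring_hom_cringI[OF D.B.is_cring E.B.is_cring]) (use f in \<open>simp add:Chat_homs_def\<close>)
 obtain x g where xg:"\<gamma> = (x,g)" "x<:V'" "g<:G" using \<gamma> by (cases \<gamma>) (simp add:semidirect_sel)
 have fs:"f (structmap B w) = structmap C w" if "w<:(Witt p k)" for w using f that by (simp add:Chat_homs_def)
 note c = rmatD[OF \<psi>_mat[OF xg(2)]] rmatD[OF \<rho>_mat[OF xg(3)]] D.\<iota>.hom_closed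
 have oc:"mone B d i j<:B" for i j by (rule rmatD[OF D.B.mone_rmat])
 have fo:"f (mone B d i j) = mone C d i j" for i j
  using fun_cong[OF fun_cong[OF f.mmap_one[of d]],of i j] by (simp add:mmap_def)
 show ?thesis
  unfolding rep_def xg(1) fst_conv snd_conv
  by (subst f.map_mmul) (use c oc s in \<open>simp_all add: mmap_def fs fo\<close>)
qed

theorem universal:"universal_deformation_ring TYPE('b) p k \<Gamma> Vt R"
 unfolding universal_deformation_ring_def
proof (intro conjI exI[of _ \<eta>] allI impI ballI)
 show "in_Chat p k R" by (rule in_Chat_W_t_mod[OF W.p_ring_axioms])
 show "bij_betw (\<eta> B) (Chat_homs p k R B) (Def k \<Gamma> Vt B)" if "in_Chat p k B" for B :: "('b,nat => 'k,'k) walg"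
  by (rule \<eta>_bij[OF that])
 fix B C :: "('b,nat => 'k,'k) walg" and f h
 assume "in_Chat p k B & in_Chat p k C" and f:"f\<in>Chat_homs p k B C" and h:"h\<in>Chat_homs p k R B"
 then have B:"in_Chat p k B" and C:"in_Chat p k C" by simp_all
 note lB = in_ChatD(1)[OF B field_k] and lC = in_ChatD(1)[OF C field_k]
 have tR:"t<:R" unfolding R_eq by (rule W.Rel_closed) simp_all
 have fr:"f\<in>ring_hom B C" "!!b. b<:B==>resmap C (f b) = resmap B b" using f by (auto simp:Chat_homs_def)
 have E:"U.represents C (rep C (f (h t))) (ext_lift k \<Gamma> Vt B C f L)" if "L\<in>\<eta> B h" for L
 proof -
  have "U.represents C (%\<gamma>. mmap f (rep B (h t) \<gamma>)) (ext_lift k \<Gamma> Vt B C f L)"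
  by (rule U.represents_ext_lift[OF lB lC fr]) (use that in \<open>simp_all add: \<eta>_def\<close>)
  then show ?thesis unfolding U.represents_def U.adapted_def
  using rep_map[OF B C f Chat_hom_eval(1)[OF B h]] by (auto simp:acts_by_def)
 qed
 obtain L where L:"L\<in>\<eta> B h" using \<eta>_nonempty[OF B h] by (auto simp:\<eta>_def)
 have "L'\<in>Def_map k \<Gamma> Vt B C f (\<eta> B h) \<longleftrightarrow> L'\<in>\<eta> C (compose (car R) f h)" for L'
 proof
  assume "L'\<in>Def_map k \<Gamma> Vt B C f (\<eta> B h)"
  then obtain L where L:"L'\<in>lifts k \<Gamma> Vt C" "L\<in>\<eta> B h" "lift_isomorphic k \<Gamma> C (ext_lift k \<Gamma> Vt B C f L) L'"
  unfolding Def_map_def by blast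
  then show "L'\<in>\<eta> C (compose (car R) f h)"
  using U.represents_transfer[OF lC E[OF L(2)] L(3) lift_group_module[OF L(1)]] tR by (simp add:\<eta>_def compose_def)
 next
  assume L': "L'\<in>\<eta> C (compose (car R) f h)"
  then have "U.represents C (rep C (f (h t))) L'" using tR by (simp add:\<eta>_def compose_def)
  then have "lift_isomorphic k \<Gamma> C (ext_lift k \<Gamma> Vt B C f L) L'" by (rule U.represents_isomorphic[OF lC E[OF L]])
  then show "L'\<in>Def_map k \<Gamma> Vt B C f (\<eta> B h)" using L L' unfolding Def_map_def \<eta>_def by blast
 qed
 then show "\<eta> C (compose (car R) f h) = Def_map k \<Gamma> Vt B C f (\<eta> B h)" by blast
qed

end

lemma Chat_isomorphic_refl: assumes k:"field k" and R:"in_Chat p k R" shows "Chat_isomorphic p k R R"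
proof -
 let ?i = "\<lambda>x\<in>car R. x"
 have "structmap R w<:R" if "w<:(Witt p k)" for w using ring_hom_closed[OF in_ChatD(3)[OF R k] that] .
 moreover have "cring R" using R by (simp add:in_Chat_def)
 then interpret cring R .
 have "?i\<in>ring_hom R R" by (rule ring_hom_memI) simp_all
 ultimately have "?i\<in>Chat_homs p k R R" by (intro Chat_homsI[OF k R R]) auto
 then show ?thesis unfolding Chat_isomorphic_def by (intro bexI[of _ ?i]) auto
qed

lemma truncation_Witt:
 assumes W:"p_ring (Witt p k) k Witt_residue p" and n:"n \<ge> 1"
 defines "I \<equiv> PIdl\<^bsub>Witt p k\<^esub> (add_pow (Witt p k) (p ^ n) 1@(Witt p k))"
 shows "truncation (Witt p k) k Witt_residue p (truncated_Witt p n k) (%w. I +>\<^bsub>Witt p k\<^esub> w) truncated_Witt_residue n"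
proof -
 interpret W: p_ring "Witt p k" k Witt_residue p by (rule W)
 have IP:"I = W.Pp n" unfolding I_def W.unif_pow_eq W.Pp_def ..
 interpret I: ideal I "Witt p k" unfolding IP by (rule W.Pp_ideal)
 have A:"truncated_Witt p n k = Witt p k Quot I" unfolding truncated_Witt_def I_def ..
 interpret q: ring_hom_cring "Witt p k" "Witt p k Quot I" "%w. I +>\<^bsub>Witt p k\<^esub> w"
  by (rule I.rcos_ring_hom_cring[OF W.is_cring])
 have q0:"I +>\<^bsub>Witt p k\<^esub> w = 0@(Witt p k Quot I) \<longleftrightarrow> w\<in>I" if w:"w<:(Witt p k)" for w
  using I.coset_eq_iff[OF w W.zero_closed] w q.hom_zero by (simp add:a_minus_def)
 show ?thesis unfolding A
 proof (intro truncation.intro truncation_axioms.intro W q.ring_hom_cring_axioms n)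
  show "(%w. I +>\<^bsub>Witt p k\<^esub> w) ` car (Witt p k) = car (Witt p k Quot I)"
  by (auto simp:FactRing_def A_RCOSETS_def' a_r_coset_def')
  show "(I +>\<^bsub>Witt p k\<^esub> w = 0@(Witt p k Quot I)) = (w\<in>W.Pp n)" if "w<:(Witt p k)" for w
  using q0[OF that] by (simp add:IP)
  show "truncated_Witt_residue (I +>\<^bsub>Witt p k\<^esub> w) = Witt_residue w" if w:"w<:(Witt p k)" for w
  proof -
  have "Witt_residue ` (I +>\<^bsub>Witt p k\<^esub> w) = {Witt_residue w}"
  proof (intro equalityI subsetI)
  fix y assume "y\<in>Witt_residue ` (I +>\<^bsub>Witt p k\<^esub> w)"
  then obtain z where z:"z\<in>I +>\<^bsub>Witt p k\<^esub> w" "y = Witt_residue z" by (rule imageE)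
  obtain i where i:"i\<in>I" "z = i+.(Witt p k) w" using z(1) unfolding a_r_coset_def' by (elim UN_E singletonE)
  show "y\<in>{Witt_residue w}"
  unfolding z(2) i(2) using i(1) W.Pp_res[OF n,of i] I.Icarr[OF i(1)] w by (simp add:IP)
  next
  fix y assume "y\<in>{Witt_residue w}"
  then show "y\<in>Witt_residue ` (I +>\<^bsub>Witt p k\<^esub> w)" using I.a_rcos_self[OF w] by simp
  qed
  then show ?thesis by (simp add:truncated_Witt_residue_def)
  qed
 qed
qed

theorem theorem3p2:
  fixes k :: "'k ring" and p n :: nat and G :: "'g monoid"
    and A :: "(nat \<Rightarrow> 'k) set ring"
    and V :: "('k, 'v, 'g) gmodule"
    and Vh :: "((nat \<Rightarrow> 'k) set, 'u, 'g) gmodule"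
    and M :: "((nat \<Rightarrow> 'k) set, 'u \<Rightarrow> 'u, 'g) gmodule"
    and Zpn :: "int ring"
    and MZ :: "(int, 'u \<Rightarrow> 'u, 'g) gmodule"
    and V' :: "(int, 'x, 'g) gmodule"
    and \<psi> :: "'x \<Rightarrow> 'u \<Rightarrow> 'u"
    and \<Gamma> :: "('x \<times> 'g) monoid"
    and Vt :: "('k, 'v, 'x \<times> 'g) gmodule"
  assumes k_field: "field k"
    and k_char: "Factorial_Ring.prime p" "add_pow k p \<one>\<^bsub>k\<^esub> = \<zero>\<^bsub>k\<^esub>"
    and k_perfect: "(\<lambda>a. a [^]\<^bsub>k\<^esub> p) ` carrier k = carrier k"
    and G: "group G" "finite (carrier G)"
    and n: "n \<ge> 1"
    and A: "A = truncated_Witt p n k"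
    and V_proj: "projective_gmodule k G V"
    and V_findim: "\<exists>d. free_of_rank k V d"
    and V_End: "bij_betw (\<lambda>c. \<lambda>x\<in>carrier V. c \<odot>\<^bsub>V\<^esub> x) (carrier k) (ghoms k G V V)"
    and Vh_proj: "projective_gmodule A G Vh"
    and Vh_red: "gisos k G (ext_scalars A k truncated_Witt_residue Vh) V \<noteq> {}"
    and M: "M = End_gmodule A G Vh"
    and Zpn: "Zpn = residue_ring (int (p ^ n))"
    and MZ: "MZ = restrict_scalars (\<lambda>z. add_pow A z \<one>\<^bsub>A\<^esub>) M"
    and V'_module: "group_module Zpn G V'"
    and V'_free: "\<exists>d. free_of_rank Zpn V' d"
    and i: "free_of_rank A (Hom_module Zpn G V' MZ M) 1"
    and ii: "\<psi> \<in> ghoms Zpn G V' MZ" "inj_on \<psi> (carrier V')"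
    and iii: "\<exists>\<tau> \<in> \<psi> ` carrier V'. \<exists>\<mu> \<in> \<psi> ` carrier V'. \<exists>v \<in> carrier Vh.
                \<tau> (\<mu> v) \<ominus>\<^bsub>Vh\<^esub> \<mu> (\<tau> v) \<notin> {add_pow Vh p x | x. x \<in> carrier Vh}"
    and \<Gamma>: "\<Gamma> = semidirect (add_monoid V') G (act V')"
    and Vt: "Vt = inflate snd V"
  shows "\<exists>R :: ((nat \<Rightarrow> nat \<Rightarrow> 'k) set, nat \<Rightarrow> 'k, 'k) walg.
           universal_deformation_ring TYPE('b) p k \<Gamma> Vt R \<and>
           Chat_isomorphic p k R (W_t_mod p n k)"
proof -
 have W:"p_ring (Witt p k) k Witt_residue p" by (rule p_ring_Witt[OF k_field k_char k_perfect])
 note T = truncation_Witt[OF W n]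
 have gV:"group_module k G V" and gVh:"group_module A G Vh" using V_proj Vh_proj by (simp_all add: projective_gmodule_def)
 obtain d where "free_of_rank k V d" using V_findim by blast
 then obtain v where v:"is_basis k V d v"
  using module.free_of_rank_imp_basis[OF group_module.axioms(1)[OF gV]] by blast
 obtain \<Phi> where \<Phi>: "\<Phi>\<in>gisos k G (ext_scalars A k truncated_Witt_residue Vh) V" using Vh_red by blast
 let ?q = "%w. PIdl\<^bsub>Witt p k\<^esub> (add_pow (Witt p k) (p ^ n) 1@(Witt p k)) +>\<^bsub>Witt p k\<^esub> w"
 interpret D: reduced_module "Witt p k" k Witt_residue p A ?q truncated_Witt_residue n G Vh V \<Phi> d v
  by (intro reduced_module.intro reduced_module_axioms.intro T[folded A] gV gVh Vh_proj \<Phi> v)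
 obtain \<rho> \<psi>' \<theta> v' where D:"deformation_data (Witt p k) k Witt_residue p G Zpn V' n d \<rho> \<psi>' \<theta>"
  "is_basis k V d v'" "acts_by k G V d v' (%g. mmap Witt_residue (\<rho> g))"
  using D.deformation_data_exists[OF G(2) prime_gt_1_nat[OF k_char(1)] V_proj V_End,of V' \<psi>]
  V'_module i ii(1) iii unfolding Zpn MZ M by blast
 interpret I: inflated_deformation p k G Zpn V' n d \<rho> \<psi>' \<theta> V v'
  by (intro inflated_deformation.intro inflated_deformation_axioms.intro D gV)
 have "universal_deformation_ring TYPE('b) p k \<Gamma> Vt (W_t_mod p n k)" unfolding \<Gamma> Vt by (rule I.universal)
 moreover have "Chat_isomorphic p k (W_t_mod p n k) (W_t_mod p n k)"
  by (rule Chat_isomorphic_refl[OF k_field in_Chat_W_t_mod[OF W]])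
 ultimately show ?thesis by blast
qed

end
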